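(* Let $\alpha_1,\alpha_2\in(0,1)$, $c>0$, $n\ge1$, $p>1$, and assume that $s\mapsto\Psi(s)^{-1}=s^{(\alpha_2c+\alpha_1s)/(c+s)}$ is a Bernstein function on $(0,\infty)$. Let $u_0\in X=L^1(\mathbb R^n)\cap L^\infty(\mathbb R^n)$ with $u_0\ge0$. Then there is a unique nonnegative maximal mild solution of $$u(t)=S_{\mathcal A}(t)u_0+\int_0^tP_{\mathcal A}(t-s)(u(s)_+)^p\,ds$$ such that $$u\in C([0,T_{\max});L^1(\mathbb R^n)),\qquad\operatorname*{ess\,sup}_{0<t<T}\|u(t)\|_\infty<\infty\ \text{ for every }T<T_{\max},$$ where $0<T_{\max}\le\infty$. If $u_0\in L^1\cap BUC$, then $u\in C([0,T_{\max});L^1\cap BUC)$. If $0\le u_0\le v_0$ with $v_0\in X$, the corresponding solutions satisfy $u(t)\le v(t)$ almost everywhere on their common existence interval. On any common finite interval $[0,T]$ on which two solutions remain bounded in $\mathcal X_T$, they depend continuously on their initial data.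
   Context: A Bernstein function is a $C^\infty$ function $F:(0,\infty)\to[0,\infty)$ with $(-1)^{m-1}F^{(m)}\ge0$ for all $m\ge1$. $\Psi(z)=z^{-B(z)}$ with $B(z)=\frac{\alpha_2c+\alpha_1z}{c+z}$ (principal branch). The families are $S_{\mathcal A}(t)g=Z(t)*g$, $P_{\mathcal A}(t)g=Y(t)*g$ ($\mathcal A=\Delta$ on $\mathbb R^n$), where, under the Bernstein condition, $Z(t)$ ($t>0$, weakly continuous in $t$) are probability measures and $Y(t)$ (a.e. $t>0$, measurable in $t$) are finite positive measures on $\mathbb R^n$ determined by their Fourier–Laplace transforms $$\int_0^\infty e^{-zt}\int_{\mathbb R^n}e^{-ix\cdot\xi}Z(t,dx)\,dt=\frac{\Psi(z)^{-1}}{z(\Psi(z)^{-1}+|\xi|^2)},\qquad\int_0^\infty e^{-zt}\int_{\mathbb R^n}e^{-ix\cdot\xi}Y(t,dx)\,dt=\frac1{\Psi(z)^{-1}+|\xi|^2}\quad(z>0);$$ $S_{\mathcal A}(0)=I$. $BUC$ is the space of bounded uniformly continuous functions. $\|v\|_X=\|v\|_1+\|v\|_\infty$; $\mathcal X_T=C([0,T];L^1(\mathbb R^n))\cap L^\infty((0,T);L^\infty(\mathbb R^n))$ with norm $\sup_{0\le t\le T}\|v(t)\|_1+\operatorname{ess\,sup}_{0<t<T}\|v(t)\|_\infty$. A mild solution on $[0,T]$ is a function in $\mathcal X_T$ satisfying the displayed equation in $L^1$ for every $t\in[0,T]$ and in $L^\infty$ for almost every $t>0$; a maximal one is a mild solution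 on every $[0,T]$, $T<T_{\max}$, that cannot be extended to a mild solution on a strictly larger interval. The equation is the mild form of ${}^{S}D_0^{\alpha(t)}u=\Delta u+u^p$, $u(0)=u_0$, with $\alpha(t)=\alpha_2+(\alpha_1-\alpha_2)e^{-ct}$. *)

theory Defs
  imports "HOL-Probability.Probability"
begin

text \<open>
  Elements of $L^1(R^n)$ and $L^\infty(R^n)$ are represented by Borel functions; two
  representatives denote the same element iff they agree almost everywhere.
\<close>

definition L1_norm :: "(real^'n \<Rightarrow> real) \<Rightarrow> ennreal" where
  "L1_norm f = (\<integral>\<^sup>+ x. ennreal \<bar>f x\<bar> \<partial>lborel)"

definition Linf_norm :: "(real^'n \<Rightarrow> real) \<Rightarrow> ennreal" where
  "Linf_norm f = esssup lborel (\<lambda>x. ennreal \<bar>f x\<bar>)"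

definition X_norm :: "(real^'n \<Rightarrow> real) \<Rightarrow> ennreal" where
  "X_norm f = L1_norm f + Linf_norm f"

definition normed_functions :: "((real^'n \<Rightarrow> real) \<Rightarrow> ennreal) \<Rightarrow> (real^'n \<Rightarrow> real) set" where
  "normed_functions N = {f \<in> borel_measurable borel. N f < \<infinity>}"

abbreviation L1 :: "(real^'n \<Rightarrow> real) set" where "L1 \<equiv> normed_functions L1_norm"

abbreviation Linf :: "(real^'n \<Rightarrow> real) set" where "Linf \<equiv> normed_functions Linf_norm"

definition BUC :: "(real^'n \<Rightarrow> real) set" where
  "BUC = {g. bounded (range g) \<and> uniformly_continuous_on UNIV g}"

text \<open>The space $C(J;E)$, where \<open>N\<close> is the norm of $E$.\<close>

definition continuous_wrt ::
  "((real^'n \<Rightarrow> real) \<Rightarrow> ennreal) \<Rightarrow> real set \<Rightarrow> (real \<Rightarrow> real^'n \<Rightarrow> real) \<Rightarrow> bool" where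
  "continuous_wrt N J v \<longleftrightarrow>
     (\<forall>t\<in>J. v t \<in> normed_functions N \<and>
            ((\<lambda>s. N (\<lambda>x. v s x - v t x)) \<longlongrightarrow> 0) (at t within J))"

text \<open>
  The library's Bochner integral needs a second countable Banach space as codomain type, which
  excludes $L^\infty$. The two definitions below are the usual strong (Bochner) measurability
  and the analogue of \<^const>\<open>has_bochner_integral\<close> for a norm \<open>N\<close> on function
  representatives; \<open>M\<close> is meant to be a finite measure.
\<close>

definition simple_wrt ::
  "((real^'n \<Rightarrow> real) \<Rightarrow> ennreal) \<Rightarrow> real measure \<Rightarrow> (real \<Rightarrow> real^'n \<Rightarrow> real) \<Rightarrow> bool" where
  "simple_wrt N M s \<longleftrightarrow> simple_function M s \<and> s \<in> space M \<rightarrow> normed_functions N"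

definition strongly_measurable_wrt ::
  "((real^'n \<Rightarrow> real) \<Rightarrow> ennreal) \<Rightarrow> real measure \<Rightarrow> (real \<Rightarrow> real^'n \<Rightarrow> real) \<Rightarrow> bool" where
  "strongly_measurable_wrt N M h \<longleftrightarrow>
     (\<exists>s :: nat \<Rightarrow> real \<Rightarrow> real^'n \<Rightarrow> real. (\<forall>k. simple_wrt N M (s k)) \<and>
        (AE t in M. h t \<in> normed_functions N \<and> (\<lambda>k. N (\<lambda>x. h t x - s k t x)) \<longlonglongrightarrow> 0))"

definition has_bochner_integral_wrt ::
  "((real^'n \<Rightarrow> real) \<Rightarrow> ennreal) \<Rightarrow> real measure \<Rightarrow> (real \<Rightarrow> real^'n \<Rightarrow> real)
     \<Rightarrow> (real^'n \<Rightarrow> real) \<Rightarrow> bool" where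
  "has_bochner_integral_wrt N M h w \<longleftrightarrow>
     strongly_measurable_wrt N M h \<and> w \<in> normed_functions N \<and>
     (\<exists>s :: nat \<Rightarrow> real \<Rightarrow> real^'n \<Rightarrow> real. (\<forall>k. simple_wrt N M (s k)) \<and>
        (\<lambda>k. \<integral>\<^sup>+ t. N (\<lambda>x. h t x - s k t x) \<partial>M) \<longlonglongrightarrow> 0 \<and>
        (\<lambda>k. N (\<lambda>x. w x - (\<integral>t. s k t x \<partial>M))) \<longlonglongrightarrow> 0)"

definition bernstein_function :: "(real \<Rightarrow> real) \<Rightarrow> bool" where
  "bernstein_function F \<longleftrightarrow>
     (\<forall>x>0. 0 \<le> F x) \<and>
     (\<forall>m. \<forall>x>0. (deriv ^^ m) F differentiable (at x)) \<and>
     (\<forall>m\<ge>1. \<forall>x>0. 0 \<le> (- 1) ^ (m - 1) * (deriv ^^ m) F x)"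

definition B_exponent :: "real \<Rightarrow> real \<Rightarrow> real \<Rightarrow> real \<Rightarrow> real" where
  "B_exponent \<alpha>\<^sub>1 \<alpha>\<^sub>2 c z = (\<alpha>\<^sub>2 * c + \<alpha>\<^sub>1 * z) / (c + z)"

text \<open>Only used for $z > 0$, where the principal branch is the real power.\<close>

definition Psi :: "real \<Rightarrow> real \<Rightarrow> real \<Rightarrow> real \<Rightarrow> real" where
  "Psi \<alpha>\<^sub>1 \<alpha>\<^sub>2 c z = z powr (- B_exponent \<alpha>\<^sub>1 \<alpha>\<^sub>2 c z)"

definition fourier_laplace :: "(real \<Rightarrow> (real^'n) measure) \<Rightarrow> real \<Rightarrow> real^'n \<Rightarrow> complex \<Rightarrow> bool" where
  "fourier_laplace K z \<xi> a \<longleftrightarrow>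
     has_bochner_integral (lebesgue_on {0<..})
       (\<lambda>t. exp (- z * t) *\<^sub>R (\<integral>x. cis (- (x \<bullet> \<xi>)) \<partial>K t)) a"

definition Z_kernel :: "real \<Rightarrow> real \<Rightarrow> real \<Rightarrow> (real \<Rightarrow> (real^'n) measure) \<Rightarrow> bool" where
  "Z_kernel \<alpha>\<^sub>1 \<alpha>\<^sub>2 c Z \<longleftrightarrow>
     (\<forall>t>0. prob_space (Z t) \<and> sets (Z t) = sets borel) \<and>
     (\<forall>f :: real^'n \<Rightarrow> real. continuous_on UNIV f \<longrightarrow> bounded (range f) \<longrightarrow>
        continuous_on {0<..} (\<lambda>t. \<integral>x. f x \<partial>Z t)) \<and>
     (\<forall>z>0. \<forall>\<xi>. fourier_laplace Z z \<xi>
        (of_real (inverse (Psi \<alpha>\<^sub>1 \<alpha>\<^sub>2 c z) / (z * (inverse (Psi \<alpha>\<^sub>1 \<alpha>\<^sub>2 c z) + (norm \<xi>)\<^sup>2)))))"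

definition Y_kernel :: "real \<Rightarrow> real \<Rightarrow> real \<Rightarrow> (real \<Rightarrow> (real^'n) measure) \<Rightarrow> bool" where
  "Y_kernel \<alpha>\<^sub>1 \<alpha>\<^sub>2 c Y \<longleftrightarrow>
     (AE t in lebesgue_on {0<..}. finite_measure (Y t) \<and> sets (Y t) = sets borel) \<and>
     (\<forall>A\<in>sets borel. (\<lambda>t. emeasure (Y t) A) \<in> borel_measurable (lebesgue_on {0<..})) \<and>
     (\<forall>z>0. \<forall>\<xi>. fourier_laplace Y z \<xi> (of_real (1 / (inverse (Psi \<alpha>\<^sub>1 \<alpha>\<^sub>2 c z) + (norm \<xi>)\<^sup>2))))"

definition measure_convolution :: "(real^'n) measure \<Rightarrow> (real^'n \<Rightarrow> real) \<Rightarrow> real^'n \<Rightarrow> real" where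
  "measure_convolution \<mu> g x = (\<integral>y. g (x - y) \<partial>\<mu>)"

definition S_family ::
  "(real \<Rightarrow> (real^'n) measure) \<Rightarrow> real \<Rightarrow> (real^'n \<Rightarrow> real) \<Rightarrow> real^'n \<Rightarrow> real" where
  "S_family Z t g = (if t = 0 then g else measure_convolution (Z t) g)"

definition P_family ::
  "(real \<Rightarrow> (real^'n) measure) \<Rightarrow> real \<Rightarrow> (real^'n \<Rightarrow> real) \<Rightarrow> real^'n \<Rightarrow> real" where
  "P_family Y t g = measure_convolution (Y t) g"

definition ess_sup_Linf :: "real \<Rightarrow> (real \<Rightarrow> real^'n \<Rightarrow> real) \<Rightarrow> ennreal" where
  "ess_sup_Linf T v = esssup (lebesgue_on {0<..<T}) (\<lambda>t. Linf_norm (v t))"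

definition XT_norm :: "real \<Rightarrow> (real \<Rightarrow> real^'n \<Rightarrow> real) \<Rightarrow> ennreal" where
  "XT_norm T v = (SUP t\<in>{0..T}. L1_norm (v t)) + ess_sup_Linf T v"

definition XT :: "real \<Rightarrow> (real \<Rightarrow> real^'n \<Rightarrow> real) set" where
  "XT T = {v. continuous_wrt L1_norm {0..T} v \<and>
              strongly_measurable_wrt Linf_norm (lebesgue_on {0<..<T}) v \<and>
              ess_sup_Linf T v < \<infinity>}"

definition mild_equation_in ::
  "((real^'n \<Rightarrow> real) \<Rightarrow> ennreal) \<Rightarrow> (real \<Rightarrow> (real^'n) measure) \<Rightarrow> (real \<Rightarrow> (real^'n) measure)
     \<Rightarrow> real \<Rightarrow> (real^'n \<Rightarrow> real) \<Rightarrow> (real \<Rightarrow> real^'n \<Rightarrow> real) \<Rightarrow> real \<Rightarrow> bool" where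
  "mild_equation_in N Z Y p u\<^sub>0 u t \<longleftrightarrow>
     u t \<in> normed_functions N \<and> S_family Z t u\<^sub>0 \<in> normed_functions N \<and>
     (\<exists>w. has_bochner_integral_wrt N (lebesgue_on {0<..<t})
             (\<lambda>s. P_family Y (t - s) (\<lambda>x. (max 0 (u s x)) powr p)) w \<and>
          N (\<lambda>x. u t x - (S_family Z t u\<^sub>0 x + w x)) = 0)"

definition mild_solution ::
  "(real \<Rightarrow> (real^'n) measure) \<Rightarrow> (real \<Rightarrow> (real^'n) measure) \<Rightarrow> real \<Rightarrow> (real^'n \<Rightarrow> real)
     \<Rightarrow> real \<Rightarrow> (real \<Rightarrow> real^'n \<Rightarrow> real) \<Rightarrow> bool" where
  "mild_solution Z Y p u\<^sub>0 T u \<longleftrightarrow>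
     u \<in> XT T \<and>
     (\<forall>t\<in>{0..T}. mild_equation_in L1_norm Z Y p u\<^sub>0 u t) \<and>
     (AE t in lebesgue_on {0<..<T}. mild_equation_in Linf_norm Z Y p u\<^sub>0 u t)"

definition existence_interval :: "ereal \<Rightarrow> real set" where
  "existence_interval Tmax = {t. 0 \<le> t \<and> ereal t < Tmax}"

text \<open>
  Every interval strictly larger than $[0,T_{max})$ contains $[0,T_{max}]$, so a proper extension
  yields a mild solution on some compact $[0,T]$ with $T \ge T_{max}$, and conversely.
\<close>

definition maximal_mild_solution ::
  "(real \<Rightarrow> (real^'n) measure) \<Rightarrow> (real \<Rightarrow> (real^'n) measure) \<Rightarrow> real \<Rightarrow> (real^'n \<Rightarrow> real)
     \<Rightarrow> ereal \<Rightarrow> (real \<Rightarrow> real^'n \<Rightarrow> real) \<Rightarrow> bool" where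
  "maximal_mild_solution Z Y p u\<^sub>0 Tmax u \<longleftrightarrow>
     0 < Tmax \<and>
     (\<forall>T>0. ereal T < Tmax \<longrightarrow> mild_solution Z Y p u\<^sub>0 T u) \<and>
     \<not> (\<exists>T v. Tmax \<le> ereal T \<and> mild_solution Z Y p u\<^sub>0 T v \<and>
          (\<forall>t\<in>existence_interval Tmax. AE x in lborel. v t x = u t x))"

definition nonneg_maximal_solution ::
  "(real \<Rightarrow> (real^'n) measure) \<Rightarrow> (real \<Rightarrow> (real^'n) measure) \<Rightarrow> real \<Rightarrow> (real^'n \<Rightarrow> real)
     \<Rightarrow> ereal \<Rightarrow> (real \<Rightarrow> real^'n \<Rightarrow> real) \<Rightarrow> bool" where
  "nonneg_maximal_solution Z Y p u\<^sub>0 Tmax u \<longleftrightarrow>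
     maximal_mild_solution Z Y p u\<^sub>0 Tmax u \<and>
     (\<forall>t\<in>existence_interval Tmax. AE x in lborel. 0 \<le> u t x) \<and>
     continuous_wrt L1_norm (existence_interval Tmax) u \<and>
     (\<forall>T>0. ereal T < Tmax \<longrightarrow> ess_sup_Linf T u < \<infinity>)"

end

theory Submission
  imports Defs
begin

text \<open>
 The Bernstein property makes \<open>Z(t)\<close> and \<open>Y(t)\<close> mixtures of Gaussians, so for almost every
 \<open>t\<close> they have densities that are jointly measurable in space-time, and the mild equation becomes
 \<open>V = A f + k * V^p\<close> for functions on space-time with values in the extended half line. Its least
 solution is the limit of the increasing Picard iterates; \<open>T\<^sub>m\<^sub>a\<^sub>x\<close> is the supremum of
 the \<open>T\<close> for which this limit is bounded on \<open>(0, T)\<close>, and smallness of the mass of the kernel on short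
 time intervals allows one to continue any bounded solution. Uniqueness and continuous dependence
 are one Gronwall argument with weight \<open>exp (- z * t)\<close>, run for the \<open>L\<^sup>1\<close> and the
 \<open>L\<^sup>\<infinity>\<close> norm at once, and monotonicity in the data is inherited from the iterates. Continuity
 of the nonlinear term comes from continuity of translations in \<open>L\<^sup>1\<close> applied to the kernel;
 together with a modulus of continuity that is uniform in time, convergence in \<open>L\<^sup>1\<close> is
 convergence in the supremum norm, which gives the statement about \<open>BUC\<close>.
\<close>

text \<open>Densities are wanted because of the L^infinity half of the equation: convolving a
  bounded function with a moving measure need not be strongly measurable in time (the translates of
  an indicator form a non-separable set), while an integrable kernel passes on the continuity of
  translations in L^1. Subordination would give densities through a mixing measure whose Laplace
  transform in t is \<open>a z * exp (- s * phi z)\<close>, but that measure is never constructed.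
  Complete monotonicity enters only through differences of step one in z. The m-th difference of a
  Laplace transform inserts the factor (1 - exp(-t))^m, so at integer points the differences are
  integrals against Bernstein polynomials in exp(-t), and these recover every continuous function of
  exp(-t). Each difference is a mixture of Gaussians \<open>heat s\<close> with nonnegative weights;
  the part with s below delta has total weight at most delta * a(1), uniformly in the degree, and
  the rest has a bounded density. Letting delta tend to zero gives absolute continuity of the
  space-time measure.\<close>

abbreviation (input) nn_integral_lborel :: "('a::euclidean_space => ennreal) => ennreal" (binder "NN " 10)
 where "nn_integral_lborel f \<equiv> integral\<^sup>N lborel f"

abbreviation (input) "Bor \<equiv> borel_measurable borel"

abbreviation (input) integral_lborel :: "('a::euclidean_space => 'b::{banach,second_countable_topology}) => 'b" (binder "LB " 10)
 where "integral_lborel f \<equiv> integral\<^sup>L lborel f"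

abbreviation (input) LIMSEQ_ascii :: "(nat => 'a::topological_space) => 'a => bool" (infixr "~~>" 60)
 where "LIMSEQ_ascii X l \<equiv> X \<longlonglongrightarrow> l"

section \<open>Approximation in L^1 and continuity of translations\<close>

definition bump :: "'a::metric_space set => nat => 'a => real" where
 "bump C j x = max 0 (1 - real (Suc j) * infdist x C)"

lemma continuous_bump: "continuous_on UNIV (bump C j)"
 unfolding bump_def by (intro continuous_intros)

lemma bump_measurable [measurable]: "bump C j : Bor"
 by (rule borel_measurable_continuous_onI[OF continuous_bump])

lemma bump_bounds: "0 <= bump C j x" "bump C j x <= 1"
 by (auto simp: bump_def infdist_nonneg)

lemma bump_tendsto:
 assumes "closed C" "C \<noteq> {}"
 shows "(%j. bump C j x) ~~> indicator C x"
proof (cases "x : C")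
 case True
 then show ?thesis by (simp add: bump_def)
next
 case False
 then have d: "infdist x C > 0"
  using assms by (simp add: infdist_pos_not_in_closed)
 obtain k :: nat where k: "1 / infdist x C < real k" using reals_Archimedean2 by blast
 have "bump C j x = 0" if "k <= j" for j
 proof -
  have "1 / infdist x C < real (Suc j)" using k that by linarith
  then show ?thesis using d by (simp add: bump_def field_simps)
 qed
 then have "eventually (%j. bump C j x = indicator C x) sequentially"
  using False by (auto simp: eventually_sequentially)
 then show ?thesis by (rule tendsto_eventually)
qed

text \<open>The support lies in the closed unit neighbourhood of \<open>C\<close> whatever
  \<open>j\<close> is, so a single ball of radius \<open>r + 1\<close> dominates the whole
  sequence.\<close>

lemma bump_eq_0:
 fixes C :: "'a::real_normed_vector set"
 assumes "C \<subseteq> cball 0 r" "C \<noteq> {}" "norm x > r + 1"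
 shows "bump C j x = 0"
proof -
 have "1 <= infdist x C"
  unfolding infdist_def using assms(2)
 proof (simp, intro cINF_greatest)
  fix a assume "a : C"
  then have "norm a <= r" using assms(1) by auto
  then show "1 <= dist x a" using assms(3) norm_triangle_ineq2[of x a] by (simp add: dist_norm)
 qed auto
 moreover have "infdist x C <= real (Suc j) * infdist x C"
  using infdist_nonneg[of x C] by (simp add: mult_le_cancel_right1)
 ultimately have "1 - real (Suc j) * infdist x C <= 0" by linarith
 then show ?thesis unfolding bump_def by (rule max_absorb1)
qed

lemma nn_integral_norm_diff_triangle:
 fixes f g h :: "'a => real"
 assumes [measurable]: "f : borel_measurable M" "g : borel_measurable M" "h : borel_measurable M"
 shows "(\<integral>\<^sup>+x. ennreal \<bar>f x - h x\<bar> \<partial>M)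
  <= (\<integral>\<^sup>+x. ennreal \<bar>f x - g x\<bar> \<partial>M) + (\<integral>\<^sup>+x. ennreal \<bar>g x - h x\<bar> \<partial>M)"
 by (subst nn_integral_add[symmetric])
   (auto intro!: nn_integral_mono simp: ennreal_plus[symmetric] simp del: ennreal_plus)

lemma emeasure_cball_less_top: "emeasure lborel (cball (x::'a::euclidean_space) r) < top"
 using emeasure_lborel_cball_finite[of x r] by simp

text \<open>Induction over integrable functions leaves indicators of sets of finite measure. Inner
  regularity replaces such a set by a compact \<open>K\<close>, and the functions
  \<open>bump K j\<close> converge to the indicator of \<open>K\<close> under a common integrable
  bound.\<close>

lemma continuous_compact_support_dense_L1:
 fixes f :: "'a::euclidean_space => real"
 assumes "integrable lborel f" "0 < eps"
 shows "\<exists>g r. continuous_on UNIV g & (\<forall>x. norm x > r --> g x = 0)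
  & (NN x. ennreal \<bar>f x - g x\<bar>) < ennreal eps"
 using assms
proof (induction f arbitrary: eps rule: integrable_induct)
 case (base A c)
 then have A[measurable]: "A : sets borel" and fin: "emeasure lborel A < \<infinity>" by auto
 \<comment> \<open>Inner regularity is applied to a finite measure, so Lebesgue measure is
   restricted to \<open>A\<close> first.\<close>
 let ?M = "density lborel (indicator A)"
 have eM: "emeasure ?M B = emeasure lborel (A \<inter> B)" if "B : sets borel" for B
  using that by (simp add: emeasure_density nn_integral_indicator flip: indicator_inter_arith)
 have "emeasure ?M A = (SUP K\<in>{K. K \<subseteq> A & compact K}. emeasure ?M K)"
  using fin by (intro inner_regular) (auto simp: eM)
 then have S: "emeasure lborel A = (SUP K\<in>{K. K \<subseteq> A & compact K}. emeasure lborel K)"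
  by (subst (asm) eM, simp, subst (asm) SUP_cong[OF refl eM]) (auto simp: borel_compact Int_absorb1 intro!: SUP_cong)
 \<comment> \<open>Half of \<open>eps\<close> is reserved for the approximation of the compact set;
   the summand 1 covers \<open>c = 0\<close>.\<close>
 define e where "e = eps / (2 * (\<bar>c\<bar> + 1))"
 have e: "e > 0" using base by (simp add: e_def)
 have "\<exists>K. K \<subseteq> A & compact K & emeasure lborel A < emeasure lborel K + ennreal e"
 proof (cases "emeasure lborel A = 0")
  case True then show ?thesis using e by (intro exI[of _ "{}"]) auto
 next
  case False
  then have "emeasure lborel A - ennreal e < emeasure lborel A"
   using fin e by (intro ennreal_between) (auto simp: zero_less_iff_neq_zero)
  then obtain K where "K \<subseteq> A" "compact K" "emeasure lborel A - ennreal e < emeasure lborel K"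
   unfolding S by (auto simp: less_SUP_iff)
  moreover have "emeasure lborel A < emeasure lborel K + ennreal e"
  proof (rule ccontr)
   assume "\<not> ?thesis"
   then have "emeasure lborel K + ennreal e <= emeasure lborel A" by (rule leI)
   then have "(emeasure lborel K + ennreal e) - ennreal e <= emeasure lborel A - ennreal e"
   by (rule ennreal_minus_mono[OF _ order_refl])
   also have "... < emeasure lborel K" by fact
   finally show False by (simp add: ennreal_add_diff_cancel_right)
  qed
  ultimately show ?thesis by blast
 qed
 then obtain K where K: "K \<subseteq> A" "compact K" "emeasure lborel A < emeasure lborel K + ennreal e"
  by blast
 have [measurable]: "K : sets borel" using K by (simp add: borel_compact)
 have fK: "emeasure lborel K < \<infinity>" using emeasure_mono[OF K(1), of lborel] fin by (auto intro: le_less_trans)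
 have AK: "(NN x. ennreal \<bar>indicator A x * c - indicator K x * c\<bar>) < ennreal (eps / 2)"
 proof -
  have "(NN x. ennreal \<bar>indicator A x * c - indicator K x * c\<bar>)
   = (NN x. ennreal \<bar>c\<bar> * indicator (A - K) x)"
   using K(1) by (intro nn_integral_cong) (auto split: split_indicator)
  also have "... = ennreal \<bar>c\<bar> * emeasure lborel (A - K)" by (simp add: nn_integral_cmult)
  also have "emeasure lborel (A - K) = emeasure lborel A - emeasure lborel K"
   using K(1) fK by (intro emeasure_Diff) auto
  also have "ennreal \<bar>c\<bar> * (emeasure lborel A - emeasure lborel K) <= ennreal \<bar>c\<bar> * ((emeasure lborel K + ennreal e) - emeasure lborel K)"
   by (intro mult_left_mono ennreal_minus_mono less_imp_le[OF K(3)] order_refl) auto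
  also have "... = ennreal \<bar>c\<bar> * ennreal e" using fK by (simp add: ennreal_add_diff_cancel_left)
  also have "... = ennreal (\<bar>c\<bar> * e)" using e by (simp add: ennreal_mult)
  also have "... < ennreal (eps / 2)" using base(3) unfolding e_def by (intro ennreal_lessI) (auto simp add: field_simps)
  finally show ?thesis .
 qed
 have "\<exists>g r. continuous_on UNIV g & (\<forall>x. norm x > r --> g x = 0)
  & (NN x. ennreal \<bar>indicator K x * c - g x\<bar>) < ennreal (eps/2)"
 proof (cases "K = {}")
  case True then show ?thesis using base(3) by (intro exI[of _ "%_. 0"]) auto
 next
  case ne: False
  obtain r where r: "K \<subseteq> cball 0 r" using compact_imp_bounded[OF K(2)] unfolding bounded_iff by (auto simp: subset_iff)
  have r0: "r \<ge> 0" using r ne by (metis cball_eq_empty not_le subset_empty)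
  have "(%j. \<integral>x. \<bar>indicator K x * c - bump K j x * c\<bar> \<partial>lborel) ~~> (\<integral>x. 0 \<partial>(lborel :: 'a measure))"
  proof (rule integral_dominated_convergence[where w = "%x. \<bar>c\<bar> * 2 * indicator (cball 0 (r+1)) x"])
   show "integrable lborel (%x::'a. \<bar>c\<bar> * 2 * indicator (cball 0 (r + 1)) x :: real)"
   using r0 by (intro integrable_mult_right integrable_real_indicator) (auto simp: emeasure_cball_less_top)
   show "AE x in lborel. (%j. \<bar>indicator K x * c - bump K j x * c\<bar>) ~~> 0"
   using bump_tendsto[OF compact_imp_closed[OF K(2)] ne]
   by (intro AE_I2 tendsto_rabs_zero LIM_zero) (auto intro!: tendsto_eq_intros)
   fix j show "AE x in lborel. norm \<bar>indicator K x * c - bump K j x * c\<bar> <= \<bar>c\<bar> * 2 * indicator (cball 0 (r + 1)) x"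
   proof (intro AE_I2)
   fix x
   have "x \<notin> cball 0 (r+1) ==> bump K j x = 0 & x \<notin> K" using bump_eq_0[OF r ne, of x j] r by auto
   moreover have "\<bar>indicator K x * c - bump K j x * c\<bar> <= \<bar>c\<bar> * 2"
   proof -
   have "\<bar>indicator K x - bump K j x\<bar> <= 2" using bump_bounds[of K j x] by (auto split: split_indicator)
   then have "\<bar>(indicator K x - bump K j x) * c\<bar> <= 2 * \<bar>c\<bar>"
   unfolding abs_mult by (rule mult_right_mono) simp
   then show ?thesis by (simp add: algebra_simps)
   qed
   ultimately show "norm \<bar>indicator K x * c - bump K j x * c\<bar> <= \<bar>c\<bar> * 2 * indicator (cball 0 (r + 1)) x"
   by (auto split: split_indicator)
   qed
  qed auto
  then have "eventually (%j. (LB x. \<bar>indicator K x * c - bump K j x * c\<bar>) < eps/2) sequentially"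
   using base(3) by (intro order_tendstoD) auto
  then obtain j where j: "(LB x. \<bar>indicator K x * c - bump K j x * c\<bar>) < eps/2"
   by (auto simp: eventually_sequentially)
  have "integrable lborel (%x. bump K j x * c)"
  proof (rule Bochner_Integration.integrable_bound[of _ "%x. \<bar>c\<bar> * indicator (cball 0 (r+1)) x :: real"])
   show "integrable lborel (%x::'a. \<bar>c\<bar> * indicator (cball 0 (r + 1)) x :: real)"
   using r0 by (intro integrable_mult_right integrable_real_indicator) (auto simp: emeasure_cball_less_top)
   show "AE x in lborel. norm (bump K j x * c) <= norm (\<bar>c\<bar> * indicator (cball 0 (r + 1)) x)"
   using bump_eq_0[OF r ne, of _ j] bump_bounds[of K j]
   by (intro AE_I2) (auto split: split_indicator simp: abs_mult mult_left_le_one_le)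
  qed auto
  then have "integrable lborel (%x. \<bar>indicator K x * c - bump K j x * c\<bar>)"
   using fK by (intro integrable_abs Bochner_Integration.integrable_diff) auto
  then have "(NN x. ennreal \<bar>indicator K x * c - bump K j x * c\<bar>) < ennreal (eps/2)"
   using j by (subst nn_integral_eq_integral) (auto simp: ennreal_less_iff intro!: integral_nonneg_AE)
  then show ?thesis using bump_eq_0[OF r ne, of _ j]
   by (intro exI[of _ "%x. bump K j x * c"] exI[of _ "r+1"]) (auto intro!: continuous_intros continuous_bump)
 qed
 then obtain g r where g: "continuous_on UNIV g" "!!x. norm x > r ==> g x = 0"
  "(NN x. ennreal \<bar>indicator K x * c - g x\<bar>) < ennreal (eps/2)" by blast
 have [measurable]: "g : Bor" using g by (intro borel_measurable_continuous_onI)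
 have "(NN x. ennreal \<bar>indicator A x * c - g x\<bar>)
   <= (NN x. ennreal \<bar>indicator A x * c - indicator K x * c\<bar>) + (NN x. ennreal \<bar>indicator K x * c - g x\<bar>)"
  by (rule nn_integral_norm_diff_triangle) auto
 also have "... < ennreal (eps/2) + ennreal (eps/2)" using AK g(3) by (rule add_strict_mono)
 also have "... = ennreal eps" using base(3) by (subst ennreal_plus[symmetric]) auto
 finally show ?case using g by auto
next
 case (add f f')
 have e2: "0 < eps/2" using add.prems by simp
 obtain g r where g: "continuous_on UNIV g" "!!x. norm x > r ==> g x = 0"
  "(NN x. ennreal \<bar>f x - g x\<bar>) < ennreal (eps/2)" using add.IH(1)[OF e2] by blast
 obtain g' r' where g': "continuous_on UNIV g'" "!!x. norm x > r' ==> g' x = 0"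
  "(NN x. ennreal \<bar>f' x - g' x\<bar>) < ennreal (eps/2)" using add.IH(2)[OF e2] by blast
 have [measurable]: "g : Bor" "g' : Bor"
  "f : Bor" "f' : Bor"
  using g g' add by (auto intro: borel_measurable_continuous_onI)
 have "(NN x. ennreal \<bar>f x + f' x - (g x + g' x)\<bar>) \<le>
  (NN x. ennreal \<bar>f x - g x\<bar> + ennreal \<bar>f' x - g' x\<bar>)"
  by (auto intro!: nn_integral_mono simp: ennreal_plus[symmetric] simp del: ennreal_plus)
 also have "... = (NN x. ennreal \<bar>f x - g x\<bar>) + (NN x. ennreal \<bar>f' x - g' x\<bar>)"
  by (rule nn_integral_add) auto
 also have "... < ennreal (eps/2) + ennreal (eps/2)" using g(3) g'(3) by (rule add_strict_mono)
 also have "... = ennreal eps" using add by (subst ennreal_plus[symmetric]) auto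
 finally show ?case using g(1,2) g'(1,2)
  by (intro exI[of _ "%x. g x + g' x"] exI[of _ "max r r'"]) (auto intro!: continuous_intros)
next
 case (lim f s)
 have [measurable]: "f : Bor" "!!i. s i : Bor"
  using lim by auto
 have "(%i. \<integral>x. \<bar>f x - s i x\<bar> \<partial>lborel) ~~> (\<integral>x. 0 \<partial>(lborel :: 'a measure))"
 proof (rule integral_dominated_convergence[where w = "%x. 3 * \<bar>f x\<bar>"])
  show "AE x in lborel. (%i. \<bar>f x - s i x\<bar>) ~~> 0"
  proof (intro AE_I2 tendsto_rabs_zero)
   fix x show "(%i. f x - s i x) ~~> 0"
   using tendsto_diff[OF tendsto_const[of "f x"] lim.hyps(2)[of x]] by simp
  qed
  show "AE x in lborel. norm \<bar>f x - s i x\<bar> <= 3 * \<bar>f x\<bar>" for i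
  proof (intro AE_I2)
   fix x show "norm \<bar>f x - s i x\<bar> <= 3 * \<bar>f x\<bar>" using lim.hyps(3)[of x i] by simp
  qed
 qed (use lim in auto)
 then have "eventually (%i. (LB x. \<bar>f x - s i x\<bar>) < eps/2) sequentially"
  using lim by (intro order_tendstoD) auto
 then obtain i where i: "(LB x. \<bar>f x - s i x\<bar>) < eps/2" by (auto simp: eventually_sequentially)
 have 1: "(NN x. ennreal \<bar>f x - s i x\<bar>) < ennreal (eps/2)"
  using lim i by (subst nn_integral_eq_integral) (auto simp: ennreal_less_iff intro!: integral_nonneg_AE)
 obtain g r where g: "continuous_on UNIV g" "!!x. norm x > r ==> g x = 0"
  "(NN x. ennreal \<bar>s i x - g x\<bar>) < ennreal (eps/2)" using lim.IH[of "eps/2" i] lim.prems by auto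
 have [measurable]: "g : Bor" using g by (intro borel_measurable_continuous_onI)
 have "(NN x. ennreal \<bar>f x - g x\<bar>)
   <= (NN x. ennreal \<bar>f x - s i x\<bar>) + (NN x. ennreal \<bar>s i x - g x\<bar>)"
  by (rule nn_integral_norm_diff_triangle) auto
 also have "... < ennreal (eps/2) + ennreal (eps/2)" using 1 g(3) by (rule add_strict_mono)
 also have "... = ennreal eps" using lim by (subst ennreal_plus[symmetric]) auto
 finally show ?case using g by auto
qed

lemma nn_integral_lborel_shift:
 fixes f :: "'a::euclidean_space => ennreal"
 assumes [measurable]: "f : Bor"
 shows "(NN x. f (x + h)) = (NN x. f x)"
proof -
 have "(NN x. f x) = (\<integral>\<^sup>+x. f x \<partial>distr lborel borel ((+) h))"
  by (simp add: lborel_distr_plus)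
 also have "... = (NN x. f (h + x))" by (rule nn_integral_distr) auto
 finally show ?thesis by (simp add: add.commute)
qed

lemma nn_integral_lborel_uminus:
 fixes f :: "'a::euclidean_space => ennreal"
 assumes [measurable]: "f : Bor"
 shows "(NN x. f (- x)) = (NN x. f x)"
proof -
 have "(lborel :: 'a measure) = distr lborel borel uminus"
  using lborel_affine[of "-1" "0::'a"] by (simp add: density_1 one_ennreal_def[symmetric])
 then have "(NN x. f x) = (\<integral>\<^sup>+x. f x \<partial>distr lborel borel uminus)" by simp
 also have "... = (NN x. f (- x))" by (rule nn_integral_distr) auto
 finally show ?thesis by simp
qed

lemma nn_integral_lborel_reflect:
 fixes f :: "'a::euclidean_space => ennreal"
 assumes [measurable]: "f : Bor"
 shows "(NN x. f (h - x)) = (NN x. f x)"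
 using nn_integral_lborel_uminus[of "%x. f (x + h)"] nn_integral_lborel_shift[of f h]
 by (simp add: algebra_simps)

text \<open>Uniform continuity of a compactly supported approximant settles the middle term of a
  three-term estimate; the two outer errors are equal by translation invariance of Lebesgue
  measure.\<close>

lemma L1_translation_continuous:
 fixes f :: "'a::euclidean_space => real"
 assumes f: "integrable lborel f" and e: "0 < eps"
 shows "\<exists>dl>0. \<forall>h. norm h < dl --> (NN x. ennreal \<bar>f (x + h) - f x\<bar>) < ennreal eps"
proof -
 obtain g r where g: "continuous_on UNIV g" "!!x. norm x > r ==> g x = 0"
  "(NN x. ennreal \<bar>f x - g x\<bar>) < ennreal (eps/3)"
  using continuous_compact_support_dense_L1[OF f, of "eps/3"] e by auto
 have [measurable]: "g : Bor" "f : Bor"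
  using g f by (auto intro: borel_measurable_continuous_onI)
 \<comment> \<open>With \<open>norm h < 1\<close>, a point outside the ball of radius
   \<open>R\<close> and its translate by \<open>h\<close> both avoid the support of
   \<open>g\<close>.\<close>
 define R where "R = \<bar>r\<bar> + 1"
 define V where "V = measure lborel (cball (0::'a) R)"
 have V0: "V \<ge> 0" by (simp add: V_def)
 have ucs: "uniformly_continuous_on (cball (0::'a) (R + 1)) g"
  by (intro compact_uniformly_continuous continuous_on_subset[OF g(1)]) auto
 define eta where "eta = eps / (3 * (V + 1))"
 have eta: "eta > 0" using V0 e by (simp add: eta_def)
 obtain d where d: "d > 0" "!!x y. x : cball 0 (R+1) ==> y : cball 0 (R+1) ==> dist y x < d ==> dist (g y) (g x) < eta"
  using ucs eta unfolding uniformly_continuous_on_def by metis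
 have "(NN x. ennreal \<bar>f (x + h) - f x\<bar>) < ennreal eps" if h: "norm h < min d 1" for h
 proof -
  have le: "\<bar>g (x + h) - g x\<bar> <= eta * indicator (cball 0 R) x" for x
  proof (cases "x : cball 0 R")
   case True
   then have "x + h : cball 0 (R+1)" "x : cball 0 (R+1)" using h norm_triangle_ineq[of x h] by auto
   then show ?thesis using d(2)[of x "x+h"] h True by (auto simp: dist_norm)
  next
   case False
   then have "norm x > r" "norm (x + h) > r" using h norm_triangle_ineq2[of x "-h"] by (auto simp: R_def)
   then show ?thesis using g(2) False by simp
  qed
  have "(NN x. ennreal \<bar>g (x + h) - g x\<bar>) <= (\<integral>\<^sup>+x. ennreal eta * indicator (cball 0 R) x \<partial>(lborel :: 'a measure))"
  proof (rule nn_integral_mono)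
   fix x show "ennreal \<bar>g (x + h) - g x\<bar> <= ennreal eta * indicator (cball 0 R) x"
   using ennreal_leI[OF le[of x]] by (auto split: split_indicator)
  qed
  also have "... = ennreal eta * ennreal V"
  proof -
   have "emeasure lborel (cball (0::'a) R) = ennreal V"
   unfolding V_def by (rule emeasure_eq_ennreal_measure[OF less_imp_neq]) (rule emeasure_cball_less_top)
   then show ?thesis by (subst nn_integral_cmult_indicator) auto
  qed
  also have "... = ennreal (eta * V)" using eta V0 by (simp add: ennreal_mult)
  also have "... < ennreal (eps/3)" using V0 e by (intro ennreal_lessI) (auto simp add: eta_def field_simps)
  finally have 2: "(NN x. ennreal \<bar>g (x + h) - g x\<bar>) < ennreal (eps/3)" .
  have 1: "(NN x. ennreal \<bar>f (x + h) - g (x + h)\<bar>) < ennreal (eps/3)"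
   using nn_integral_lborel_shift[of "%x. ennreal \<bar>f x - g x\<bar>" h] g(3) by simp
  have "(NN x. ennreal \<bar>f (x + h) - f x\<bar>) <= 
   (NN x. ennreal \<bar>f (x + h) - g (x + h)\<bar>) + (NN x. ennreal \<bar>g (x + h) - f x\<bar>)"
   by (rule nn_integral_norm_diff_triangle) auto
  also have "(NN x. ennreal \<bar>g (x + h) - f x\<bar>) <= 
   (NN x. ennreal \<bar>g (x + h) - g x\<bar>) + (NN x. ennreal \<bar>g x - f x\<bar>)"
   by (rule nn_integral_norm_diff_triangle) auto
  also have "(NN x. ennreal \<bar>g x - f x\<bar>) = (NN x. ennreal \<bar>f x - g x\<bar>)"
   by (simp add: abs_minus_commute)
  finally have "(NN x. ennreal \<bar>f (x + h) - f x\<bar>) <= (NN x. ennreal \<bar>f (x + h) - g (x + h)\<bar>) +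
   ((NN x. ennreal \<bar>g (x + h) - g x\<bar>) + (NN x. ennreal \<bar>f x - g x\<bar>))" by (simp add: add_left_mono)
  also have "... < ennreal (eps/3) + (ennreal (eps/3) + ennreal (eps/3))"
   using 1 2 g(3) by (intro add_strict_mono) auto
  also have "... = ennreal eps" using e by (simp add: ennreal_plus[symmetric] del: ennreal_plus)
  finally show ?thesis .
 qed
 then show ?thesis using d by (intro exI[of _ "min d 1"]) auto
qed

section \<open>Complete monotonicity by finite differences\<close>

definition fdiff :: "(real => real) => real => real" where
 "fdiff G z = G z - G (z + 1)"

text \<open>Complete monotonicity with differences of step one in place of derivatives: the signs of
  differences survive products and pointwise limits without any smoothness, and step one is what the
  integer points of a Laplace transform can see.\<close>

definition alternating_upto :: "nat => (real => real) => bool" where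
 "alternating_upto m G \<longleftrightarrow> (\<forall>j\<le>m. \<forall>z>0. 0 <= (fdiff ^^ j) G z)"

lemma fdiff_pow_Suc: "(fdiff ^^ Suc j) G = (fdiff ^^ j) (fdiff G)"
 by (simp add: funpow_Suc_right del: funpow.simps)

lemma fdiff_pow_linear:
 "(fdiff ^^ j) (%z. a * F z + b * G z) = (%z. a * (fdiff ^^ j) F z + b * (fdiff ^^ j) G z)"
 by (induction j) (auto simp: fdiff_def fun_eq_iff algebra_simps)

lemma fdiff_pow_shift: "(fdiff ^^ j) (%z. G (z + c)) = (%z. (fdiff ^^ j) G (z + c))"
 by (induction j) (auto simp: fdiff_def fun_eq_iff algebra_simps)

lemma fdiff_pow_cong:
 assumes "!!z. z > 0 ==> F z = G z" "z > 0"
 shows "(fdiff ^^ j) F z = (fdiff ^^ j) G z"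
 using assms by (induction j arbitrary: z) (auto simp: fdiff_def)

lemma fdiff_pow_tendsto:
 assumes "!!z. z > 0 ==> (%n. F n z) ~~> G z" "z > 0"
 shows "(%n. (fdiff ^^ j) (F n) z) ~~> (fdiff ^^ j) G z"
 using assms by (induction j arbitrary: z) (auto simp: fdiff_def intro!: tendsto_diff)

lemma alternating_upto_Suc:
 "alternating_upto (Suc m) G \<longleftrightarrow> (\<forall>z>0. 0 <= G z) & alternating_upto m (fdiff G)"
proof
 assume *: "alternating_upto (Suc m) G"
 show "(\<forall>z>0. 0 <= G z) & alternating_upto m (fdiff G)"
  unfolding alternating_upto_def
 proof (intro conjI allI impI)
  fix z :: real assume "0 < z"
  then show "0 <= G z" using *[unfolded alternating_upto_def, rule_format, of 0 z] by simp
 next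
  fix j z assume "j <= m" "(0::real) < z"
  then show "0 <= (fdiff ^^ j) (fdiff G) z"
   using *[unfolded alternating_upto_def, rule_format, of "Suc j" z] unfolding fdiff_pow_Suc by simp
 qed
next
 assume *: "(\<forall>z>0. 0 <= G z) & alternating_upto m (fdiff G)"
 show "alternating_upto (Suc m) G" unfolding alternating_upto_def
 proof (intro allI impI)
  fix j z assume "j <= Suc m" "(0::real) < z"
  then show "0 <= (fdiff ^^ j) G z"
   using * by (cases j) (auto simp: alternating_upto_def fdiff_pow_Suc simp del: funpow.simps(2))
 qed
qed

lemma alternating_upto_0: "alternating_upto 0 G \<longleftrightarrow> (\<forall>z>0. 0 <= G z)"
 by (simp add: alternating_upto_def)

lemma alternating_upto_mono: "alternating_upto m G ==> k <= m ==> alternating_upto k G"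
 by (auto simp: alternating_upto_def)

lemma alternating_upto_shift: "alternating_upto m G ==> 0 <= c ==> alternating_upto m (%z. G (z + c))"
 by (auto simp: alternating_upto_def fdiff_pow_shift)

lemma alternating_upto_add:
 "alternating_upto m F ==> alternating_upto m G ==> alternating_upto m (%z. F z + G z)"
 using fdiff_pow_linear[of _ 1 F 1 G] by (auto simp: alternating_upto_def)

lemma alternating_upto_cmult:
 "alternating_upto m F ==> 0 <= a ==> alternating_upto m (%z. a * F z)"
 using fdiff_pow_linear[of _ a F 0 F] by (auto simp: alternating_upto_def)

lemma alternating_upto_cong:
 assumes "alternating_upto m F" "!!z. z > 0 ==> F z = G z"
 shows "alternating_upto m G"
 using assms fdiff_pow_cong[of F G] unfolding alternating_upto_def by simp

text \<open>Leibniz rule: \<open>fdiff\<close> of a product is \<open>F\<close> times the difference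
  of \<open>G\<close> plus the difference of \<open>F\<close> times the shifted \<open>G\<close>,
  both products of functions that alternate to the order below.\<close>

lemma alternating_upto_mult:
 "alternating_upto m F ==> alternating_upto m G ==> alternating_upto m (%z. F z * G z)"
proof (induction m arbitrary: F G)
 case (Suc m)
 have "fdiff (%z. F z * G z) = (%z. F z * fdiff G z + fdiff F z * G (z + 1))"
  by (auto simp: fdiff_def fun_eq_iff algebra_simps)
 moreover have "alternating_upto m (%z. F z * fdiff G z + fdiff F z * G (z + 1))"
  using Suc.prems by (intro alternating_upto_add Suc.IH alternating_upto_shift)
   (auto simp: alternating_upto_Suc intro: alternating_upto_mono[of "Suc m"])
 ultimately show ?case using Suc.prems by (auto simp: alternating_upto_Suc)
qed (auto simp: alternating_upto_0)

lemma alternating_upto_power: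
 "alternating_upto m F ==> alternating_upto m (%z. F z ^ k)"
proof (induction k)
 case 0
 have "(fdiff ^^ j) (%z. 1) = (%z. if j = 0 then 1 else 0)" for j
  by (induction j) (auto simp: fdiff_def fun_eq_iff)
 then show ?case by (simp add: alternating_upto_def)
qed (auto intro: alternating_upto_mult)

text \<open>The difference of \<open>1 / (1 + l * phi z)\<close> is \<open>l\<close> times the
  increment of \<open>phi\<close> times the values of the same function at \<open>z\<close> and
  \<open>z + 1\<close>, so each order follows from the one before.\<close>

lemma alternating_upto_resolvent:
 assumes pos: "!!z. z > 0 ==> 0 <= phi z" and l: "l \<ge> 0"
  and alt: "!!m. alternating_upto m (%z. phi (z + 1) - phi z)"
 shows "alternating_upto m (%z. 1 / (1 + l * phi z))"
proof (induction m)
 case 0 then show ?case using pos l by (auto simp: alternating_upto_0)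
next
 case (Suc m)
 let ?G = "%z. 1 / (1 + l * phi z)"
 have "alternating_upto m (%z. l * ((phi (z + 1) - phi z) * (?G z * ?G (z + 1))))"
  using Suc alt l by (intro alternating_upto_cmult alternating_upto_mult alternating_upto_shift[of m ?G]) auto
 moreover have "l * ((phi (z + 1) - phi z) * (?G z * ?G (z + 1))) = fdiff ?G z" if "z > 0" for z
 proof -
  have "1 + l * phi z > 0" "1 + l * phi (z + 1) > 0"
   using pos[of z] pos[of "z+1"] l that by (auto intro: add_pos_nonneg)
  then show ?thesis by (simp add: fdiff_def field_simps)
 qed
 ultimately have "alternating_upto m (fdiff ?G)" by (rule alternating_upto_cong)
 then show ?case using pos l by (simp add: alternating_upto_Suc)
qed

text \<open>Euler's limit: \<open>exp (- s * phi z)\<close> is the pointwise limit of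
  \<open>n\<close>-th powers of resolvents with \<open>l = s / n\<close>, and powers and limits
  preserve the signs. No derivative of a composition has to be computed.\<close>

lemma alternating_upto_exp:
 assumes pos: "!!z. z > 0 ==> 0 <= phi z" and s: "s \<ge> 0"
  and alt: "!!m. alternating_upto m (%z. phi (z + 1) - phi z)"
 shows "alternating_upto m (%z. exp (- s * phi z))"
 unfolding alternating_upto_def
proof (intro allI impI)
 fix j z assume j: "j <= m" "(0::real) < z"
 let ?F = "%n z. (1 / (1 + s / real n * phi z)) ^ n"
 have "(%n. ?F n z) ~~> exp (- s * phi z)" for z
 proof -
  have "(%n. inverse ((1 + (s * phi z) / real n) ^ n)) ~~> inverse (exp (s * phi z))"
   by (intro tendsto_inverse tendsto_exp_limit_sequentially) auto
  then show ?thesis by (simp add: exp_minus power_inverse[symmetric] field_simps)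
 qed
 then have "(%n. (fdiff ^^ j) (?F n) z) ~~> (fdiff ^^ j) (%z. exp (- s * phi z)) z"
  using j by (intro fdiff_pow_tendsto)
 moreover have "0 <= (fdiff ^^ j) (?F n) z" for n
  using alternating_upto_power[OF alternating_upto_resolvent[of phi "s / real n" j, OF pos _ alt], of n] s j
  by (auto simp: alternating_upto_def)
 ultimately show "0 <= (fdiff ^^ j) (%z. exp (- s * phi z)) z"
  by (intro LIMSEQ_le_const) auto
qed

text \<open>Every difference costs one derivative by the mean value theorem. A whole sequence of
  successive derivatives is carried along, so that the induction can pass to the sequence of its
  differences.\<close>

lemma fdiff_pow_nonneg_of_derivs:
 fixes f :: "nat => real => real"
 assumes "!!j z. z > 0 ==> (f j has_real_derivative f (Suc j) z) (at z)"
  and "!!z. z > 0 ==> 0 <= (- 1) ^ m * f m z" and "z > 0"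
 shows "0 <= (fdiff ^^ m) (f 0) z"
 using assms
proof (induction m arbitrary: f z)
 case (Suc m)
 let ?g = "%j z. f j z - f j (z + 1)"
 have "0 <= (fdiff ^^ m) (?g 0) z"
 proof (rule Suc.IH)
  show "(?g j has_real_derivative ?g (Suc j) z) (at z)" if "z > 0" for j z
  proof -
   have "((%z. f j (z + 1)) has_real_derivative f (Suc j) (z + 1)) (at z)"
   using Suc.prems(1)[of "z+1" j] that by (simp add: DERIV_shift)
   then show ?thesis using Suc.prems(1)[OF that] by (intro DERIV_diff)
  qed
  show "0 <= (- 1) ^ m * ?g m z" if z: "z > 0" for z
  proof -
   obtain xi where "z < xi" "f m (z + 1) - f m z = (z + 1 - z) * f (Suc m) xi"
   using MVT2[of z "z+1" "f m" "f (Suc m)"] Suc.prems(1) z by auto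
   then show ?thesis using Suc.prems(2)[of xi] z by (simp add: algebra_simps)
  qed
 qed (use Suc.prems in auto)
 then show ?case unfolding fdiff_pow_Suc by (simp add: fdiff_def[abs_def])
qed simp

definition derivs_of :: "(real => real) => nat => real => real" where
 "derivs_of F j = (deriv ^^ j) F"

lemma bernstein_derivs:
 assumes "bernstein_function F" "z > 0"
 shows "(derivs_of F j has_real_derivative derivs_of F (Suc j) z) (at z)"
 using assms unfolding bernstein_function_def derivs_of_def
 by (simp add: DERIV_deriv_iff_real_differentiable)

lemma bernstein_sign:
 assumes "bernstein_function F" "z > 0"
 shows "0 <= (- 1) ^ m * derivs_of F (Suc m) z"
 using assms unfolding bernstein_function_def derivs_of_def
 by (metis One_nat_def diff_Suc_1 le_add1 plus_1_eq_Suc)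

text \<open>The \<open>j\<close>-th derivative of the increment of \<open>F\<close> over
  \<open>[z, z + 1]\<close> is the derivative of order \<open>j + 1\<close> at an intermediate
  point, whose sign is the Bernstein condition.\<close>

lemma bernstein_alternating:
 assumes "bernstein_function F"
 shows "alternating_upto m (%z. F (z + 1) - F z)"
 unfolding alternating_upto_def
proof (intro allI impI)
 fix j z assume "j <= m" "(0::real) < z"
 let ?f = "%j z. derivs_of F j (z + 1) - derivs_of F j z"
 have "0 <= (fdiff ^^ j) (?f 0) z"
 proof (rule fdiff_pow_nonneg_of_derivs)
  show "(?f j has_real_derivative ?f (Suc j) z) (at z)" if "z > 0" for j z
  proof -
   have "((%z. derivs_of F j (z + 1)) has_real_derivative derivs_of F (Suc j) (z + 1)) (at z)"
   using bernstein_derivs[OF assms, of "z+1" j] that by (simp add: DERIV_shift)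
   then show ?thesis using bernstein_derivs[OF assms that] by (intro DERIV_diff)
  qed
  show "0 <= (- 1) ^ j * ?f j z" if z: "z > 0" for z
  proof -
   obtain xi where "z < xi" "derivs_of F j (z + 1) - derivs_of F j z = (z + 1 - z) * derivs_of F (Suc j) xi"
   using MVT2[of z "z+1" "derivs_of F j" "derivs_of F (Suc j)"] bernstein_derivs[OF assms] z by auto
   then show ?thesis using bernstein_sign[OF assms, of xi j] z by simp
  qed
 qed fact
 then show "0 <= (fdiff ^^ j) (%z. F (z + 1) - F z) z" by (simp add: derivs_of_def)
qed

text \<open>Taylor's formula at \<open>z\<close>, evaluated at a small \<open>eps > 0\<close>: the
  remainder is nonpositive by the sign of the derivative of order \<open>m + 1\<close>, and
  \<open>F eps\<close> is nonnegative. So the polynomial is nonnegative at \<open>eps\<close> and,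
  in the limit, at 0, where \<open>F\<close> itself is not controlled.\<close>

lemma bernstein_taylor_nonneg:
 assumes F: "bernstein_function F" and z: "z > 0"
 shows "0 <= (\<Sum>j\<le>m. derivs_of F j z / fact j * (- z) ^ j)"
proof -
 have le: "0 <= (\<Sum>j\<le>m. derivs_of F j z / fact j * (eps - z) ^ j)" if e: "0 < eps" "eps < z" for eps
 proof -
  have "\<exists>t>eps. t < z & F eps = (\<Sum>j<Suc m. derivs_of F j z / fact j * (eps - z) ^ j)
   + derivs_of F (Suc m) t / fact (Suc m) * (eps - z) ^ Suc m"
   using e by (intro Taylor_down[where b = z]) (auto simp: derivs_of_def[of _ 0] intro!: bernstein_derivs[OF F])
  then obtain t where t: "t > eps" "F eps = (\<Sum>j\<le>m. derivs_of F j z / fact j * (eps - z) ^ j)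
   + derivs_of F (Suc m) t / fact (Suc m) * (eps - z) ^ Suc m" by (auto simp: lessThan_Suc_atMost)
  have "(eps - z) ^ Suc m = - ((- 1) ^ m * (z - eps) ^ Suc m)"
   using power_mult_distrib[of "-1" "z - eps" "Suc m"] by simp
  then have "derivs_of F (Suc m) t / fact (Suc m) * (eps - z) ^ Suc m
   = - (((- 1) ^ m * derivs_of F (Suc m) t) * ((z - eps) ^ Suc m / fact (Suc m)))" by (simp del: power_Suc fact_Suc)
  moreover have "0 <= ((- 1) ^ m * derivs_of F (Suc m) t) * ((z - eps) ^ Suc m / fact (Suc m))"
   using bernstein_sign[OF F, of t m] t e by (intro mult_nonneg_nonneg[of "(- 1) ^ m * derivs_of F (Suc m) t"] divide_nonneg_pos) auto
  moreover have "0 <= F eps" using F e by (simp add: bernstein_function_def)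
  ultimately show ?thesis using t(2) by linarith
 qed
 have "((%eps. \<Sum>j\<le>m. derivs_of F j z / fact j * (eps - z) ^ j) \<longlongrightarrow> (\<Sum>j\<le>m. derivs_of F j z / fact j * (0 - z) ^ j)) (at_right 0)"
  by (intro tendsto_intros)
 then have "0 <= (\<Sum>j\<le>m. derivs_of F j z / fact j * (0 - z) ^ j)"
 proof (rule tendsto_lowerbound)
  show "\<forall>\<^sub>F eps in at_right 0. 0 <= (\<Sum>j\<le>m. derivs_of F j z / fact j * (eps - z) ^ j)"
   using le z by (auto simp: eventually_at_right_field)
 qed auto
 then show ?thesis by simp
qed

text \<open>With \<open>T k z\<close> the Taylor polynomial of \<open>F\<close> centred at
  \<open>z\<close> and evaluated at 0, the \<open>k\<close>-th derivative of \<open>F z / z\<close>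
  is \<open>(- 1) ^ k * fact k * T k z / z ^ Suc k\<close>. The derivative of \<open>T\<close>
  telescopes to its last term, and \<open>T\<close> is nonnegative by the previous lemma.\<close>

lemma bernstein_div_alternating:
 assumes F: "bernstein_function F"
 shows "alternating_upto m (%z. F z / z)"
 unfolding alternating_upto_def
proof (intro allI impI)
 fix k z assume "k <= m" "(0::real) < z"
 define T where "T = (%j z. \<Sum>i\<le>j. derivs_of F i z / fact i * (- z) ^ i)"
 define f where "f = (%j z. (- 1) ^ j * fact j * T j z / z ^ Suc j)"
 have dT: "(T j has_real_derivative (derivs_of F (Suc j) z / fact j * (- z) ^ j)) (at z)" if "z > 0" for j z
 proof (induction j)
  case 0 then show ?case using bernstein_derivs[OF F that, of 0] by (simp add: T_def)
 next
  case (Suc j)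
  have "((%z. derivs_of F (Suc j) z / fact (Suc j) * (- z) ^ Suc j) has_real_derivative
   derivs_of F (Suc (Suc j)) z / fact (Suc j) * (- z) ^ Suc j - derivs_of F (Suc j) z / fact j * (- z) ^ j) (at z)"
  proof -
   have "((%z. derivs_of F (Suc j) z * ((- z) ^ Suc j / fact (Suc j))) has_real_derivative
   derivs_of F (Suc j) z * ((real (Suc j) * (- z) ^ j * (- 1)) / fact (Suc j)) + derivs_of F (Suc (Suc j)) z * ((- z) ^ Suc j / fact (Suc j))) (at z)"
   proof (rule DERIV_mult'[OF bernstein_derivs[OF F that]])
   show "((%z. (- z) ^ Suc j / fact (Suc j)) has_real_derivative real (Suc j) * (- z) ^ j * - 1 / fact (Suc j)) (at z)"
   using DERIV_power_Suc[OF DERIV_minus[OF DERIV_ident], where n = j and x = z] by (intro DERIV_cdivide) (simp add: algebra_simps)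
   qed
   note a = this
   have b: "real (Suc j) * (- z) ^ j * (- 1) / fact (Suc j) = - ((- z) ^ j / fact j)"
   proof -
   have f: "(fact (Suc j) :: real) = real (Suc j) * fact j" by simp
   show ?thesis unfolding f by (simp del: of_nat_Suc fact_Suc)
   qed
   from a[unfolded b] show ?thesis by (simp add: algebra_simps del: power_Suc of_nat_Suc fact_Suc)
  qed
  from DERIV_add[OF Suc this] show ?case by (simp add: T_def)
 qed
 have "0 <= (fdiff ^^ k) (f 0) z"
 proof (rule fdiff_pow_nonneg_of_derivs)
  show "(f j has_real_derivative f (Suc j) z) (at z)" if "z > 0" for j z
  proof -
   have "((%z. z ^ Suc j) has_real_derivative real (Suc j) * z ^ j) (at z)"
   using DERIV_power_Suc[OF DERIV_ident, where n = j and x = z] by simp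
   from DERIV_divide[OF DERIV_cmult[OF dT[OF that, of j], of "(- 1) ^ j * fact j"] this] that
   have "(f j has_real_derivative (- 1) ^ j * fact j * 
   (derivs_of F (Suc j) z / fact j * (- z) ^ j * z ^ Suc j - T j z * (real (Suc j) * z ^ j)) / (z ^ Suc j * z ^ Suc j)) (at z)"
   unfolding f_def by (simp add: algebra_simps del: power_Suc of_nat_Suc)
   moreover have "(- 1) ^ j * fact j * 
   (derivs_of F (Suc j) z / fact j * (- z) ^ j * z ^ Suc j - T j z * (real (Suc j) * z ^ j)) / (z ^ Suc j * z ^ Suc j)
   = f (Suc j) z"
   proof -
   have alg: "sg * q * (d / q * M * (z * P) - t * (r * P)) / ((z * P) * (z * P))
   = (- 1 * sg) * (r * q) * (t + d / (r * q) * (- z * M)) / (z * (z * P))"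
   if "q \<noteq> 0" "P \<noteq> 0" "r \<noteq> 0" for sg q d M P t r :: real
   using that \<open>z > 0\<close> by (simp add: field_simps)
   have "T (Suc j) z = T j z + derivs_of F (Suc j) z / fact (Suc j) * (- z) ^ Suc j" by (simp add: T_def)
   then show ?thesis using that alg[of "fact j" "z ^ j" "real (Suc j)"] unfolding f_def
   by (simp del: of_nat_Suc)
   qed
   ultimately show ?thesis by simp
  qed
  show "0 <= (- 1) ^ k * f k z" if "z > 0" for z
  proof -
   have "(- 1) ^ k * f k z = fact k * T k z / z ^ Suc k"
   by (simp add: f_def flip: power_mult_distrib mult.assoc)
   then show ?thesis using bernstein_taylor_nonneg[OF F that, of k] that by (simp add: T_def)
  qed
 qed fact
 then show "0 <= (fdiff ^^ k) (%z. F z / z) z" by (simp add: f_def T_def derivs_of_def)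
qed

section \<open>Gaussians and uniqueness of Fourier transforms\<close>

definition heat :: "real => 'a::euclidean_space => real" where
 "heat s x = (\<Prod>b\<in>Basis. normal_density 0 (sqrt (2 * s)) (x \<bullet> b))"

lemma heat_nonneg: "0 <= heat s x"
 unfolding heat_def by (intro prod_nonneg) auto

lemma heat_measurable [measurable]: "heat s : Bor"
 unfolding heat_def[abs_def] by measurable

lemma heat_measurable2 [measurable]: "(%p. heat (fst p) (snd p :: 'a::euclidean_space)) : borel_measurable (borel \<Otimes>\<^sub>M borel)"
 unfolding heat_def normal_density_def by measurable

lemma heat_eq_exp:
 assumes "s > 0"
 shows "heat s (x::'a::euclidean_space) = (1 / sqrt (4 * pi * s)) ^ DIM('a) * exp (- (norm x)\<^sup>2 / (4 * s))"
proof -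
 have "heat s x = (\<Prod>b\<in>Basis. (1 / sqrt (4 * pi * s)) * exp (- (x \<bullet> b)\<^sup>2 / (4 * s)))"
  unfolding heat_def normal_density_def using assms by (intro prod.cong) (auto simp: algebra_simps)
 also have "... = (1 / sqrt (4 * pi * s)) ^ DIM('a) * exp (\<Sum>b\<in>Basis. - (x \<bullet> b)\<^sup>2 / (4 * s))"
  by (subst prod.distrib) (simp add: exp_sum)
 also have "(\<Sum>b\<in>Basis. - (x \<bullet> b)\<^sup>2 / (4 * s)) = - (norm x)\<^sup>2 / (4 * s)"
 proof -
  have "(norm x)\<^sup>2 = (\<Sum>b\<in>Basis. (x \<bullet> b)\<^sup>2)"
   using power2_norm_eq_inner[of x] euclidean_inner[of x x] by (simp add: power2_eq_square)
  then show ?thesis by (simp add: sum_divide_distrib sum_negf)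
 qed
 finally show ?thesis .
qed

lemma heat_le:
 assumes "0 < dl" "dl <= s"
 shows "heat s (x::'a::euclidean_space) <= (1 / sqrt (4 * pi * dl)) ^ DIM('a)"
proof -
 have "heat s x <= (1 / sqrt (4 * pi * s)) ^ DIM('a) * 1"
  unfolding heat_eq_exp[OF less_le_trans[OF assms]] using assms by (intro mult_left_mono) auto
 also have "... <= (1 / sqrt (4 * pi * dl)) ^ DIM('a)"
  using assms by (auto intro!: power_mono divide_left_mono)
 finally show ?thesis .
qed

lemma nn_integral_heat:
 assumes "s > 0"
 shows "(NN x. ennreal (heat s (x::'a::euclidean_space))) = 1"
proof -
 have "(NN x. ennreal (heat s (x::'a))) = (NN x. (\<Prod>b\<in>Basis. ennreal (normal_density 0 (sqrt (2 * s)) ((x::'a) \<bullet> b))))"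
  unfolding heat_def by (simp add: prod_ennreal)
 also have "... = (\<Prod>b\<in>(Basis::'a set). (NN x. ennreal (normal_density 0 (sqrt (2 * s)) x)))"
  by (rule nn_integral_lborel_prod) auto
 also have "(NN x. ennreal (normal_density 0 (sqrt (2 * s)) x)) = 1"
  using assms by (subst nn_integral_eq_integral) auto
 finally show ?thesis by simp
qed

lemma integrable_heat: "s > 0 ==> integrable lborel (heat s :: 'a::euclidean_space => real)"
 using nn_integral_heat[of s, where 'a = 'a] by (intro integrableI_nonneg) (auto simp: heat_nonneg)

lemma normal_density_fourier:
 assumes s: "sg > 0"
 shows "(LB x. normal_density 0 sg x *\<^sub>R cis (x * t)) = of_real (exp (- (sg * t)\<^sup>2 / 2))"
proof -
 have "(LB x. normal_density 0 sg x *\<^sub>R cis (x * t))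
  = \<bar>sg\<bar> *\<^sub>R (LB x. normal_density 0 sg (0 + sg * x) *\<^sub>R cis ((0 + sg * x) * t))"
  using s by (intro lborel_integral_real_affine) auto
 also have "... = (LB x. sg *\<^sub>R (normal_density 0 sg (sg * x) *\<^sub>R cis (sg * x * t)))"
  using s by (simp del: scaleR_scaleR)
 also have "... = (LB x. std_normal_density x *\<^sub>R cis (sg * t * x))"
 proof (intro Bochner_Integration.integral_cong refl)
  fix x
  have "sg * normal_density 0 sg (sg * x) = std_normal_density x"
   using s by (simp add: normal_density_def real_sqrt_mult power_mult_distrib field_simps)
  then show "sg *\<^sub>R (normal_density 0 sg (sg * x) *\<^sub>R cis (sg * x * t)) = std_normal_density x *\<^sub>R cis (sg * t * x)"
   by (simp add: mult_ac)
 qed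
 also have "... = (\<integral>x. iexp (sg * t * x) \<partial>std_normal_distribution)"
  by (subst integral_density) (auto simp: cis_conv_exp)
 also have "... = char std_normal_distribution (sg * t)" by (simp add: char_def)
 finally show ?thesis by (simp add: char_std_normal_distribution)
qed

lemma cis_sum: "finite A ==> cis (\<Sum>a\<in>A. f a) = (\<Prod>a\<in>A. cis (f a))"
 by (induction A rule: finite_induct) (auto simp: cis_mult[symmetric])

lemma cis_measurable [measurable (raw)]:
 "f : borel_measurable M ==> (%x. cis (f x)) : borel_measurable M"
 unfolding cis_conv_exp by measurable

text \<open>Density and character both factor over the coordinates, and Fubini reduces the integral
  to dimension one. The variance \<open>2 * s\<close> in \<open>heat\<close> makes the exponent
  exactly \<open>- s * (norm xi)^2\<close>, the symbol of the heat semigroup of the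
  Laplacian.\<close>

lemma heat_fourier_cis:
 fixes xi :: "'a::euclidean_space"
 assumes s: "s > 0"
 shows "(LB x. heat s x *\<^sub>R cis (x \<bullet> xi)) = of_real (exp (- s * (norm xi)\<^sup>2))"
proof -
 interpret product_sigma_finite "%_. lborel :: real measure" by standard
 let ?g = "%b x. normal_density 0 (sqrt (2 * s)) x *\<^sub>R cis (x * (xi \<bullet> b))"
 have prod: "heat s x *\<^sub>R cis (x \<bullet> xi) = (\<Prod>b\<in>Basis. ?g b (x \<bullet> b))" for x
 proof -
  have "x \<bullet> xi = (\<Sum>b\<in>Basis. (x \<bullet> b) * (xi \<bullet> b))" by (rule euclidean_inner)
  then show ?thesis by (simp add: heat_def cis_sum scaleR_conv_of_real prod.distrib)
 qed
 have int: "integrable lborel (?g b)" for b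
  by (rule Bochner_Integration.integrable_bound[OF integrable_normal_density[of "sqrt (2 * s)" 0]])
   (use s in auto)
 have "(LB x. heat s x *\<^sub>R cis (x \<bullet> xi)) = (LB x. (\<Prod>b\<in>Basis. ?g b ((x::'a) \<bullet> b)))"
  by (simp only: prod)
 also have "... = (\<integral>f. (\<Prod>b\<in>(Basis::'a set). ?g b (f b)) \<partial>(Pi\<^sub>M Basis (%_. lborel)))"
  by (subst lborel_eq, subst integral_distr) (auto intro!: Bochner_Integration.integral_cong prod.cong)
 also have "... = (\<Prod>b\<in>(Basis::'a set). (LB x. ?g b x))"
  by (rule product_integral_prod) (auto intro: int)
 also have "... = (\<Prod>b\<in>(Basis::'a set). of_real (exp (- s * (xi \<bullet> b)\<^sup>2)))"
  using s by (intro prod.cong refl) (subst normal_density_fourier, auto simp: power_mult_distrib)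
 also have "... = of_real (exp (\<Sum>b\<in>(Basis::'a set). - s * (xi \<bullet> b)\<^sup>2))"
  by (simp add: exp_sum)
 also have "(\<Sum>b\<in>(Basis::'a set). - s * (xi \<bullet> b)\<^sup>2) = - s * (norm xi)\<^sup>2"
  using power2_norm_eq_inner[of xi] euclidean_inner[of xi xi]
  by (simp add: sum_distrib_left[symmetric] sum_negf power2_eq_square)
 finally show ?thesis .
qed

lemma integrable_heat_mult:
 fixes f :: "'a::euclidean_space => real"
 assumes "s > 0" "f : Bor" "!!x. \<bar>f x\<bar> <= B"
 shows "integrable lborel (%x. heat s x * f x)"
proof (rule Bochner_Integration.integrable_bound[of _ "%x. heat s x * B"])
 show "AE x in lborel. norm (heat s x * f x) <= norm (heat s x * B)"
 proof (intro AE_I2)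
  fix x :: 'a
  have "\<bar>f x\<bar> <= \<bar>B\<bar>" using assms(3)[of x] by linarith
  then show "norm (heat s x * f x) <= norm (heat s x * B)" by (simp add: abs_mult mult_left_mono)
 qed
qed (use assms integrable_heat[of s] in auto)

lemma heat_fourier:
 fixes xi :: "'a::euclidean_space"
 assumes s: "s > 0"
 shows "(LB x. heat s x * cos (x \<bullet> xi)) = exp (- s * (norm xi)\<^sup>2)"
  and "(LB x. heat s x * sin (x \<bullet> xi)) = 0"
proof -
 have "integrable lborel (%x. heat s x *\<^sub>R cis (x \<bullet> xi))"
  by (rule Bochner_Integration.integrable_bound[OF integrable_heat[OF s]]) auto
 from integral_Re[OF this] integral_Im[OF this]
 show "(LB x. heat s x * cos (x \<bullet> xi)) = exp (- s * (norm xi)\<^sup>2)"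
  and "(LB x. heat s x * sin (x \<bullet> xi)) = 0"
  unfolding heat_fourier_cis[OF s] by auto
qed

lemma heat_scale:
 assumes "c > 0"
 shows "heat (c\<^sup>2) (c *\<^sub>R w :: 'a::euclidean_space) * c ^ DIM('a) = heat 1 w"
 using assms by (simp add: heat_eq_exp real_sqrt_mult power_mult_distrib power_divide)

text \<open>Closed sets generate the Borel sets and are stable under intersection, and the indicator
  of a closed set is a bounded limit of the functions \<open>bump C j\<close>.\<close>

lemma measure_eqI_bounded_continuous:
 fixes M N :: "'a::euclidean_space measure"
 assumes fin: "finite_measure M" "finite_measure N" and sets: "sets M = sets borel" "sets N = sets borel"
  and eq: "!!f :: 'a => real. continuous_on UNIV f ==> (!!x. 0 <= f x & f x <= 1) ==> (\<integral>x. f x \<partial>M) = (\<integral>x. f x \<partial>N)"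
 shows "M = N"
proof -
 interpret M: finite_measure M by fact
 interpret N: finite_measure N by fact
 note [measurable_cong] = sets
 have closed: "emeasure M C = emeasure N C" if C: "closed C" for C
 proof (cases "C = {}")
  case False
  have [measurable]: "C : sets borel" using C by auto
  have lim: "(%j. \<integral>x. bump C j x \<partial>K) ~~> measure K C" if "finite_measure K" and [measurable_cong]: "sets K = sets borel" for K
  proof -
   interpret finite_measure K by fact
   have "(%j. \<integral>x. bump C j x \<partial>K) ~~> (\<integral>x. indicator C x \<partial>K)"
   using bump_bounds[of C] by (intro integral_dominated_convergence[where w = "%_. 1"])
   (auto intro!: AE_I2 bump_tendsto C False simp: abs_of_nonneg)
   moreover have "space K = UNIV" using \<open>sets K = sets borel\<close> sets_eq_imp_space_eq by fastforce
   ultimately show ?thesis by simp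
  qed
  have "measure M C = measure N C"
   using lim[OF fin(1) sets(1)] lim[OF fin(2) sets(2)] eq[OF continuous_bump[of C]] bump_bounds[of C]
   by (auto intro: LIMSEQ_unique)
  then show ?thesis by (simp add: M.emeasure_eq_measure N.emeasure_eq_measure)
 qed simp
 show ?thesis
 proof (rule measure_eqI_generator_eq[where E = "Collect closed" and \<Omega> = UNIV and A = "%_. UNIV"])
  show "Int_stable (Collect closed :: 'a set set)" by (auto simp: Int_stable_def)
  show "sets M = sigma_sets UNIV (Collect closed)" "sets N = sigma_sets UNIV (Collect closed)"
   unfolding sets borel_eq_closed by (auto intro!: sets_measure_of)
 qed (use closed in auto)
qed

lemma heat_average_tendsto:
 fixes f :: "'a::euclidean_space => real"
 assumes f: "continuous_on UNIV f" "!!x. 0 <= f x & f x <= 1"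
 shows "(%j. \<integral>w. heat 1 w * f (y + (1 / real (Suc j)) *\<^sub>R w) \<partial>lborel) ~~> f y"
proof -
 have [measurable]: "f : Bor" using f by (intro borel_measurable_continuous_onI)
 have "(%j. \<integral>w. heat 1 w * f (y + (1 / real (Suc j)) *\<^sub>R w) \<partial>lborel) ~~> (\<integral>w. heat 1 w * f y \<partial>(lborel :: 'a measure))"
 proof (rule integral_dominated_convergence[where w = "heat 1"])
  show "AE w in lborel. (%j. heat 1 w * f (y + (1 / real (Suc j)) *\<^sub>R w)) ~~> heat 1 w * f y"
  proof (intro AE_I2 tendsto_mult tendsto_const)
   fix w :: 'a
   have "(%j. y + (1 / real (Suc j)) *\<^sub>R w) ~~> y + 0 *\<^sub>R w"
   using LIMSEQ_inverse_real_of_nat by (intro tendsto_intros) (simp add: inverse_eq_divide)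
   then show "(%j. f (y + (1 / real (Suc j)) *\<^sub>R w)) ~~> f y"
   using f(1) by (intro isCont_tendsto_compose[of _ f]) (auto simp: continuous_on_eq_continuous_at)
  qed
  show "AE w in lborel. norm (heat 1 w * f (y + (1 / real (Suc j)) *\<^sub>R w)) <= heat 1 w" for j
   using f(2) by (intro AE_I2) (auto simp: abs_mult heat_nonneg abs_of_nonneg mult_left_le)
 qed (auto intro: integrable_heat)
 moreover have "(LB w. heat 1 (w::'a)) = 1"
  using nn_integral_heat[of 1, where 'a = 'a] by (subst integral_eq_nn_integral) (auto simp: heat_nonneg)
 ultimately show ?thesis by simp
qed

text \<open>The substitution of \<open>y + c w\<close> for \<open>x\<close>: averaging at scale
  \<open>c\<close> is integration against the heat kernel at time \<open>c^2\<close>.\<close>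

lemma nn_integral_heat_average:
 fixes f :: "'a::euclidean_space => real"
 assumes [measurable]: "f : Bor" and f: "!!x. 0 <= f x" and c: "c > 0"
 shows "(NN w. ennreal (heat 1 w * f (y + c *\<^sub>R w))) = (NN x. ennreal (f x) * ennreal (heat (c\<^sup>2) (x - y)))"
proof -
 have "(NN x. ennreal (f x) * ennreal (heat (c\<^sup>2) (x - y)))
  = (NN w. \<bar>c\<bar> ^ DIM('a) * (ennreal (f (y + c *\<^sub>R w)) * ennreal (heat (c\<^sup>2) (c *\<^sub>R w))))"
  using c by (subst lborel_affine[of c y]) (auto simp: nn_integral_density nn_integral_distr)
 also have "... = (NN w. ennreal (heat 1 w * f (y + c *\<^sub>R w)))"
  using c by (intro nn_integral_cong, subst heat_scale[symmetric, OF c])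
   (simp add: ennreal_mult'[symmetric] f heat_nonneg mult_ac)
 finally show ?thesis by simp
qed

text \<open>A Gaussian is itself the Fourier transform of the Gaussian \<open>heat r\<close>;
  exchanging the integrals expresses the smoothing of \<open>K\<close> through the transform of
  \<open>K\<close> alone.\<close>

lemma gaussian_average:
 fixes K :: "'a::euclidean_space measure"
 assumes K: "finite_measure K" and [measurable_cong]: "sets K = sets borel" and r: "r > 0"
 shows "(\<integral>y. exp (- r * (norm (x - y))\<^sup>2) \<partial>K) =
   (LB xi. heat r xi * (cos (xi \<bullet> x) * (\<integral>y. cos (y \<bullet> xi) \<partial>K) + sin (xi \<bullet> x) * (\<integral>y. sin (y \<bullet> xi) \<partial>K)))"
proof -
 interpret K: finite_measure K by fact
 interpret P: pair_sigma_finite K lborel by standard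
 have i: "integrable K (%y. cos (y \<bullet> xi))" "integrable K (%y. sin (y \<bullet> xi))" for xi
  by (auto intro!: K.integrable_const_bound[of _ 1])
 have "integrable (K \<Otimes>\<^sub>M lborel) (%(y, xi). heat r xi * cos (xi \<bullet> (x - y)))"
 proof (rule Bochner_Integration.integrable_bound)
  show "integrable (K \<Otimes>\<^sub>M lborel) (%(y, xi). heat r xi)"
   by (rule P.Fubini_integrable) (auto simp: integrable_heat[OF r])
 qed (auto simp: abs_mult heat_nonneg mult_left_le)
 from P.Fubini_integral[OF this]
 have "(\<integral>y. (LB xi. heat r xi * cos (xi \<bullet> (x - y))) \<partial>K) = (LB xi. (\<integral>y. heat r xi * cos (xi \<bullet> (x - y)) \<partial>K))"
  by simp
 also have "... = (LB xi. heat r xi * (cos (xi \<bullet> x) * (\<integral>y. cos (y \<bullet> xi) \<partial>K) + sin (xi \<bullet> x) * (\<integral>y. sin (y \<bullet> xi) \<partial>K)))"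
  using i by (intro Bochner_Integration.integral_cong refl) (simp add: inner_diff_right cos_diff inner_commute)
 finally show ?thesis by (simp add: heat_fourier[OF r])
qed

text \<open>The integral of \<open>f\<close> is the limit of the integrals of its Gaussian averages
  of width \<open>1 / Suc j\<close>. By Tonelli each of these is an integral of \<open>f\<close>
  against the smoothed measure, which by \<open>gaussian_average\<close> depends on the Fourier
  transform only.\<close>

lemma fourier_unique:
 fixes M N :: "'a::euclidean_space measure"
 assumes fin: "finite_measure M" "finite_measure N" and sets: "sets M = sets borel" "sets N = sets borel"
  and cos: "!!xi. (\<integral>x. cos (x \<bullet> xi) \<partial>M) = (\<integral>x. cos (x \<bullet> xi) \<partial>N)"
  and sin: "!!xi. (\<integral>x. sin (x \<bullet> xi) \<partial>M) = (\<integral>x. sin (x \<bullet> xi) \<partial>N)"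
 shows "M = N"
proof -
 show ?thesis
 proof (rule measure_eqI_bounded_continuous[OF fin sets])
  fix f :: "'a => real" assume f: "continuous_on UNIV f" "!!x. 0 <= f x & f x <= 1"
  have [measurable]: "f : Bor" using f by (intro borel_measurable_continuous_onI)
  let ?F = "%j y. \<integral>w. heat 1 w * f (y + (1 / real (Suc j)) *\<^sub>R w) \<partial>lborel"
  have F01: "0 <= ?F j y & ?F j y <= 1" for j y
  proof -
   have "?F j y <= (LB w. heat 1 (w::'a))"
   using f(2) by (intro integral_mono integrable_heat_mult[where B = 1] integrable_heat) (auto simp: mult_left_le heat_nonneg abs_of_nonneg)
   also have "... = 1"
   using nn_integral_heat[of 1, where 'a = 'a] by (subst integral_eq_nn_integral) (auto simp: heat_nonneg)
   finally show ?thesis using f(2) by (auto intro!: integral_nonneg_AE simp: heat_nonneg)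
  qed
  have lim: "(%j. \<integral>y. ?F j y \<partial>K) ~~> (\<integral>y. f y \<partial>K)" if "finite_measure K" and [measurable_cong]: "sets K = sets borel" for K
  proof -
   interpret finite_measure K by fact
   show ?thesis
   proof (rule integral_dominated_convergence[where w = "%_. 1"])
   show "AE y in K. (%j. ?F j y) ~~> f y" by (intro AE_I2 heat_average_tendsto f)
   show "AE y in K. norm (?F j y) <= 1" for j
   using F01 by (intro AE_I2) (simp add: abs_of_nonneg del: of_nat_Suc)
   qed auto
  qed
  have nn: "(\<integral>y. ?F j y \<partial>K) = enn2real (NN x. ennreal (f x) * ennreal ((1 / sqrt (4 * pi * (1 / real (Suc j))\<^sup>2)) ^ DIM('a) *
   (\<integral>y. exp (- (1 / (4 * (1 / real (Suc j))\<^sup>2)) * (norm (x - y))\<^sup>2) \<partial>K)))"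
   if "finite_measure K" and [measurable_cong]: "sets K = sets borel" for K j
  proof -
   interpret K: finite_measure K by fact
   interpret P: pair_sigma_finite K lborel by standard
   define c where "c = 1 / real (Suc j)"
   have c: "c > 0" by (simp add: c_def)
   have "(\<integral>y. ?F j y \<partial>K) = enn2real (\<integral>\<^sup>+y. ennreal (?F j y) \<partial>K)"
   using F01 by (intro integral_eq_nn_integral) auto
   also have "(\<integral>\<^sup>+y. ennreal (?F j y) \<partial>K) = (\<integral>\<^sup>+y. (NN w. ennreal (heat 1 w * f (y + c *\<^sub>R w))) \<partial>K)"
   unfolding c_def
   proof (intro nn_integral_cong nn_integral_eq_integral[symmetric] AE_I2)
   fix y show "integrable lborel (%w. heat 1 w * f (y + (1 / real (Suc j)) *\<^sub>R w))"
   using f(2) by (intro integrable_heat_mult[where B = 1]) (auto simp: abs_of_nonneg)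
   qed (use f(2) in \<open>auto simp: heat_nonneg\<close>)
   also have "... = (\<integral>\<^sup>+y. (NN x. ennreal (f x) * ennreal (heat (c\<^sup>2) (x - y))) \<partial>K)"
   using f(2) c by (intro nn_integral_cong nn_integral_heat_average) auto
   also have "... = (NN x. (\<integral>\<^sup>+y. ennreal (f x) * ennreal (heat (c\<^sup>2) (x - y)) \<partial>K))"
   by (rule P.Fubini'[symmetric]) (auto simp: heat_def)
   also have "... = (NN x. ennreal (f x) * ennreal ((1 / sqrt (4 * pi * c\<^sup>2)) ^ DIM('a) * (\<integral>y. exp (- (1 / (4 * c\<^sup>2)) * (norm (x - y))\<^sup>2) \<partial>K)))"
   proof (intro nn_integral_cong)
   fix x :: 'a
   have "(\<integral>\<^sup>+y. ennreal (heat (c\<^sup>2) (x - y)) \<partial>K) = ennreal (\<integral>y. heat (c\<^sup>2) (x - y) \<partial>K)"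
   proof (rule nn_integral_eq_integral)
   show "integrable K (%y. heat (c\<^sup>2) (x - y))"
   proof (rule K.integrable_const_bound)
   show "AE y in K. norm (heat (c\<^sup>2) (x - y)) <= (1 / sqrt (4 * pi * c\<^sup>2)) ^ DIM('a)"
   using c heat_le[of "c\<^sup>2" "c\<^sup>2"] by (intro AE_I2) (auto simp: heat_nonneg abs_of_nonneg)
   qed auto
   qed (simp add: heat_nonneg)
   also have "(\<integral>y. heat (c\<^sup>2) (x - y) \<partial>K) = (1 / sqrt (4 * pi * c\<^sup>2)) ^ DIM('a) * (\<integral>y. exp (- (1 / (4 * c\<^sup>2)) * (norm (x - y))\<^sup>2) \<partial>K)"
   using c by (simp add: heat_eq_exp)
   finally show "(\<integral>\<^sup>+y. ennreal (f x) * ennreal (heat (c\<^sup>2) (x - y)) \<partial>K) = 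
   ennreal (f x) * ennreal ((1 / sqrt (4 * pi * c\<^sup>2)) ^ DIM('a) * (\<integral>y. exp (- (1 / (4 * c\<^sup>2)) * (norm (x - y))\<^sup>2) \<partial>K))"
   by (subst nn_integral_cmult) (auto simp: heat_def)
   qed
   finally show ?thesis by (simp only: c_def)
  qed
  have "(\<integral>y. ?F j y \<partial>M) = (\<integral>y. ?F j y \<partial>N)" for j
   unfolding nn[OF fin(1) sets(1)] nn[OF fin(2) sets(2)]
   by (subst (1 2) gaussian_average) (use fin sets in \<open>auto simp: cos sin\<close>)
  then show "(\<integral>y. f y \<partial>M) = (\<integral>y. f y \<partial>N)"
   using lim[OF fin(1) sets(1)] lim[OF fin(2) sets(2)] by (auto intro: LIMSEQ_unique)
 qed
qed

text \<open>The combinations \<open>1 + cos\<close> and \<open>1 - sin\<close> are nonnegative, so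
  the hypotheses can be verified with nonnegative integrals and Tonelli's theorem. At
  \<open>xi = 0\<close> the first one yields twice the total mass, which is then subtracted.\<close>

lemma fourier_unique_nonneg:
 fixes M N :: "'a::euclidean_space measure"
 assumes fin: "finite_measure M" "finite_measure N" and sets: "sets M = sets borel" "sets N = sets borel"
  and cos: "!!xi. (\<integral>\<^sup>+x. ennreal (1 + cos (x \<bullet> xi)) \<partial>M) = (\<integral>\<^sup>+x. ennreal (1 + cos (x \<bullet> xi)) \<partial>N)"
  and sin: "!!xi. (\<integral>\<^sup>+x. ennreal (1 - sin (x \<bullet> xi)) \<partial>M) = (\<integral>\<^sup>+x. ennreal (1 - sin (x \<bullet> xi)) \<partial>N)"
 shows "M = N"
proof -
 have c: "(\<integral>\<^sup>+x. ennreal (1 + cos (x \<bullet> xi)) \<partial>K) = ennreal (measure K UNIV + (\<integral>x. cos (x \<bullet> xi) \<partial>K)) \<and>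
   (\<integral>\<^sup>+x. ennreal (1 - sin (x \<bullet> xi)) \<partial>K) = ennreal (measure K UNIV - (\<integral>x. sin (x \<bullet> xi) \<partial>K)) \<and>
   0 <= measure K UNIV + (\<integral>x. cos (x \<bullet> xi) \<partial>K) & 0 <= measure K UNIV - (\<integral>x. sin (x \<bullet> xi) \<partial>K)"
  if "finite_measure K" and [measurable_cong]: "sets K = sets borel" for K and xi :: 'a
 proof -
  interpret finite_measure K by fact
  have sp: "space K = UNIV" using \<open>sets K = sets borel\<close>[THEN sets_eq_imp_space_eq] by simp
  have i: "integrable K (%y. cos (y \<bullet> xi))" "integrable K (%y. sin (y \<bullet> xi))"
   by (auto intro!: integrable_const_bound[of _ 1])
  have nn: "0 <= 1 + cos x" "0 <= 1 - sin x" for x :: real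
   using cos_ge_minus_one[of x] sin_le_one[of x] by linarith+
  have e: "(\<integral>x. 1 + cos (x \<bullet> xi) \<partial>K) = measure K UNIV + (\<integral>x. cos (x \<bullet> xi) \<partial>K)"
   "(\<integral>x. 1 - sin (x \<bullet> xi) \<partial>K) = measure K UNIV - (\<integral>x. sin (x \<bullet> xi) \<partial>K)"
   using i sp by auto
  have "0 <= (\<integral>x. 1 + cos (x \<bullet> xi) \<partial>K)" "0 <= (\<integral>x. 1 - sin (x \<bullet> xi) \<partial>K)"
   using nn by (auto intro!: integral_nonneg_AE)
  moreover have "(\<integral>\<^sup>+x. ennreal (1 + cos (x \<bullet> xi)) \<partial>K) = ennreal (\<integral>x. 1 + cos (x \<bullet> xi) \<partial>K)"
   "(\<integral>\<^sup>+x. ennreal (1 - sin (x \<bullet> xi)) \<partial>K) = ennreal (\<integral>x. 1 - sin (x \<bullet> xi) \<partial>K)"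
   using i nn by (intro nn_integral_eq_integral; auto)+
  ultimately show ?thesis unfolding e[symmetric] by blast
 qed
 note cM = c[OF fin(1) sets(1)] and cN = c[OF fin(2) sets(2)]
 have sp: "space M = UNIV" "space N = UNIV" using sets[THEN sets_eq_imp_space_eq] by auto
 have m: "measure M UNIV = measure N UNIV"
  using cos[of 0] cM[of 0] cN[of 0] sp by auto
 show ?thesis
 proof (rule fourier_unique[OF fin sets])
  show "(\<integral>x. cos (x \<bullet> xi) \<partial>M) = (\<integral>x. cos (x \<bullet> xi) \<partial>N)" for xi using cos[of xi] cM[of xi] cN[of xi] m by auto
  show "(\<integral>x. sin (x \<bullet> xi) \<partial>M) = (\<integral>x. sin (x \<bullet> xi) \<partial>N)" for xi using sin[of xi] cM[of xi] cN[of xi] m by auto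
 qed
qed

section \<open>Differences of Laplace transforms\<close>

lemma fdiff_pow_Suc_apply: "(fdiff ^^ Suc m) G z = (fdiff ^^ m) G z - (fdiff ^^ m) G (z + 1)"
 by (simp add: fdiff_def)

lemma has_bochner_integral_fdiff:
 assumes "!!z. z > 0 ==> has_bochner_integral M (%s. G s z) (I z)" "z > 0"
 shows "has_bochner_integral M (%s. (fdiff ^^ m) (G s) z) ((fdiff ^^ m) I z)"
 using assms by (induction m arbitrary: z) (auto simp: fdiff_def intro!: has_bochner_integral_diff)

text \<open>Each difference inserts a factor \<open>1 - exp (- t)\<close>. At
  \<open>z = k + 1\<close> with \<open>m = N - k\<close> this gives, up to the binomial coefficient,
  \<open>exp (- t)\<close> times a Bernstein basis polynomial in \<open>exp (- t)\<close>.\<close>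

lemma fdiff_pow_exp: "(fdiff ^^ m) (%z. exp (- z * t) * c) z = exp (- z * t) * (1 - exp (- t)) ^ m * c"
proof (induction m arbitrary: z)
 case (Suc m)
 have "exp (- (z + 1) * t) = exp (- z * t) * exp (- t)" by (simp add: exp_add[symmetric] algebra_simps)
 then show ?case unfolding fdiff_pow_Suc_apply Suc.IH by (simp add: algebra_simps)
qed simp

lemma has_bochner_integral_exp:
 fixes \<kappa> :: real
 assumes "\<kappa> > 0"
 shows "has_bochner_integral lborel (%s. indicator {0<..} s * exp (- s * \<kappa>)) (1 / \<kappa>)"
proof -
 interpret prob_space "density lborel (exponential_density \<kappa>)"
  using assms by (rule prob_space_exponential_density)
 have "(NN s. ennreal (exponential_density \<kappa> s)) = 1"
  using emeasure_space_1 by (simp add: emeasure_density)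
 then have "has_bochner_integral lborel (exponential_density \<kappa>) 1"
  using assms by (intro has_bochner_integral_nn_integral) (auto simp: exponential_density_def)
 then have "has_bochner_integral lborel (%s. 1 / \<kappa> * exponential_density \<kappa> s) (1 / \<kappa> * 1)"
  by (rule has_bochner_integral_mult_right[rotated]) 
 moreover have "AE s in lborel. s \<noteq> (0::real)" by (rule AE_lborel_singleton)
 then have "AE s in lborel. 1 / \<kappa> * exponential_density \<kappa> s = indicator {0<..} s * exp (- s * \<kappa>)"
 proof eventually_elim
  case (elim s)
  then show ?case using assms by (cases "s < 0") (simp_all add: exponential_density_def)
 qed
 then have "has_bochner_integral lborel (%s. 1 / \<kappa> * exponential_density \<kappa> s) (1 / \<kappa> * 1)
  = has_bochner_integral lborel (%s. indicator {0<..} s * exp (- s * \<kappa>)) (1 / \<kappa> * 1)"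
  by (intro has_bochner_integral_cong_AE) auto
 ultimately show ?thesis by simp
qed

text \<open>Operator form of the binomial theorem: with the shift \<open>E\<close> by one,
  \<open>fdiff\<close> is \<open>1 - E\<close>, and the sum is \<open>((1 - E) + E) ^ N\<close>
  applied to \<open>G\<close>.\<close>

lemma bernstein_weights_sum:
 "(\<Sum>k\<le>N. real (N choose k) * (fdiff ^^ (N - k)) G (z + real k)) = G z"
proof (induction N arbitrary: G)
 case (Suc N)
 let ?S = "%G. \<Sum>k\<le>N. real (N choose k) * (fdiff ^^ (N - k)) G (z + real k)"
 have "(\<Sum>k\<le>Suc N. real (Suc N choose k) * (fdiff ^^ (Suc N - k)) G (z + real k))
  = (fdiff ^^ Suc N) G z + (\<Sum>k\<le>N. real (Suc N choose Suc k) * (fdiff ^^ (N - k)) G (z + real (Suc k)))"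
  by (subst sum.atMost_Suc_shift) simp
 also have "(\<Sum>k\<le>N. real (Suc N choose Suc k) * (fdiff ^^ (N - k)) G (z + real (Suc k))) =
   (\<Sum>k\<le>N. real (N choose k) * (fdiff ^^ (N - k)) G (z + real (Suc k))) +
   (\<Sum>k\<le>N. real (N choose Suc k) * (fdiff ^^ (N - k)) G (z + real (Suc k)))"
  by (simp add: sum.distrib[symmetric] algebra_simps)
 also have "(\<Sum>k\<le>N. real (N choose k) * (fdiff ^^ (N - k)) G (z + real (Suc k))) = ?S (%z. G (z + 1))"
  unfolding fdiff_pow_shift by (simp add: algebra_simps)
 also have "... = G (z + 1)" by (rule Suc.IH)
 also have "(fdiff ^^ Suc N) G z + (G (z + 1) + (\<Sum>k\<le>N. real (N choose Suc k) * (fdiff ^^ (N - k)) G (z + real (Suc k))))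
  = G (z + 1) + ?S (fdiff G)"
 proof -
  have "?S (fdiff G) = (\<Sum>k\<le>N. real (N choose k) * (fdiff ^^ (Suc N - k)) G (z + real k))"
   by (intro sum.cong refl) (simp add: Suc_diff_le fdiff_pow_Suc del: funpow.simps)
  also have "... = (\<Sum>k\<le>Suc N. real (N choose k) * (fdiff ^^ (Suc N - k)) G (z + real k))"
   by (simp add: binomial_eq_0)
  also have "... = (fdiff ^^ Suc N) G z + (\<Sum>k\<le>N. real (N choose Suc k) * (fdiff ^^ (N - k)) G (z + real (Suc k)))"
   by (subst sum.atMost_Suc_shift) simp
  finally show ?thesis by simp
 qed
 also have "?S (fdiff G) = fdiff G z" by (rule Suc.IH)
 finally show ?case by (simp add: fdiff_def)
qed simp

section \<open>Kernels given by a symbol and their Gaussian moments\<close>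

abbreviation pos_time :: "real measure" where "pos_time \<equiv> lebesgue_on {0<..}"

lemma borel_measurable_pos_time [measurable (raw)]:
 "f : Bor ==> f : borel_measurable pos_time"
 by (intro measurable_restrict_space1) (simp add: measurable_completion)

lemma nn_integral_pos_time:
 "(\<integral>\<^sup>+t. f t \<partial>pos_time) = (NN t. f t * indicator {0<..} t)"
 by (subst nn_integral_restrict_space) (auto simp: nn_integral_completion)

lemma AE_pos_time_iff: "(AE t in pos_time. P t) \<longleftrightarrow> (AE t in lborel. 0 < t --> P t)"
 by (subst AE_restrict_space_iff) (auto simp: AE_completion_iff)

text \<open>One framework for both families: \<open>a\<close> is the constant 1 for \<open>Y\<close>
  and \<open>phi z / z\<close> for \<open>Z\<close>. The function
  \<open>a z * exp (- s * phi z)\<close> is the Laplace transform in time of the weight with which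
  the Gaussian \<open>heat s\<close> enters the kernel; of this weight only the alternating
  differences of the transform are assumed.\<close>

locale subordinated_kernel =
 fixes K :: "real => (real^'n) measure" and a phi :: "real => real"
 assumes finite_K: "!!t. finite_measure (K t)"
  and sets_K [measurable_cong]: "!!t. sets (K t) = sets borel"
  and emeasure_K_measurable: "!!A. A : sets borel ==> (%t. emeasure (K t) A) : borel_measurable pos_time"
  and fourier_laplace_K: "!!z xi. z > 0 ==> fourier_laplace K z xi (of_real (a z / (phi z + (norm xi)\<^sup>2)))"
  and phi_pos: "!!z. z > 0 ==> 0 < phi z"
  and alternating_exp: "!!m s. s \<ge> 0 ==> alternating_upto m (%z. a z * exp (- s * phi z))"
begin

lemma space_K: "space (K t) = UNIV"
 using sets_K[of t, THEN sets_eq_imp_space_eq] by simp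

lemma a_nonneg: "z > 0 ==> 0 <= a z"
 using alternating_exp[of 0 0] by (simp add: alternating_upto_def)

definition mass :: "real => real" where "mass t = measure (K t) UNIV"

lemma emeasure_K_UNIV: "emeasure (K t) UNIV = ennreal (mass t)"
proof -
 interpret finite_measure "K t" by (rule finite_K)
 show ?thesis by (simp add: mass_def emeasure_eq_measure)
qed

lemma mass_nonneg: "0 <= mass t" by (simp add: mass_def)

lemma mass_measurable [measurable]: "mass : borel_measurable pos_time"
 unfolding mass_def[abs_def] measure_def using emeasure_K_measurable[of UNIV] by measurable

text \<open>Normalised to total mass below 1, so that measurable kernels into subprobability
  measures apply; \<open>1 + mass t\<close> avoids a division by zero.\<close>

definition K1 :: "real => (real^'n) measure" where
 "K1 t = scale_measure (ennreal (1 / (1 + mass t))) (K t)"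

lemma K1_kernel [measurable]: "K1 : measurable pos_time (subprob_algebra borel)"
proof (rule measurable_subprob_algebra)
 fix t
 show "sets (K1 t) = sets borel" by (simp add: K1_def sets_K)
 have "emeasure (K1 t) UNIV = ennreal (1 / (1 + mass t)) * ennreal (mass t)"
  unfolding K1_def by (simp add: emeasure_scale_measure emeasure_K_UNIV)
 also have "... = ennreal (mass t / (1 + mass t))"
  using mass_nonneg[of t] by (simp add: ennreal_mult[symmetric])
 also have "... <= ennreal 1" using mass_nonneg[of t] by (intro ennreal_leI) (simp add: field_simps)
 finally have "emeasure (K1 t) UNIV <= 1" by simp
 then show "subprob_space (K1 t)"
  by (intro subprob_spaceI) (auto simp: K1_def space_scale_measure space_K)
next
 fix A :: "(real^'n) set" assume "A : sets borel"
 note emeasure_K_measurable[OF this, measurable]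
 show "(%t. emeasure (K1 t) A) : borel_measurable pos_time"
  unfolding K1_def by (simp add: emeasure_scale_measure)
qed

lemma nn_integral_K1:
 assumes "f : Bor"
 shows "(\<integral>\<^sup>+x. f x \<partial>K t) = ennreal (1 + mass t) * (\<integral>\<^sup>+x. f x \<partial>K1 t)"
proof -
 have "ennreal (1 + mass t) * ennreal (1 / (1 + mass t)) = 1"
  using mass_nonneg[of t] by (subst ennreal_mult[symmetric]) auto
 then show ?thesis unfolding K1_def
  using assms by (subst nn_integral_scale_measure) (auto simp: mult.assoc[symmetric] sets_K cong: measurable_cong_sets)
qed

lemma nn_integral_K_measurable:
 assumes [measurable]: "(%p. f (fst p) (snd p)) : borel_measurable (pos_time \<Otimes>\<^sub>M borel)"
 shows "(%t. \<integral>\<^sup>+x. f t x \<partial>K t) : borel_measurable pos_time"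
proof -
 have "(%t. \<integral>\<^sup>+x. f t x \<partial>K1 t) : borel_measurable pos_time"
  by (rule nn_integral_measurable_subprob_algebra2[OF _ K1_kernel]) (use assms in \<open>simp add: split_beta'\<close>)
 then have "(%t. ennreal (1 + mass t) * (\<integral>\<^sup>+x. f t x \<partial>K1 t)) : borel_measurable pos_time" by measurable
 moreover have "(\<integral>\<^sup>+x. f t x \<partial>K t) = ennreal (1 + mass t) * (\<integral>\<^sup>+x. f t x \<partial>K1 t)" if "t : space pos_time" for t
  by (rule nn_integral_K1) (use measurable_compose[OF measurable_Pair1'[OF that] assms] in simp)
 ultimately show ?thesis by (subst measurable_cong) auto
qed

text \<open>The space-time measure \<open>exp (- t) dt K t (dx)\<close>. The factor
  \<open>exp (- t)\<close> makes it finite, by the transform at \<open>z = 1\<close>, and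
  \<open>1 + mass t\<close> undoes the normalisation in \<open>K1\<close>.\<close>

definition mu :: "(real \<times> (real^'n)) measure" where
 "mu = density pos_time (%t. ennreal (exp (- t)) * ennreal (1 + mass t)) \<bind> (%t. distr (K1 t) borel (Pair t))"

lemma mu_kernel: "(%t. distr (K1 t) borel (Pair t)) : measurable (density pos_time w) (subprob_algebra borel)"
proof -
 have "(%t. distr (K1 t) (borel \<Otimes>\<^sub>M borel) (%y. (t, y))) : measurable pos_time (subprob_algebra (borel \<Otimes>\<^sub>M borel))"
 proof (rule measurable_distr2[OF _ K1_kernel])
  have [measurable]: "(%t. t) : measurable pos_time borel" by simp
  show "case_prod Pair : measurable (pos_time \<Otimes>\<^sub>M borel) (borel \<Otimes>\<^sub>M borel)"
   unfolding split_beta' by measurable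
 qed
 then show ?thesis by (simp add: borel_prod cong: measurable_cong_sets)
qed

lemma sets_mu [measurable_cong]: "sets mu = sets borel"
 unfolding mu_def by (rule sets_bind[OF sets_kernel[OF mu_kernel]]) auto

lemma space_mu: "space mu = UNIV" using sets_mu[THEN sets_eq_imp_space_eq] by simp

lemma pair_measurable [measurable]:
 assumes "f : borel_measurable (borel :: (real \<times> (real^'n)) measure)"
 shows "(%p. f (fst p, snd p)) : borel_measurable (pos_time \<Otimes>\<^sub>M borel)" "(%x. f (t, x)) : Bor"
proof -
 have [measurable]: "(%t. t) : measurable pos_time borel" by simp
 have [measurable]: "f : borel_measurable (borel \<Otimes>\<^sub>M borel)" using assms by (simp add: borel_prod)
 show "(%p. f (fst p, snd p)) : borel_measurable (pos_time \<Otimes>\<^sub>M borel)" "(%x. f (t, x)) : Bor"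
  by measurable
qed

lemma nn_integral_mu:
 assumes f: "f : Bor"
 shows "(\<integral>\<^sup>+p. f p \<partial>mu) = (\<integral>\<^sup>+t. ennreal (exp (- t)) * (\<integral>\<^sup>+x. f (t, x) \<partial>K t) \<partial>pos_time)"
proof -
 have "(%t. \<integral>\<^sup>+p. f p \<partial>distr (K1 t) borel (Pair t)) : borel_measurable pos_time"
  using nn_integral_measurable_subprob_algebra[OF f] mu_kernel[of "%_. 1"] by (simp add: density_1 measurable_compose)
 then have "(\<integral>\<^sup>+p. f p \<partial>mu) = (\<integral>\<^sup>+t. (ennreal (exp (- t)) * ennreal (1 + mass t)) * (\<integral>\<^sup>+p. f p \<partial>distr (K1 t) borel (Pair t)) \<partial>pos_time)"
  unfolding mu_def by (subst nn_integral_bind[OF f mu_kernel], subst nn_integral_density) auto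
 also have "... = (\<integral>\<^sup>+t. ennreal (exp (- t)) * (\<integral>\<^sup>+x. f (t, x) \<partial>K t) \<partial>pos_time)"
 proof (intro nn_integral_cong)
  fix t :: real
  have "Pair t : measurable (borel :: (real^'n) measure) (borel \<Otimes>\<^sub>M borel)"
   by (rule measurable_Pair1') simp
  then have "Pair t : measurable (borel :: (real^'n) measure) borel"
   by (simp only: borel_prod)
  moreover have "sets (K1 t) = sets borel" by (simp add: K1_def sets_K)
  ultimately have "Pair t : measurable (K1 t) borel"
   using measurable_cong_sets[of "K1 t" borel "borel :: (real \<times> (real^'n)) measure" borel] by simp
  then have "(\<integral>\<^sup>+p. f p \<partial>distr (K1 t) borel (Pair t)) = (\<integral>\<^sup>+x. f (t, x) \<partial>K1 t)"
   by (rule nn_integral_distr) (use f in simp)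
  then show "(ennreal (exp (- t)) * ennreal (1 + mass t)) * (\<integral>\<^sup>+p. f p \<partial>distr (K1 t) borel (Pair t)) = ennreal (exp (- t)) * (\<integral>\<^sup>+x. f (t, x) \<partial>K t)"
   by (simp add: nn_integral_K1[OF pair_measurable(2)[OF f]] mult.assoc)
 qed
 finally show ?thesis .
qed

text \<open>Real and imaginary parts of the transform, with the mass (frequency 0) added so that the
  integrands become nonnegative. The symbol is real, hence the sine part integrates to 0.\<close>

lemma fourier_K:
 assumes z: "z > 0"
 shows "has_bochner_integral pos_time (%t. exp (- z * t) * (mass t + (\<integral>x. cos (x \<bullet> xi) \<partial>K t))) (a z / phi z + a z / (phi z + (norm xi)\<^sup>2))"
  and "has_bochner_integral pos_time (%t. exp (- z * t) * (mass t - (\<integral>x. sin (x \<bullet> xi) \<partial>K t))) (a z / phi z)"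
  and "has_bochner_integral pos_time (%t. exp (- z * t) * mass t) (a z / phi z)"
proof -
 have i: "integrable (K t) (%x. cis (- (x \<bullet> xi)))" for t xi
 proof -
  interpret finite_measure "K t" by (rule finite_K)
  show ?thesis by (rule integrable_const_bound[of _ 1]) auto
 qed
 have r: "Re (\<integral>x. cis (- (x \<bullet> xi)) \<partial>K t) = (\<integral>x. cos (x \<bullet> xi) \<partial>K t)" 
   "Im (\<integral>x. cis (- (x \<bullet> xi)) \<partial>K t) = - (\<integral>x. sin (x \<bullet> xi) \<partial>K t)" for t xi
  using integral_Re[OF i[of t xi]] integral_Im[OF i[of t xi]] by simp_all
 have h: "has_bochner_integral pos_time (%t. exp (- z * t) * (\<integral>x. cos (x \<bullet> xi) \<partial>K t)) (a z / (phi z + (norm xi)\<^sup>2))"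
  "has_bochner_integral pos_time (%t. exp (- z * t) * - (\<integral>x. sin (x \<bullet> xi) \<partial>K t)) 0" for xi
 proof -
  note fl = fourier_laplace_K[OF z, of xi, unfolded fourier_laplace_def]
  show "has_bochner_integral pos_time (%t. exp (- z * t) * (\<integral>x. cos (x \<bullet> xi) \<partial>K t)) (a z / (phi z + (norm xi)\<^sup>2))"
   using has_bochner_integral_bounded_linear[OF bounded_linear_Re fl] by (simp add: r del: of_real_divide of_real_add)
  show "has_bochner_integral pos_time (%t. exp (- z * t) * - (\<integral>x. sin (x \<bullet> xi) \<partial>K t)) 0"
   using has_bochner_integral_bounded_linear[OF bounded_linear_Im fl] by (simp add: r del: of_real_divide of_real_add)
 qed
 show m: "has_bochner_integral pos_time (%t. exp (- z * t) * mass t) (a z / phi z)"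
  using h(1)[of 0] by (simp add: space_K mass_def)
 show "has_bochner_integral pos_time (%t. exp (- z * t) * (mass t + (\<integral>x. cos (x \<bullet> xi) \<partial>K t))) (a z / phi z + a z / (phi z + (norm xi)\<^sup>2))"
  unfolding distrib_left by (intro has_bochner_integral_add m h)
 show "has_bochner_integral pos_time (%t. exp (- z * t) * (mass t - (\<integral>x. sin (x \<bullet> xi) \<partial>K t))) (a z / phi z)"
  using has_bochner_integral_add[OF m h(2)[of xi]] by (simp add: algebra_simps)
qed

lemma finite_mu: "finite_measure mu"
proof (rule finite_measureI)
 have "emeasure mu (space mu) = (\<integral>\<^sup>+p. 1 \<partial>mu)" by simp
 also have "... = (\<integral>\<^sup>+t. ennreal (exp (- 1 * t) * mass t) \<partial>pos_time)"
  by (subst nn_integral_mu) (auto simp: space_K emeasure_K_UNIV ennreal_mult[symmetric] mass_nonneg intro!: nn_integral_cong)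
 also have "... = ennreal (a 1 / phi 1)"
  using fourier_K(3)[of 1] mass_nonneg by (subst nn_integral_eq_integral) (auto dest: integrable.intros has_bochner_integral_integral_eq)
 finally show "emeasure mu (space mu) \<noteq> \<infinity>" by simp
qed

text \<open>The \<open>m\<close>-th difference in \<open>z\<close> of the Laplace transform of the
  kernel, as a measure on space; the exponent is \<open>z - 1\<close> because \<open>mu\<close>
  already carries \<open>exp (- t)\<close>.\<close>

definition R :: "nat => real => (real^'n) measure" where
 "R m z = distr (density mu (%p. ennreal (exp (- (z - 1) * fst p) * (1 - exp (- fst p)) ^ m))) borel snd"

lemma fst_snd_measurable [measurable]:
 "fst : borel_measurable (borel :: (real \<times> (real^'n)) measure)" "snd : borel_measurable (borel :: (real \<times> (real^'n)) measure)"
 by (auto simp: borel_prod[symmetric])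

lemma nn_integral_R:
 assumes [measurable]: "f : Bor"
 shows "(\<integral>\<^sup>+x. f x \<partial>R m z) = (\<integral>\<^sup>+p. ennreal (exp (- (z - 1) * fst p) * (1 - exp (- fst p)) ^ m) * f (snd p) \<partial>mu)"
 unfolding R_def by (subst nn_integral_distr) (auto simp: nn_integral_density)

lemma nn_integral_R':
 assumes [measurable]: "f : Bor"
 shows "(\<integral>\<^sup>+x. f x \<partial>R m z) = (\<integral>\<^sup>+t. ennreal (exp (- z * t) * (1 - exp (- t)) ^ m) * (\<integral>\<^sup>+x. f x \<partial>K t) \<partial>pos_time)"
proof -
 have "(\<integral>\<^sup>+x. f x \<partial>R m z) = (\<integral>\<^sup>+t. ennreal (exp (- t)) * (\<integral>\<^sup>+x. ennreal (exp (- (z - 1) * t) * (1 - exp (- t)) ^ m) * f x \<partial>K t) \<partial>pos_time)"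
  by (subst nn_integral_R, simp, subst nn_integral_mu) auto
 also have "... = (\<integral>\<^sup>+t. ennreal (exp (- z * t) * (1 - exp (- t)) ^ m) * (\<integral>\<^sup>+x. f x \<partial>K t) \<partial>pos_time)"
 proof (intro nn_integral_cong)
  fix t assume "t : space pos_time"
  then have "t > 0" by simp
  have "ennreal (exp (- t)) * ennreal (exp (- (z - 1) * t) * (1 - exp (- t)) ^ m) = ennreal (exp (- z * t) * (1 - exp (- t)) ^ m)"
   using \<open>t > 0\<close> by (subst ennreal_mult[symmetric]) (auto simp: mult.assoc[symmetric] exp_add[symmetric] algebra_simps)
  then show "ennreal (exp (- t)) * (\<integral>\<^sup>+x. ennreal (exp (- (z - 1) * t) * (1 - exp (- t)) ^ m) * f x \<partial>K t) =
   ennreal (exp (- z * t) * (1 - exp (- t)) ^ m) * (\<integral>\<^sup>+x. f x \<partial>K t)"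
   by (simp add: nn_integral_cmult mult.assoc[symmetric])
 qed
 finally show ?thesis .
qed

lemma nn_integral_R_trig:
 assumes z: "z > 0"
 shows "(\<integral>\<^sup>+x. ennreal (1 + cos (x \<bullet> xi)) \<partial>R m z) = ennreal ((fdiff ^^ m) (%z. a z / phi z + a z / (phi z + (norm xi)\<^sup>2)) z)"
  and "(\<integral>\<^sup>+x. ennreal (1 - sin (x \<bullet> xi)) \<partial>R m z) = ennreal ((fdiff ^^ m) (%z. a z / phi z) z)"
proof -
 have nn: "0 <= 1 + cos x" "0 <= 1 - sin x" for x :: real
  using cos_ge_minus_one[of x] sin_le_one[of x] by linarith+
 have gen: "(\<integral>\<^sup>+x. ennreal (f x) \<partial>R m z) = ennreal ((fdiff ^^ m) I z)"
  if h: "!!z. z > 0 ==> has_bochner_integral pos_time (%t. exp (- z * t) * c t) (I z)"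
   and c: "!!t. (\<integral>\<^sup>+x. ennreal (f x) \<partial>K t) = ennreal (c t)" "!!t. 0 <= c t" and [measurable]: "f : Bor" for f :: "real^'n => real" and c I
 proof -
  have "has_bochner_integral pos_time (%t. exp (- z * t) * (1 - exp (- t)) ^ m * c t) ((fdiff ^^ m) I z)"
   using has_bochner_integral_fdiff[of pos_time "%t z. exp (- z * t) * c t" I, OF h z, of m] by (simp only: fdiff_pow_exp)
  moreover have "AE t in pos_time. 0 <= exp (- z * t) * (1 - exp (- t)) ^ m * c t"
   by (intro AE_I2 mult_nonneg_nonneg zero_le_power c(2)) auto
  ultimately have "(\<integral>\<^sup>+t. ennreal (exp (- z * t) * (1 - exp (- t)) ^ m * c t) \<partial>pos_time) = ennreal ((fdiff ^^ m) I z)"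
   unfolding has_bochner_integral_iff using nn_integral_eq_integral by metis
  then show ?thesis
   by (subst nn_integral_R') (simp_all add: c ennreal_mult'')
 qed
 have i: "integrable (K t) (%x. cos (x \<bullet> xi))" "integrable (K t) (%x. sin (x \<bullet> xi))" "integrable (K t) (%x. 1 :: real)" for t
 proof -
  interpret finite_measure "K t" by (rule finite_K)
  show "integrable (K t) (%x. cos (x \<bullet> xi))" "integrable (K t) (%x. sin (x \<bullet> xi))" "integrable (K t) (%x. 1 :: real)" by (auto intro!: integrable_const_bound[of _ 1])
 qed
 have e: "(\<integral>x. 1 + cos (x \<bullet> xi) \<partial>K t) = mass t + (\<integral>x. cos (x \<bullet> xi) \<partial>K t)"
   "(\<integral>x. 1 - sin (x \<bullet> xi) \<partial>K t) = mass t - (\<integral>x. sin (x \<bullet> xi) \<partial>K t)" for t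
  using i[of t] by (auto simp: space_K mass_def)
 have n: "(\<integral>\<^sup>+x. ennreal (1 + cos (x \<bullet> xi)) \<partial>K t) = ennreal (mass t + (\<integral>x. cos (x \<bullet> xi) \<partial>K t))"
   "(\<integral>\<^sup>+x. ennreal (1 - sin (x \<bullet> xi)) \<partial>K t) = ennreal (mass t - (\<integral>x. sin (x \<bullet> xi) \<partial>K t))" for t
  unfolding e[of t, symmetric] using i[of t] nn by (intro nn_integral_eq_integral; auto)+
 have p: "0 <= mass t + (\<integral>x. cos (x \<bullet> xi) \<partial>K t)" "0 <= mass t - (\<integral>x. sin (x \<bullet> xi) \<partial>K t)" for t
  unfolding e[of t, symmetric] using nn by (intro integral_nonneg_AE AE_I2; simp)+
 show "(\<integral>\<^sup>+x. ennreal (1 + cos (x \<bullet> xi)) \<partial>R m z) = ennreal ((fdiff ^^ m) (%z. a z / phi z + a z / (phi z + (norm xi)\<^sup>2)) z)"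
  by (rule gen[OF fourier_K(1) n(1) p(1)]) auto
 show "(\<integral>\<^sup>+x. ennreal (1 - sin (x \<bullet> xi)) \<partial>R m z) = ennreal ((fdiff ^^ m) (%z. a z / phi z) z)"
  by (rule gen[OF fourier_K(2) n(2) p(2)]) auto
qed

text \<open>The density in \<open>s\<close> with which \<open>heat s\<close> enters the
  \<open>m\<close>-th difference; its nonnegativity is the assumption of alternating
  differences.\<close>

definition weight :: "nat => real => real => real" where
 "weight m z s = indicator {0<..} s * (fdiff ^^ m) (%z. a z * exp (- s * phi z)) z"

lemma weight_nonneg: "z > 0 ==> 0 <= weight m z s"
 using alternating_exp[of s m] by (auto simp: weight_def alternating_upto_def split: split_indicator)

lemma weight_measurable [measurable]: "weight m z : Bor"
proof -
 have "(%s. (fdiff ^^ m) (%z. a z * exp (- s * phi z)) z) : Bor"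
  by (induction m arbitrary: z) (auto simp: fdiff_def)
 then show ?thesis unfolding weight_def by measurable
qed

lemma weight_integral:
 assumes z: "z > 0" and l: "l \<ge> 0"
 shows "has_bochner_integral lborel (%s. weight m z s * exp (- s * l)) ((fdiff ^^ m) (%z. a z / (phi z + l)) z)"
proof -
 \<comment> \<open>The vacuous summand \<open>0 * 1\<close> brings the integrand into the form
   \<open>a * F z + b * G z\<close> on which \<open>fdiff_pow_linear\<close> rewrites.\<close>
 let ?G = "%s z. (indicator {0<..} s * exp (- s * l)) * (a z * exp (- s * phi z)) + 0 * 1"
 have "has_bochner_integral lborel (%s. ?G s z) (a z / (phi z + l))" if "z > 0" for z
 proof -
  have pos: "phi z + l > 0" using phi_pos[OF that] l by simp
  have "has_bochner_integral lborel (%s. a z * (indicator {0<..} s * exp (- s * (phi z + l)))) (a z * (1 / (phi z + l)))"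
   by (intro has_bochner_integral_mult_right has_bochner_integral_exp pos)
  moreover have "(%s. ?G s z) = (%s. a z * (indicator {0<..} s * exp (- s * (phi z + l))))"
   by (simp add: fun_eq_iff exp_add[symmetric] algebra_simps)
  ultimately show ?thesis by simp
 qed
 from has_bochner_integral_fdiff[of lborel ?G, OF this z, of m] show ?thesis
  unfolding fdiff_pow_linear by (simp add: weight_def mult_ac)
qed

text \<open>The Gaussian mixture that subordination predicts for \<open>R m z\<close>:
  \<open>1 / (phi z + l)\<close> is the integral of \<open>exp (- s * (phi z + l))\<close> over
  \<open>s > 0\<close>, and \<open>exp (- s * l)\<close> with \<open>l = (norm xi)^2\<close> is the
  transform of \<open>heat s\<close>.\<close>

definition Q :: "nat => real => (real^'n) measure" where
 "Q m z = density lborel (%x. \<integral>\<^sup>+s. ennreal (weight m z s) * ennreal (heat s x) \<partial>lborel)"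

lemma nn_integral_Q:
 assumes [measurable]: "f : Bor"
 shows "(\<integral>\<^sup>+x. f x \<partial>Q m z) = (NN s. ennreal (weight m z s) * (NN x. f x * ennreal (heat s x)))"
proof -
 have "(\<integral>\<^sup>+x. f x \<partial>Q m z) = (NN x. (NN s. ennreal (weight m z s) * ennreal (heat s x)) * f x)"
  unfolding Q_def by (intro nn_integral_density) (auto simp: heat_def normal_density_def)
 also have "... = (NN x. (NN s. ennreal (weight m z s) * (f x * ennreal (heat s x))))"
  by (intro nn_integral_cong, subst nn_integral_multc[symmetric]) (auto simp: heat_def normal_density_def mult_ac)
 also have "... = (NN s. (NN x. ennreal (weight m z s) * (f x * ennreal (heat s x))))"
  by (rule lborel_pair.Fubini') (simp add: heat_def normal_density_def split_beta')
 also have "... = (NN s. ennreal (weight m z s) * (NN x. f x * ennreal (heat s x)))"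
  by (intro nn_integral_cong nn_integral_cmult) auto
 finally show ?thesis .
qed

text \<open>Frequency by frequency, the Gaussian transform turns the integral over \<open>s\<close>
  into \<open>weight_integral\<close> with \<open>l = 0\<close> and \<open>l = (norm xi)^2\<close>,
  which reproduces the transforms found for \<open>R m z\<close>.\<close>

lemma nn_integral_Q_trig:
 assumes z: "z > 0"
 shows "(\<integral>\<^sup>+x. ennreal (1 + cos (x \<bullet> xi)) \<partial>Q m z) = ennreal ((fdiff ^^ m) (%z. a z / phi z + a z / (phi z + (norm xi)\<^sup>2)) z)"
  and "(\<integral>\<^sup>+x. ennreal (1 - sin (x \<bullet> xi)) \<partial>Q m z) = ennreal ((fdiff ^^ m) (%z. a z / phi z) z)"
proof -
 have nn: "0 <= 1 + cos x" "0 <= 1 - sin x" for x :: real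
  using cos_ge_minus_one[of x] sin_le_one[of x] by linarith+
 have one: "(LB x. heat s (x::real^'n)) = 1" if "s > 0" for s
  using nn_integral_heat[of s, where 'a = "real^'n"] that by (subst integral_eq_nn_integral) (auto simp: heat_nonneg)
 have 1: "(NN x. ennreal (1 + cos (x \<bullet> xi)) * ennreal (heat s x)) = ennreal (1 + exp (- s * (norm xi)\<^sup>2))"
  "(NN x. ennreal (1 - sin (x \<bullet> xi)) * ennreal (heat s x)) = 1" if s: "s > 0" for s
 proof -
  have i: "integrable lborel (%x. heat s x * cos (x \<bullet> xi))" "integrable lborel (%x. heat s x * sin (x \<bullet> xi))"
   using s by (auto intro!: integrable_heat_mult[where B = 1])
  have pos: "0 <= heat s x + heat s x * cos (x \<bullet> xi)" "0 <= heat s x - heat s x * sin (x \<bullet> xi)" for x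
   using mult_nonneg_nonneg[OF heat_nonneg nn(1), of s x "x \<bullet> xi"] mult_nonneg_nonneg[OF heat_nonneg nn(2), of s x "x \<bullet> xi"]
   by (simp_all add: distrib_left right_diff_distrib)
  have eq: "ennreal (1 + cos (x \<bullet> xi)) * ennreal (heat s x) = ennreal (heat s x + heat s x * cos (x \<bullet> xi))"
   "ennreal (1 - sin (x \<bullet> xi)) * ennreal (heat s x) = ennreal (heat s x - heat s x * sin (x \<bullet> xi))" for x
   using ennreal_mult[OF nn(1) heat_nonneg, of "x \<bullet> xi" s x] ennreal_mult[OF nn(2) heat_nonneg, of "x \<bullet> xi" s x]
   by (simp_all add: distrib_left distrib_right right_diff_distrib left_diff_distrib mult.commute)
  have "(NN x. ennreal (heat s x + heat s x * cos (x \<bullet> xi))) = ennreal (LB x. heat s x + heat s x * cos (x \<bullet> xi))"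
   by (intro nn_integral_eq_integral AE_I2 pos Bochner_Integration.integrable_add i integrable_heat s)
  then show "(NN x. ennreal (1 + cos (x \<bullet> xi)) * ennreal (heat s x)) = ennreal (1 + exp (- s * (norm xi)\<^sup>2))"
   unfolding eq using i integrable_heat[OF s, where 'a = "real^'n"] one[OF s] heat_fourier[OF s, of xi] by simp
  have "(NN x. ennreal (heat s x - heat s x * sin (x \<bullet> xi))) = ennreal (LB x. heat s x - heat s x * sin (x \<bullet> xi))"
   by (intro nn_integral_eq_integral AE_I2 pos Bochner_Integration.integrable_diff i integrable_heat s)
  then show "(NN x. ennreal (1 - sin (x \<bullet> xi)) * ennreal (heat s x)) = 1"
   unfolding eq using i integrable_heat[OF s, where 'a = "real^'n"] one[OF s] heat_fourier[OF s, of xi] by simp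
 qed
 note w0 = weight_integral[OF z order_refl, of m] and w1 = weight_integral[OF z, of "(norm xi)\<^sup>2" m]
 have "(\<integral>\<^sup>+x. ennreal (1 + cos (x \<bullet> xi)) \<partial>Q m z) = (NN s. ennreal (weight m z s * exp (- s * 0) + weight m z s * exp (- s * (norm xi)\<^sup>2)))"
 proof (subst nn_integral_Q, simp, intro nn_integral_cong)
  fix s show "ennreal (weight m z s) * (NN x. ennreal (1 + cos (x \<bullet> xi)) * ennreal (heat s x))
   = ennreal (weight m z s * exp (- s * 0) + weight m z s * exp (- s * (norm xi)\<^sup>2))"
  proof (cases "s > 0")
   case True
   show ?thesis unfolding 1(1)[OF True] using weight_nonneg[OF z, of m s]
   by (subst ennreal_mult[symmetric]) (simp_all add: distrib_left del: ennreal_plus)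
  qed (simp add: weight_def)
 qed
 also have "... = ennreal ((fdiff ^^ m) (%z. a z / (phi z + 0)) z + (fdiff ^^ m) (%z. a z / (phi z + (norm xi)\<^sup>2)) z)"
  using has_bochner_integral_add[OF w0 w1] weight_nonneg[OF z, of m]
  by (subst nn_integral_eq_integral) (auto simp: has_bochner_integral_iff intro!: AE_I2)
 finally show "(\<integral>\<^sup>+x. ennreal (1 + cos (x \<bullet> xi)) \<partial>Q m z) = ennreal ((fdiff ^^ m) (%z. a z / phi z + a z / (phi z + (norm xi)\<^sup>2)) z)"
  using fdiff_pow_linear[of m 1 "%z. a z / phi z" 1 "%z. a z / (phi z + (norm xi)\<^sup>2)"] by simp
 have "(\<integral>\<^sup>+x. ennreal (1 - sin (x \<bullet> xi)) \<partial>Q m z) = (NN s. ennreal (weight m z s * exp (- s * 0)))"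
 proof (subst nn_integral_Q, simp, intro nn_integral_cong)
  fix s show "ennreal (weight m z s) * (NN x. ennreal (1 - sin (x \<bullet> xi)) * ennreal (heat s x))
   = ennreal (weight m z s * exp (- s * 0))"
  proof (cases "s > 0")
   case True
   show ?thesis unfolding 1(2)[OF True] by simp
  qed (simp add: weight_def)
 qed
 also have "... = ennreal ((fdiff ^^ m) (%z. a z / (phi z + 0)) z)"
  using w0 weight_nonneg[OF z, of m]
  by (subst nn_integral_eq_integral) (auto simp: has_bochner_integral_iff intro!: AE_I2)
 finally show "(\<integral>\<^sup>+x. ennreal (1 - sin (x \<bullet> xi)) \<partial>Q m z) = ennreal ((fdiff ^^ m) (%z. a z / phi z) z)" by simp
qed

lemma sets_R: "sets (R m z) = sets borel" by (simp add: R_def)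
lemma sets_Q: "sets (Q m z) = sets borel" by (simp add: Q_def)

text \<open>Comparing Fourier transforms identifies the Bernstein moments of the kernel in time as
 mixtures of Gaussians; this replaces the construction of the subordinator.\<close>

lemma R_eq_Q:
 assumes z: "z > 0"
 shows "R m z = Q m z"
proof (rule fourier_unique_nonneg)
 \<comment> \<open>At frequency 0 the integrand is 1, so a finite transform there bounds the total
   mass.\<close>
 have fin: "finite_measure M" if "(\<integral>\<^sup>+x. ennreal (1 - sin (x \<bullet> 0)) \<partial>M) = ennreal c" for M :: "(real^'n) measure" and c
  using that by (intro finite_measureI) simp
 show "finite_measure (R m z)" "finite_measure (Q m z)"
  by (rule fin, rule nn_integral_R_trig(2)[OF z]) (rule fin, rule nn_integral_Q_trig(2)[OF z])
qed (auto simp: sets_R sets_Q nn_integral_R_trig[OF z] nn_integral_Q_trig[OF z])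

end

section \<open>Absolute continuity in space-time\<close>

context subordinated_kernel begin

lemma nn_integral_weight:
 assumes z: "z > 0"
 shows "(NN s. ennreal (weight m z s)) = emeasure (R m z) UNIV"
proof -
 have "emeasure (R m z) UNIV = (\<integral>\<^sup>+x. 1 \<partial>Q m z)"
  using sets_eq_imp_space_eq[OF sets_Q] by (simp add: R_eq_Q[OF z])
 also have "... = (NN s. ennreal (weight m z s))"
 proof (subst nn_integral_Q, simp, intro nn_integral_cong)
  fix s show "ennreal (weight m z s) * (NN x. 1 * ennreal (heat s (x :: real^'n))) = ennreal (weight m z s)"
   by (cases "s > 0") (simp_all add: nn_integral_heat weight_def)
 qed
 finally show ?thesis by simp
qed

text \<open>The mixture is split at \<open>s = dl\<close>. Below, the Gaussians have mass 1 and
  \<open>g <= 1\<close>; above, they are bounded by the maximum of \<open>heat dl\<close>, so only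
  the Lebesgue integral of \<open>g\<close> matters.\<close>

lemma R_estimate:
 assumes z: "z > 0" and d: "dl > 0" and [measurable]: "g : Bor" and g1: "!!x. g x <= 1"
 shows "(\<integral>\<^sup>+x. g x \<partial>R m z) <= (NN s. indicator {..<dl} s * ennreal (weight m z s))
  + ennreal ((1 / sqrt (4 * pi * dl)) ^ DIM(real^'n)) * (NN x. g x) * emeasure (R m z) UNIV"
proof -
 let ?c = "ennreal ((1 / sqrt (4 * pi * dl)) ^ DIM(real^'n))"
 have "(\<integral>\<^sup>+x. g x \<partial>R m z) = (NN s. ennreal (weight m z s) * (NN x. g x * ennreal (heat s x)))"
  unfolding R_eq_Q[OF z] by (rule nn_integral_Q) simp
 also have "... <= (NN s. indicator {..<dl} s * ennreal (weight m z s) + ?c * (NN x. g x) * ennreal (weight m z s))"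
 proof (rule nn_integral_mono)
  fix s :: real
  consider "s <= 0" | "0 < s" "s < dl" | "dl <= s" by linarith
  then show "ennreal (weight m z s) * (NN x. g x * ennreal (heat s x))
   <= indicator {..<dl} s * ennreal (weight m z s) + ?c * (NN x. g x) * ennreal (weight m z s)"
  proof cases
   case 1 then show ?thesis by (simp add: weight_def)
  next
   case 2
   have "(NN x. g x * ennreal (heat s x)) <= (NN x. ennreal (heat s (x::real^'n)))"
   proof (rule nn_integral_mono)
   fix x show "g x * ennreal (heat s x) <= ennreal (heat s x)"
   using mult_right_mono[OF g1[of x], of "ennreal (heat s x)"] by simp
   qed
   also have "... = 1" by (rule nn_integral_heat[OF 2(1)])
   finally have "ennreal (weight m z s) * (NN x. g x * ennreal (heat s x)) <= ennreal (weight m z s) * 1"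
   by (intro mult_left_mono) auto
   then show ?thesis using 2 by (simp add: add_increasing2)
  next
   case 3
   have "(NN x. g x * ennreal (heat s x)) <= (NN x. g x * ?c)"
   by (intro nn_integral_mono mult_left_mono ennreal_leI heat_le d 3) auto
   also have "... = (NN x. g x) * ?c" by (rule nn_integral_multc) simp
   finally have "ennreal (weight m z s) * (NN x. g x * ennreal (heat s x)) <= ennreal (weight m z s) * ((NN x. g x) * ?c)"
   by (intro mult_left_mono) auto
   then show ?thesis using 3 by (simp add: mult_ac)
  qed
 qed
 also have "... = (NN s. indicator {..<dl} s * ennreal (weight m z s)) + ?c * (NN x. g x) * emeasure (R m z) UNIV"
  by (subst nn_integral_add) (auto simp: nn_integral_cmult nn_integral_weight[OF z])
 finally show ?thesis .
qed

text \<open>For \<open>t > 0\<close> this is the Bernstein basis polynomial of degree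
  \<open>N\<close> at \<open>exp (- t)\<close>, see \<open>moment_pos\<close>; the exponent is
  spelled \<open>real (Suc k) - 1\<close> to match \<open>R (N - k) (real (Suc k))\<close>.\<close>

definition moment :: "nat => nat => real => ennreal" where
 "moment N k t = ennreal (real (N choose k)) * ennreal (exp (- (real (Suc k) - 1) * t) * (1 - exp (- t)) ^ (N - k))"

lemma moment_measurable [measurable]: "moment N k : Bor"
 unfolding moment_def by measurable

lemma moment_pos:
 assumes "t > 0"
 shows "moment N k t = ennreal (Bernstein N k (exp (- t)))"
proof -
 have "exp (- (real (Suc k) - 1) * t) = exp (- t) ^ k"
  by (simp add: exp_of_nat_mult[symmetric])
 then show ?thesis using assms
  by (simp add: moment_def Bernstein_def ennreal_mult[symmetric] mult.assoc)
qed

lemma AE_mu_pos: "AE p in mu. 0 < fst p"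
proof -
 have "emeasure mu {p. \<not> 0 < fst p} = (\<integral>\<^sup>+p. indicator {p. \<not> 0 < fst p} p \<partial>mu)"
  by (subst nn_integral_indicator) auto
 also have "... = (\<integral>\<^sup>+t. ennreal (exp (- t)) * (\<integral>\<^sup>+x. indicator {p. \<not> 0 < fst p} (t, x) \<partial>K t) \<partial>pos_time)"
  by (rule nn_integral_mu) simp
 also have "... = (\<integral>\<^sup>+t. 0 \<partial>pos_time)" by (intro nn_integral_cong) (simp add: indicator_def)
 finally show ?thesis by (subst AE_iff_measurable[of "{p. \<not> 0 < fst p}"]) (auto simp: space_mu)
qed

lemma emeasure_mu_less_top: "emeasure mu A < top"
 using finite_measure.emeasure_finite[OF finite_mu] top.not_eq_extremum by blast

text \<open>\<open>R_estimate\<close> is applied to each Bernstein moment. By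
  \<open>bernstein_weights_sum\<close> the weights add up to
  \<open>a 1 * exp (- s * phi 1) <= a 1\<close>, so small \<open>s\<close> contribute at most
  \<open>dl * a 1\<close> however large \<open>N\<close> is.\<close>

lemma bernstein_estimate:
 fixes g :: "real \<times> (real^'n) => real"
 assumes d: "dl > 0" and g[measurable]: "g : Bor" and g1: "!!p. 0 <= g p & g p <= 1"
  and gN_def: "gN = (%t x. \<Sum>k\<le>N. moment N k t * ennreal (g (real k / real N, x)))"
 shows "(\<integral>\<^sup>+p. gN (fst p) (snd p) \<partial>mu) <= ennreal (dl * a 1)
  + ennreal ((1 / sqrt (4 * pi * dl)) ^ DIM(real^'n)) * (\<integral>\<^sup>+p. (NN x. gN (fst p) x) \<partial>mu)"
proof -
 let ?c = "ennreal ((1 / sqrt (4 * pi * dl)) ^ DIM(real^'n))"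
 let ?I = "%k. \<integral>\<^sup>+x. ennreal (g (real k / real N, x)) \<partial>lborel"
 let ?R = "%k. R (N - k) (real (Suc k))"
 let ?C = "%k. ennreal (real (N choose k))"
 have [measurable]: "(%x. g (r, x)) : Bor" for r by (rule pair_measurable(2)[OF g])
 have mom: "(\<integral>\<^sup>+p. moment N k (fst p) * f (snd p) \<partial>mu) = ?C k * (\<integral>\<^sup>+x. f x \<partial>?R k)"
  if [measurable]: "f : Bor" for f k
  unfolding moment_def by (simp add: nn_integral_R mult.assoc nn_integral_cmult)
 have "(\<integral>\<^sup>+p. gN (fst p) (snd p) \<partial>mu) = (\<Sum>k\<le>N. ?C k * (\<integral>\<^sup>+x. ennreal (g (real k / real N, x)) \<partial>?R k))"
 proof -
  have "(\<integral>\<^sup>+p. gN (fst p) (snd p) \<partial>mu) = (\<Sum>k\<le>N. (\<integral>\<^sup>+p. moment N k (fst p) * ennreal (g (real k / real N, snd p)) \<partial>mu))"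
   unfolding gN_def by (rule nn_integral_sum) measurable
  also have "... = (\<Sum>k\<le>N. ?C k * (\<integral>\<^sup>+x. ennreal (g (real k / real N, x)) \<partial>?R k))"
   by (intro sum.cong refl mom) measurable
  finally show ?thesis .
 qed
 also have "... <= (\<Sum>k\<le>N. ?C k * ((NN s. indicator {..<dl} s * ennreal (weight (N - k) (real (Suc k)) s))
   + ?c * ?I k * emeasure (?R k) UNIV))"
  using g1 by (intro sum_mono mult_left_mono R_estimate d) auto
 also have "... = (\<Sum>k\<le>N. ?C k * (NN s. indicator {..<dl} s * ennreal (weight (N - k) (real (Suc k)) s)))
   + ?c * (\<Sum>k\<le>N. ?C k * emeasure (?R k) UNIV * ?I k)"
  by (simp add: distrib_left sum.distrib sum_distrib_left mult_ac)
 also have "(\<Sum>k\<le>N. ?C k * (NN s. indicator {..<dl} s * ennreal (weight (N - k) (real (Suc k)) s)))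
   = (NN s. indicator {..<dl} s * ennreal (\<Sum>k\<le>N. real (N choose k) * weight (N - k) (real (Suc k)) s))"
 proof -
  have "(\<Sum>k\<le>N. ?C k * (NN s. indicator {..<dl} s * ennreal (weight (N - k) (real (Suc k)) s)))
   = (NN s. (\<Sum>k\<le>N. ?C k * (indicator {..<dl} s * ennreal (weight (N - k) (real (Suc k)) s))))"
   by (simp add: nn_integral_sum nn_integral_cmult)
  also have "... = (NN s. indicator {..<dl} s * ennreal (\<Sum>k\<le>N. real (N choose k) * weight (N - k) (real (Suc k)) s))"
  proof (intro nn_integral_cong)
   fix s
   have "ennreal (\<Sum>k\<le>N. real (N choose k) * weight (N - k) (real (Suc k)) s) = (\<Sum>k\<le>N. ?C k * ennreal (weight (N - k) (real (Suc k)) s))"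
   using weight_nonneg by (subst sum_ennreal[symmetric]) (auto simp: ennreal_mult)
   then show "(\<Sum>k\<le>N. ?C k * (indicator {..<dl} s * ennreal (weight (N - k) (real (Suc k)) s)))
   = indicator {..<dl} s * ennreal (\<Sum>k\<le>N. real (N choose k) * weight (N - k) (real (Suc k)) s)"
   by (simp add: sum_distrib_left mult.left_commute)
  qed
  finally show ?thesis .
 qed
 also have "... <= (NN s. ennreal (a 1) * indicator {0<..<dl} s)"
 proof (intro nn_integral_mono)
  fix s
  have "(\<Sum>k\<le>N. real (N choose k) * weight (N - k) (real (Suc k)) s) = indicator {0<..} s *
   (\<Sum>k\<le>N. real (N choose k) * (fdiff ^^ (N - k)) (%z. a z * exp (- s * phi z)) (1 + real k))"
   by (simp add: weight_def sum_distrib_left mult.left_commute)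
  also have "... = indicator {0<..} s * (a 1 * exp (- s * phi 1))" by (subst bernstein_weights_sum) simp
  finally have e: "(\<Sum>k\<le>N. real (N choose k) * weight (N - k) (real (Suc k)) s) = indicator {0<..} s * (a 1 * exp (- s * phi 1))" .
  have "a 1 * exp (- s * phi 1) <= a 1" if "s > 0"
   using a_nonneg[of 1] phi_pos[of 1] that by (intro mult_left_le) auto
  then show "indicator {..<dl} s * ennreal (\<Sum>k\<le>N. real (N choose k) * weight (N - k) (real (Suc k)) s) <= ennreal (a 1) * indicator {0<..<dl} s"
   unfolding e by (auto split: split_indicator intro!: ennreal_leI)
 qed
 also have "... = ennreal (dl * a 1)"
  using d a_nonneg[of 1] by (simp add: nn_integral_cmult_indicator ennreal_mult[symmetric] mult.commute)
 also have "(\<Sum>k\<le>N. ?C k * emeasure (?R k) UNIV * ?I k) = (\<integral>\<^sup>+p. (NN x. gN (fst p) x) \<partial>mu)"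
 proof -
  have "(\<integral>\<^sup>+p. (NN x. gN (fst p) x) \<partial>mu) = (\<integral>\<^sup>+p. (\<Sum>k\<le>N. moment N k (fst p) * ?I k) \<partial>mu)"
   unfolding gN_def by (intro nn_integral_cong) (simp add: nn_integral_sum nn_integral_cmult)
  also have "... = (\<Sum>k\<le>N. ?C k * emeasure (?R k) UNIV * ?I k)"
  proof (subst nn_integral_sum, measurable, intro sum.cong refl)
   fix k
   have "(\<integral>\<^sup>+p. moment N k (fst p) * ?I k \<partial>mu) = ?C k * (\<integral>\<^sup>+x. ?I k \<partial>?R k)" by (rule mom) simp
   also have "... = ?C k * emeasure (?R k) UNIV * ?I k"
   using sets_eq_imp_space_eq[OF sets_R[of "N - k" "real (Suc k)"]] by (simp add: mult_ac)
   finally show "(\<integral>\<^sup>+p. moment N k (fst p) * ?I k \<partial>mu) = ?C k * emeasure (?R k) UNIV * ?I k" .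
  qed
  finally show ?thesis by simp
 qed
 finally show ?thesis by (auto simp: add_right_mono)
qed

text \<open>Time is seen through \<open>exp (- t)\<close> in the unit interval, where for each
  \<open>x\<close> the Bernstein polynomials of \<open>g (., x)\<close> converge uniformly. The
  constants of the previous bound do not depend on \<open>N\<close>; bounded support in space
  supplies the dominating functions.\<close>

lemma main_estimate:
 fixes g :: "real \<times> (real^'n) => real"
 assumes d: "dl > 0" and g: "continuous_on UNIV g" and g1: "!!p. 0 <= g p & g p <= 1"
  and supp: "!!r x. norm x > \<rho> ==> g (r, x) = 0"
 shows "(\<integral>\<^sup>+p. ennreal (g (exp (- fst p), snd p)) \<partial>mu) <= ennreal (dl * a 1)
  + ennreal ((1 / sqrt (4 * pi * dl)) ^ DIM(real^'n)) * (\<integral>\<^sup>+p. (NN x. ennreal (g (exp (- fst p), x))) \<partial>mu)"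
proof -
 interpret mu: finite_measure mu by (rule finite_mu)
 define gN where "gN = (%N t x. \<Sum>k\<le>N. moment N k t * ennreal (g (real k / real N, x)))"
 have gm[measurable]: "g : Bor" using g by (rule borel_measurable_continuous_onI)
 have gm'[measurable]: "g : borel_measurable (borel \<Otimes>\<^sub>M borel)" using gm by (simp add: borel_prod)
 have gNm[measurable]: "(%p. gN N (fst p) (snd p)) : borel_measurable (borel \<Otimes>\<^sub>M borel)" for N
  unfolding gN_def by measurable
 have eq: "gN N t x = ennreal (\<Sum>k\<le>N. g (real k / real N, x) * Bernstein N k (exp (- t)))" if "t > 0" for N t x
  unfolding gN_def using that g1
  by (subst sum_ennreal[symmetric]) (auto simp: moment_pos Bernstein_nonneg ennreal_mult mult.commute)
 have lim: "(%N. gN N t x) ~~> ennreal (g (exp (- t), x))" if t: "t > 0" for t x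
  unfolding eq[OF t]
 proof (intro tendsto_ennrealI LIMSEQ_I)
  fix e :: real assume "0 < e"
  have "continuous_on {0..1} (%r. g (r, x))"
   by (intro continuous_on_compose2[OF g] continuous_intros) auto
  from Bernstein_Weierstrass[OF this \<open>0 < e\<close>] obtain N0 where
   N0: "!!n r. N0 <= n ==> r : {0..1} ==> \<bar>g (r, x) - (\<Sum>k\<le>n. g (real k / real n, x) * Bernstein n k r)\<bar> < e" by blast
  show "\<exists>no. \<forall>n\<ge>no. norm ((\<Sum>k\<le>n. g (real k / real n, x) * Bernstein n k (exp (- t))) - g (exp (- t), x)) < e"
   using N0[of _ "exp (- t)"] t by (auto simp: abs_minus_commute)
 qed
 have le1: "gN N t x <= indicator (cball 0 \<rho>) x" if t: "t > 0" for N t x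
 proof (cases "x : cball 0 \<rho>")
  case True
  have "(\<Sum>k\<le>N. g (real k / real N, x) * Bernstein N k (exp (- t))) <= (\<Sum>k\<le>N. Bernstein N k (exp (- t)))"
   using g1 t by (intro sum_mono mult_left_le_one_le) (auto intro!: Bernstein_nonneg)
  also have "... = 1" by simp
  finally show ?thesis using True unfolding eq[OF t] by (simp add: ennreal_le_1)
 next
  case False
  then show ?thesis using supp[of x] by (simp add: gN_def)
 qed
 have vol: "emeasure lborel (cball (0::real^'n) \<rho>) < \<infinity>" using emeasure_cball_less_top by simp
 have muT: "(\<integral>\<^sup>+p. C \<partial>mu) < \<infinity>" if "C < \<infinity>" for C :: ennreal
  using that emeasure_mu_less_top by (simp add: ennreal_mult_less_top)
 have L1: "(%N. \<integral>\<^sup>+p. gN N (fst p) (snd p) \<partial>mu) ~~> (\<integral>\<^sup>+p. ennreal (g (exp (- fst p), snd p)) \<partial>mu)"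
 proof (rule nn_integral_dominated_convergence[where w = "%_. 1"])
  show "(%p. gN N (fst p) (snd p)) : borel_measurable mu" for N
   using gNm[of N] by (simp add: borel_prod cong: measurable_cong_sets[OF sets_mu refl])
  have "(%p. ennreal (g (exp (- fst p), snd p))) : borel_measurable (borel \<Otimes>\<^sub>M borel)" by measurable
  then show "(%p. ennreal (g (exp (- fst p), snd p))) : borel_measurable mu"
   by (simp add: borel_prod cong: measurable_cong_sets[OF sets_mu refl])
  show "AE p in mu. gN N (fst p) (snd p) <= 1" for N
   using AE_mu_pos by eventually_elim (rule order_trans[OF le1], auto split: split_indicator)
  show "AE p in mu. (%N. gN N (fst p) (snd p)) ~~> ennreal (g (exp (- fst p), snd p))"
   using AE_mu_pos by eventually_elim (rule lim)
  show "(\<integral>\<^sup>+p. 1 \<partial>mu) < \<infinity>" by (rule muT) simp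
 qed auto
 have L2: "(%N. \<integral>\<^sup>+p. (NN x. gN N (fst p) x) \<partial>mu) ~~> (\<integral>\<^sup>+p. (NN x. ennreal (g (exp (- fst p), x))) \<partial>mu)"
 proof (rule nn_integral_dominated_convergence[where w = "%_. emeasure lborel (cball (0::real^'n) \<rho>)"])
  have m: "(%p. F (fst p)) : borel_measurable mu" if "F : Bor" for F :: "real => ennreal"
   using that by measurable
  have "(%t. \<integral>\<^sup>+x. gN N t x \<partial>lborel) : Bor" for N
   by (rule lborel.borel_measurable_nn_integral) (use gNm[of N] in \<open>simp add: split_beta'\<close>)
  then show "(%p. \<integral>\<^sup>+x. gN N (fst p) x \<partial>lborel) : borel_measurable mu" for N by (rule m)
  have "(%t. \<integral>\<^sup>+x. ennreal (g (exp (- t), x)) \<partial>lborel) : Bor"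
   by (rule lborel.borel_measurable_nn_integral) (simp add: split_beta')
  then show "(%p. \<integral>\<^sup>+x. ennreal (g (exp (- fst p), x)) \<partial>lborel) : borel_measurable mu" by (rule m)
  show "AE p in mu. (NN x. gN N (fst p) x) <= emeasure lborel (cball (0::real^'n) \<rho>)" for N
   using AE_mu_pos
  proof eventually_elim
   case (elim p)
   have "(NN x. gN N (fst p) x) <= (NN x. indicator (cball (0::real^'n) \<rho>) x)"
   by (intro nn_integral_mono le1 elim)
   then show ?case by simp
  qed
  show "AE p in mu. (%N. \<integral>\<^sup>+x. gN N (fst p) x \<partial>lborel) ~~> (NN x. ennreal (g (exp (- fst p), x)))"
   using AE_mu_pos
  proof eventually_elim
   case (elim p)
   show ?case
   proof (rule nn_integral_dominated_convergence[where w = "indicator (cball 0 \<rho>)"])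
   show "(%x. gN N (fst p) x) : borel_measurable lborel" for N unfolding gN_def by measurable
   show "AE x in lborel. gN N (fst p) x <= indicator (cball 0 \<rho>) x" for N by (intro AE_I2 le1 elim)
   show "AE x in lborel. (%N. gN N (fst p) x) ~~> ennreal (g (exp (- fst p), x))" by (intro AE_I2 lim elim)
   qed (use vol in \<open>auto intro!: borel_measurable_indicator\<close>)
  qed
  show "(\<integral>\<^sup>+p. emeasure lborel (cball (0::real^'n) \<rho>) \<partial>mu) < \<infinity>" by (rule muT[OF vol])
 qed auto
 show ?thesis
 proof (rule LIMSEQ_le[OF L1])
  show "(%N. ennreal (dl * a 1) + ennreal ((1 / sqrt (4 * pi * dl)) ^ DIM(real^'n)) * (\<integral>\<^sup>+p. (NN x. gN N (fst p) x) \<partial>mu))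
   ~~> ennreal (dl * a 1) + ennreal ((1 / sqrt (4 * pi * dl)) ^ DIM(real^'n)) * (\<integral>\<^sup>+p. (NN x. ennreal (g (exp (- fst p), x))) \<partial>mu)"
   by (intro tendsto_add tendsto_const ennreal_tendsto_cmult L2) auto
  show "\<exists>N. \<forall>n\<ge>N. (\<integral>\<^sup>+p. gN n (fst p) (snd p) \<partial>mu) <= ennreal (dl * a 1) + ennreal ((1 / sqrt (4 * pi * dl)) ^ DIM(real^'n)) * (\<integral>\<^sup>+p. (NN x. gN n (fst p) x) \<partial>mu)"
   unfolding gN_def using bernstein_estimate[OF d gm g1 refl] by blast
 qed
qed

end

text \<open>Finite intersections of a countable base form a countable generator stable under
  intersection, so one null set of times serves all Borel sets.\<close>

lemma AE_finite_kernels_eq: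
 fixes K L :: "real => 'a::second_countable_topology measure"
 assumes fin: "!!t. finite_measure (K t)" and sets: "!!t. sets (K t) = sets borel" "!!t. sets (L t) = sets borel"
  and eq: "!!A. A : sets borel ==> AE t in M. emeasure (K t) A = emeasure (L t) A"
 shows "AE t in M. K t = L t"
proof -
 obtain B :: "'a set set" where B: "countable B" "topological_basis B" using ex_countable_basis by blast
 define E where "E = (%F. \<Inter>F) ` {F. F \<subseteq> B & finite F}"
 have "countable {F. F \<subseteq> B & finite F}"
  using countable_Collect_finite_subset[OF B(1)] by (simp add: conj_commute)
 then have cE: "countable E" by (simp add: E_def)
 have BE: "B \<subseteq> E" unfolding E_def
 proof
  fix b assume "b : B" then show "b : Inter ` {F. F \<subseteq> B & finite F}"
   by (intro image_eqI[of _ _ "{b}"]) auto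
 qed
 have Eb: "E \<subseteq> sets borel"
  unfolding E_def using topological_basis_open[OF B(2)] by (auto intro!: borel_open)
 have UE: "UNIV : E" unfolding E_def by (intro image_eqI[of _ _ "{}"]) auto
 have stable: "Int_stable E" unfolding Int_stable_def
 proof (intro ballI)
  fix a b assume "a : E" "b : E"
  then obtain F F' where "a = \<Inter>F" "b = \<Inter>F'" "F \<subseteq> B" "finite F" "F' \<subseteq> B" "finite F'" by (auto simp: E_def)
  then show "a \<inter> b : E" unfolding E_def by (intro image_eqI[of _ _ "F \<union> F'"]) auto
 qed
 have gen: "sets borel = sigma_sets UNIV E"
 proof (rule antisym)
  have "sets (borel :: 'a measure) = sigma_sets UNIV B"
   using borel_eq_countable_basis[OF B] by (metis sets_measure_of_conv subset_UNIV Pow_UNIV)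
  also have "... \<subseteq> sigma_sets UNIV E" using BE by (rule sigma_sets_mono')
  finally show "sets borel \<subseteq> sigma_sets UNIV E" .
  show "sigma_sets UNIV E \<subseteq> sets borel" using sets.sigma_sets_subset[OF Eb] by simp
 qed
 have "AE t in M. \<forall>A\<in>E. emeasure (K t) A = emeasure (L t) A"
  using Eb eq by (intro AE_ball_countable[THEN iffD2] cE) auto
 then show ?thesis
 proof eventually_elim
  case (elim t)
  show "K t = L t"
  proof (rule measure_eqI_generator_eq_countable[where E = E and \<Omega> = UNIV and A = "{UNIV}"])
   show "emeasure (K t) a \<noteq> \<infinity>" if "a : {UNIV}" for a
   using finite_measure.emeasure_finite[OF fin[of t]] by simp
  qed (use stable elim sets gen UE in auto)
 qed
qed

context subordinated_kernel begin

text \<open>Almost every time slice of a Lebesgue null set is null. Hence the Lebesgue term of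
  \<open>main_estimate\<close> vanishes in the limit of the bumps, and
  \<open>emeasure mu C <= dl * a 1\<close> remains for every \<open>dl > 0\<close>.\<close>

lemma mu_compact_null:
 assumes C: "compact C" and null: "emeasure lborel C = 0"
 shows "emeasure mu C = 0"
proof (cases "C = {}")
 case False
 interpret mu: finite_measure mu by (rule finite_mu)
 \<comment> \<open>The estimate accepts functions of \<open>exp (- t)\<close>, so the bumps are
   taken around the image of \<open>C\<close> under this change of time.\<close>
 define h :: "real \<times> (real^'n) => real \<times> (real^'n)" where "h = (%p. (exp (- fst p), snd p))"
 define C' where "C' = h ` C"
 have "continuous_on UNIV h" unfolding h_def by (intro continuous_intros)
 then have C': "compact C'" "C' \<noteq> {}"
  using C False unfolding C'_def by (auto intro: compact_continuous_image continuous_on_subset)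
 have inC': "(exp (- t), x) : C' \<longleftrightarrow> (t, x) : C" for t x
  unfolding C'_def h_def by (auto simp: image_iff) force
 obtain r where r: "C' \<subseteq> cball 0 r" using compact_imp_bounded[OF C'(1)] unfolding bounded_iff by (auto simp: subset_iff)
 have supp: "bump C' j (s, x) = 0" if "norm x > r + 1" for j s x
  using that norm_snd_le[of x s] by (intro bump_eq_0[OF r C'(2)]) auto
 have Cb[measurable]: "C : sets borel" using C by (rule borel_compact)
 have CS: "C : sets (borel \<Otimes>\<^sub>M borel)" unfolding borel_prod by (rule Cb)
 have ind: "indicator C : borel_measurable (borel \<Otimes>\<^sub>M lborel)"
  using CS by (intro borel_measurable_indicator) (simp cong: sets_pair_measure_cong)
 have bm: "(%p. bump C' j (exp (- fst p), snd p)) : Bor" for j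
  by (rule borel_measurable_continuous_onI, rule continuous_on_compose2[OF continuous_bump]) (auto intro!: continuous_intros)
 have bm2: "(%p. bump C' j (exp (- fst p), snd p)) : borel_measurable (borel \<Otimes>\<^sub>M borel)" for j
  using bm[of j] by (simp add: borel_prod)
 have bm1: "(%x. bump C' j (s, x)) : Bor" for j s
  by (rule borel_measurable_continuous_onI, rule continuous_on_compose2[OF continuous_bump]) (auto intro!: continuous_intros)
 have lim: "(%j. ennreal (bump C' j (exp (- t), x))) ~~> indicator C (t, x)" for t x
 proof -
  have "(%j. ennreal (bump C' j (exp (- t), x))) ~~> ennreal (indicator C' (exp (- t), x))"
   by (intro tendsto_ennrealI bump_tendsto compact_imp_closed C')
  also have "ennreal (indicator C' (exp (- t), x)) = indicator C (t, x)"
   using inC'[of t x] by (auto split: split_indicator)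
  finally show ?thesis .
 qed
 have L1: "(%j. \<integral>\<^sup>+p. ennreal (bump C' j (exp (- fst p), snd p)) \<partial>mu) ~~> (\<integral>\<^sup>+p. indicator C p \<partial>mu)"
 proof (rule nn_integral_dominated_convergence[where w = "%_. 1"])
  show "AE p in mu. (%j. ennreal (bump C' j (exp (- fst p), snd p))) ~~> indicator C p"
   using lim by (intro AE_I2) auto
  show "(%p. ennreal (bump C' j (exp (- fst p), snd p))) : borel_measurable mu" for j using bm[of j] by measurable
  show "(\<integral>\<^sup>+p. 1 \<partial>mu) < \<infinity>" using emeasure_mu_less_top by simp
 qed (auto simp: ennreal_le_1 bump_bounds)
 have vol: "emeasure lborel (cball (0::real^'n) (r + 1)) < \<infinity>" using emeasure_cball_less_top by simp
 have m: "(%p. F (fst p)) : borel_measurable mu" if "F : Bor" for F :: "real => ennreal"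
  using that by measurable
 have L2: "(%j. \<integral>\<^sup>+p. (NN x. ennreal (bump C' j (exp (- fst p), x))) \<partial>mu) ~~> (\<integral>\<^sup>+p. (NN x. indicator C (fst p, x)) \<partial>mu)"
 proof (rule nn_integral_dominated_convergence[where w = "%_. emeasure lborel (cball (0::real^'n) (r + 1))"])
  have le: "ennreal (bump C' j (s, x)) <= indicator (cball 0 (r + 1)) x" for j s x
   using supp[of x j s] bump_bounds[of C' j "(s, x)"] by (auto split: split_indicator simp: ennreal_le_1)
  have "(%t. \<integral>\<^sup>+x. ennreal (bump C' j (exp (- t), x)) \<partial>lborel) : Bor" for j
   by (rule lborel.borel_measurable_nn_integral) (use bm2[of j] in \<open>simp add: split_beta'\<close>)
  then show "(%p. \<integral>\<^sup>+x. ennreal (bump C' j (exp (- fst p), x)) \<partial>lborel) : borel_measurable mu" for j by (rule m)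
  have "(%t. \<integral>\<^sup>+x. indicator C (t, x) \<partial>(lborel :: (real^'n) measure)) : Bor"
   by (intro lborel.borel_measurable_nn_integral) (use ind in \<open>simp add: split_beta'\<close>)
  then show "(%p. \<integral>\<^sup>+x. indicator C (fst p, x) \<partial>lborel) : borel_measurable mu" by (rule m)
  show "AE p in mu. (NN x. ennreal (bump C' j (exp (- fst p), x))) <= emeasure lborel (cball (0::real^'n) (r + 1))" for j
  proof (intro AE_I2)
   fix p
   have "(NN x. ennreal (bump C' j (exp (- fst p), x))) <= (NN x. indicator (cball (0::real^'n) (r + 1)) x)"
   by (intro nn_integral_mono le)
   then show "(NN x. ennreal (bump C' j (exp (- fst p), x))) <= emeasure lborel (cball (0::real^'n) (r + 1))" by simp
  qed
  show "AE p in mu. (%j. \<integral>\<^sup>+x. ennreal (bump C' j (exp (- fst p), x)) \<partial>lborel) ~~> (NN x. indicator C (fst p, x))"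
  proof (intro AE_I2)
   fix p
   show "(%j. \<integral>\<^sup>+x. ennreal (bump C' j (exp (- fst p), x)) \<partial>lborel) ~~> (NN x. indicator C (fst p, x))"
   proof (rule nn_integral_dominated_convergence[where w = "indicator (cball 0 (r + 1))"])
   show "(%x. ennreal (bump C' j (exp (- fst p), x))) : borel_measurable lborel" for j using bm1 by measurable
   have "(%x. indicator C (fst p, x) :: ennreal) : Bor" by (rule pair_measurable(2)) simp
   then show "(%x. indicator C (fst p, x) :: ennreal) : borel_measurable lborel" by simp
   show "AE x in lborel. (%j. ennreal (bump C' j (exp (- fst p), x))) ~~> indicator C (fst p, x)" by (intro AE_I2 lim)
   qed (use vol le in \<open>auto intro!: borel_measurable_indicator\<close>)
  qed
  show "(\<integral>\<^sup>+p. emeasure lborel (cball (0::real^'n) (r + 1)) \<partial>mu) < \<infinity>"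
   using vol emeasure_mu_less_top by (simp add: ennreal_mult_less_top)
 qed auto
 have slice: "AE t in lborel. (\<integral>\<^sup>+x. indicator C (t, x) \<partial>(lborel :: (real^'n) measure)) = 0"
 proof -
  have Cb2: "C : sets (lborel \<Otimes>\<^sub>M lborel)" unfolding lborel_prod using Cb by simp
  have "(NN t. (\<integral>\<^sup>+x. indicator C (t, x) \<partial>(lborel :: (real^'n) measure))) = (\<integral>\<^sup>+p. indicator C p \<partial>(lborel \<Otimes>\<^sub>M lborel))"
   by (rule lborel.nn_integral_fst[OF borel_measurable_indicator[OF Cb2]])
  also have "... = 0" unfolding lborel_prod using null Cb by simp
  finally have z: "(NN t. (\<integral>\<^sup>+x. indicator C (t, x) \<partial>(lborel :: (real^'n) measure))) = 0" .
  have "(%t. \<integral>\<^sup>+x. indicator C (t, x) \<partial>(lborel :: (real^'n) measure)) : borel_measurable lborel"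
   using lborel.borel_measurable_nn_integral[of "%t x. indicator C (t, x)" borel] ind by (simp add: split_beta')
  from nn_integral_0_iff_AE[OF this] z show ?thesis by simp
 qed
 have zero: "(\<integral>\<^sup>+p. (NN x. indicator C (fst p, x)) \<partial>mu) = 0"
 proof -
  have [measurable]: "(%t. \<integral>\<^sup>+x. indicator C (t, x) \<partial>(lborel :: (real^'n) measure)) : Bor"
   by (intro lborel.borel_measurable_nn_integral) (use ind in \<open>simp add: split_beta'\<close>)
  have "(\<integral>\<^sup>+p. (NN x. indicator C (fst p, x)) \<partial>mu)
   = (\<integral>\<^sup>+t. ennreal (exp (- t)) * (\<integral>\<^sup>+y. (NN x. indicator C (t, x)) \<partial>K t) \<partial>pos_time)"
   by (subst nn_integral_mu) auto
  also have "... = (\<integral>\<^sup>+t. 0 \<partial>pos_time)"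
  proof (rule nn_integral_cong_AE)
   show "AE t in pos_time. ennreal (exp (- t)) * (\<integral>\<^sup>+y. (NN x. indicator C (t, x)) \<partial>K t) = 0"
   unfolding AE_pos_time_iff using slice by eventually_elim simp
  qed
  finally show ?thesis by simp
 qed
 have est: "emeasure mu C <= ennreal (dl * a 1)" if "dl > 0" for dl
 proof -
  have "(\<integral>\<^sup>+p. indicator C p \<partial>mu) <= ennreal (dl * a 1) + ennreal ((1 / sqrt (4 * pi * dl)) ^ DIM(real^'n)) * (\<integral>\<^sup>+p. (NN x. indicator C (fst p, x)) \<partial>mu)"
  proof (rule LIMSEQ_le[OF L1])
   show "(%j. ennreal (dl * a 1) + ennreal ((1 / sqrt (4 * pi * dl)) ^ DIM(real^'n)) * (\<integral>\<^sup>+p. (NN x. ennreal (bump C' j (exp (- fst p), x))) \<partial>mu))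
   ~~> ennreal (dl * a 1) + ennreal ((1 / sqrt (4 * pi * dl)) ^ DIM(real^'n)) * (\<integral>\<^sup>+p. (NN x. indicator C (fst p, x)) \<partial>mu)"
   by (intro tendsto_add tendsto_const ennreal_tendsto_cmult L2) auto
   show "\<exists>N. \<forall>j\<ge>N. (\<integral>\<^sup>+p. ennreal (bump C' j (exp (- fst p), snd p)) \<partial>mu) \<le>
   ennreal (dl * a 1) + ennreal ((1 / sqrt (4 * pi * dl)) ^ DIM(real^'n)) * (\<integral>\<^sup>+p. (NN x. ennreal (bump C' j (exp (- fst p), x))) \<partial>mu)"
   by (intro exI allI impI main_estimate[OF that continuous_bump, where \<rho> = "r + 1"])
   (use bump_bounds[of C'] supp in auto)
  qed
  then show ?thesis by (simp add: zero)
 qed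
 have "emeasure mu C <= 0"
 proof (rule ennreal_le_epsilon)
  fix e :: real assume "0 < e"
  have "emeasure mu C <= ennreal (e / (a 1 + 1) * a 1)"
   using \<open>0 < e\<close> a_nonneg[of 1] by (intro est) simp
  also have "... <= ennreal e" using \<open>0 < e\<close> a_nonneg[of 1] by (intro ennreal_leI) (simp add: field_simps)
  finally show "emeasure mu C <= 0 + ennreal e" by simp
 qed
 then show ?thesis by simp
qed simp

text \<open>Inner regularity of the finite measure \<open>mu\<close> reduces Borel null sets to
  compact ones.\<close>

lemma absolutely_continuous_mu: "absolutely_continuous lborel mu"
 unfolding absolutely_continuous_def
proof (intro subsetI null_setsI)
 fix S assume "S : null_sets (lborel :: (real \<times> (real^'n)) measure)"
 then have S: "S : sets borel" "emeasure lborel S = 0" by (auto simp: null_sets_def)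
 show "S : sets mu" using S by (simp add: sets_mu)
 have "emeasure mu S = (SUP C\<in>{C. C \<subseteq> S & compact C}. emeasure mu C)"
  using finite_measure.emeasure_finite[OF finite_mu] S by (intro inner_regular) (auto simp: sets_mu)
 also have "... = (SUP C\<in>{C. C \<subseteq> S & compact C}. 0)"
 proof (intro SUP_cong refl mu_compact_null)
  fix C assume C: "C : {C. C \<subseteq> S & compact C}"
  then show "compact C" by simp
  have "emeasure lborel C <= emeasure lborel S" using C S by (intro emeasure_mono) auto
  then show "emeasure lborel C = 0" using S by simp
 qed
 also have "... = 0" by (subst SUP_constant) auto
 finally show "emeasure mu S = 0" .
qed

text \<open>\<open>k\<close> is the Radon-Nikodym density of \<open>mu\<close> with the factor
  \<open>exp (- t)\<close> removed. For a fixed Borel set the slice identity holds at almost every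
  time; a countable generator then gives it for all sets at once.\<close>

theorem kernel_density:
 obtains k :: "real \<times> (real^'n) => ennreal" where "k : Bor"
  "!!t x. t <= 0 ==> k (t, x) = 0"
  "AE t in pos_time. K t = density lborel (%x. k (t, x))"
proof -
 obtain f where f: "f : borel_measurable lborel" "density lborel f = mu"
  using sigma_finite_measure.Radon_Nikodym[OF sigma_finite_lborel absolutely_continuous_mu] by (auto simp: sets_mu)
 have fm[measurable]: "f : Bor" using f by simp
 have fm2[measurable]: "f : borel_measurable (borel \<Otimes>\<^sub>M borel)" using fm by (simp add: borel_prod)
 define k where "k = (%p. indicator {0<..} (fst p) * ennreal (exp (fst p)) * f p)"
 have km: "k : Bor" unfolding k_def by measurable
 have ks: "(%x. k (t, x)) : Bor" for t by (rule pair_measurable(2)[OF km])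
 have fs[measurable]: "(%x. f (t, x)) : Bor" for t by (rule pair_measurable(2)[OF fm])
 have "AE t in pos_time. K t = density lborel (%x. k (t, x))"
 proof (rule AE_finite_kernels_eq[OF finite_K sets_K])
  show "sets (density lborel (%x. k (t, x))) = sets borel" for t by simp
  fix A :: "(real^'n) set" assume A[measurable]: "A : sets borel"
  define u where "u = (%t. ennreal (exp (- t)) * emeasure (K t) A * indicator {0<..} t)"
  have "(%t. ennreal (exp (- t)) * emeasure (K t) A) : borel_measurable pos_time"
   using emeasure_K_measurable[OF A] by measurable
  then have um: "u : borel_measurable lebesgue"
   unfolding u_def by (subst (asm) borel_measurable_restrict_space_iff_ennreal) auto
  \<comment> \<open>\<open>u\<close> is known to be Lebesgue measurable only; a Borel version makes
    both sides densities with respect to Lebesgue measure, where uniqueness of densities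
    applies.\<close>
  obtain u' where u'[measurable]: "u' : borel_measurable lborel" and uu': "AE t in lborel. u t = u' t"
   using completion_ex_borel_measurable[OF um] by blast
  define v where "v = (%t. indicator {0<..} t * (NN x. f (t, x) * indicator A x))"
  have "(%t. \<integral>\<^sup>+x. f (t, x) * indicator A x \<partial>lborel) : Bor"
   by (rule lborel.borel_measurable_nn_integral) (simp add: split_beta')
  then have vm[measurable]: "v : Bor" unfolding v_def by measurable
  have AI: "I \<times> A : sets borel" if "I : sets borel" for I :: "real set"
   using that A by (metis borel_prod pair_measureI)
  have eq: "(NN t. u' t * indicator I t) = (NN t. v t * indicator I t)" if I[measurable]: "I : sets borel" for I
  proof -
   let ?J = "I \<inter> {0<..}"
   have J: "?J \<times> A : sets borel" by (intro AI) auto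
   have "(NN t. u' t * indicator I t) = (NN t. u t * indicator I t)"
   using uu' by (intro nn_integral_cong_AE) auto
   also have "... = (\<integral>\<^sup>+t. ennreal (exp (- t)) * (\<integral>\<^sup>+x. indicator (?J \<times> A) (t, x) \<partial>K t) \<partial>pos_time)"
   proof (subst nn_integral_pos_time, intro nn_integral_cong)
   fix t
   have "(\<integral>\<^sup>+x. indicator (?J \<times> A) (t, x) \<partial>K t) = indicator ?J t * emeasure (K t) A"
   by (auto simp: indicator_times split: split_indicator)
   then show "u t * indicator I t = ennreal (exp (- t)) * (\<integral>\<^sup>+x. indicator (?J \<times> A) (t, x) \<partial>K t) * indicator {0<..} t"
   by (auto simp: u_def split: split_indicator)
   qed
   also have "... = (\<integral>\<^sup>+p. indicator (?J \<times> A) p \<partial>mu)" by (rule nn_integral_mu[symmetric]) (use J in simp)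
   also have "... = (NN p. f p * indicator (?J \<times> A) p)"
   unfolding f(2)[symmetric] using J f by (subst nn_integral_density) auto
   also have "... = (NN t. (NN x. f (t, x) * indicator (?J \<times> A) (t, x)))"
   unfolding lborel_prod[symmetric] using J
   by (intro lborel.nn_integral_fst[symmetric]) (auto simp: borel_prod)
   also have "... = (NN t. v t * indicator I t)"
   by (intro nn_integral_cong) (auto simp: v_def indicator_times split: split_indicator)
   finally show ?thesis .
  qed
  have "density lborel u' = density lborel v"
   by (rule measure_eqI) (auto simp: emeasure_density eq)
  then have "AE t in lborel. u' t = v t"
   by (subst (asm) sigma_finite_measure.density_unique_iff[OF sigma_finite_lborel]) auto
  with uu' have "AE t in lborel. u t = v t" by eventually_elim simp
  then show "AE t in pos_time. emeasure (K t) A = emeasure (density lborel (%x. k (t, x))) A"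
   unfolding AE_pos_time_iff
  proof eventually_elim
   case (elim t)
   show ?case
   proof
   assume t: "0 < t"
   have "ennreal (exp t) * (ennreal (exp (- t)) * emeasure (K t) A) = ennreal (exp t) * (NN x. f (t, x) * indicator A x)"
   using elim t by (simp add: u_def v_def)
   also have "ennreal (exp t) * (ennreal (exp (- t)) * emeasure (K t) A) = emeasure (K t) A"
   by (simp add: mult.assoc[symmetric] ennreal_mult[symmetric] exp_minus_inverse)
   also have "ennreal (exp t) * (NN x. f (t, x) * indicator A x) = (NN x. k (t, x) * indicator A x)"
   using t by (subst nn_integral_cmult[symmetric]) (auto simp: k_def mult.assoc)
   also have "... = emeasure (density lborel (%x. k (t, x))) A"
   using ks[of t] by (subst emeasure_density) auto
   finally show "emeasure (K t) A = emeasure (density lborel (%x. k (t, x))) A" .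
   qed
  qed
 qed
 then show ?thesis using km by (intro that[of k]) (auto simp: k_def)
qed

end

section \<open>Laplace transforms on the half line\<close>

lemma complete_lebesgue_on:
 assumes "S : sets lebesgue"
 shows "complete_measure (lebesgue_on S)"
proof
 fix A B assume *: "B \<subseteq> A" "A : null_sets (lebesgue_on S)"
 then have "A : null_sets lebesgue" "A \<subseteq> S" using assms by (auto simp: null_sets_restrict_space)
 then have "B : sets lebesgue" using completion.complete[OF *(1)] by auto
 then show "B : sets (lebesgue_on S)"
  using *(1) \<open>A \<subseteq> S\<close> assms by (auto simp: sets_restrict_space_iff)
qed

lemma (in complete_measure) borel_measurable_AE_eq:
 assumes f: "f : borel_measurable M" and eq: "AE x in M. f x = g x"
 shows "g : borel_measurable M"
proof (rule measurableI)
 fix A :: "'b set" assume A: "A : sets borel"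
 show "g -` A \<inter> space M : sets M"
 proof (rule in_sets_AE)
  show "AE x in M. x : f -` A \<inter> space M \<longleftrightarrow> x : g -` A \<inter> space M"
   using eq by eventually_elim auto
 qed (use f A in \<open>auto intro: measurable_sets\<close>)
qed simp

text \<open>Were \<open>f\<close> positive at \<open>t\<^sub>0\<close>, a tent function
  \<open>g\<close> of the variable \<open>exp (- t)\<close> would be supported where
  \<open>f > 0\<close>. Differences of the transform at integers show that
  \<open>exp (- t) * f t\<close> integrates to zero against all Bernstein polynomials in
  \<open>exp (- t)\<close>, hence against \<open>g\<close>, although the integrand is then
  nonnegative and positive near \<open>t\<^sub>0\<close>.\<close>

lemma laplace_unique_nonpos:
 fixes f :: "real => real"
 assumes cont: "continuous_on {0<..} f"
  and lap: "!!z. z > 0 ==> has_bochner_integral pos_time (%t. exp (- z * t) * f t) 0"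
  and t0: "t\<^sub>0 > 0"
 shows "f t\<^sub>0 <= 0"
proof (rule ccontr)
 assume "\<not> f t\<^sub>0 <= 0"
 then have f0: "f t\<^sub>0 > 0" by simp
 have "isCont f t\<^sub>0" using cont t0 by (simp add: continuous_on_eq_continuous_at)
 from this[unfolded continuous_at_eps_delta, rule_format, OF f0]
 obtain d where d0: "d > 0" "!!t. dist t t\<^sub>0 < d ==> dist (f t) (f t\<^sub>0) < f t\<^sub>0" by blast
 have d: "d > 0" "!!t. dist t t\<^sub>0 < d ==> f t > 0"
  using d0 by (auto simp: dist_real_def abs_less_iff) 
 \<comment> \<open>Continuity of the logarithm converts closeness of \<open>exp (- t)\<close> into
   closeness of \<open>t\<close>, so the tent of half-width \<open>eta\<close> stays inside the
   interval where \<open>f > 0\<close>.\<close>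
 have "isCont ln (exp (- t\<^sub>0))" by (intro isCont_ln) simp
 then obtain eta where eta: "eta > 0" "!!r. dist r (exp (- t\<^sub>0)) < eta ==> dist (ln r) (ln (exp (- t\<^sub>0))) < d"
  using d(1) unfolding continuous_at_eps_delta by metis
 define g where "g = (%r. max 0 (1 - \<bar>r - exp (- t\<^sub>0)\<bar> / eta))"
 have g_cont: "continuous_on S g" for S unfolding g_def using eta(1) by (intro continuous_intros) auto
 have g1: "0 <= g r & g r <= 1" for r using eta(1) by (auto simp: g_def)
 have gpos: "f t > 0" if "g (exp (- t)) > 0" for t
 proof -
  have "0 < 1 - \<bar>exp (- t) - exp (- t\<^sub>0)\<bar> / eta" using that by (simp add: g_def less_max_iff_disj)
  then have "dist (exp (- t)) (exp (- t\<^sub>0)) < eta" using eta(1) by (simp add: dist_real_def field_simps)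
  from eta(2)[OF this] have "dist t t\<^sub>0 < d" by (simp add: dist_real_def abs_minus_commute)
  then show ?thesis by (rule d(2))
 qed
 have f_int: "integrable pos_time (%t. exp (- t) * f t)" using lap[of 1] by (auto intro: integrable.intros)
 define B where "B = (%N r. \<Sum>k\<le>N. g (real k / real N) * Bernstein N k r)"
 have zero: "(\<integral>t. exp (- t) * f t * B N (exp (- t)) \<partial>pos_time) = 0" for N
 proof -
  have k: "has_bochner_integral pos_time (%t. exp (- t) * f t * Bernstein N k (exp (- t))) 0" for k
  proof -
   have "has_bochner_integral pos_time (%t. (fdiff ^^ (N - k)) (%z. exp (- z * t) * f t) (real (Suc k))) ((fdiff ^^ (N - k)) (%_. 0) (real (Suc k)))"
   by (rule has_bochner_integral_fdiff) (use lap in auto)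
   also have "(fdiff ^^ (N - k)) (%_. 0) (real (Suc k)) = 0"
   using fdiff_pow_linear[of "N - k" 0 "%_. 0" 0 "%_. 0"] by simp
   finally have "has_bochner_integral pos_time (%t. real (N choose k) * (exp (- real (Suc k) * t) * (1 - exp (- t)) ^ (N - k) * f t)) (real (N choose k) * 0)"
   unfolding fdiff_pow_exp by (rule has_bochner_integral_mult_right)
   moreover have "(%t. real (N choose k) * (exp (- real (Suc k) * t) * (1 - exp (- t)) ^ (N - k) * f t)) = (%t. exp (- t) * f t * Bernstein N k (exp (- t)))"
   proof
   fix t
   have "exp (- real (Suc k) * t) = exp (- t) * exp (- t) ^ k"
   by (simp add: exp_of_nat_mult[symmetric] exp_add[symmetric] algebra_simps)
   then show "real (N choose k) * (exp (- real (Suc k) * t) * (1 - exp (- t)) ^ (N - k) * f t) = exp (- t) * f t * Bernstein N k (exp (- t))"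
   by (simp add: Bernstein_def)
   qed
   ultimately show ?thesis by (simp only: mult_zero_right)
  qed
  have "has_bochner_integral pos_time (%t. \<Sum>k\<le>N. g (real k / real N) * (exp (- t) * f t * Bernstein N k (exp (- t)))) (\<Sum>k\<le>N. g (real k / real N) * 0)"
   by (intro has_bochner_integral_sum has_bochner_integral_mult_right k)
  then show ?thesis
   by (intro has_bochner_integral_integral_eq) (simp add: B_def sum_distrib_left mult_ac)
 qed
 have "(%N. \<integral>t. exp (- t) * f t * B N (exp (- t)) \<partial>pos_time) ~~> (\<integral>t. exp (- t) * f t * g (exp (- t)) \<partial>pos_time)"
 proof (rule integral_dominated_convergence[where w = "%t. norm (exp (- t) * f t)"])
  have fm: "(%t. exp (- t) * f t) : borel_measurable pos_time" using f_int by simp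
  have [measurable]: "g : Bor" using g_cont by (rule borel_measurable_continuous_onI)
  have "(%t. B N (exp (- t))) : borel_measurable pos_time" for N
   by (rule borel_measurable_pos_time) (simp add: B_def Bernstein_def)
  then show "(%t. exp (- t) * f t * B N (exp (- t))) : borel_measurable pos_time" for N using fm by simp
  have "(%t. g (exp (- t))) : borel_measurable pos_time"
   by (rule borel_measurable_pos_time) simp
  then show "(%t. exp (- t) * f t * g (exp (- t))) : borel_measurable pos_time" using fm by simp
  show "integrable pos_time (%t. norm (exp (- t) * f t))" using f_int by (rule integrable_norm)
  show "AE t in pos_time. (%N. exp (- t) * f t * B N (exp (- t))) ~~> exp (- t) * f t * g (exp (- t))"
  proof (intro AE_I2 tendsto_mult tendsto_const LIMSEQ_I)
   fix t e :: real assume t: "t : space pos_time" and "0 < e"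
   from Bernstein_Weierstrass[OF g_cont \<open>0 < e\<close>] obtain N0 where
   N0: "!!n r. N0 <= n ==> r : {0..1} ==> \<bar>g r - (\<Sum>k\<le>n. g (real k / real n) * Bernstein n k r)\<bar> < e" by blast
   show "\<exists>no. \<forall>n\<ge>no. norm (B n (exp (- t)) - g (exp (- t))) < e"
   using N0[of _ "exp (- t)"] t by (auto simp: abs_minus_commute B_def)
  qed
  show "AE t in pos_time. norm (exp (- t) * f t * B N (exp (- t))) <= norm (exp (- t) * f t)" for N
  proof (intro AE_I2)
   fix t assume t: "t : space pos_time"
   have "B N (exp (- t)) <= (\<Sum>k\<le>N. Bernstein N k (exp (- t)))" unfolding B_def
   using g1 t by (intro sum_mono mult_left_le_one_le) (auto intro!: Bernstein_nonneg)
   moreover have "0 <= B N (exp (- t))" unfolding B_def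
   using g1 t by (intro sum_nonneg mult_nonneg_nonneg) (auto intro!: Bernstein_nonneg)
   ultimately have "\<bar>B N (exp (- t))\<bar> <= 1" by simp
   then show "norm (exp (- t) * f t * B N (exp (- t))) <= norm (exp (- t) * f t)"
   by (simp add: abs_mult mult_left_le)
  qed
 qed
 then have I0: "(\<integral>t. exp (- t) * f t * g (exp (- t)) \<partial>pos_time) = 0"
  unfolding zero using LIMSEQ_unique tendsto_const by blast
 have nn: "0 <= exp (- t) * f t * g (exp (- t))" for t
  using gpos[of t] g1[of "exp (- t)"] by (cases "g (exp (- t)) = 0") (auto simp: less_le)
 have gi: "integrable pos_time (%t. exp (- t) * f t * g (exp (- t)))"
 proof (rule Bochner_Integration.integrable_bound[OF f_int])
  have "(%t. g (exp (- t))) : borel_measurable pos_time"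
   using borel_measurable_continuous_onI[OF g_cont] by (intro borel_measurable_pos_time) simp
  then show "(%t. exp (- t) * f t * g (exp (- t))) : borel_measurable pos_time" using f_int by simp
  show "AE t in pos_time. norm (exp (- t) * f t * g (exp (- t))) <= norm (exp (- t) * f t)"
   using g1 by (intro AE_I2) (simp add: abs_mult mult_left_le abs_of_nonneg)
 qed
 have "AE t in pos_time. exp (- t) * f t * g (exp (- t)) = 0"
  using integral_nonneg_eq_0_iff_AE[OF gi] nn I0 by simp
 then have ae: "AE t in lborel. 0 < t --> g (exp (- t)) = 0 \<or> f t = 0" unfolding AE_pos_time_iff by eventually_elim auto
 have "isCont (%t. g (exp (- t))) t\<^sub>0"
  using g_cont[of UNIV] by (intro continuous_at_compose[unfolded o_def, of t\<^sub>0 "%t. exp (- t)" g])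
   (auto simp: continuous_on_eq_continuous_at intro!: continuous_intros)
 from this[unfolded continuous_at_eps_delta, rule_format, OF zero_less_one]
 obtain d' where d0': "d' > 0" "!!t. dist t t\<^sub>0 < d' ==> dist (g (exp (- t))) (g (exp (- t\<^sub>0))) < 1" by blast
 have "g (exp (- t\<^sub>0)) = 1" by (simp add: g_def)
 then have d': "d' > 0" "!!t. dist t t\<^sub>0 < d' ==> g (exp (- t)) > 0"
  using d0' by (auto simp: dist_real_def abs_less_iff)
 \<comment> \<open>The bound by \<open>t\<^sub>0\<close> keeps the interval within the positive
   times, where the almost everywhere statement speaks.\<close>
 define e where "e = min d' t\<^sub>0"
 have "AE t in lborel. t \<notin> {t\<^sub>0 - e<..<t\<^sub>0 + e}"
  using ae
 proof eventually_elim
  case (elim t)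
  show ?case
  proof
   assume "t : {t\<^sub>0 - e<..<t\<^sub>0 + e}"
   then have "dist t t\<^sub>0 < d'" "0 < t" by (auto simp: e_def dist_real_def)
   then show False using elim d'(2)[of t] gpos[of t] by auto
  qed
 qed
 then have "emeasure lborel {t\<^sub>0 - e<..<t\<^sub>0 + e} = 0"
  by (subst (asm) AE_iff_measurable[of "{t\<^sub>0 - e<..<t\<^sub>0 + e}"]) auto
 moreover have "e > 0" using t0 d' by (simp add: e_def)
 ultimately show False by simp
qed

lemma laplace_unique:
 fixes f :: "real => real"
 assumes cont: "continuous_on {0<..} f"
  and lap: "!!z. z > 0 ==> has_bochner_integral pos_time (%t. exp (- z * t) * f t) 0"
  and t0: "t > 0"
 shows "f t = 0"
proof -
 have "has_bochner_integral pos_time (%t. exp (- z * t) * - f t) 0" if "z > 0" for z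
  using has_bochner_integral_minus[OF lap[OF that]] by simp
 then have "- f t <= 0"
  using cont by (intro laplace_unique_nonpos[of "%t. - f t"] t0 continuous_intros) auto
 moreover have "f t <= 0" by (rule laplace_unique_nonpos[OF cont lap t0])
 ultimately show ?thesis by simp
qed

definition primitive :: "(real => real) => real => real" where
 "primitive c t = (LB s. indicator {0<..<t} s * c s)"

text \<open>For nonnegative \<open>c\<close> Tonelli's theorem applies at once: integrating
  \<open>exp (- z * t)\<close> over \<open>t > s\<close> gives \<open>exp (- z * s) / z\<close>. The
  transform at \<open>z = 1\<close> makes \<open>c\<close> integrable on bounded intervals, hence
  the primitive continuous.\<close>

lemma
 fixes c :: "real => real"
 assumes [measurable]: "c : Bor" and nn: "!!s. 0 <= c s"
  and lap: "!!z. z > 0 ==> has_bochner_integral pos_time (%t. exp (- z * t) * c t) (C z)"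
 shows primitive_tendsto: "!!X t. X ~~> t ==> (%n. primitive c (X n)) ~~> primitive c t"
  and primitive_laplace: "!!z. z > 0 ==> has_bochner_integral pos_time (%t. exp (- z * t) * primitive c t) (C z / z)"
proof -
 have L: "(NN t. ennreal (exp (- z * t) * c t) * indicator {0<..} t) = ennreal (C z)" if "z > 0" for z
  unfolding nn_integral_pos_time[symmetric] using lap[OF that] nn
  by (simp add: nn_integral_eq_integral has_bochner_integral_iff)
 have fin: "integrable lborel (%s. indicator {0<..<T} s * c s)" for T
 proof (rule integrableI_nonneg)
  have "(NN s. ennreal (indicator {0<..<T} s * c s)) <= (NN s. ennreal (exp T) * (ennreal (exp (- 1 * s) * c s) * indicator {0<..} s))"
  proof (rule nn_integral_mono)
   fix s :: real
   have "c s <= exp T * (exp (- s) * c s)" if "s < T"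
   proof -
   have "1 <= exp (T - s)" using that by simp
   then have "1 * c s <= exp (T - s) * c s" using nn by (intro mult_right_mono)
   then show ?thesis by (simp add: exp_diff exp_minus field_simps)
   qed
   then show "ennreal (indicator {0<..<T} s * c s) <= ennreal (exp T) * (ennreal (exp (- 1 * s) * c s) * indicator {0<..} s)"
   using nn[of s] by (auto split: split_indicator simp: ennreal_mult[symmetric] intro!: ennreal_leI)
  qed
  also have "... = ennreal (exp T) * ennreal (C 1)" by (subst nn_integral_cmult) (simp_all only: L zero_less_one, measurable)
  also have "... < \<infinity>" by (simp add: ennreal_mult_less_top)
  finally show "(NN s. ennreal (indicator {0<..<T} s * c s)) < \<infinity>" .
 qed (use nn in auto)
 have tend: "(%n. primitive c (X n)) ~~> primitive c t" if X: "X ~~> t" for X t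
 proof -
  obtain T where T: "!!n. X n < T"
  proof -
   obtain K where "!!n. norm (X n) <= K" using convergent_imp_Bseq[OF convergentI[OF X]] by (auto simp: Bseq_def)
   then have "X n < K + 1" for n by (smt (verit) real_norm_def)
   then show ?thesis by (rule that)
  qed
  show ?thesis unfolding primitive_def
  proof (rule integral_dominated_convergence[where w = "%s. indicator {0<..<T} s * c s"])
   show "AE s in lborel. (%n. indicator {0<..<X n} s * c s) ~~> indicator {0<..<t} s * c s"
   using AE_lborel_singleton[of t]
   proof eventually_elim
   case (elim s)
   have "eventually (%n. indicator {0<..<X n} s = (indicator {0<..<t} s :: real)) sequentially"
   proof (cases "s < t")
   case True
   then show ?thesis using order_tendstoD(1)[OF X True] by (auto elim!: eventually_mono split: split_indicator)
   next
   case False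
   then have "t < s" using elim by simp
   then show ?thesis using order_tendstoD(2)[OF X \<open>t < s\<close>] by (auto elim!: eventually_mono split: split_indicator)
   qed
   then show ?case by (intro tendsto_mult tendsto_const tendsto_eventually)
   qed
   show "AE s in lborel. norm (indicator {0<..<X n} s * c s) <= indicator {0<..<T} s * c s" for n
   using nn T[of n] by (intro AE_I2) (auto split: split_indicator)
  qed (use fin in auto)
 qed
 then show "(%n. primitive c (X n)) ~~> primitive c t" if "X ~~> t" for X t using that by blast
 show "has_bochner_integral pos_time (%t. exp (- z * t) * primitive c t) (C z / z)" if z: "z > 0" for z
 proof (rule has_bochner_integral_nn_integral)
  have pm: "primitive c : Bor"
   by (intro borel_measurable_continuous_onI continuous_on_sequentiallyI tend)
  then show "(%t. exp (- z * t) * primitive c t) : borel_measurable pos_time"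
   by (intro borel_measurable_pos_time) simp
  have pn: "0 <= primitive c t" for t unfolding primitive_def using nn by (intro integral_nonneg_AE) auto
  show "AE t in pos_time. 0 <= exp (- z * t) * primitive c t" using pn by auto
  have Cn: "0 <= C z"
   using has_bochner_integral_integral_eq[OF lap[OF z]] nn
   by (metis (no_types, lifting) AE_I2 exp_ge_zero integral_nonneg_AE mult_nonneg_nonneg)
  then show "0 <= C z / z" using z by simp
  have tail: "(NN t. ennreal (exp (- z * t)) * indicator {s<..} t) = ennreal (exp (- z * s) / z)" for s
  proof -
   have "(NN t. ennreal (exp (- z * t)) * indicator {s<..} t) = (NN t. ennreal (exp (- z * (t + s))) * indicator {s<..} (t + s))"
   by (rule nn_integral_lborel_shift[symmetric]) simp
   also have "... = (NN t. ennreal (exp (- z * s)) * ennreal (indicator {0<..} t * exp (- t * z)))"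
   by (intro nn_integral_cong) (auto split: split_indicator simp: ennreal_mult[symmetric] exp_add[symmetric] algebra_simps)
   also have "... = ennreal (exp (- z * s)) * ennreal (1 / z)"
   using has_bochner_integral_exp[OF z] by (subst nn_integral_cmult) (auto simp: nn_integral_eq_integral has_bochner_integral_iff)
   finally show ?thesis using z by (simp add: ennreal_mult[symmetric])
  qed
  have "(\<integral>\<^sup>+t. ennreal (exp (- z * t) * primitive c t) \<partial>pos_time)
   = (NN t. (NN s. ennreal (exp (- z * t)) * indicator {s<..} t * (ennreal (c s) * indicator {0<..} s)))"
   unfolding nn_integral_pos_time
  proof (intro nn_integral_cong)
   fix t :: real
   have "ennreal (primitive c t) = (NN s. ennreal (indicator {0<..<t} s * c s))"
   unfolding primitive_def using fin nn by (subst nn_integral_eq_integral) auto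
   then have "ennreal (exp (- z * t) * primitive c t) * indicator {0<..} t =
   (NN s. ennreal (exp (- z * t)) * ennreal (indicator {0<..<t} s * c s)) * indicator {0<..} t"
   using pn by (simp add: nn_integral_cmult ennreal_mult)
   also have "... = (NN s. ennreal (exp (- z * t)) * indicator {s<..} t * (ennreal (c s) * indicator {0<..} s))"
   proof (cases "t > 0")
   case True
   then show ?thesis by (auto intro!: nn_integral_cong split: split_indicator)
   next
   case False
   then have "(NN s. ennreal (exp (- z * t)) * indicator {s<..} t * (ennreal (c s) * indicator {0<..} s)) = (\<integral>\<^sup>+s. 0 \<partial>(lborel :: real measure))"
   by (intro nn_integral_cong) (auto split: split_indicator)
   then show ?thesis using False by simp
   qed
   finally show "ennreal (exp (- z * t) * primitive c t) * indicator {0<..} t =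
   (NN s. ennreal (exp (- z * t)) * indicator {s<..} t * (ennreal (c s) * indicator {0<..} s))" .
  qed
  also have "... = (NN s. (NN t. ennreal (exp (- z * t)) * indicator {s<..} t * (ennreal (c s) * indicator {0<..} s)))"
  proof (rule lborel_pair.Fubini'[symmetric])
   have "(%p. indicator {snd p<..} (fst p)) = (%p :: real \<times> real. if snd p < fst p then 1 else (0::ennreal))"
   by (auto simp: fun_eq_iff)
   then have [measurable]: "(%p :: real \<times> real. indicator {snd p<..} (fst p) :: ennreal) : borel_measurable (borel \<Otimes>\<^sub>M borel)" by simp
   show "(%(t, s). ennreal (exp (- z * t)) * indicator {s<..} t * (ennreal (c s) * indicator {0<..} s)) : borel_measurable (lborel \<Otimes>\<^sub>M lborel)"
   unfolding split_beta' by measurable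
  qed
  also have "... = (NN s. ennreal (exp (- z * s) / z) * (ennreal (c s) * indicator {0<..} s))"
   by (intro nn_integral_cong, subst nn_integral_multc) (simp_all only: tail, measurable)
  also have "... = (NN s. ennreal (1 / z) * (ennreal (exp (- z * s) * c s) * indicator {0<..} s))"
   using z nn by (intro nn_integral_cong) (auto split: split_indicator simp: ennreal_mult[symmetric])
  also have "... = ennreal (1 / z) * ennreal (C z)" by (subst nn_integral_cmult) (simp_all only: L[OF z], measurable)
  also have "... = ennreal (C z / z)" using z Cn by (simp add: ennreal_mult[symmetric])
  finally show "(\<integral>\<^sup>+t. ennreal (exp (- z * t) * primitive c t) \<partial>pos_time) = ennreal (C z / z)" .
 qed
qed

text \<open>Measurability of \<open>g\<close> comes for free, since Lebesgue measure on the half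
  line is complete.\<close>

lemma has_bochner_integral_AE_eq:
 fixes f g :: "real => 'a::{banach, second_countable_topology}"
 assumes f: "has_bochner_integral pos_time f x" and eq: "AE t in pos_time. f t = g t"
 shows "has_bochner_integral pos_time g x"
proof -
 have fm: "f : borel_measurable pos_time" using f by (rule borel_measurable_has_bochner_integral)
 have gm: "g : borel_measurable pos_time"
  by (rule complete_measure.borel_measurable_AE_eq[OF complete_lebesgue_on fm eq]) simp
 show ?thesis using f has_bochner_integral_cong_AE[OF fm gm eq, of x] by simp
qed

lemma (in subordinated_kernel) nn_integral_K_cos:
 "(\<integral>\<^sup>+x. ennreal (1 + cos (x \<bullet> xi)) \<partial>K t) = ennreal (mass t + (\<integral>x. cos (x \<bullet> xi) \<partial>K t))"
 "0 <= mass t + (\<integral>x. cos (x \<bullet> xi) \<partial>K t)"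
proof -
 interpret finite_measure "K t" by (rule finite_K)
 have i: "integrable (K t) (%x. cos (x \<bullet> xi))" "integrable (K t) (%x. 1 :: real)"
  by (auto intro!: integrable_const_bound[of _ 1])
 have nn: "0 <= 1 + cos x" for x :: real using cos_ge_minus_one[of x] by linarith
 have e: "(\<integral>x. 1 + cos (x \<bullet> xi) \<partial>K t) = mass t + (\<integral>x. cos (x \<bullet> xi) \<partial>K t)"
  using i by (simp add: space_K mass_def)
 show "0 <= mass t + (\<integral>x. cos (x \<bullet> xi) \<partial>K t)"
  unfolding e[symmetric] using nn by (intro integral_nonneg_AE AE_I2) simp
 show "(\<integral>\<^sup>+x. ennreal (1 + cos (x \<bullet> xi)) \<partial>K t) = ennreal (mass t + (\<integral>x. cos (x \<bullet> xi) \<partial>K t))"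
  unfolding e[symmetric] using i nn by (intro nn_integral_eq_integral) auto
qed

section \<open>The kernels of the fractional equation\<close>

locale fractional_kernels =
 fixes \<alpha>\<^sub>1 \<alpha>\<^sub>2 c :: real and Z Y :: "real => (real^'n) measure"
 assumes bernstein: "bernstein_function (%s. inverse (Psi \<alpha>\<^sub>1 \<alpha>\<^sub>2 c s))"
  and Z_kernel: "Z_kernel \<alpha>\<^sub>1 \<alpha>\<^sub>2 c Z" and Y_kernel: "Y_kernel \<alpha>\<^sub>1 \<alpha>\<^sub>2 c Y"
begin

definition phi :: "real => real" where "phi z = inverse (Psi \<alpha>\<^sub>1 \<alpha>\<^sub>2 c z)"

lemma phi_pos: "z > 0 ==> 0 < phi z" by (simp add: phi_def Psi_def)

lemma alternating_phi:
 assumes "s \<ge> 0"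
 shows "alternating_upto m (%z. 1 * exp (- s * phi z))" "alternating_upto m (%z. phi z / z * exp (- s * phi z))"
proof -
 have b: "bernstein_function phi" using bernstein by (simp add: phi_def[abs_def])
 have e: "alternating_upto m (%z. exp (- s * phi z))"
  using phi_pos less_imp_le assms by (intro alternating_upto_exp bernstein_alternating b) auto
 then show "alternating_upto m (%z. 1 * exp (- s * phi z))" by simp
 show "alternating_upto m (%z. phi z / z * exp (- s * phi z))"
  by (intro alternating_upto_mult bernstein_div_alternating b e)
qed

text \<open>Changed on the exceptional null set of times only, because the common locale wants a
  finite Borel measure at every time.\<close>

definition Y0 :: "real => (real^'n) measure" where
 "Y0 t = (if finite_measure (Y t) & sets (Y t) = sets borel then Y t else null_measure borel)"

text \<open>The point mass for \<open>t <= 0\<close> turns \<open>S_family\<close> at time 0 into a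
  convolution as well, so that continuity at 0 becomes weak continuity of \<open>Z0\<close>.\<close>

definition Z0 :: "real => (real^'n) measure" where
 "Z0 t = (if 0 < t then Z t else return borel 0)"

lemma AE_Y0: "AE t in pos_time. Y t = Y0 t"
proof -
 have "AE t in pos_time. finite_measure (Y t) & sets (Y t) = sets borel"
  using Y_kernel by (simp add: Y_kernel_def)
 then show ?thesis by eventually_elim (simp add: Y0_def)
qed

lemma Y0_kernel: "subordinated_kernel Y0 (%_. 1) phi"
proof (rule subordinated_kernel.intro)
 show "finite_measure (Y0 t)" for t
  by (auto simp: Y0_def intro!: finite_measureI)
 show "sets (Y0 t) = sets borel" for t by (simp add: Y0_def)
 show "(%t. emeasure (Y0 t) A) : borel_measurable pos_time" if "A : sets borel" for A
 proof (rule complete_measure.borel_measurable_AE_eq[OF complete_lebesgue_on])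
  show "(%t. emeasure (Y t) A) : borel_measurable pos_time" using Y_kernel that by (simp add: Y_kernel_def)
  show "AE t in pos_time. emeasure (Y t) A = emeasure (Y0 t) A" using AE_Y0 by eventually_elim simp
 qed simp
 show "fourier_laplace Y0 z xi (of_real (1 / (phi z + (norm xi)\<^sup>2)))" if "z > 0" for z xi
  unfolding fourier_laplace_def
 proof (rule has_bochner_integral_AE_eq)
  show "has_bochner_integral pos_time (%t. exp (- z * t) *\<^sub>R (\<integral>x. cis (- (x \<bullet> xi)) \<partial>Y t)) (of_real (1 / (phi z + (norm xi)\<^sup>2)))"
   using Y_kernel that by (simp add: Y_kernel_def fourier_laplace_def phi_def)
  show "AE t in pos_time. exp (- z * t) *\<^sub>R (\<integral>x. cis (- (x \<bullet> xi)) \<partial>Y t) = exp (- z * t) *\<^sub>R (\<integral>x. cis (- (x \<bullet> xi)) \<partial>Y0 t)"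
   using AE_Y0 by eventually_elim simp
 qed
qed (use phi_pos alternating_phi in auto)

lemma prob_Z: "t > 0 ==> prob_space (Z t)" and sets_Z: "t > 0 ==> sets (Z t) = sets borel"
 using Z_kernel by (auto simp: Z_kernel_def)

lemma prob_Z0: "prob_space (Z0 t)" and sets_Z0 [measurable_cong]: "sets (Z0 t) = sets borel"
 by (auto simp: Z0_def prob_Z sets_Z prob_space_return)

lemma continuous_Z0:
 fixes f :: "real^'n => real"
 assumes "continuous_on UNIV f" "bounded (range f)"
 shows "continuous_on {0<..} (%t. \<integral>x. f x \<partial>Z0 t)"
proof -
 have "continuous_on {0<..} (%t. \<integral>x. f x \<partial>Z t)" using Z_kernel assms by (simp add: Z_kernel_def)
 then show ?thesis by (rule continuous_on_eq) (simp add: Z0_def)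
qed

text \<open>Weak continuity makes the integrals of the functions \<open>bump C j\<close> continuous
  in time; closed sets follow as limits, and the rest is a pi-lambda induction.\<close>

lemma emeasure_Z0_measurable:
 assumes "A : sets borel"
 shows "(%t. emeasure (Z0 t) A) : borel_measurable pos_time"
proof -
 have sp: "space (Z0 t) = UNIV" for t using sets_Z0[of t, THEN sets_eq_imp_space_eq] by simp
 have "Int_stable (Collect closed :: (real^'n) set set)" by (auto simp: Int_stable_def)
 moreover have "Collect closed \<subseteq> Pow (UNIV :: (real^'n) set)" by auto
 moreover have "A : sigma_sets UNIV (Collect closed)" using assms unfolding borel_eq_closed by (simp add: sets_measure_of_conv)
 ultimately show ?thesis
 proof (induction rule: sigma_sets_induct_disjoint)
  case (basic C)
  show ?case
  proof (cases "C = {}")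
   case False
   have "emeasure (Z0 t) C = ennreal (lim (%j. \<integral>x. bump C j x \<partial>Z0 t))" for t
   proof -
   interpret prob_space "Z0 t" by (rule prob_Z0)
   have [measurable]: "C : sets borel" using basic by simp
   have "(%j. \<integral>x. bump C j x \<partial>Z0 t) ~~> (\<integral>x. indicator C x \<partial>Z0 t)"
   using bump_bounds[of C] basic
   by (intro integral_dominated_convergence[where w = "%_. 1"]) (auto intro!: AE_I2 bump_tendsto False simp: abs_of_nonneg sets_Z0)
   moreover have "C : sets (Z0 t)" using basic by (simp add: sets_Z0)
   ultimately show ?thesis by (simp add: limI emeasure_eq_measure sp)
   qed
   moreover have "(%t. lim (%j. \<integral>x. bump C j x \<partial>Z0 t)) : borel_measurable pos_time"
   proof (rule borel_measurable_lim_metric)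
   fix j
   have "continuous_on {0<..} (%t. \<integral>x. bump C j x \<partial>Z0 t)"
   using bump_bounds[of C j] by (intro continuous_Z0 continuous_bump boundedI[of _ 1]) auto
   then show "(%t. \<integral>x. bump C j x \<partial>Z0 t) : borel_measurable pos_time"
   by (rule continuous_imp_measurable_on_sets_lebesgue) simp
   qed
   ultimately show ?thesis by simp
  qed simp
 next
  case empty show ?case by simp
 next
  case (compl A)
  have "emeasure (Z0 t) (UNIV - A) = 1 - emeasure (Z0 t) A" for t
  proof -
   interpret prob_space "Z0 t" by (rule prob_Z0)
   have "A : sets (Z0 t)" using compl(1) unfolding sets_Z0 borel_eq_closed by (simp add: sets_measure_of_conv)
   then show ?thesis using emeasure_compl[of A "Z0 t"] emeasure_space_1 by (simp add: sp)
  qed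
  then show ?case using compl by simp
 next
  case (union A)
  have "emeasure (Z0 t) (\<Union>i. A i) = (\<Sum>i. emeasure (Z0 t) (A i))" for t
   using union by (intro suminf_emeasure[symmetric]) (auto simp: sets_Z0 borel_eq_closed sets_measure_of_conv)
  then show ?case using union by simp
 qed
qed

lemma Z0_kernel: "subordinated_kernel Z0 (%z. phi z / z) phi"
proof (rule subordinated_kernel.intro)
 show "finite_measure (Z0 t)" for t using prob_Z0[of t] by (rule prob_space.finite_measure)
 show "fourier_laplace Z0 z xi (of_real (phi z / z / (phi z + (norm xi)\<^sup>2)))" if "z > 0" for z xi
 proof -
  have "has_bochner_integral pos_time (%t. exp (- z * t) *\<^sub>R (\<integral>x. cis (- (x \<bullet> xi)) \<partial>Z t)) (of_real (phi z / z / (phi z + (norm xi)\<^sup>2)))"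
   using Z_kernel that by (simp add: Z_kernel_def fourier_laplace_def phi_def)
  then show ?thesis unfolding fourier_laplace_def
   by (subst has_bochner_integral_cong[OF refl _ refl]) (auto simp: Z0_def)
 qed
qed (use phi_pos alternating_phi sets_Z0 emeasure_Z0_measurable in auto)

definition kY :: "real \<times> (real^'n) => ennreal" where
 "kY = (SOME k. k : Bor & (\<forall>t x. t <= 0 --> k (t, x) = 0) \<and>
   (AE t in pos_time. Y0 t = density lborel (%x. k (t, x))))"

definition kZ :: "real \<times> (real^'n) => ennreal" where
 "kZ = (SOME k. k : Bor & (\<forall>t x. t <= 0 --> k (t, x) = 0) \<and>
   (AE t in pos_time. Z0 t = density lborel (%x. k (t, x))))"

lemma kY_measurable [measurable]: "kY : Bor"
 and kY_nonpos: "t <= 0 ==> kY (t, x) = 0"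
 and AE_Y0_density: "AE t in pos_time. Y0 t = density lborel (%x. kY (t, x))"
proof -
 have "\<exists>k. k : Bor & (\<forall>t x. t <= 0 --> k (t, x) = 0) \<and>
   (AE t in pos_time. Y0 t = density lborel (%x. k (t, x)))"
  by (rule subordinated_kernel.kernel_density[OF Y0_kernel]) blast
 from someI_ex[OF this] show "kY : Bor" "t <= 0 ==> kY (t, x) = 0"
  "AE t in pos_time. Y0 t = density lborel (%x. kY (t, x))" unfolding kY_def by auto
qed

lemma kZ_measurable [measurable]: "kZ : Bor"
 and kZ_nonpos: "t <= 0 ==> kZ (t, x) = 0"
 and AE_Z0_density: "AE t in pos_time. Z0 t = density lborel (%x. kZ (t, x))"
proof -
 have "\<exists>k. k : Bor & (\<forall>t x. t <= 0 --> k (t, x) = 0) \<and>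
   (AE t in pos_time. Z0 t = density lborel (%x. k (t, x)))"
  by (rule subordinated_kernel.kernel_density[OF Z0_kernel]) blast
 from someI_ex[OF this] show "kZ : Bor" "t <= 0 ==> kZ (t, x) = 0"
  "AE t in pos_time. Z0 t = density lborel (%x. kZ (t, x))" unfolding kZ_def by auto
qed

lemma kY_slice: "(%x. kY (t, x)) : Bor"
 and kY_pair: "kY : borel_measurable (borel \<Otimes>\<^sub>M borel)"
 using subordinated_kernel.pair_measurable(2)[OF Y0_kernel kY_measurable] by (auto simp: borel_prod)

lemma kY_laplace_mass:
 "(NN t. ennreal (exp (- t)) * (NN x. kY (t, x))) < \<infinity>"
proof -
 interpret subordinated_kernel Y0 "%_. 1" phi by (rule Y0_kernel)
 have "(NN t. ennreal (exp (- t)) * (NN x. kY (t, x)))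
  = (\<integral>\<^sup>+t. ennreal (exp (- t)) * (NN x. kY (t, x)) \<partial>pos_time)"
  unfolding nn_integral_pos_time by (intro nn_integral_cong) (auto simp: kY_nonpos split: split_indicator)
 also have "... = (\<integral>\<^sup>+t. ennreal (exp (- 1 * t) * mass t) \<partial>pos_time)"
 proof (rule nn_integral_cong_AE)
  show "AE t in pos_time. ennreal (exp (- t)) * (NN x. kY (t, x)) = ennreal (exp (- 1 * t) * mass t)"
   using AE_Y0_density
  proof eventually_elim
   case (elim t)
   have "ennreal (mass t) = emeasure (density lborel (%x. kY (t, x))) UNIV"
   using emeasure_K_UNIV[of t] elim by simp
   also have "... = (NN x. kY (t, x))" using kY_slice[of t] by (subst emeasure_density) auto
   finally show ?case by (simp add: ennreal_mult mass_nonneg)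
  qed
 qed
 also have "... = ennreal (1 / phi 1)"
  using fourier_K(3)[of 1] mass_nonneg by (subst nn_integral_eq_integral) (auto simp: has_bochner_integral_iff)
 finally show ?thesis by simp
qed

text \<open>On the Fourier side \<open>1 - Z(t)\<close> is \<open>norm xi ^ 2\<close> times the primitive of \<open>Y\<close>. The primitives
 of two nonnegative functions are used because the transform of \<open>Y\<close> itself has no sign.\<close>

lemma Z0_fourier:
 "\<exists>C D. (\<forall>X t. X ~~> t --> (%n. primitive C (X n)) ~~> primitive C t)
   & (\<forall>X t. X ~~> t --> (%n. primitive D (X n)) ~~> primitive D t)
   & (\<forall>t\<ge>0. 1 - (\<integral>x. cos (x \<bullet> xi) \<partial>Z0 t) = (norm xi)\<^sup>2 * (primitive C t - primitive D t))"
proof -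
 interpret Y: subordinated_kernel Y0 "%_. 1" phi by (rule Y0_kernel)
 interpret Zk: subordinated_kernel Z0 "%z. phi z / z" phi by (rule Z0_kernel)
 define C where "C = (%t. enn2real (NN x. kY (t, x) * ennreal (1 + cos (x \<bullet> xi))))"
 define D where "D = (%t. enn2real (NN x. kY (t, x)))"
 note kY_pair[measurable]
 have Cm: "C : Bor" "D : Bor"
  unfolding C_def D_def
  by (auto intro!: measurable_compose[OF _ borel_measurable_enn2real] lborel.borel_measurable_nn_integral simp: split_beta')
 have C0: "0 <= C t" "0 <= D t" for t by (auto simp: C_def D_def)
 have CAE: "AE t in pos_time. Y.mass t + (\<integral>x. cos (x \<bullet> xi) \<partial>Y0 t) = C t"
  using AE_Y0_density
 proof eventually_elim
  case (elim t)
  have "(\<integral>\<^sup>+x. ennreal (1 + cos (x \<bullet> xi)) \<partial>density lborel (%x. kY (t, x))) = (NN x. kY (t, x) * ennreal (1 + cos (x \<bullet> xi)))"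
   using kY_slice[of t] by (subst nn_integral_density) auto
  then have "(NN x. kY (t, x) * ennreal (1 + cos (x \<bullet> xi))) = ennreal (Y.mass t + (\<integral>x. cos (x \<bullet> xi) \<partial>Y0 t))"
   using Y.nn_integral_K_cos(1)[of t xi] unfolding elim[symmetric] by simp
  then show ?case using Y.nn_integral_K_cos(2)[of t xi] by (simp add: C_def)
 qed
 have DAE: "AE t in pos_time. Y.mass t = D t"
  using AE_Y0_density
 proof eventually_elim
  case (elim t)
  have "emeasure (density lborel (%x. kY (t, x))) UNIV = (NN x. kY (t, x))"
   using kY_slice[of t] by (subst emeasure_density) auto
  then have "(NN x. kY (t, x)) = ennreal (Y.mass t)"
   using Y.emeasure_K_UNIV[of t] unfolding elim[symmetric] by simp
  then show ?case by (simp add: D_def Y.mass_nonneg)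
 qed
 have CL: "has_bochner_integral pos_time (%t. exp (- z * t) * C t) (1 / phi z + 1 / (phi z + (norm xi)\<^sup>2))" if "z > 0" for z
  by (rule has_bochner_integral_AE_eq[OF Y.fourier_K(1)[OF that]]) (use CAE in eventually_elim, simp)
 have DL: "has_bochner_integral pos_time (%t. exp (- z * t) * D t) (1 / phi z)" if "z > 0" for z
  by (rule has_bochner_integral_AE_eq[OF Y.fourier_K(3)[OF that]]) (use DAE in eventually_elim, simp)
 have T: "(%n. primitive C (X n)) ~~> primitive C t" "(%n. primitive D (X n)) ~~> primitive D t" if "X ~~> t" for X t
  by (rule primitive_tendsto[OF Cm(1) C0(1) CL that] primitive_tendsto[OF Cm(2) C0(2) DL that]; assumption)+
 have PC: "continuous_on S (primitive C)" "continuous_on S (primitive D)" for S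
  by (auto intro!: continuous_on_sequentiallyI T)
 define f where "f = (%t. (1 - (\<integral>x. cos (x \<bullet> xi) \<partial>Z0 t)) - (norm xi)\<^sup>2 * (primitive C t - primitive D t))"
 have mass1: "Zk.mass t = 1" for t
  using prob_space.prob_space[OF prob_Z0[of t]] by (simp add: Zk.mass_def Zk.space_K)
 have "f t = 0" if "t > 0" for t
 proof (rule laplace_unique[OF _ _ that])
  have "bounded (range (%x. cos (x \<bullet> xi)))" by (intro boundedI[of _ 1]) auto
  then have "continuous_on {0<..} (%t. \<integral>x. cos (x \<bullet> xi) \<partial>Z0 t)"
   by (intro continuous_Z0 continuous_intros)
  then show "continuous_on {0<..} f" unfolding f_def by (intro continuous_intros PC)
  fix z :: real assume z: "z > 0"
  have p: "phi z > 0" "phi z + (norm xi)\<^sup>2 > 0" using phi_pos[OF z] by (auto intro: add_pos_nonneg)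
  have 1: "has_bochner_integral pos_time (%t. exp (- z * t) * 1) (phi z / z / phi z)"
   using Zk.fourier_K(3)[OF z] by (simp add: mass1)
  have 2: "has_bochner_integral pos_time (%t. exp (- z * t) * (1 + (\<integral>x. cos (x \<bullet> xi) \<partial>Z0 t))) (phi z / z / phi z + phi z / z / (phi z + (norm xi)\<^sup>2))"
   using Zk.fourier_K(1)[OF z, of xi] by (simp add: mass1)
  note 3 = primitive_laplace[OF Cm(1) C0(1) CL z] and 4 = primitive_laplace[OF Cm(2) C0(2) DL z]
  \<comment> \<open>\<open>1 - cos\<close> is written as \<open>2 * 1 - (1 + cos)\<close>, since the
    transforms at hand are those of the mass and of \<open>1 + cos\<close>; likewise the primitive
    of the cosine transform of \<open>Y\<close> is the difference of the primitives of
    \<open>C\<close> and \<open>D\<close>.\<close>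
  have "has_bochner_integral pos_time (%t. (2 * (exp (- z * t) * 1) - exp (- z * t) * (1 + (\<integral>x. cos (x \<bullet> xi) \<partial>Z0 t)))
   - (norm xi)\<^sup>2 * (exp (- z * t) * primitive C t - exp (- z * t) * primitive D t))
   ((2 * (phi z / z / phi z) - (phi z / z / phi z + phi z / z / (phi z + (norm xi)\<^sup>2)))
   - (norm xi)\<^sup>2 * ((1 / phi z + 1 / (phi z + (norm xi)\<^sup>2)) / z - (1 / phi z) / z))"
   by (intro has_bochner_integral_diff has_bochner_integral_mult_right 1 2 3 4)
  also have "(%t. (2 * (exp (- z * t) * 1) - exp (- z * t) * (1 + (\<integral>x. cos (x \<bullet> xi) \<partial>Z0 t)))
   - (norm xi)\<^sup>2 * (exp (- z * t) * primitive C t - exp (- z * t) * primitive D t)) = (%t. exp (- z * t) * f t)"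
   by (simp add: f_def fun_eq_iff algebra_simps)
  also have "((2 * (phi z / z / phi z) - (phi z / z / phi z + phi z / z / (phi z + (norm xi)\<^sup>2)))
   - (norm xi)\<^sup>2 * ((1 / phi z + 1 / (phi z + (norm xi)\<^sup>2)) / z - (1 / phi z) / z)) = 0"
  proof -
   define n N where "n = (norm xi)\<^sup>2" and "N = phi z + n"
   have "N > 0" using p by (simp add: N_def n_def)
   then have "(N - n) / z / N + n * (1 / N / z) = 1 / z" using z by (simp add: field_simps)
   then have 1: "phi z / z / N + n * (1 / N / z) = 1 / z" by (simp add: N_def)
   have 2: "(1 / phi z + 1 / N) / z - 1 / phi z / z = 1 / N / z" by (simp add: add_divide_distrib)
   have 3: "phi z / z / phi z = 1 / z" using p by simp
   show ?thesis unfolding n_def[symmetric] N_def[symmetric] 2 3 using 1 by linarith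
  qed
  finally show "has_bochner_integral pos_time (%t. exp (- z * t) * f t) 0" .
 qed
 moreover have "f 0 = 0" by (simp add: f_def Z0_def primitive_def integral_return)
 ultimately have "f t = 0" if "t \<ge> 0" for t using that by (cases "t = 0") auto
 then show ?thesis using T unfolding f_def by (intro exI[of _ C] exI[of _ D]) auto
qed

text \<open>Only \<open>t = 0\<close> needs work. There the cosine transforms tend to 1 by
  \<open>Z0_fourier\<close>, hence so do the integrals of \<open>exp (- (norm y)^2)\<close> by
  \<open>gaussian_average\<close>; since \<open>1 - exp (- (norm y)^2)\<close> is bounded below away
  from the origin, the mass concentrates at 0.\<close>

lemma Z0_weakly_continuous:
 fixes f :: "real^'n => real"
 assumes f: "continuous_on UNIV f" "bounded (range f)" and X: "X ~~> t" "!!n. 0 <= X n"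
 shows "(%n. \<integral>x. f x \<partial>Z0 (X n)) ~~> (\<integral>x. f x \<partial>Z0 t)"
proof (cases "t > 0")
 case True
 have "isCont (%t. \<integral>x. f x \<partial>Z0 t) t"
  using continuous_Z0[OF f] True by (simp add: continuous_on_eq_continuous_at)
 then show ?thesis by (rule isCont_tendsto_compose[OF _ X(1)])
next
 case False
 then have t: "t = 0" using LIMSEQ_le_const[OF X(1)] X(2) by (metis less_eq_real_def)
 have [measurable]: "f : Bor" using f(1) by (rule borel_measurable_continuous_onI)
 obtain B where B: "!!x. \<bar>f x\<bar> <= B" using f(2) by (auto simp: bounded_iff)
 have B0: "0 <= B" using B[of 0] by linarith
 have heat1: "(LB xi. heat 1 (xi :: real^'n)) = 1"
  using nn_integral_heat[of 1, where 'a = "real^'n"] by (subst integral_eq_nn_integral) (auto simp: heat_nonneg)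
 have cos1: "\<bar>\<integral>y. cos (y \<bullet> xi) \<partial>Z0 s\<bar> <= 1" for s xi
 proof -
  interpret prob_space "Z0 s" by (rule prob_Z0)
  have "\<bar>\<integral>y. cos (y \<bullet> xi) \<partial>Z0 s\<bar> <= (\<integral>y. \<bar>cos (y \<bullet> xi)\<bar> \<partial>Z0 s)" by (rule integral_abs_bound)
  also have "... <= (\<integral>y. 1 \<partial>Z0 s)" by (intro integral_mono integrable_const_bound[of _ 1]) auto
  finally show ?thesis by (simp add: prob_space)
 qed
 have cosm: "(%xi. \<integral>y. cos (y \<bullet> xi) \<partial>Z0 s) : Bor" for s
 proof -
  interpret prob_space "Z0 s" by (rule prob_Z0)
  show ?thesis by (rule borel_measurable_lebesgue_integral) (simp add: split_beta')
 qed
 have "(%n. \<integral>xi. heat 1 xi * (\<integral>y. cos (y \<bullet> xi) \<partial>Z0 (X n)) \<partial>lborel) ~~> (LB xi. heat 1 (xi :: real^'n) * 1)"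
 proof (rule integral_dominated_convergence[where w = "heat 1"])
  show "AE xi in lborel. (%n. heat 1 xi * (\<integral>y. cos (y \<bullet> xi) \<partial>Z0 (X n))) ~~> heat 1 xi * 1"
  proof (intro AE_I2 tendsto_mult tendsto_const)
   fix xi :: "real^'n"
   obtain C D where CD: "!!X t. X ~~> t ==> (%n. primitive C (X n)) ~~> primitive C t"
   "!!X t. X ~~> t ==> (%n. primitive D (X n)) ~~> primitive D t"
   "!!t. t \<ge> 0 ==> 1 - (\<integral>x. cos (x \<bullet> xi) \<partial>Z0 t) = (norm xi)\<^sup>2 * (primitive C t - primitive D t)"
   using Z0_fourier[of xi] by blast
   have "(%n. 1 - (norm xi)\<^sup>2 * (primitive C (X n) - primitive D (X n))) ~~> 1 - (norm xi)\<^sup>2 * (primitive C 0 - primitive D 0)"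
   using X(1) unfolding t by (intro tendsto_intros CD)
   moreover have "(\<integral>x. cos (x \<bullet> xi) \<partial>Z0 (X n)) = 1 - (norm xi)\<^sup>2 * (primitive C (X n) - primitive D (X n))" for n
   using CD(3)[OF X(2)[of n]] by linarith
   ultimately show "(%n. \<integral>y. cos (y \<bullet> xi) \<partial>Z0 (X n)) ~~> 1" by (simp add: primitive_def)
  qed
  show "AE xi in lborel. norm (heat 1 xi * (\<integral>y. cos (y \<bullet> xi) \<partial>Z0 (X n))) <= heat 1 xi" for n
   using cos1 by (intro AE_I2) (auto simp: abs_mult heat_nonneg abs_of_nonneg mult_left_le)
 qed (use cosm in \<open>auto intro: integrable_heat\<close>)
 moreover have "(\<integral>y. exp (- (norm y)\<^sup>2) \<partial>Z0 s) = (LB xi. heat 1 xi * (\<integral>y. cos (y \<bullet> xi) \<partial>Z0 s))" for s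
  using gaussian_average[OF prob_space.finite_measure[OF prob_Z0] sets_Z0, where r = 1 and x = 0, of s] by simp
 ultimately have lim: "(%n. \<integral>y. exp (- (norm y)\<^sup>2) \<partial>Z0 (X n)) ~~> 1" by (simp add: heat1)
 have Z00: "(\<integral>x. f x \<partial>Z0 t) = f 0" by (simp add: t Z0_def integral_return)
 show ?thesis unfolding Z00
 proof (rule LIMSEQ_I)
  fix e :: real assume e: "0 < e"
  have "isCont f 0" using f(1) by (simp add: continuous_on_eq_continuous_at)
  from this[unfolded continuous_at_eps_delta, rule_format, of "e/2"] e
  obtain \<rho> where \<rho>: "\<rho> > 0" "!!x. dist x 0 < \<rho> ==> dist (f x) (f 0) < e/2" by auto
  \<comment> \<open>Lower bound of \<open>1 - exp (- (norm y)^2)\<close> outside the ball of radius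
    \<open>\<rho>\<close>: the constant of a Chebyshev estimate.\<close>
  define A where "A = 1 - exp (- \<rho>\<^sup>2)"
  have A: "A > 0" using \<rho> by (simp add: A_def)
  have pt: "\<bar>f y - f 0\<bar> <= e/2 + 2 * B / A * (1 - exp (- (norm y)\<^sup>2))" for y
  proof (cases "norm y < \<rho>")
   case True
   then have "\<bar>f y - f 0\<bar> <= e/2" using \<rho>(2)[of y] by (simp add: dist_real_def)
   moreover have "0 <= 2 * B / A * (1 - exp (- (norm y)\<^sup>2))" using A B0 by simp
   ultimately show ?thesis by linarith
  next
   case False
   then have "A <= 1 - exp (- (norm y)\<^sup>2)" using \<rho> by (simp add: A_def power_mono)
   then have "2 * B / A * A <= 2 * B / A * (1 - exp (- (norm y)\<^sup>2))" using A B0 by (intro mult_left_mono) auto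
   then have "2 * B <= 2 * B / A * (1 - exp (- (norm y)\<^sup>2))" using A by simp
   moreover have "\<bar>f y - f 0\<bar> <= 2 * B" using B[of y] B[of 0] by linarith
   ultimately show ?thesis using e by linarith
  qed
  have bound: "norm ((\<integral>y. f y \<partial>Z0 s) - f 0) <= e/2 + 2 * B / A * (1 - (\<integral>y. exp (- (norm y)\<^sup>2) \<partial>Z0 s))" for s
  proof -
   interpret prob_space "Z0 s" by (rule prob_Z0)
   have i: "integrable (Z0 s) f" "integrable (Z0 s) (%y. exp (- (norm y)\<^sup>2))"
   using B by (auto intro!: integrable_const_bound[of f B] integrable_const_bound[of "%y. exp (- (norm y)\<^sup>2)" 1])
   have "(\<integral>y. f y \<partial>Z0 s) - f 0 = (\<integral>y. f y - f 0 \<partial>Z0 s)" using i by (simp add: prob_space)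
   also have "norm ... <= (\<integral>y. \<bar>f y - f 0\<bar> \<partial>Z0 s)" by (simp add: integral_abs_bound)
   also have "... <= (\<integral>y. e/2 + 2 * B / A * (1 - exp (- (norm y)\<^sup>2)) \<partial>Z0 s)"
   using i by (intro integral_mono pt) auto
   also have "... = e/2 + 2 * B / A * (1 - (\<integral>y. exp (- (norm y)\<^sup>2) \<partial>Z0 s))" using i by (simp add: prob_space)
   finally show ?thesis .
  qed
  have "(%n. e/2 + 2 * B / A * (1 - (\<integral>y. exp (- (norm y)\<^sup>2) \<partial>Z0 (X n)))) ~~> e/2 + 2 * B / A * (1 - 1)"
   by (intro tendsto_intros lim)
  from order_tendstoD(2)[OF this, of e] have "eventually (%n. e/2 + 2 * B / A * (1 - (\<integral>y. exp (- (norm y)\<^sup>2) \<partial>Z0 (X n))) < e) sequentially"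
   using e by simp
  then show "\<exists>no. \<forall>n\<ge>no. norm ((\<integral>y. f y \<partial>Z0 (X n)) - f 0) < e"
   unfolding eventually_sequentially using bound by (meson le_less_trans)
 qed
qed

end

section \<open>Convolution of integrable functions with measures\<close>

lemma slice_measurable:
 fixes f :: "real \<times> 'a::euclidean_space => 'b::topological_space"
 assumes "f : Bor"
 shows "(%x. f (t, x)) : Bor" "f : borel_measurable (borel \<Otimes>\<^sub>M borel)"
proof -
 show m: "f : borel_measurable (borel \<Otimes>\<^sub>M borel)" using assms by (simp add: borel_prod)
 show "(%x. f (t, x)) : Bor"
  using measurable_compose[OF measurable_Pair1'[of t borel borel] m] by simp
qed

lemma
 fixes \<mu> :: "(real^'n) measure" and f :: "real^'n => real"
 assumes \<mu>: "finite_measure \<mu>" and [measurable_cong]: "sets \<mu> = sets borel"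
  and f[measurable]: "f : Bor"
 shows measure_convolution_measurable: "measure_convolution \<mu> f : Bor"
  and nn_integral_convolution: "(NN x. (\<integral>\<^sup>+y. ennreal \<bar>f (x - y)\<bar> \<partial>\<mu>)) = emeasure \<mu> UNIV * (NN x. ennreal \<bar>f x\<bar>)"
  and AE_integrable_convolution: "integrable lborel f ==> AE x in lborel. integrable \<mu> (%y. f (x - y))"
  and L1_convolution_le: "(NN x. ennreal \<bar>measure_convolution \<mu> f x\<bar>) <= emeasure \<mu> UNIV * (NN x. ennreal \<bar>f x\<bar>)"
proof -
 interpret finite_measure \<mu> by fact
 interpret P: pair_sigma_finite \<mu> "lborel :: (real^'n) measure" by standard
 have sp: "space \<mu> = UNIV" using \<open>sets \<mu> = sets borel\<close>[THEN sets_eq_imp_space_eq] by simp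
 show "measure_convolution \<mu> f : Bor"
  unfolding measure_convolution_def[abs_def] by (rule borel_measurable_lebesgue_integral) (simp add: split_beta')
 have "(NN x. (\<integral>\<^sup>+y. ennreal \<bar>f (x - y)\<bar> \<partial>\<mu>)) = (\<integral>\<^sup>+y. (NN x. ennreal \<bar>f (x - y)\<bar>) \<partial>\<mu>)"
  by (rule P.Fubini') (simp add: split_beta')
 also have "... = (\<integral>\<^sup>+y. (NN x. ennreal \<bar>f x\<bar>) \<partial>\<mu>)"
 proof -
  have "(NN x. ennreal \<bar>f (x - y)\<bar>) = (NN x. ennreal \<bar>f x\<bar>)" for y
   using nn_integral_lborel_shift[of "%x. ennreal \<bar>f x\<bar>" "- y"] by simp
  then show ?thesis by (simp only:)
 qed
 finally show N: "(NN x. (\<integral>\<^sup>+y. ennreal \<bar>f (x - y)\<bar> \<partial>\<mu>)) = emeasure \<mu> UNIV * (NN x. ennreal \<bar>f x\<bar>)"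
  by (simp add: sp mult.commute)
 show "(NN x. ennreal \<bar>measure_convolution \<mu> f x\<bar>) <= emeasure \<mu> UNIV * (NN x. ennreal \<bar>f x\<bar>)"
  unfolding N[symmetric] measure_convolution_def
 proof (rule nn_integral_mono)
  \<comment> \<open>Where the integral does not exist its value is 0, and the bound holds
    trivially.\<close>
  fix x show "ennreal \<bar>\<integral>y. f (x - y) \<partial>\<mu>\<bar> <= (\<integral>\<^sup>+y. ennreal \<bar>f (x - y)\<bar> \<partial>\<mu>)"
   using integral_norm_bound_ennreal[of \<mu> "%y. f (x - y)"]
   by (cases "integrable \<mu> (%y. f (x - y))") (auto simp: not_integrable_integral_eq)
 qed
 show "AE x in lborel. integrable \<mu> (%y. f (x - y))" if "integrable lborel f"
 proof -
  have "(NN x. ennreal \<bar>f x\<bar>) < \<infinity>" using that by (auto simp: integrable_iff_bounded)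
  then have "(NN x. (\<integral>\<^sup>+y. ennreal \<bar>f (x - y)\<bar> \<partial>\<mu>)) < \<infinity>"
   unfolding N using emeasure_finite[of UNIV] by (auto simp: ennreal_mult_eq_top_iff top.not_eq_extremum[symmetric])
  moreover have "(%x. \<integral>\<^sup>+y. ennreal \<bar>f (x - y)\<bar> \<partial>\<mu>) : borel_measurable lborel"
   by (rule borel_measurable_nn_integral) (simp add: split_beta')
  ultimately have "AE x in lborel. (\<integral>\<^sup>+y. ennreal \<bar>f (x - y)\<bar> \<partial>\<mu>) \<noteq> \<infinity>"
   by (intro nn_integral_PInf_AE) auto
  then show ?thesis by eventually_elim (auto simp: integrable_iff_bounded top.not_eq_extremum[symmetric])
 qed
qed

text \<open>Linearity of the convolution can fail only where one of the integrals does not exist,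
  which is a null set for integrable \<open>f\<close> and \<open>g\<close>.\<close>

lemma L1_convolution_diff_le:
 fixes \<mu> :: "(real^'n) measure" and f g :: "real^'n => real"
 assumes \<mu>: "finite_measure \<mu>" "sets \<mu> = sets borel" and f: "integrable lborel f" and g: "integrable lborel g"
 shows "(NN x. ennreal \<bar>measure_convolution \<mu> f x - measure_convolution \<mu> g x\<bar>)
  <= emeasure \<mu> UNIV * (NN x. ennreal \<bar>f x - g x\<bar>)"
proof -
 have fm: "f : Bor" "g : Bor" using f g by auto
 have "AE x in lborel. measure_convolution \<mu> f x - measure_convolution \<mu> g x = measure_convolution \<mu> (%x. f x - g x) x"
  using AE_integrable_convolution[OF \<mu> fm(1) f] AE_integrable_convolution[OF \<mu> fm(2) g]
  by eventually_elim (simp add: measure_convolution_def)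
 then have "(NN x. ennreal \<bar>measure_convolution \<mu> f x - measure_convolution \<mu> g x\<bar>)
  = (NN x. ennreal \<bar>measure_convolution \<mu> (%x. f x - g x) x\<bar>)"
  by (intro nn_integral_cong_AE) (auto elim: eventually_mono)
 also have "... <= emeasure \<mu> UNIV * (NN x. ennreal \<bar>f x - g x\<bar>)"
  by (rule L1_convolution_le[OF \<mu>]) (use fm in simp)
 finally show ?thesis .
qed

text \<open>For continuous \<open>g >= 0\<close> of compact support the convolutions converge
  pointwise and all have the same integral, so Scheffe's lemma gives convergence in L^1. Convolution
  with a probability measure is an L^1 contraction, and \<open>u\<close> is approximated by such
  \<open>g\<close>.\<close>

lemma weak_convergence_imp_L1_convolution:
 fixes Z :: "nat => (real^'n) measure" and u :: "real^'n => real"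
 assumes prob: "!!n. prob_space (Z n)" "prob_space Z'" and sets: "!!n. sets (Z n) = sets borel" "sets Z' = sets borel"
  and weak: "!!f :: real^'n => real. continuous_on UNIV f ==> bounded (range f) ==> (%n. \<integral>x. f x \<partial>Z n) ~~> (\<integral>x. f x \<partial>Z')"
  and u: "integrable lborel u" "!!x. 0 <= u x"
 shows "(%n. \<integral>\<^sup>+x. ennreal \<bar>measure_convolution (Z n) u x - measure_convolution Z' u x\<bar> \<partial>lborel) ~~> 0"
proof (rule order_tendstoI)
 fix e :: ennreal assume e: "0 < e"
 obtain eps :: real where eps: "0 < eps" "ennreal eps < e"
 proof -
  obtain r where "0 < r" "ennreal r < e" using e by (metis ennreal_less_zero_iff dense ennreal_cases less_top_ennreal order.strict_trans2 top_greatest)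
  then show ?thesis using that by blast
 qed
 obtain g0 r where g0: "continuous_on UNIV g0" "!!x. norm x > r ==> g0 x = 0"
  "(NN x. ennreal \<bar>u x - g0 x\<bar>) < ennreal (eps/3)"
  using continuous_compact_support_dense_L1[OF u(1), of "eps/3"] eps by auto
 \<comment> \<open>Taking the positive part does not increase the distance to \<open>u >= 0\<close>,
   and nonnegativity is what makes the masses of the convolutions equal in Scheffe's lemma.\<close>
 define g where "g = (%x. max 0 (g0 x))"
 have gc: "continuous_on UNIV g" unfolding g_def by (intro continuous_intros g0)
 have gs: "g x = 0" if "norm x > r" for x using g0(2)[OF that] by (simp add: g_def)
 have g_nonneg: "0 <= g x" for x by (simp add: g_def)
 have gm[measurable]: "g : Bor" using gc by (rule borel_measurable_continuous_onI)
 have g0m[measurable]: "g0 : Bor" using g0(1) by (rule borel_measurable_continuous_onI)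
 have um[measurable]: "u : Bor" using u by auto
 have "(NN x. ennreal \<bar>u x - g x\<bar>) <= (NN x. ennreal \<bar>u x - g0 x\<bar>)"
 proof (intro nn_integral_mono ennreal_leI)
  fix x show "\<bar>u x - g x\<bar> <= \<bar>u x - g0 x\<bar>" using u(2)[of x] by (auto simp: g_def)
 qed
 then have ug: "(NN x. ennreal \<bar>u x - g x\<bar>) < ennreal (eps/3)" using g0(3) by (rule le_less_trans)
 have "bounded (g ` cball 0 \<bar>r\<bar>)"
  by (intro compact_imp_bounded compact_continuous_image continuous_on_subset[OF gc]) auto
 then obtain B where "\<forall>y\<in>g ` cball 0 \<bar>r\<bar>. norm y <= B" unfolding bounded_iff by blast
 then have B: "!!x. x : cball 0 \<bar>r\<bar> ==> \<bar>g x\<bar> <= B" by auto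
 have gB: "\<bar>g x\<bar> <= \<bar>B\<bar>" for x
 proof (cases "norm x > r")
  case True then show ?thesis by (simp add: gs)
 next
  case False
  then have "x : cball 0 \<bar>r\<bar>" by auto
  from B[OF this] show ?thesis by linarith
 qed
 have gi: "integrable lborel g"
 proof (rule Bochner_Integration.integrable_bound[of _ "%x. \<bar>B\<bar> * indicator (cball 0 \<bar>r\<bar>) x :: real"])
  show "integrable lborel (%x::real^'n. \<bar>B\<bar> * indicator (cball 0 \<bar>r\<bar>) x :: real)"
   by (intro integrable_mult_right integrable_real_indicator) (auto simp: emeasure_cball_less_top)
  show "AE x in lborel. norm (g x) <= norm (\<bar>B\<bar> * indicator (cball 0 \<bar>r\<bar>) x)"
   using gB gs by (intro AE_I2) (auto split: split_indicator)
 qed simp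
 have gcx: "continuous_on UNIV (%y. g (x - y))" "bounded (range (%y. g (x - y)))" for x
  using gB by (auto intro!: continuous_on_compose2[OF gc] continuous_intros boundedI[of _ "\<bar>B\<bar>"])
 have mass: "(NN x. ennreal \<bar>measure_convolution K g x\<bar>) = (NN x. ennreal (g x))"
  if K: "prob_space K" and [measurable_cong]: "sets K = sets borel" for K
 proof -
  interpret prob_space K by fact
  have sp: "space K = UNIV" using \<open>sets K = sets borel\<close>[THEN sets_eq_imp_space_eq] by simp
  have i: "integrable K (%y. g (x - y))" for x using gB by (intro integrable_const_bound[of _ "\<bar>B\<bar>"]) auto
  have "(NN x. ennreal \<bar>measure_convolution K g x\<bar>) = (NN x. (\<integral>\<^sup>+y. ennreal \<bar>g (x - y)\<bar> \<partial>K))"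
   unfolding measure_convolution_def using i g_nonneg
   by (intro nn_integral_cong) (subst nn_integral_eq_integral, auto simp: integral_nonneg_AE)
  also have "... = (NN x. ennreal (g x))"
   using nn_integral_convolution[OF finite_measure_axioms \<open>sets K = sets borel\<close> gm] emeasure_space_1 g_nonneg by (simp add: sp)
  finally show ?thesis .
 qed
 have fin: "finite_measure K" if "prob_space K" for K using that by (rule prob_space.finite_measure)
 have G: "(%n. \<integral>\<^sup>+x. norm (measure_convolution (Z n) g x - measure_convolution Z' g x) \<partial>lborel) ~~> 0"
 proof (rule Scheffe_lemma2)
  show "measure_convolution (Z n) g : borel_measurable lborel" for n
   using measure_convolution_measurable[OF fin[OF prob(1)] sets(1) gm] by simp
  show "integrable lborel (measure_convolution Z' g)"
  proof -
   have "(NN x. ennreal (g x)) < \<infinity>" using gi g_nonneg by (auto simp: integrable_iff_bounded)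
   then show ?thesis unfolding integrable_iff_bounded
   using mass[OF prob(2) sets(2)] measure_convolution_measurable[OF fin[OF prob(2)] sets(2) gm] by simp
  qed
  show "AE x in lborel. (%n. measure_convolution (Z n) g x) ~~> measure_convolution Z' g x"
   unfolding measure_convolution_def by (intro AE_I2 weak gcx)
  show "(NN x. norm (measure_convolution (Z n) g x)) <= (NN x. norm (measure_convolution Z' g x))" for n
   using mass[OF prob(1)[of n] sets(1)[of n]] mass[OF prob(2) sets(2)] by simp
 qed
 have "0 < ennreal (eps/3)" using eps by simp
 then have "eventually (%n. (NN x. norm (measure_convolution (Z n) g x - measure_convolution Z' g x)) < ennreal (eps/3)) sequentially"
  by (rule order_tendstoD(2)[OF G])
 then show "eventually (%n. (NN x. ennreal \<bar>measure_convolution (Z n) u x - measure_convolution Z' u x\<bar>) < e) sequentially"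
 proof eventually_elim
  case (elim n)
  have d: "(NN x. ennreal \<bar>measure_convolution K u x - measure_convolution K g x\<bar>) < ennreal (eps/3)"
   if K: "prob_space K" and sK: "sets K = sets borel" for K
  proof -
   have "emeasure K UNIV = 1" using prob_space.emeasure_space_1[OF K] sets_eq_imp_space_eq[OF sK] by simp
   then show ?thesis using L1_convolution_diff_le[OF fin[OF K] sK u(1) gi] ug by simp
  qed
  have [measurable]: "measure_convolution (Z n) f : Bor" "measure_convolution Z' f : Bor"
   if "f : Bor" for f
   using measure_convolution_measurable[OF fin[OF prob(1)] sets(1) that] measure_convolution_measurable[OF fin[OF prob(2)] sets(2) that] by auto
  let ?D = "%a b. \<integral>\<^sup>+x. ennreal \<bar>a x - b x\<bar> \<partial>lborel"
  have "?D (measure_convolution (Z n) u) (measure_convolution Z' u) \<le>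
   ?D (measure_convolution (Z n) u) (measure_convolution (Z n) g) + ?D (measure_convolution (Z n) g) (measure_convolution Z' u)"
   by (rule nn_integral_norm_diff_triangle) auto
  also have "?D (measure_convolution (Z n) g) (measure_convolution Z' u) \<le>
   ?D (measure_convolution (Z n) g) (measure_convolution Z' g) + ?D (measure_convolution Z' g) (measure_convolution Z' u)"
   by (rule nn_integral_norm_diff_triangle) auto
  also have "?D (measure_convolution Z' g) (measure_convolution Z' u) = ?D (measure_convolution Z' u) (measure_convolution Z' g)"
   by (simp add: abs_minus_commute)
  finally have "?D (measure_convolution (Z n) u) (measure_convolution Z' u) \<le>
   ?D (measure_convolution (Z n) u) (measure_convolution (Z n) g) +
   (?D (measure_convolution (Z n) g) (measure_convolution Z' g) + ?D (measure_convolution Z' u) (measure_convolution Z' g))"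
   by (simp add: add_left_mono)
  also have "... < ennreal (eps/3) + (ennreal (eps/3) + ennreal (eps/3))"
   using d[OF prob(1)[of n] sets(1)[of n]] d[OF prob(2) sets(2)] elim by (intro add_strict_mono) auto
  also have "... = ennreal eps" using eps by (simp add: ennreal_plus[symmetric] del: ennreal_plus)
  finally show ?case using eps(2) by simp
 qed
qed simp

section \<open>Vector-valued measurability and integration in L^1 and L^infinity\<close>

lemma ennreal_tendsto_0_le:
 fixes f g :: "nat => ennreal"
 assumes "!!k. f k <= g k" "g ~~> 0"
 shows "f ~~> 0"
 by (rule tendsto_sandwich[of "%_. 0" f sequentially g]) (use assms in auto)

lemma measurable_lebesgue_on_borel:
 "f : Bor ==> f : borel_measurable (lebesgue_on S)"
 by (intro measurable_restrict_space1) (simp add: measurable_completion)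

lemma Linf_norm_le:
 assumes "f : Bor" "AE x in lborel. \<bar>f x\<bar> <= C"
 shows "Linf_norm f <= ennreal C"
 unfolding Linf_norm_def using assms by (intro esssup_I) (auto intro: ennreal_leI elim!: eventually_mono)

lemma Linf_norm_AE: "AE x in lborel. ennreal \<bar>f x\<bar> <= Linf_norm f"
 unfolding Linf_norm_def by (rule esssup_AE)

text \<open>Both norms run through the set \<open>{L1_norm, Linf_norm}\<close>, so that later
  estimates are proved once for either of them.\<close>

lemma norm_triangle:
 fixes f g :: "real^'n => real"
 assumes "N : {L1_norm, Linf_norm}" and [measurable]: "f : Bor" "g : Bor"
 shows "N (%x. f x + g x) <= N f + N g"
proof -
 have "L1_norm (%x. f x + g x) <= L1_norm f + L1_norm g"
  unfolding L1_norm_def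
  by (subst nn_integral_add[symmetric])
   (auto intro!: nn_integral_mono simp: ennreal_plus[symmetric] simp del: ennreal_plus)
 moreover have "Linf_norm (%x. f x + g x) <= Linf_norm f + Linf_norm g"
  unfolding Linf_norm_def[of "%x. f x + g x"]
 proof (rule esssup_I)
  show "AE x in lborel. ennreal \<bar>f x + g x\<bar> <= Linf_norm f + Linf_norm g"
   using Linf_norm_AE[of f] Linf_norm_AE[of g]
  proof eventually_elim
   case (elim x)
   have "ennreal \<bar>f x + g x\<bar> <= ennreal \<bar>f x\<bar> + ennreal \<bar>g x\<bar>"
   by (simp add: ennreal_plus[symmetric] ennreal_leI del: ennreal_plus)
   then show ?case using add_mono[OF elim] by (rule order_trans)
  qed
 qed simp
 ultimately show ?thesis using assms(1) by auto
qed

lemma norm_minus: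
 assumes "N : {L1_norm, Linf_norm}"
 shows "N (%x. - f x) = N f" "N (%x. f x - g x) = N (%x. g x - f x)" "N (%x. 0) = 0"
proof -
 have "Linf_norm (%x::real^'a. 0) <= ennreal 0" by (rule Linf_norm_le) auto
 then show "N (%x. - f x) = N f" "N (%x. f x - g x) = N (%x. g x - f x)" "N (%x. 0) = 0"
  using assms by (auto simp: L1_norm_def Linf_norm_def abs_minus_commute)
qed

lemma norm_AE_cong:
 assumes "N : {L1_norm, Linf_norm}" "f : Bor" "g : Bor" "AE x in lborel. f x = g x"
 shows "N f = N g"
proof -
 have "L1_norm f = L1_norm g" unfolding L1_norm_def using assms(4) by (intro nn_integral_cong_AE) (auto elim!: eventually_mono)
 moreover have "Linf_norm f = Linf_norm g" unfolding Linf_norm_def using assms(2-4) by (intro esssup_AE_cong) (auto elim!: eventually_mono)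
 ultimately show ?thesis using assms(1) by auto
qed

lemma norm_eq_0_iff:
 assumes N: "N : {L1_norm, Linf_norm}" and f: "f : Bor"
 shows "N f = 0 \<longleftrightarrow> (AE x in lborel. f x = 0)"
proof
 assume "AE x in lborel. f x = 0"
 then have "N f = N (%x. 0)" using N f by (intro norm_AE_cong) auto
 then show "N f = 0" using norm_minus(3)[OF N] by simp
next
 assume *: "N f = 0"
 show "AE x in lborel. f x = 0"
 proof (cases "N = L1_norm")
  case True
  then have "(NN x. ennreal \<bar>f x\<bar>) = 0" using * by (simp add: L1_norm_def)
  then have "AE x in lborel. ennreal \<bar>f x\<bar> = 0" using f by (subst (asm) nn_integral_0_iff_AE) auto
  then show ?thesis by eventually_elim simp
 next
  case False
  then have "Linf_norm f = 0" using N * by auto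
  then show ?thesis using Linf_norm_AE[of f] by (auto elim!: eventually_mono)
 qed
qed

text \<open>A quantitative form of Bochner integrability. The majorant \<open>G\<close> is there because
 \<open>t \<mapsto> N (h t - s t)\<close> need not be known to be measurable in advance.\<close>

definition approximable ::
 "((real^'n => real) => ennreal) => real measure => (real => real^'n => real) => (real^'n => real) => bool" where
 "approximable N M h w \<longleftrightarrow> (\<forall>eps>0. \<exists>s G. simple_wrt N M s & G : borel_measurable M \<and>
   (AE t in M. h t : Bor & N (%x. h t x - s t x) <= G t) \<and>
   (\<integral>\<^sup>+t. G t \<partial>M) < ennreal eps & N (%x. w x - (\<integral>t. s t x \<partial>M)) < ennreal eps)"

lemma approximableD:
 assumes "approximable N M h w"
 obtains s G where "!!k. simple_wrt N M (s k)" "!!k. G k : borel_measurable M"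
  "!!k. AE t in M. h t : Bor & N (%x. h t x - s k t x) <= G k t"
  "!!k. (\<integral>\<^sup>+t. G k t \<partial>M) < ennreal ((1/2) ^ k)" "!!k. N (%x. w x - (\<integral>t. s k t x \<partial>M)) < ennreal ((1/2) ^ k)"
proof -
 have "\<forall>k::nat. \<exists>s G. simple_wrt N M s & G : borel_measurable M \<and>
   (AE t in M. h t : Bor & N (%x. h t x - s t x) <= G t) \<and>
   (\<integral>\<^sup>+t. G t \<partial>M) < ennreal ((1/2) ^ k) & N (%x. w x - (\<integral>t. s t x \<partial>M)) < ennreal ((1/2) ^ k)"
  using assms unfolding approximable_def by simp
 from choice[OF this] obtain s where "\<forall>k::nat. \<exists>G. simple_wrt N M (s k) & G : borel_measurable M \<and>
   (AE t in M. h t : Bor & N (%x. h t x - s k t x) <= G t) \<and>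
   (\<integral>\<^sup>+t. G t \<partial>M) < ennreal ((1/2) ^ k) & N (%x. w x - (\<integral>t. s k t x \<partial>M)) < ennreal ((1/2) ^ k)" ..
 from choice[OF this] obtain G where "\<forall>k::nat. simple_wrt N M (s k) & G k : borel_measurable M \<and>
   (AE t in M. h t : Bor & N (%x. h t x - s k t x) <= G k t) \<and>
   (\<integral>\<^sup>+t. G k t \<partial>M) < ennreal ((1/2) ^ k) & N (%x. w x - (\<integral>t. s k t x \<partial>M)) < ennreal ((1/2) ^ k)" ..
 then show ?thesis by (intro that[of s G]) auto
qed

lemma ennreal_half_power_tendsto: "(%k. ennreal ((1/2) ^ k)) ~~> 0"
 using tendsto_ennrealI[OF LIMSEQ_realpow_zero[of "1/2"]] by simp

text \<open>The errors \<open>(1/2) ^ k\<close> are summable, so the series of the majorants is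
  integrable and hence finite almost everywhere; its terms, and with them the distances to the step
  functions, tend to 0.\<close>

lemma approximable_strongly_measurable:
 assumes N: "N : {L1_norm, Linf_norm}" and h: "approximable N M h w"
 shows "strongly_measurable_wrt N M h"
proof -
 obtain s G where s: "!!k. simple_wrt N M (s k)" "!!k. G k : borel_measurable M"
  "!!k. AE t in M. h t : Bor & N (%x. h t x - s k t x) <= G k t"
  "!!k. (\<integral>\<^sup>+t. G k t \<partial>M) < ennreal ((1/2) ^ k)" by (rule approximableD[OF h]) blast
 have "(\<integral>\<^sup>+t. (\<Sum>k. G k t) \<partial>M) = (\<Sum>k. \<integral>\<^sup>+t. G k t \<partial>M)" by (rule nn_integral_suminf) (rule s)
 also have "... <= (\<Sum>k. ennreal ((1/2) ^ k))" by (intro suminf_le less_imp_le s) auto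
 also have "... = ennreal (\<Sum>k. (1/2) ^ k)" by (intro suminf_ennreal2) (auto simp: summable_geometric)
 also have "... < \<infinity>" by simp
 finally have "(\<integral>\<^sup>+t. (\<Sum>k. G k t) \<partial>M) \<noteq> \<infinity>" by simp
 then have "AE t in M. (\<Sum>k. G k t) \<noteq> \<infinity>" by (intro nn_integral_PInf_AE borel_measurable_suminf_order s) auto
 moreover have "AE t in M. \<forall>k. h t : Bor & N (%x. h t x - s k t x) <= G k t"
  using s(3) by (simp add: AE_all_countable)
 moreover have "AE t in M. t : space M" by simp
 ultimately have "AE t in M. h t : normed_functions N & (%k. N (%x. h t x - s k t x)) ~~> 0"
 proof eventually_elim
  case (elim t)
  have lim: "(%k. G k t) ~~> 0"
  proof -
   have fin: "G k t \<noteq> top" for k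
   proof -
   have "G k t <= (\<Sum>k. G k t)" using sum_le_suminf[of "%k. G k t" "{k}"] by simp
   then show ?thesis using elim(1) by (auto simp: top_unique)
   qed
   then have G: "G k t = ennreal (enn2real (G k t))" for k by (simp add: top.not_eq_extremum)
   have "summable (%k. enn2real (G k t))"
   using elim(1) by (intro summable_suminf_not_top) (simp_all add: G[symmetric])
   from tendsto_ennrealI[OF summable_LIMSEQ_zero[OF this]] show ?thesis by (simp add: G[symmetric])
  qed
  have "(%k. N (%x. h t x - s k t x)) ~~> 0"
   using elim(2) by (intro ennreal_tendsto_0_le[OF _ lim]) auto
  moreover have "N (h t) < \<infinity>"
  proof -
   have sm: "s 0 t : Bor" "N (s 0 t) < \<infinity>"
   using s(1)[of 0] elim(3) by (auto simp: simple_wrt_def normed_functions_def)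
   have "N (h t) = N (%x. (h t x - s 0 t x) + s 0 t x)" by simp
   also have "... <= N (%x. h t x - s 0 t x) + N (s 0 t)" using elim(2) sm by (intro norm_triangle[OF N]) auto
   also have "... <= G 0 t + N (s 0 t)" using elim(2) by (intro add_right_mono) auto
   also have "... < \<infinity>"
   proof -
   have "G 0 t <= (\<Sum>k. G k t)" using sum_le_suminf[of "%k. G k t" "{0}"] by simp
   then show ?thesis using elim(1) sm(2) by (auto simp: top.not_eq_extremum intro: le_less_trans)
   qed
   finally show ?thesis .
  qed
  ultimately show ?case using elim(2) by (simp add: normed_functions_def)
 qed
 then show ?thesis unfolding strongly_measurable_wrt_def using s(1) by blast
qed

lemma approximable_has_bochner_integral:
 assumes N: "N : {L1_norm, Linf_norm}" and h: "approximable N M h w" and w: "w : normed_functions N"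
 shows "has_bochner_integral_wrt N M h w"
proof -
 obtain s G where s: "!!k. simple_wrt N M (s k)" "!!k. G k : borel_measurable M"
  "!!k. AE t in M. h t : Bor & N (%x. h t x - s k t x) <= G k t"
  "!!k. (\<integral>\<^sup>+t. G k t \<partial>M) < ennreal ((1/2) ^ k)" "!!k. N (%x. w x - (\<integral>t. s k t x \<partial>M)) < ennreal ((1/2) ^ k)"
  by (rule approximableD[OF h]) blast
 have "(%k. \<integral>\<^sup>+t. N (%x. h t x - s k t x) \<partial>M) ~~> 0"
 proof (rule ennreal_tendsto_0_le[OF _ ennreal_half_power_tendsto])
  fix k
  have "(\<integral>\<^sup>+t. N (%x. h t x - s k t x) \<partial>M) <= (\<integral>\<^sup>+t. G k t \<partial>M)"
   using s(3)[of k] by (intro nn_integral_mono_AE) (auto elim!: eventually_mono)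
  then show "(\<integral>\<^sup>+t. N (%x. h t x - s k t x) \<partial>M) <= ennreal ((1/2) ^ k)" using s(4)[of k] by simp
 qed
 moreover have "(%k. N (%x. w x - (\<integral>t. s k t x \<partial>M))) ~~> 0"
  by (rule ennreal_tendsto_0_le[OF less_imp_le[OF s(5)] ennreal_half_power_tendsto])
 ultimately show ?thesis
  unfolding has_bochner_integral_wrt_def using approximable_strongly_measurable[OF N h] w s(1) by blast
qed

lemma strongly_measurable_add:
 fixes g h :: "real => real^'n => real"
 assumes N: "N : {L1_norm, Linf_norm}" and g: "strongly_measurable_wrt N M g" and h: "strongly_measurable_wrt N M h"
 shows "strongly_measurable_wrt N M (%t x. g t x + h t x)"
proof -
 obtain s where s: "!!k. simple_wrt N M (s k)" "AE t in M. g t : normed_functions N & (%k. N (%x. g t x - s k t x)) ~~> 0"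
  using g unfolding strongly_measurable_wrt_def by blast
 obtain r where r: "!!k. simple_wrt N M (r k)" "AE t in M. h t : normed_functions N & (%k. N (%x. h t x - r k t x)) ~~> 0"
  using h unfolding strongly_measurable_wrt_def by blast
 have tri: "(%x. f x + f' x) : normed_functions N" if f: "f : normed_functions N" "f' : normed_functions N" for f f' :: "real^'n => real"
 proof -
  have m: "f : Bor" "f' : Bor" using f by (auto simp: normed_functions_def)
  have "N (%x. f x + f' x) <= N f + N f'" by (rule norm_triangle[OF N m])
  also have "... < \<infinity>" using f by (simp add: normed_functions_def)
  finally show ?thesis using m by (simp add: normed_functions_def)
 qed
 have "simple_wrt N M (%t x. s k t x + r k t x)" for k
 proof -
  have "simple_function M (%t x. s k t x + r k t x)"
   using simple_function_compose2[of M "s k" "r k" "%a b x. a x + b x"] s(1)[of k] r(1)[of k] by (simp add: simple_wrt_def)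
  then show ?thesis using s(1)[of k] r(1)[of k] tri by (auto simp: simple_wrt_def)
 qed
 moreover have "AE t in M. (%x. g t x + h t x) : normed_functions N & (%k. N (%x. (g t x + h t x) - (s k t x + r k t x))) ~~> 0"
  using s(2) r(2) AE_space
 proof eventually_elim
  case (elim t)
  have m: "g t : Bor" "h t : Bor" "s k t : Bor" "r k t : Bor" for k
   using elim s(1)[of k] r(1)[of k] by (auto simp: normed_functions_def simple_wrt_def)
  have "(%k. N (%x. g t x - s k t x) + N (%x. h t x - r k t x)) ~~> 0 + 0" using elim by (intro tendsto_add) auto
  moreover have "N (%x. (g t x + h t x) - (s k t x + r k t x)) <= N (%x. g t x - s k t x) + N (%x. h t x - r k t x)" for k
   using norm_triangle[OF N, of "%x. g t x - s k t x" "%x. h t x - r k t x"] m by (simp add: algebra_simps)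
  ultimately have "(%k. N (%x. (g t x + h t x) - (s k t x + r k t x))) ~~> 0"
   using ennreal_tendsto_0_le[of "%k. N (%x. (g t x + h t x) - (s k t x + r k t x))"
   "%k. N (%x. g t x - s k t x) + N (%x. h t x - r k t x)"] by simp
  then show ?case using tri elim by blast
 qed
 ultimately show ?thesis unfolding strongly_measurable_wrt_def by (intro exI[of _ "%k t x. s k t x + r k t x"]) blast
qed

lemma strongly_measurable_uminus:
 fixes g :: "real => real^'n => real"
 assumes N: "N : {L1_norm, Linf_norm}" and g: "strongly_measurable_wrt N M g"
 shows "strongly_measurable_wrt N M (%t x. - g t x)"
proof -
 obtain s where s: "!!k. simple_wrt N M (s k)" "AE t in M. g t : normed_functions N & (%k. N (%x. g t x - s k t x)) ~~> 0"
  using g unfolding strongly_measurable_wrt_def by blast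
 have m: "f : normed_functions N ==> (%x. - f x) : normed_functions N" for f :: "real^'n => real"
  using norm_minus(1)[OF N, of f] by (simp add: normed_functions_def)
 have "simple_wrt N M (%t x. - s k t x)" for k
  using s(1)[of k] m simple_function_compose1[of M "s k" "%f x. - f x"] by (auto simp: simple_wrt_def)
 moreover have "N (%x. - g t x - - s k t x) = N (%x. g t x - s k t x)" for t k
  using norm_minus(2)[OF N, of "g t" "s k t"] by simp
 ultimately show ?thesis unfolding strongly_measurable_wrt_def using s(2) m
  by (intro exI[of _ "%k t x. - s k t x"]) (auto elim!: eventually_mono)
qed

text \<open>The norms of the step functions are simple and converge to \<open>N (h t)\<close>;
  completeness of Lebesgue measure absorbs the exceptional null set.\<close>

lemma strongly_measurable_norm:
 assumes N: "N : {L1_norm, Linf_norm}" and T: "S : sets lebesgue" and h: "strongly_measurable_wrt N (lebesgue_on S) h"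
 shows "(%t. N (h t)) : borel_measurable (lebesgue_on S)"
proof -
 obtain s where s: "!!k. simple_wrt N (lebesgue_on S) (s k)"
  "AE t in lebesgue_on S. h t : normed_functions N & (%k. N (%x. h t x - s k t x)) ~~> 0"
  using h unfolding strongly_measurable_wrt_def by blast
 have m: "(%t. N (s k t)) : borel_measurable (lebesgue_on S)" for k
  using s(1)[of k] simple_function_compose1[of _ "s k" N] by (intro borel_measurable_simple_function) (simp add: simple_wrt_def)
 have "AE t in lebesgue_on S. lim (%k. N (s k t)) = N (h t)"
  using s(2) AE_space
 proof eventually_elim
  case (elim t)
  have b: "h t : Bor" "s k t : Bor" for k
   using elim s(1)[of k] by (auto simp: normed_functions_def simple_wrt_def)
  let ?d = "%k. N (%x. h t x - s k t x)"
  have le1: "N (s k t) <= N (h t) + ?d k" for k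
   using norm_triangle[OF N, of "h t" "%x. s k t x - h t x"] b norm_minus(2)[OF N, of "s k t" "h t"] by simp
  have le2: "N (h t) - ?d k <= N (s k t)" for k
   using norm_triangle[OF N, of "s k t" "%x. h t x - s k t x"] b
   elim(1) by (subst ennreal_minus_le_iff) (auto simp: add.commute normed_functions_def)
  have "(%k. N (s k t)) ~~> N (h t)"
  proof (rule tendsto_sandwich)
   have "(%k. N (h t) - ?d k) ~~> N (h t) - 0" using elim by (intro tendsto_diff_ennreal tendsto_const) (auto simp: normed_functions_def)
   then show "(%k. N (h t) - ?d k) ~~> N (h t)" by simp
   have "(%k. N (h t) + ?d k) ~~> N (h t) + 0" using elim by (intro tendsto_add tendsto_const) auto
   then show "(%k. N (h t) + ?d k) ~~> N (h t)" by simp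
  qed (use le1 le2 in auto)
  then show ?case by (rule limI)
 qed
 then show ?thesis
  by (rule complete_measure.borel_measurable_AE_eq[OF complete_lebesgue_on[OF T], rotated])
   (intro borel_measurable_lim m)
qed

text \<open>A continuous function \<open>g\<close> of compact support approximates \<open>H\<close>
  in L^1 of space-time; its time argument is then frozen at a grid point, and uniform continuity
  controls the error. The result is a step function in time that is still jointly measurable and
  bounded.\<close>

lemma joint_step:
 fixes H :: "real \<times> (real^'n) => real"
 assumes H: "integrable lborel H" and e: "0 < eps" and T: "0 < T"
 obtains sg :: "real => real^'n => real" and B :: real
 where "simple_function (lebesgue_on {0<..<T}) sg" "!!t. sg t : Bor"
  "(%p. sg (fst p) (snd p)) : Bor"
  "!!t x. \<bar>sg t x\<bar> <= B" "0 <= B" "!!t. integrable lborel (sg t)" "finite (range sg)"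
  "(NN t. indicator {0<..<T} t * (NN x. ennreal \<bar>H (t, x) - sg t x\<bar>)) < ennreal eps"
proof -
 obtain g r where g: "continuous_on UNIV g" "!!p. norm p > r ==> g p = 0"
  "(NN p. ennreal \<bar>H p - g p\<bar>) < ennreal (eps/2)"
  using continuous_compact_support_dense_L1[OF H, of "eps/2"] e by auto
 have gm[measurable]: "g : Bor" using g(1) by (rule borel_measurable_continuous_onI)
 have Hm[measurable]: "H : Bor" using H by auto
 define V where "V = measure lborel (cball (0::real^'n) \<bar>r\<bar>)"
 have V: "emeasure lborel (cball (0::real^'n) \<bar>r\<bar>) = ennreal V"
  unfolding V_def by (rule emeasure_eq_ennreal_measure[OF less_imp_neq]) (rule emeasure_cball_less_top)
 have V0: "0 <= V" by (simp add: V_def)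
 define eta where "eta = eps / (4 * (T * V + 1))"
 have eta: "0 < eta" using e T V0 by (auto simp: eta_def intro!: divide_pos_pos add_nonneg_pos mult_nonneg_nonneg)
 have comp: "compact ({0..T} \<times> cball (0::real^'n) \<bar>r\<bar>)" by (intro compact_Times) auto
 then have "uniformly_continuous_on ({0..T} \<times> cball (0::real^'n) \<bar>r\<bar>) g"
  by (rule compact_uniformly_continuous[OF continuous_on_subset[OF g(1) subset_UNIV]])
 then obtain d where d: "d > 0" "!!p q. p : {0..T} \<times> cball 0 \<bar>r\<bar> ==> q : {0..T} \<times> cball 0 \<bar>r\<bar> ==> dist q p < d ==> dist (g q) (g p) < eta"
  unfolding uniformly_continuous_on_def using eta by metis
 obtain m :: nat where m: "1 / d < real m" using reals_Archimedean2 by blast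
 moreover have "0 < 1 / d" using d(1) by simp
 ultimately have m0: "0 < real m" by linarith
 \<comment> \<open>Left end point of the cell of length \<open>1 / m\<close>; the value 0 outside
   \<open>(0, T)\<close> keeps the range finite on the whole line.\<close>
 define q where "q = (%t. if 0 < t & t < T then real_of_int \<lfloor>t * real m\<rfloor> / real m else 0)"
 have q: "q t : {0..T}" "\<bar>q t - t\<bar> < d" if "0 < t" "t < T" for t
 proof -
  have f: "real_of_int \<lfloor>t * real m\<rfloor> <= t * real m" "t * real m < real_of_int \<lfloor>t * real m\<rfloor> + 1" by linarith+
  have "0 <= \<lfloor>t * real m\<rfloor>" using that m0 by simp
  then have q0: "0 <= q t" using that m0 by (simp add: q_def)
  have qt: "q t <= t" using f(1) that m0 by (simp add: q_def field_simps)
  have "t * real m / real m < (real_of_int \<lfloor>t * real m\<rfloor> + 1) / real m"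
   using f(2) m0 by (rule divide_strict_right_mono)
  then have "t - q t < 1 / real m" using that m0 by (simp add: q_def add_divide_distrib)
  also have "1 / real m < d" using m d(1) m0 by (simp add: field_simps)
  finally show "q t : {0..T}" "\<bar>q t - t\<bar> < d" using q0 qt that by auto
 qed
 have finq: "finite (range q)"
 proof (rule finite_subset)
  show "range q \<subseteq> (%i. real_of_int i / real m) ` {0..\<lceil>T * real m\<rceil>} \<union> {0}"
  proof
   fix y assume "y : range q"
   then obtain t where y: "y = q t" by auto
   show "y : (%i. real_of_int i / real m) ` {0..\<lceil>T * real m\<rceil>} \<union> {0}"
   proof (cases "0 < t & t < T")
   case True
   then have "t * real m <= T * real m" "0 <= t * real m" using m0 by auto
   then have "0 <= \<lfloor>t * real m\<rfloor>" "\<lfloor>t * real m\<rfloor> <= \<lceil>T * real m\<rceil>" by linarith+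
   then show ?thesis using True by (auto simp: y q_def)
   next
   case False
   then have "q t = 0" by (simp only: q_def if_False)
   then show ?thesis by (simp add: y)
   qed
  qed
 qed auto
 have qm[measurable]: "q : Bor" unfolding q_def by measurable
 define sg where "sg = (%t x. g (q t, x))"
 have "bounded (g ` cball 0 \<bar>r\<bar>)"
  by (intro compact_imp_bounded compact_continuous_image continuous_on_subset[OF g(1)]) auto
 then obtain B where "\<forall>y\<in>g ` cball 0 \<bar>r\<bar>. norm y <= B" unfolding bounded_iff by blast
 then have B: "\<bar>g p\<bar> <= B" if "p : cball 0 \<bar>r\<bar>" for p using that by auto
 have gB: "\<bar>g p\<bar> <= \<bar>B\<bar>" for p
 proof (cases "norm p > r")
  case True then show ?thesis by (simp add: g(2))
 next
  case False
  then have "p : cball 0 \<bar>r\<bar>" by auto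
  from B[OF this] show ?thesis by linarith
 qed
 have g0: "g (t, x) = 0" if "x \<notin> cball 0 \<bar>r\<bar>" for t x
 proof (rule g(2))
  have "norm x <= norm (t, x)" by (rule norm_snd_le)
  then show "r < norm (t, x)" using that by auto
 qed
 show ?thesis
 proof (rule that[of sg "\<bar>B\<bar>"])
  have "simple_function (lebesgue_on {0<..<T}) q"
   using finq by (intro simple_function_borel_measurable) (auto intro: finite_subset[OF _ finq] measurable_lebesgue_on_borel)
  then show "simple_function (lebesgue_on {0<..<T}) sg"
   unfolding sg_def using simple_function_compose1[of _ q "%s x. g (s, x)"] by simp
  show sm: "sg t : Bor" for t unfolding sg_def by (rule slice_measurable[OF gm])
  have "g : borel_measurable (borel \<Otimes>\<^sub>M borel)" by (rule slice_measurable[OF gm])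
  then have "(%p. sg (fst p) (snd p)) : borel_measurable (borel \<Otimes>\<^sub>M borel)" unfolding sg_def by measurable
  then show sj: "(%p. sg (fst p) (snd p)) : Bor" by (simp add: borel_prod)
  show "\<bar>sg t x\<bar> <= \<bar>B\<bar>" for t x unfolding sg_def by (rule gB)
  show "integrable lborel (sg t)" for t
  proof (rule Bochner_Integration.integrable_bound[of _ "%x. \<bar>B\<bar> * indicator (cball 0 \<bar>r\<bar>) x :: real"])
   show "integrable lborel (%x::real^'n. \<bar>B\<bar> * indicator (cball 0 \<bar>r\<bar>) x :: real)"
   by (intro integrable_mult_right integrable_real_indicator) (auto simp: emeasure_cball_less_top)
   show "AE x in lborel. norm (sg t x) <= norm (\<bar>B\<bar> * indicator (cball 0 \<bar>r\<bar>) x)"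
   using gB g0 by (intro AE_I2) (auto simp: sg_def split: split_indicator)
  qed (use sm in simp)
  show "finite (range sg)"
   unfolding sg_def using finite_imageI[OF finq, of "%s x. g (s, x)"] by (simp add: image_image)
  have g2: "g : borel_measurable (borel \<Otimes>\<^sub>M borel)" "H : borel_measurable (borel \<Otimes>\<^sub>M borel)"
   by (rule slice_measurable[OF gm] slice_measurable[OF Hm])+
  have gs: "(%x. g (t, x)) : Bor" "(%x. H (t, x)) : Bor" for t
   by (rule slice_measurable[OF gm] slice_measurable[OF Hm])+
  have Im: "(%t. \<integral>\<^sup>+x. ennreal \<bar>H (t, x) - g (t, x)\<bar> \<partial>lborel) : Bor"
   by (rule lborel.borel_measurable_nn_integral) (use g2 in \<open>simp add: split_beta'\<close>)
  have "(NN t. indicator {0<..<T} t * (NN x. ennreal \<bar>H (t, x) - sg t x\<bar>))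
   <= (NN t. (NN x. ennreal \<bar>H (t, x) - g (t, x)\<bar>) + ennreal (eta * V) * indicator {0<..<T} t)"
  proof (rule nn_integral_mono)
   fix t :: real
   show "indicator {0<..<T} t * (NN x. ennreal \<bar>H (t, x) - sg t x\<bar>)
   <= (NN x. ennreal \<bar>H (t, x) - g (t, x)\<bar>) + ennreal (eta * V) * indicator {0<..<T} t"
   proof (cases "0 < t & t < T")
   case True
   have "(NN x. ennreal \<bar>H (t, x) - sg t x\<bar>) <= (NN x. ennreal \<bar>H (t, x) - g (t, x)\<bar>) + (NN x. ennreal \<bar>g (t, x) - sg t x\<bar>)"
   by (rule nn_integral_norm_diff_triangle) (use gs sm in auto)
   also have "(NN x. ennreal \<bar>g (t, x) - sg t x\<bar>) <= (NN x. ennreal eta * indicator (cball (0::real^'n) \<bar>r\<bar>) x)"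
   proof (rule nn_integral_mono)
   fix x :: "real^'n"
   show "ennreal \<bar>g (t, x) - sg t x\<bar> <= ennreal eta * indicator (cball 0 \<bar>r\<bar>) x"
   proof (cases "x : cball 0 \<bar>r\<bar>")
   case x: True
   have "dist (q t, x) (t, x) < d" using q(2)[of t] True by (simp add: dist_Pair_Pair dist_real_def)
   then have "dist (g (q t, x)) (g (t, x)) < eta" using q(1)[of t] True x by (intro d(2)) auto
   then show ?thesis using x by (auto simp: sg_def dist_real_def abs_minus_commute intro!: ennreal_leI)
   qed (simp add: sg_def g0)
   qed
   also have "... = ennreal (eta * V)" using eta V0 by (simp add: nn_integral_cmult_indicator V ennreal_mult)
   finally show ?thesis using True by (simp add: add_left_mono)
   qed auto
  qed
  also have "... = (NN t. (NN x. ennreal \<bar>H (t, x) - g (t, x)\<bar>)) + ennreal (eta * V) * ennreal T"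
   using Im T by (subst nn_integral_add) (auto simp: nn_integral_cmult_indicator)
  also have "(NN t. (NN x. ennreal \<bar>H (t, x) - g (t, x)\<bar>)) = (NN p. ennreal \<bar>H p - g p\<bar>)"
   unfolding lborel_prod[symmetric] by (rule lborel.nn_integral_fst) (use g2 in simp)
  finally have fin: "(NN t. indicator {0<..<T} t * (NN x. ennreal \<bar>H (t, x) - sg t x\<bar>))
   <= (NN p. ennreal \<bar>H p - g p\<bar>) + ennreal (eta * V) * ennreal T" .
  have lt: "ennreal (eta * V) * ennreal T < ennreal (eps/2)"
  proof -
   have "eta * V * T <= eps / 4"
   proof -
   have "eta * V * T = (eps/4) * ((T * V) / (T * V + 1))" by (simp add: eta_def field_simps)
   also have "... <= (eps/4) * 1" 
   proof (rule mult_left_mono)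
   have frac: "y / (y + 1) <= 1" if "0 <= y" for y :: real using that by simp
   show "T * V / (T * V + 1) <= 1" using T V0 by (intro frac mult_nonneg_nonneg) auto
   qed (use e in simp)
   finally show ?thesis by simp
   qed
   then show ?thesis using e eta V0 T by (simp add: ennreal_mult[symmetric] ennreal_less_iff)
  qed
  have "ennreal (eps/2) + ennreal (eps/2) = ennreal eps" using e by (simp add: ennreal_plus[symmetric] del: ennreal_plus)
  then show "(NN t. indicator {0<..<T} t * (NN x. ennreal \<bar>H (t, x) - sg t x\<bar>)) < ennreal eps"
   using le_less_trans[OF fin add_strict_mono[OF g(3) lt]] by simp
 qed simp
qed

lemma nn_integral_lebesgue_on:
 "S : sets borel ==> (\<integral>\<^sup>+t. f t \<partial>lebesgue_on S) = (NN t. indicator S t * f t)"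
 by (subst nn_integral_restrict_space) (auto simp: nn_integral_completion mult.commute)

lemma AE_lebesgue_on: "S : sets borel ==> (AE t in lebesgue_on S. P t) \<longleftrightarrow> (AE t in lborel. t : S --> P t)"
 by (subst AE_restrict_space_iff) (auto simp: AE_completion_iff)

lemma integrable_lebesgue_on:
 fixes f :: "real => real"
 assumes "f : Bor" "S : sets borel"
 shows "integrable (lebesgue_on S) f \<longleftrightarrow> (NN t. indicator S t * ennreal \<bar>f t\<bar>) < \<infinity>"
 using assms by (simp add: integrable_iff_bounded measurable_lebesgue_on_borel nn_integral_lebesgue_on)

lemma simple_step_integrable:
 fixes s :: "real => real^'n => real"
 assumes "simple_function (lebesgue_on {0<..<T}) s"
 shows "integrable (lebesgue_on {0<..<T}) (%t. s t x)"
proof (cases "0 < T")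
 case True
 interpret finite_measure "lebesgue_on {0<..<T}"
  using True by (intro finite_measureI) (simp add: emeasure_restrict_space)
 have sf: "simple_function (lebesgue_on {0<..<T}) (%t. s t x)"
  using simple_function_compose1[OF assms, of "%f. f x"] .
 have "finite ((%t. \<bar>s t x\<bar>) ` {0<..<T})"
  using simple_functionD(1)[OF sf] finite_imageI[of "(%t. s t x) ` {0<..<T}" abs] by (simp add: image_image)
 then have "\<bar>s t x\<bar> <= Max ((%t. \<bar>s t x\<bar>) ` {0<..<T})" if "t : {0<..<T}" for t
  using that by (intro Max_ge) auto
 then show ?thesis
  by (intro integrable_const_bound[of _ "Max ((%t. \<bar>s t x\<bar>) ` {0<..<T})"] AE_I2 borel_measurable_simple_function[OF sf]) auto
next
 case False
 then have e: "lebesgue_on {0<..<T} = count_space {} \<or> space (lebesgue_on {0<..<T}) = {}" by simp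
 have "(%t. s t x) : borel_measurable (lebesgue_on {0<..<T})"
  by (rule borel_measurable_simple_function[OF simple_function_compose1[OF assms, of "%f. f x"]])
 then show ?thesis using False by (simp add: integrable_iff_bounded nn_integral_empty)
qed

text \<open>For an integrable function on space-time the step functions of \<open>joint_step\<close>
  are Bochner approximations, and by Fubini the integral can be taken pointwise in
  \<open>x\<close>.\<close>

lemma approximable_joint_L1:
 fixes H :: "real \<times> (real^'n) => real"
 assumes H[measurable]: "H : Bor" and T: "0 < T"
  and int: "(NN t. indicator {0<..<T} t * (NN x. ennreal \<bar>H (t, x)\<bar>)) < \<infinity>"
  and h: "AE t in lebesgue_on {0<..<T}. h t = (%x. H (t, x))"
 shows "approximable L1_norm (lebesgue_on {0<..<T}) h (%x. \<integral>t. H (t, x) \<partial>lebesgue_on {0<..<T})"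
 unfolding approximable_def
proof (intro allI impI)
 fix eps :: real assume e: "0 < eps"
 let ?M = "lebesgue_on {0<..<T}"
 have Hs[measurable]: "(%x. H (t, x)) : Bor" for t by (rule slice_measurable[OF H])
 have H2[measurable]: "H : borel_measurable (borel \<Otimes>\<^sub>M borel)" by (rule slice_measurable[OF H])
 have Ht[measurable]: "(%t. H (t, x)) : Bor" for x by simp
 define H1 where "H1 = (%p. indicator {0<..<T} (fst p) * H p)"
 have H1m: "H1 : borel_measurable (borel \<Otimes>\<^sub>M borel)" unfolding H1_def by measurable
 have "integrable lborel H1"
 proof (rule integrableI_bounded)
  show "H1 : borel_measurable lborel" using H1m by (simp add: borel_prod)
  have "(NN p. ennreal (norm (H1 p))) = (NN t. (NN x. ennreal (norm (H1 (t, x)))))"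
   unfolding lborel_prod[symmetric] by (rule lborel.nn_integral_fst[symmetric]) (use H1m in simp)
  also have "... = (NN t. indicator {0<..<T} t * (NN x. ennreal \<bar>H (t, x)\<bar>))"
   by (intro nn_integral_cong) (auto simp: H1_def split: split_indicator)
  also have "... < \<infinity>" by fact
  finally show "(NN p. ennreal (norm (H1 p))) < \<infinity>" .
 qed
 then obtain sg B where
  s: "simple_function ?M sg" "!!t. sg t : Bor" "(%p. sg (fst p) (snd p)) : Bor"
  "!!t. integrable lborel (sg t)"
  "(NN t. indicator {0<..<T} t * (NN x. ennreal \<bar>H1 (t, x) - sg t x\<bar>)) < ennreal eps" 
  by (rule joint_step[OF _ e T]) blast
 have sm[measurable]: "(%p. sg (fst p) (snd p)) : borel_measurable (borel \<Otimes>\<^sub>M borel)" using s(3) by (simp add: borel_prod)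
 have ss[measurable]: "sg t : Bor" for t by (rule s(2))
 have st[measurable]: "(%t. sg t x) : Bor" for x
  using measurable_compose[OF _ sm, of "%t. (t, x)" borel] by simp
 define G where "G = (%t. \<integral>\<^sup>+x. ennreal \<bar>H (t, x) - sg t x\<bar> \<partial>lborel)"
 have Gm: "G : Bor" unfolding G_def
  by (rule lborel.borel_measurable_nn_integral) (simp add: split_beta')
 have GI: "(NN t. indicator {0<..<T} t * G t) < ennreal eps"
 proof -
  have "(NN t. indicator {0<..<T} t * G t) = (NN t. indicator {0<..<T} t * (NN x. ennreal \<bar>H1 (t, x) - sg t x\<bar>))"
   by (intro nn_integral_cong) (auto simp: G_def H1_def split: split_indicator)
  then show ?thesis using s(5) by simp
 qed
 have "simple_wrt L1_norm ?M sg"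
  using s by (auto simp: simple_wrt_def normed_functions_def L1_norm_def integrable_iff_bounded)
 moreover have "AE t in ?M. h t : Bor & L1_norm (%x. h t x - sg t x) <= G t"
  using h by eventually_elim (simp add: L1_norm_def G_def)
 moreover have "(\<integral>\<^sup>+t. G t \<partial>?M) < ennreal eps" using GI by (simp add: nn_integral_lebesgue_on)
 moreover have "L1_norm (%x. (\<integral>t. H (t, x) \<partial>?M) - (\<integral>t. sg t x \<partial>?M)) < ennreal eps"
 proof -
  have sw: "(NN x. (NN t. indicator {0<..<T} t * ennreal \<bar>F (t, x)\<bar>))
   = (NN t. indicator {0<..<T} t * (NN x. ennreal \<bar>F (t, x)\<bar>))"
   if F: "F : Bor" for F :: "real \<times> (real^'n) => real"
  proof -
   have [measurable]: "F : borel_measurable (borel \<Otimes>\<^sub>M borel)" "(%x. F (t, x)) : Bor" for t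
   by (rule slice_measurable[OF F])+
   have "(NN x. (NN t. indicator {0<..<T} t * ennreal \<bar>F (t, x)\<bar>))
   = (NN t. (NN x. indicator {0<..<T} t * ennreal \<bar>F (t, x)\<bar>))"
   by (rule lborel_pair.Fubini') (simp add: split_beta')
   then show ?thesis by (simp add: nn_integral_cmult)
  qed
  have "(NN x. (NN t. indicator {0<..<T} t * ennreal \<bar>H (t, x)\<bar>)) \<noteq> \<infinity>"
   unfolding sw[OF H] using int by simp
  moreover have "(%x. \<integral>\<^sup>+t. indicator {0<..<T} t * ennreal \<bar>H (t, x)\<bar> \<partial>lborel) : borel_measurable lborel"
   using lborel.borel_measurable_nn_integral[of "%x t. indicator {0<..<T} t * ennreal \<bar>H (t, x)\<bar>" borel] by (simp add: split_beta')
  ultimately have "AE x in lborel. (NN t. indicator {0<..<T} t * ennreal \<bar>H (t, x)\<bar>) \<noteq> \<infinity>"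
   by (intro nn_integral_PInf_AE)
  then have ae: "AE x in lborel. integrable ?M (%t. H (t, x))"
   by eventually_elim (simp add: integrable_lebesgue_on top.not_eq_extremum)
  have "L1_norm (%x. (\<integral>t. H (t, x) \<partial>?M) - (\<integral>t. sg t x \<partial>?M)) <= (NN x. (NN t. indicator {0<..<T} t * ennreal \<bar>H (t, x) - sg t x\<bar>))"
   unfolding L1_norm_def
  proof (rule nn_integral_mono_AE)
   show "AE x in lborel. ennreal \<bar>(\<integral>t. H (t, x) \<partial>?M) - (\<integral>t. sg t x \<partial>?M)\<bar> <= (NN t. indicator {0<..<T} t * ennreal \<bar>H (t, x) - sg t x\<bar>)"
   using ae
   proof eventually_elim
   case (elim x)
   have i: "integrable ?M (%t. H (t, x) - sg t x)"
   by (rule Bochner_Integration.integrable_diff[OF elim simple_step_integrable[OF s(1)]])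
   have "(\<integral>t. H (t, x) \<partial>?M) - (\<integral>t. sg t x \<partial>?M) = (\<integral>t. H (t, x) - sg t x \<partial>?M)"
   by (rule Bochner_Integration.integral_diff[symmetric, OF elim simple_step_integrable[OF s(1)]])
   then show ?case using integral_norm_bound_ennreal[OF i] by (simp add: nn_integral_lebesgue_on)
   qed
  qed
  also have "... = (NN t. indicator {0<..<T} t * G t)"
   using sw[of "%p. H p - sg (fst p) (snd p)"] s(3) H unfolding G_def by simp
  finally show ?thesis using GI by simp
 qed
 ultimately show "\<exists>s G. simple_wrt L1_norm ?M s & G : borel_measurable ?M \<and>
   (AE t in ?M. h t : Bor & L1_norm (%x. h t x - s t x) <= G t) \<and>
   (\<integral>\<^sup>+t. G t \<partial>?M) < ennreal eps & L1_norm (%x. (\<integral>t. H (t, x) \<partial>?M) - (\<integral>t. s t x \<partial>?M)) < ennreal eps"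
  using Gm by (intro exI[of _ sg] exI[of _ G]) (auto intro: measurable_lebesgue_on_borel)
qed

text \<open>Both factors are approximated in L^1 by step functions, and the convolution of two
  bounded integrable step functions is a step function with values in L^infinity. The error is split
  as \<open>(k - \<kappa>) * f + \<kappa> * (f - sg)\<close>, whose supremum norm is bounded by L^1
  distances with the factors \<open>R\<close> and \<open>B\<close>.\<close>

lemma approximable_convolution_Linf:
 fixes k f :: "real \<times> (real^'n) => real"
 assumes k: "k : Bor" and f: "f : Bor" and T: "0 < T"
  and k_int: "(NN t. indicator {0<..<T} t * (NN x. ennreal \<bar>k (t, x)\<bar>)) < \<infinity>"
  and f_int: "(NN t. indicator {0<..<T} t * (NN x. ennreal \<bar>f (t, x)\<bar>)) < \<infinity>"
  and fR: "!!p. \<bar>f p\<bar> <= R"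
  and h: "AE t in lebesgue_on {0<..<T}. h t = (%x. \<integral>y. k (t, x - y) * f (t, y) \<partial>lborel)"
 shows "approximable Linf_norm (lebesgue_on {0<..<T}) h (%x. \<integral>t. (LB y. k (t, x - y) * f (t, y)) \<partial>lebesgue_on {0<..<T})"
 unfolding approximable_def
proof (intro allI impI)
 fix eps :: real assume e: "0 < eps"
 let ?M = "lebesgue_on {0<..<T}"
 have R0: "0 <= R" using fR[of 0] by linarith
 have k2[measurable]: "k : borel_measurable (borel \<Otimes>\<^sub>M borel)" "(%x. k (t, x)) : Bor" for t by (rule slice_measurable[OF k])+
 have f2[measurable]: "f : borel_measurable (borel \<Otimes>\<^sub>M borel)" "(%x. f (t, x)) : Bor" for t by (rule slice_measurable[OF f])+
 have cut: "integrable lborel (%p. indicator {0<..<T} (fst p) * F p)"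
  if F: "F : Bor" and FI: "(NN t. indicator {0<..<T} t * (NN x. ennreal \<bar>F (t, x)\<bar>)) < \<infinity>" for F :: "real \<times> (real^'n) => real"
 proof (rule integrableI_bounded)
  have [measurable]: "F : borel_measurable (borel \<Otimes>\<^sub>M borel)" by (rule slice_measurable[OF F])
  have m: "(%p. indicator {0<..<T} (fst p) * F p) : borel_measurable (borel \<Otimes>\<^sub>M borel)" by measurable
  then show "(%p. indicator {0<..<T} (fst p) * F p) : borel_measurable lborel" by (simp add: borel_prod)
  have "(NN p. ennreal (norm (indicator {0<..<T} (fst p) * F p))) = (NN t. (NN x. ennreal (norm (indicator {0<..<T} (fst (t, x)) * F (t, x)))))"
   unfolding lborel_prod[symmetric] by (rule lborel.nn_integral_fst[symmetric]) (use m in simp)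
  also have "... = (NN t. indicator {0<..<T} t * (NN x. ennreal \<bar>F (t, x)\<bar>))"
   by (intro nn_integral_cong) (auto split: split_indicator)
  finally show "(NN p. ennreal (norm (indicator {0<..<T} (fst p) * F p))) < \<infinity>" using FI by simp
 qed
 define eps1 where "eps1 = eps / (4 * (R + 1))"
 have e1: "0 < eps1" using e R0 by (simp add: eps1_def)
 obtain \<kappa> B where ka: "simple_function ?M \<kappa>" "!!t. \<kappa> t : Bor" "(%p. \<kappa> (fst p) (snd p)) : Bor"
  "!!t x. \<bar>\<kappa> t x\<bar> <= B" "0 <= B" "!!t. integrable lborel (\<kappa> t)"
  "(NN t. indicator {0<..<T} t * (NN x. ennreal \<bar>indicator {0<..<T} (fst (t, x)) * k (t, x) - \<kappa> t x\<bar>)) < ennreal eps1"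
  by (rule joint_step[OF cut[OF k k_int] e1 T]) blast
 \<comment> \<open>The approximation \<open>\<kappa>\<close> of the kernel comes first, because its
   bound \<open>B\<close> decides how well \<open>f\<close> must be approximated.\<close>
 define eps2 where "eps2 = eps / (4 * (B + 1))"
 have e2: "0 < eps2" using e ka(5) by (simp add: eps2_def)
 obtain sg B' where si: "simple_function ?M sg" "!!t. sg t : Bor" "(%p. sg (fst p) (snd p)) : Bor"
  "!!t x. \<bar>sg t x\<bar> <= B'" "0 <= B'" "!!t. integrable lborel (sg t)"
  "(NN t. indicator {0<..<T} t * (NN x. ennreal \<bar>indicator {0<..<T} (fst (t, x)) * f (t, x) - sg t x\<bar>)) < ennreal eps2"
  by (rule joint_step[OF cut[OF f f_int] e2 T]) blast
 have kam[measurable]: "(%p. \<kappa> (fst p) (snd p)) : borel_measurable (borel \<Otimes>\<^sub>M borel)" "\<kappa> t : Bor" for t using ka by (simp_all add: borel_prod)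
 have sim[measurable]: "(%p. sg (fst p) (snd p)) : borel_measurable (borel \<Otimes>\<^sub>M borel)" "sg t : Bor" for t using si by (simp_all add: borel_prod)
 define I where "I = (%t. \<integral>\<^sup>+x. ennreal \<bar>k (t, x) - \<kappa> t x\<bar> \<partial>lborel)"
 define J where "J = (%t. \<integral>\<^sup>+x. ennreal \<bar>f (t, x) - sg t x\<bar> \<partial>lborel)"
 define K where "K = (%t. \<integral>\<^sup>+x. ennreal \<bar>k (t, x)\<bar> \<partial>lborel)"
 have IJm[measurable]: "I : Bor" "J : Bor" "K : Bor"
  unfolding I_def J_def K_def by (auto intro!: lborel.borel_measurable_nn_integral simp: split_beta')
 have II: "(NN t. indicator {0<..<T} t * I t) < ennreal eps1" and JI: "(NN t. indicator {0<..<T} t * J t) < ennreal eps2"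
 proof -
  have "(NN t. indicator {0<..<T} t * I t) = (NN t. indicator {0<..<T} t * (NN x. ennreal \<bar>indicator {0<..<T} (fst (t, x)) * k (t, x) - \<kappa> t x\<bar>))"
   by (intro nn_integral_cong) (auto simp: I_def split: split_indicator)
  then show "(NN t. indicator {0<..<T} t * I t) < ennreal eps1" using ka(7) by simp
  have "(NN t. indicator {0<..<T} t * J t) = (NN t. indicator {0<..<T} t * (NN x. ennreal \<bar>indicator {0<..<T} (fst (t, x)) * f (t, x) - sg t x\<bar>))"
   by (intro nn_integral_cong) (auto simp: J_def split: split_indicator)
  then show "(NN t. indicator {0<..<T} t * J t) < ennreal eps2" using si(7) by simp
 qed
 define s where "s = (%t x. \<integral>y. \<kappa> t (x - y) * sg t y \<partial>lborel)"
 define hh where "hh = (%t x. \<integral>y. k (t, x - y) * f (t, y) \<partial>lborel)"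
 define G where "G = (%t. ennreal R * I t + ennreal B * J t)"
 have Gm: "G : Bor" unfolding G_def by measurable
 have GI: "(NN t. indicator {0<..<T} t * G t) < ennreal eps"
 proof -
  have "(NN t. indicator {0<..<T} t * G t) = (NN t. ennreal R * (indicator {0<..<T} t * I t) + ennreal B * (indicator {0<..<T} t * J t))"
   by (intro nn_integral_cong) (simp add: G_def distrib_left mult.left_commute)
  also have "... = ennreal R * (NN t. indicator {0<..<T} t * I t) + ennreal B * (NN t. indicator {0<..<T} t * J t)"
   by (simp add: nn_integral_add nn_integral_cmult)
  also have "... <= ennreal R * ennreal eps1 + ennreal B * ennreal eps2"
   using II JI by (intro add_mono mult_left_mono) auto
  also have "... = ennreal (R * eps1 + B * eps2)" using R0 ka(5) e1 e2 by (simp add: ennreal_mult ennreal_plus)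
  also have "... < ennreal eps"
  proof (rule ennreal_lessI[OF e])
   have "R * eps1 <= eps / 4" "B * eps2 <= eps / 4"
   using e R0 ka(5) by (simp_all add: eps1_def eps2_def field_simps)
   then show "R * eps1 + B * eps2 < eps" using e by linarith
  qed
  finally show ?thesis .
 qed
 have hm: "(%p. hh (fst p) (snd p)) : borel_measurable (borel \<Otimes>\<^sub>M borel)"
  unfolding hh_def by (rule lborel.borel_measurable_lebesgue_integral) (simp add: split_beta')
 have sm: "(%p. s (fst p) (snd p)) : borel_measurable (borel \<Otimes>\<^sub>M borel)"
  unfolding s_def
 proof (rule lborel.borel_measurable_lebesgue_integral)
  have c: "(%x. \<kappa> (fst (fst x)) (snd (fst x) - snd x)) : borel_measurable ((borel \<Otimes>\<^sub>M borel) \<Otimes>\<^sub>M lborel)"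
   using measurable_compose[OF _ kam(1), of "%x. (fst (fst x), snd (fst x) - snd x)" "(borel \<Otimes>\<^sub>M borel) \<Otimes>\<^sub>M lborel"] by simp
  have d: "(%x. sg (fst (fst x)) (snd x)) : borel_measurable ((borel \<Otimes>\<^sub>M borel) \<Otimes>\<^sub>M lborel)"
   using measurable_compose[OF _ sim(1), of "%x. (fst (fst x), snd x)" "(borel \<Otimes>\<^sub>M borel) \<Otimes>\<^sub>M lborel"] by simp
  show "(%(p, y). \<kappa> (fst p) (snd p - y) * sg (fst p) y) : borel_measurable ((borel \<Otimes>\<^sub>M borel) \<Otimes>\<^sub>M lborel)"
   unfolding split_beta' by (rule borel_measurable_times[OF c d])
 qed
 have hsl[measurable]: "hh t : Bor" "(%t. hh t x) : Bor" for t x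
  using measurable_compose[OF _ hm, of "%x. (t, x)" borel] measurable_compose[OF _ hm, of "%t. (t, x)" borel] by simp_all
 have ssl[measurable]: "s t : Bor" "(%t. s t x) : Bor" for t x
  using measurable_compose[OF _ sm, of "%x. (t, x)" borel] measurable_compose[OF _ sm, of "%t. (t, x)" borel] by simp_all
 have refl: "(NN y. ennreal \<bar>F (x - y)\<bar>) = (NN y. ennreal \<bar>F y\<bar>)" if "F : Bor" for F :: "real^'n => real" and x
  using nn_integral_lborel_reflect[of "%y. ennreal \<bar>F y\<bar>" x] that by simp
 have refl_i: "integrable lborel (%y. F (x - y))" if "integrable lborel F" for F :: "real^'n => real" and x
  using that refl[of F x] by (auto simp: integrable_iff_bounded)
 have bound: "ennreal \<bar>hh t x - s t x\<bar> <= G t" if Kfin: "K t < \<infinity>" for t x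
 proof -
  have ki: "integrable lborel (%x. k (t, x))" using Kfin by (auto simp: K_def integrable_iff_bounded)
  have i1: "integrable lborel (%y. k (t, x - y) * f (t, y))"
  proof (rule Bochner_Integration.integrable_bound[OF integrable_mult_right[OF refl_i[OF ki, of x], of R]])
   show "AE y in lborel. norm (k (t, x - y) * f (t, y)) <= norm (R * k (t, x - y))"
   using fR R0 by (intro AE_I2) (simp add: abs_mult mult.commute mult_left_mono mult_right_mono)
  qed simp
  have i2: "integrable lborel (%y. \<kappa> t (x - y) * sg t y)"
  proof (rule Bochner_Integration.integrable_bound[OF integrable_mult_right[OF si(6)[of t], of B]])
   show "AE y in lborel. norm (\<kappa> t (x - y) * sg t y) <= norm (B * sg t y)"
   using ka(4,5) by (intro AE_I2) (simp add: abs_mult mult_right_mono)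
  qed simp
  have "hh t x - s t x = (LB y. k (t, x - y) * f (t, y) - \<kappa> t (x - y) * sg t y)"
   unfolding hh_def s_def using i1 i2 by simp
  then have "ennreal \<bar>hh t x - s t x\<bar> <= (NN y. ennreal \<bar>k (t, x - y) * f (t, y) - \<kappa> t (x - y) * sg t y\<bar>)"
   using integral_norm_bound_ennreal[OF Bochner_Integration.integrable_diff[OF i1 i2]] by simp
  also have "... <= (NN y. ennreal R * ennreal \<bar>k (t, x - y) - \<kappa> t (x - y)\<bar> + ennreal B * ennreal \<bar>f (t, y) - sg t y\<bar>)"
  proof (rule nn_integral_mono)
   fix y
   have "k (t, x - y) * f (t, y) - \<kappa> t (x - y) * sg t y = (k (t, x - y) - \<kappa> t (x - y)) * f (t, y) + \<kappa> t (x - y) * (f (t, y) - sg t y)"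
   by (simp add: algebra_simps)
   also have "\<bar>...\<bar> <= \<bar>k (t, x - y) - \<kappa> t (x - y)\<bar> * \<bar>f (t, y)\<bar> + \<bar>\<kappa> t (x - y)\<bar> * \<bar>f (t, y) - sg t y\<bar>"
   by (metis abs_mult abs_triangle_ineq)
   also have "... <= \<bar>k (t, x - y) - \<kappa> t (x - y)\<bar> * R + B * \<bar>f (t, y) - sg t y\<bar>"
   using fR ka(4) by (intro add_mono mult_left_mono mult_right_mono) auto
   finally have "ennreal \<bar>k (t, x - y) * f (t, y) - \<kappa> t (x - y) * sg t y\<bar> <= ennreal (\<bar>k (t, x - y) - \<kappa> t (x - y)\<bar> * R + B * \<bar>f (t, y) - sg t y\<bar>)"
   by (rule ennreal_leI)
   then show "ennreal \<bar>k (t, x - y) * f (t, y) - \<kappa> t (x - y) * sg t y\<bar> <= ennreal R * ennreal \<bar>k (t, x - y) - \<kappa> t (x - y)\<bar> + ennreal B * ennreal \<bar>f (t, y) - sg t y\<bar>"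
   using R0 ka(5) by (simp add: ennreal_plus ennreal_mult mult.commute)
  qed
  also have "... = G t"
   using refl[of "%y. k (t, y) - \<kappa> t y" x] by (simp add: nn_integral_add nn_integral_cmult G_def I_def J_def)
  finally show ?thesis .
 qed
 have Kae: "AE t in lborel. t : {0<..<T} --> K t < \<infinity>"
 proof -
  have "(NN t. indicator {0<..<T} t * K t) \<noteq> \<infinity>" using k_int by (simp add: K_def)
  then have "AE t in lborel. indicator {0<..<T} t * K t \<noteq> \<infinity>" by (intro nn_integral_PInf_AE) auto
  then show ?thesis by eventually_elim (auto simp: top.not_eq_extremum)
 qed
 have s_simple: "simple_function ?M s"
  unfolding s_def using simple_function_compose2[OF ka(1) si(1), of "%a b x. \<integral>y. a (x - y) * b y \<partial>lborel"] by simp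
 have sB: "Linf_norm (s t) < \<infinity>" for t
 proof -
  have "\<bar>s t x\<bar> <= (LB y. B * \<bar>sg t y\<bar>)" for x unfolding s_def
  proof (rule integral_abs_bound[THEN order_trans], rule integral_mono')
   show "integrable lborel (%y. B * \<bar>sg t y\<bar>)" using si(6)[of t] by simp
  qed (use ka(4,5) in \<open>auto simp: abs_mult mult_right_mono\<close>)
  then have "Linf_norm (s t) <= ennreal (LB y. B * \<bar>sg t y\<bar>)" by (intro Linf_norm_le) auto
  then show ?thesis by (rule le_less_trans) simp
 qed
 have "simple_wrt Linf_norm ?M s" using s_simple sB by (auto simp: simple_wrt_def normed_functions_def)
 moreover have "AE t in ?M. h t : Bor & Linf_norm (%x. h t x - s t x) <= G t"
 proof -
  have "AE t in ?M. K t < \<infinity>" using Kae by (subst AE_lebesgue_on) auto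
  with h show ?thesis
  proof eventually_elim
  case (elim t)
  have "Linf_norm (%x. hh t x - s t x) <= G t"
   unfolding Linf_norm_def using bound[OF elim(2)] by (intro esssup_I) auto
  then show ?case using elim(1) by (simp add: hh_def)
  qed
 qed
 moreover have "(\<integral>\<^sup>+t. G t \<partial>?M) < ennreal eps" using GI by (simp add: nn_integral_lebesgue_on)
 moreover have "Linf_norm (%x. (\<integral>t. hh t x \<partial>?M) - (\<integral>t. s t x \<partial>?M)) < ennreal eps"
 proof -
  have bx: "ennreal \<bar>(\<integral>t. hh t x \<partial>?M) - (\<integral>t. s t x \<partial>?M)\<bar> <= (NN t. indicator {0<..<T} t * G t)" for x
  proof -
   have "(NN t. indicator {0<..<T} t * ennreal \<bar>hh t x\<bar>) <= (NN t. ennreal R * (indicator {0<..<T} t * K t))"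
   proof (rule nn_integral_mono)
   fix t
   have "ennreal \<bar>hh t x\<bar> <= (NN y. ennreal \<bar>k (t, x - y) * f (t, y)\<bar>)"
   using integral_norm_bound_ennreal[of lborel "%y. k (t, x - y) * f (t, y)"] unfolding hh_def
   by (cases "integrable lborel (%y. k (t, x - y) * f (t, y))") (auto simp: not_integrable_integral_eq)
   also have "... <= (NN y. ennreal R * ennreal \<bar>k (t, x - y)\<bar>)"
   using fR R0 by (intro nn_integral_mono) (simp add: abs_mult ennreal_mult[symmetric] mult.commute[of R] ennreal_leI mult_left_mono)
   also have "... = ennreal R * K t" using refl[of "%y. k (t, y)" x] by (simp add: nn_integral_cmult K_def)
   finally show "indicator {0<..<T} t * ennreal \<bar>hh t x\<bar> <= ennreal R * (indicator {0<..<T} t * K t)"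
   by (auto split: split_indicator)
   qed
   also have "... = ennreal R * (NN t. indicator {0<..<T} t * K t)" by (rule nn_integral_cmult) simp
   also have "... < \<infinity>" using k_int by (simp add: K_def ennreal_mult_less_top)
   finally have hi: "integrable ?M (%t. hh t x)" by (simp add: integrable_lebesgue_on)
   have "(\<integral>t. hh t x \<partial>?M) - (\<integral>t. s t x \<partial>?M) = (\<integral>t. hh t x - s t x \<partial>?M)"
   by (rule Bochner_Integration.integral_diff[symmetric, OF hi simple_step_integrable[OF s_simple]])
   then have "ennreal \<bar>(\<integral>t. hh t x \<partial>?M) - (\<integral>t. s t x \<partial>?M)\<bar> <= (\<integral>\<^sup>+t. ennreal \<bar>hh t x - s t x\<bar> \<partial>?M)"
   using integral_norm_bound_ennreal[OF Bochner_Integration.integrable_diff[OF hi simple_step_integrable[OF s_simple]]] by simp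
   also have "... = (NN t. indicator {0<..<T} t * ennreal \<bar>hh t x - s t x\<bar>)" by (simp add: nn_integral_lebesgue_on)
   also have "... <= (NN t. indicator {0<..<T} t * G t)"
   using Kae by (intro nn_integral_mono_AE) (auto elim!: eventually_mono intro: bound split: split_indicator)
   finally show ?thesis .
  qed
  have hI: "(%x. \<integral>t. F t x \<partial>?M) : Bor" if F: "(%p. F (fst p) (snd p)) : borel_measurable (borel \<Otimes>\<^sub>M borel)" for F :: "real => real^'n => real"
  proof -
   have "(%p. F (snd p) (fst p)) : borel_measurable (borel \<Otimes>\<^sub>M borel)"
   using measurable_compose[OF _ F, of "%p. (snd p, fst p)" "borel \<Otimes>\<^sub>M borel"] by simp
   then have "(%x. \<integral>t. indicator {0<..<T} t * F t x \<partial>lborel) : Bor"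
   by (intro lborel.borel_measurable_lebesgue_integral) (simp add: split_beta')
   moreover have "(LB t. indicator {0<..<T} t * F t x) = (\<integral>t. F t x \<partial>?M)" for x
   proof -
   have "(%t. F t x) : Bor" using measurable_compose[OF _ F, of "%t. (t, x)" borel] by simp
   then show ?thesis by (subst integral_restrict_space) (auto simp: integral_completion)
   qed
   ultimately show ?thesis by simp
  qed
  have "Linf_norm (%x. (\<integral>t. hh t x \<partial>?M) - (\<integral>t. s t x \<partial>?M)) <= (NN t. indicator {0<..<T} t * G t)"
   unfolding Linf_norm_def using hI[OF hm] hI[OF sm] by (intro esssup_I AE_I2 bx) auto
  then show ?thesis using GI by (rule le_less_trans)
 qed
 ultimately show "\<exists>s G. simple_wrt Linf_norm ?M s & G : borel_measurable ?M \<and>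
   (AE t in ?M. h t : Bor & Linf_norm (%x. h t x - s t x) <= G t) \<and>
   (\<integral>\<^sup>+t. G t \<partial>?M) < ennreal eps & Linf_norm (%x. (\<integral>t. (LB y. k (t, x - y) * f (t, y)) \<partial>?M) - (\<integral>t. s t x \<partial>?M)) < ennreal eps"
  using Gm unfolding hh_def by (intro exI[of _ s] exI[of _ G]) (auto intro: measurable_lebesgue_on_borel)
qed

section \<open>Convolution inequalities with exponential weights\<close>

definition nconv :: "('a::euclidean_space => ennreal) => ('a => ennreal) => 'a => ennreal" where
 "nconv k F e = (NN e'. k (e - e') * F e')"

lemma nconv_measurable [measurable]:
 assumes [measurable]: "k : Bor" "F : Bor"
 shows "nconv k F : Bor"
 unfolding nconv_def[abs_def] by (rule lborel.borel_measurable_nn_integral) (simp add: split_beta')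

lemma nconv_mono: "(AE e in lborel. F e <= G e) ==> nconv k F e <= nconv k G e"
 unfolding nconv_def by (intro nn_integral_mono_AE) (auto elim!: eventually_mono intro: mult_left_mono)

lemma nconv_cong: "(AE e in lborel. F e = G e) ==> nconv k F e = nconv k G e"
 unfolding nconv_def by (intro nn_integral_cong_AE) (auto elim!: eventually_mono)

lemma nconv_add:
 assumes [measurable]: "k : Bor" "F : Bor" "G : Bor"
 shows "nconv k (%e. F e + G e) e = nconv k F e + nconv k G e"
 unfolding nconv_def distrib_left by (rule nn_integral_add) auto

lemma nconv_cmult:
 assumes [measurable]: "k : Bor" "F : Bor"
 shows "nconv k (%e. c * F e) e = c * nconv k F e"
 unfolding nconv_def mult.left_commute[of _ c] by (rule nn_integral_cmult) auto

text \<open>\<open>tau\<close> will be the time coordinate on space-time or the identity on the time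
  line. As it is additive, \<open>exp (z * tau e)\<close> is multiplicative and can be pulled out of
  the convolution, leaving the Laplace transform of the kernel.\<close>

lemma nconv_exp_bound:
 assumes [measurable]: "k : Bor" "tau : Bor"
  and add: "!!x y. tau (x - y) = tau x - tau y" and M: "0 <= M"
  and F: "AE e in lborel. F e <= ennreal (exp (z * tau e) * M)"
 shows "nconv k F e <= ennreal (exp (z * tau e) * M) * (NN e. ennreal (exp (- z * tau e)) * k e)"
proof -
 have "nconv k F e <= (NN e'. k (e - e') * ennreal (exp (z * tau e') * M))"
  unfolding nconv_def using F by (intro nn_integral_mono_AE) (auto elim!: eventually_mono intro: mult_left_mono)
 also have "... = (NN e'. ennreal (exp (z * tau e) * M) * (ennreal (exp (- z * tau (e - e'))) * k (e - e')))"
 proof (intro nn_integral_cong)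
  fix e'
  have "exp (z * tau e') * M = exp (z * tau e) * M * exp (- z * tau (e - e'))"
   unfolding add by (simp add: mult.commute mult.left_commute exp_add[symmetric] algebra_simps)
  then have "ennreal (exp (z * tau e') * M) = ennreal (exp (z * tau e) * M) * ennreal (exp (- z * tau (e - e')))"
   using M by (simp add: ennreal_mult[symmetric])
  then show "k (e - e') * ennreal (exp (z * tau e') * M) = ennreal (exp (z * tau e) * M) * (ennreal (exp (- z * tau (e - e'))) * k (e - e'))"
   by (simp add: mult_ac)
 qed
 also have "... = ennreal (exp (z * tau e) * M) * (NN e'. (ennreal (exp (- z * tau (e - e'))) * k (e - e')))"
  by (rule nn_integral_cmult) simp
 also have "(NN e'. (ennreal (exp (- z * tau (e - e'))) * k (e - e'))) = (NN e. ennreal (exp (- z * tau e)) * k e)"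
  by (rule nn_integral_lborel_reflect[of "%e. ennreal (exp (- z * tau e)) * k e"]) simp
 finally show ?thesis .
qed

text \<open>With the weight \<open>exp (- z * tau e)\<close> the convolution is a contraction, so an inequality
 \<open>D <= dl + L * (k * D)\<close> can be iterated.\<close>

lemma weighted_bound:
 fixes k D :: "'a::euclidean_space => ennreal"
 assumes km: "k : Bor" and taum: "tau : Bor"
  and add: "!!x y. tau (x - y) = tau x - tau y" and nn: "0 <= M" "0 <= dl" "0 <= z"
  and L: "ennreal L * (NN e. ennreal (exp (- z * tau e)) * k e) <= ennreal (1/2)"
  and D0: "AE e in lborel. D e <= ennreal M" and causal: "!!e. tau e <= 0 ==> D e = 0"
  and ineq: "AE e in lborel. D e <= ennreal dl + ennreal L * nconv k D e"
 shows "AE e in lborel. D e <= ennreal (exp (z * tau e) * (2 * dl + M / 2 ^ j))"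
proof (induction j)
 case 0
 show ?case using D0
 proof eventually_elim
  case (elim e)
  show ?case
  proof (cases "tau e <= 0")
   case False
   have "M <= 1 * (2 * dl + M)" using nn by simp
   also have "... <= exp (z * tau e) * (2 * dl + M)" using nn False by (intro mult_right_mono) auto
   finally have "M <= exp (z * tau e) * (2 * dl + M)" .
   then show ?thesis using order_trans[OF elim ennreal_leI] by simp
  qed (simp add: causal)
 qed
next
 case (Suc j)
 \<comment> \<open>\<open>2 * dl\<close> is the fixed point of \<open>x -> dl + x / 2\<close>, and
   each round halves the contribution of the a priori bound \<open>M\<close>.\<close>
 let ?M = "2 * dl + M / 2 ^ j"
 have M: "0 <= ?M" using nn by auto
 show ?case using ineq
 proof eventually_elim
  case (elim e)
  show ?case
  proof (cases "tau e <= 0")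
   case False
   have "ennreal L * nconv k D e <= ennreal L * (ennreal (exp (z * tau e) * ?M) * (NN e. ennreal (exp (- z * tau e)) * k e))"
   by (intro mult_left_mono nconv_exp_bound[OF km taum add M Suc.IH]) auto
   also have "... = ennreal (exp (z * tau e) * ?M) * (ennreal L * (NN e. ennreal (exp (- z * tau e)) * k e))"
   by (simp add: mult_ac)
   also have "... <= ennreal (exp (z * tau e) * ?M) * ennreal (1/2)" by (intro mult_left_mono L) auto
   also have "... = ennreal (exp (z * tau e) * ?M * (1/2))" using M by (simp only: ennreal_mult mult_nonneg_nonneg exp_ge_zero)
   finally have 1: "ennreal L * nconv k D e <= ennreal (exp (z * tau e) * ?M * (1/2))" .
   have "1 * dl <= exp (z * tau e) * dl" using nn False by (intro mult_right_mono) auto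
   then have "ennreal dl <= ennreal (exp (z * tau e) * dl)" by (simp add: ennreal_leI)
   then have "D e <= ennreal (exp (z * tau e) * dl) + ennreal (exp (z * tau e) * ?M * (1/2))"
   using order_trans[OF elim add_mono[OF _ 1]] by blast
   also have "... = ennreal (exp (z * tau e) * (2 * dl + M / 2 ^ Suc j))"
   using nn M by (subst ennreal_plus[symmetric]) (auto simp: field_simps)
   finally show ?thesis .
  qed (simp add: causal)
 qed
qed

text \<open>The kernel lives on \<open>tau > 0\<close>, where \<open>exp (- z * tau e)\<close>
  decreases to 0 as \<open>z\<close> grows; dominated convergence along integer \<open>z\<close>
  suffices.\<close>

lemma laplace_tends_0:
 fixes k :: "'a::euclidean_space => real"
 assumes [measurable]: "k : Bor" "tau : Bor"
  and causal: "!!e. tau e <= 0 ==> k e = 0" and fin: "(NN e. ennreal (exp (- tau e)) * ennreal (k e)) < \<infinity>"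
  and L: "0 <= L"
 obtains z where "1 <= z" "ennreal L * (NN e. ennreal (exp (- z * tau e)) * ennreal (k e)) <= ennreal (1/2)"
proof -
 have "(%n. \<integral>\<^sup>+e. ennreal (exp (- real (Suc n) * tau e)) * ennreal (k e) \<partial>lborel) ~~> (\<integral>\<^sup>+e. 0 \<partial>(lborel :: 'a measure))"
 proof (rule nn_integral_dominated_convergence[where w = "%e. ennreal (exp (- tau e)) * ennreal (k e)"])
  show "AE e in lborel. ennreal (exp (- real (Suc n) * tau e)) * ennreal (k e) <= ennreal (exp (- tau e)) * ennreal (k e)" for n
  proof (intro AE_I2)
   fix e :: 'a
   show "ennreal (exp (- real (Suc n) * tau e)) * ennreal (k e) <= ennreal (exp (- tau e)) * ennreal (k e)"
   proof (cases "tau e <= 0")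
   case False
   then have "1 * tau e <= real (Suc n) * tau e" by (intro mult_right_mono) auto
   then show ?thesis by (intro mult_right_mono ennreal_leI) (auto simp: algebra_simps)
   qed (simp add: causal)
  qed
  show "AE e in lborel. (%n. ennreal (exp (- real (Suc n) * tau e)) * ennreal (k e)) ~~> 0"
  proof (intro AE_I2)
   fix e :: 'a
   show "(%n. ennreal (exp (- real (Suc n) * tau e)) * ennreal (k e)) ~~> 0"
   proof (cases "tau e <= 0")
   case False
   have "(%n. exp (- tau e) ^ Suc n) ~~> 0"
   using False by (intro LIMSEQ_Suc LIMSEQ_realpow_zero) auto
   moreover have "exp (- tau e) ^ Suc n = exp (- real (Suc n) * tau e)" for n
   by (simp add: exp_of_nat_mult[symmetric] del: of_nat_Suc power_Suc)
   ultimately have "(%n. exp (- real (Suc n) * tau e)) ~~> 0" by (simp only:)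
   then have "(%n. ennreal (exp (- real (Suc n) * tau e))) ~~> ennreal 0"
   by (rule tendsto_ennrealI)
   then have "(%n. ennreal (k e) * ennreal (exp (- real (Suc n) * tau e))) ~~> ennreal (k e) * ennreal 0"
   by (intro ennreal_tendsto_cmult) auto
   then show ?thesis by (simp add: mult.commute)
   qed (simp add: causal)
  qed
 qed (use fin in auto)
 then have lim: "(%n. ennreal L * (NN e. ennreal (exp (- real (Suc n) * tau e)) * ennreal (k e))) ~~> ennreal L * 0"
  by (intro ennreal_tendsto_cmult) auto
 have "eventually (%n. ennreal L * (NN e. ennreal (exp (- real (Suc n) * tau e)) * ennreal (k e)) < ennreal (1/2)) sequentially"
  by (rule order_tendstoD(2)[OF lim]) (simp only: mult_zero_right ennreal_less_zero_iff)
 then obtain n where "ennreal L * (NN e. ennreal (exp (- real (Suc n) * tau e)) * ennreal (k e)) < ennreal (1/2)"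
  by (auto simp: eventually_sequentially)
 then show ?thesis by (intro that[of "real (Suc n)"]) auto
qed

section \<open>The power nonlinearity on the extended half line\<close>

definition pw :: "real => ennreal => ennreal" where
 "pw p x = (if x = top then top else ennreal (enn2real x powr p))"

lemma pw_ennreal: "0 <= r ==> pw p (ennreal r) = ennreal (r powr p)"
 by (simp add: pw_def)

lemma pw_0 [simp]: "pw p 0 = 0" by (simp add: pw_def)

lemma pw_mono: "0 <= p ==> x <= y ==> pw p x <= pw p y"
 unfolding pw_def by (auto simp: top_unique intro!: ennreal_leI powr_mono2 enn2real_mono simp: top.not_eq_extremum)

lemma pw_measurable [measurable]: "pw p : Bor"
 unfolding pw_def[abs_def] by measurable

text \<open>Continuity of the real power settles the case of a finite supremum. If it is infinite,
  the inequality \<open>x n <= max 1 (pw p (x n))\<close>, which rests on \<open>1 <= p\<close>,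
  forces the powers to be unbounded.\<close>

lemma pw_SUP:
 fixes x :: "nat => ennreal"
 assumes p: "1 <= p" and x: "incseq x"
 shows "pw p (SUP n. x n) = (SUP n. pw p (x n))"
proof (rule antisym)
 have p0: "0 <= p" using p by simp
 show "(SUP n. pw p (x n)) <= pw p (SUP n. x n)"
  by (intro SUP_least pw_mono p0 SUP_upper) auto
 show "pw p (SUP n. x n) <= (SUP n. pw p (x n))"
 proof (cases "(SUP n. x n) = top")
  case True
  have "min (x n) (pw p (x n)) \<ge> x n" if "x n \<ge> 1" for n
  proof (cases "x n")
   case (real r)
   then have "1 <= r" using that by simp
   then have "r powr 1 <= r powr p" using p by (intro powr_mono) auto
   then show ?thesis using real \<open>1 <= r\<close> by (simp add: pw_ennreal ennreal_leI)
  qed (simp add: pw_def)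
  then have le: "x n <= max 1 (pw p (x n))" for n by (metis le_max_iff_disj linear min.boundedE)
  have "(SUP n. pw p (x n)) = top"
  proof (rule ccontr)
   assume "(SUP n. pw p (x n)) \<noteq> top"
   then have "(SUP n. pw p (x n)) < top" using top.not_eq_extremum by blast
   then have "max 1 (SUP n. pw p (x n)) < top" by (simp only: max_less_iff_conj) simp
   moreover have "(SUP n. x n) <= max 1 (SUP n. pw p (x n))"
   proof (rule SUP_least)
   fix n
   have "pw p (x n) <= (SUP n. pw p (x n))" by (rule SUP_upper) simp
   then show "x n <= max 1 (SUP n. pw p (x n))" using le[of n] by (meson max.mono order_refl order_trans)
   qed
   ultimately have "(SUP n. x n) < top" by (meson le_less_trans)
   then show False unfolding True by simp
  qed
  then show ?thesis by (simp only: top_greatest)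
 next
  case False
  have fin: "x n < top" for n
   using SUP_upper[of n UNIV x] False by (metis UNIV_I order_le_less_trans top.not_eq_extremum)
  have eq: "ennreal (enn2real (SUP n. x n)) = (SUP n. x n)"
   by (rule ennreal_enn2real) (use False top.not_eq_extremum in blast)
  have "x ~~> ennreal (enn2real (SUP n. x n))" unfolding eq by (rule LIMSEQ_SUP[OF x])
  then have "(%n. enn2real (x n)) ~~> enn2real (SUP n. x n)" by (rule tendsto_enn2real) (rule enn2real_nonneg)
  then have "(%n. enn2real (x n) powr p) ~~> enn2real (SUP n. x n) powr p"
   using p by (intro tendsto_powr' tendsto_const) auto
  then have "(%n. ennreal (enn2real (x n) powr p)) ~~> ennreal (enn2real (SUP n. x n) powr p)"
   by (rule tendsto_ennrealI)
  moreover have "pw p (SUP n. x n) = ennreal (enn2real (SUP n. x n) powr p)"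
   unfolding pw_def using False by (simp only: if_False)
  moreover have "pw p (x n) = ennreal (enn2real (x n) powr p)" for n
   using fin[of n] by (simp add: pw_def)
  ultimately have "(%n. pw p (x n)) ~~> pw p (SUP n. x n)" by (simp only:)
  moreover have "incseq (%n. pw p (x n))" using x p0 by (auto simp: incseq_def intro: pw_mono)
  then have "(%n. pw p (x n)) ~~> (SUP n. pw p (x n))" by (rule LIMSEQ_SUP)
  ultimately have "pw p (SUP n. x n) = (SUP n. pw p (x n))" by (rule LIMSEQ_unique)
  then show ?thesis by (simp only: order_refl)
 qed
qed

lemma powr_diff_le:
 fixes a b :: real
 assumes p: "1 < p" and ab: "0 <= a" "0 <= b" "a <= R" "b <= R"
 shows "\<bar>a powr p - b powr p\<bar> <= p * R powr (p - 1) * \<bar>a - b\<bar>"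
proof -
 have *: "b powr p - a powr p <= p * R powr (p - 1) * (b - a)" if "0 <= a" "a < b" "b <= R" for a b
 proof -
  have "continuous_on {a..b} (%x. x powr p)" using that p by (intro continuous_on_powr' continuous_intros) auto
  moreover have "((%x. x powr p) has_real_derivative p * x powr (p - 1)) (at x)" if "a < x" for x
   using that \<open>0 <= a\<close> by (auto intro!: derivative_eq_intros)
  ultimately obtain c where c: "a < c" "c < b" "b powr p - a powr p = (b - a) * (p * c powr (p - 1))"
   using MVT[OF \<open>a < b\<close>, of "%x. x powr p"] by (metis DERIV_unique real_differentiable_def)
  have "c powr (p - 1) <= R powr (p - 1)" using c that p by (intro powr_mono2) auto
  then have "(b - a) * (p * c powr (p - 1)) <= (b - a) * (p * R powr (p - 1))"
   using that p by (intro mult_left_mono) auto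
  then show ?thesis using c by (simp add: mult_ac)
 qed
 have mono: "x <= y ==> 0 <= x ==> x powr p <= y powr p" for x y using p by (intro powr_mono2) auto
 consider "a = b" | "a < b" | "b < a" by linarith
 then show ?thesis
  by cases (use *[of a b] *[of b a] mono[of a b] mono[of b a] ab in auto)
qed

lemma fst_borel_measurable [measurable]: "fst : borel_measurable (borel :: ('a::euclidean_space \<times> 'b::euclidean_space) measure)"
 and snd_borel_measurable [measurable]: "snd : borel_measurable (borel :: ('a::euclidean_space \<times> 'b::euclidean_space) measure)"
 by (intro borel_measurable_continuous_onI continuous_intros)+

lemma lborel_integral_reflect:
 fixes f :: "'a::euclidean_space => real"
 assumes [measurable]: "f : Bor"
 shows "(LB y. f (x - y)) = (LB y. f y)"
proof -
 have "distr lborel borel (%y. x - y) = (lborel :: 'a measure)"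
 proof (rule measure_eqI)
  fix A :: "'a set" assume "A : sets (distr lborel borel (%y. x - y))"
  then have [measurable]: "A : sets borel" by simp
  have "emeasure (distr lborel borel (%y. x - y)) A = emeasure lborel {y. x - y : A}"
   by (subst emeasure_distr) (simp_all add: vimage_def)
  also have "... = (NN y. indicator {y. x - y : A} y)" by (subst nn_integral_indicator) simp_all
  also have "... = (NN y. indicator A (x - y))"
   by (intro nn_integral_cong) (auto split: split_indicator)
  also have "... = emeasure lborel A" by (subst nn_integral_lborel_reflect) simp_all
  finally show "emeasure (distr lborel borel (%y. x - y)) A = emeasure lborel A" .
 qed simp
 then have "(LB y. f y) = (\<integral>y. f y \<partial>distr lborel borel (%y. x - y))" by simp
 also have "... = (LB y. f (x - y))" by (rule integral_distr) auto
 finally show ?thesis by simp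
qed

lemma measure_convolution_density:
 fixes k :: "real^'n => real"
 assumes [measurable]: "k : Bor" "g : Bor" and k: "!!x. 0 <= k x"
 shows "measure_convolution (density lborel (%x. ennreal (k x))) g x = (LB y. k (x - y) * g y)"
proof -
 have "measure_convolution (density lborel (%x. ennreal (k x))) g x = (LB y. k y * g (x - y))"
  unfolding measure_convolution_def using k by (subst integral_density) auto
 also have "... = (LB y. k (x - y) * g (x - (x - y)))"
  by (rule lborel_integral_reflect[symmetric]) simp
 finally show ?thesis by simp
qed

lemma joint_slice_AE:
 fixes P :: "real \<times> (real^'n) => bool"
 assumes "Measurable.pred borel P"
 shows "(AE e in lborel. P e) \<longleftrightarrow> (AE t in lborel. AE x in lborel. P (t, x))"
proof -
 have P: "Measurable.pred (lborel \<Otimes>\<^sub>M lborel) P"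
  using assms by (simp add: lborel_prod)
 have "{x : space (lborel \<Otimes>\<^sub>M lborel). P (fst x, snd x)} : sets (lborel \<Otimes>\<^sub>M lborel)"
  using predE[OF P] by simp
 from lborel_pair.AE_pair_iff[of "%t x. P (t, x)", OF this] show ?thesis
  unfolding lborel_prod[symmetric] by simp
qed

section \<open>Picard iterates in space-time\<close>

locale mild_setting = fractional_kernels \<alpha>\<^sub>1 \<alpha>\<^sub>2 c Z Y for \<alpha>\<^sub>1 \<alpha>\<^sub>2 c :: real and Z Y :: "real => (real^'n) measure" +
 fixes p :: real assumes p: "1 < p"
begin

text \<open>Real-valued versions of the densities: infinite values become 0, which for almost every
  time changes the slice on a null set only, as its mass is finite.\<close>

definition ky :: "real \<times> (real^'n) => real" where "ky e = enn2real (kY e)"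
definition kz :: "real \<times> (real^'n) => real" where "kz e = enn2real (kZ e)"
abbreviation k :: "real \<times> (real^'n) => ennreal" where "k \<equiv> %e. ennreal (ky e)"

lemma ky_measurable [measurable]: "ky : Bor" and kz_measurable [measurable]: "kz : Bor"
 unfolding ky_def[abs_def] kz_def[abs_def] by measurable

lemma ky_slice [measurable]: "(%x. ky (t, x)) : Bor" and kz_slice [measurable]: "(%x. kz (t, x)) : Bor"
 by (rule slice_measurable[OF ky_measurable] slice_measurable[OF kz_measurable])+

lemma ky_pair [measurable]: "ky : borel_measurable (borel \<Otimes>\<^sub>M borel)" and kz_pair [measurable]: "kz : borel_measurable (borel \<Otimes>\<^sub>M borel)"
 by (rule slice_measurable[OF ky_measurable] slice_measurable[OF kz_measurable])+

lemma ky_nonneg: "0 <= ky e" and kz_nonneg: "0 <= kz e" by (auto simp: ky_def kz_def)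

lemma ky_nonpos: "fst e <= 0 ==> ky e = 0" and kz_nonpos: "fst e <= 0 ==> kz e = 0"
 using kY_nonpos[of "fst e" "snd e"] kZ_nonpos[of "fst e" "snd e"] by (auto simp: ky_def kz_def)

lemma density_enn2real:
 assumes K: "finite_measure M" "M = density lborel f" and f[measurable]: "f : Bor"
 shows "M = density lborel (%x. ennreal (enn2real (f x)))"
proof -
 have "(NN x. f x) = emeasure M UNIV" unfolding K(2) by (subst emeasure_density) auto
 also have "... \<noteq> \<infinity>" using finite_measure.emeasure_finite[OF K(1)] by simp
 finally have "AE x in lborel. f x \<noteq> \<infinity>" by (intro nn_integral_PInf_AE) auto
 then have "AE x in lborel. f x = ennreal (enn2real (f x))" by eventually_elim (simp add: top.not_eq_extremum)
 then have "density lborel f = density lborel (%x. ennreal (enn2real (f x)))" by (intro density_cong) auto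
 then show ?thesis using K(2) by simp
qed

lemma AE_Y_density: "AE t in lborel. 0 < t --> Y t = density lborel (%x. k (t, x))"
 and AE_Z_density: "AE t in lborel. 0 < t --> Z t = density lborel (%x. ennreal (kz (t, x)))"
proof -
 interpret Y: subordinated_kernel Y0 "%_. 1" phi by (rule Y0_kernel)
 interpret Zk: subordinated_kernel Z0 "%z. phi z / z" phi by (rule Z0_kernel)
 show "AE t in lborel. 0 < t --> Y t = density lborel (%x. k (t, x))"
  using AE_Y0 AE_Y0_density unfolding AE_pos_time_iff
 proof eventually_elim
  case (elim t)
  then show ?case using density_enn2real[OF Y.finite_K[of t], of "%x. kY (t, x)"] kY_slice[of t] by (simp add: ky_def)
 qed
 have kZs: "(%x. kZ (t, x)) : Bor" for t by (rule slice_measurable[OF kZ_measurable])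
 show "AE t in lborel. 0 < t --> Z t = density lborel (%x. ennreal (kz (t, x)))"
  using AE_Z0_density unfolding AE_pos_time_iff
 proof eventually_elim
  case (elim t)
  then show ?case using density_enn2real[OF Zk.finite_K[of t], of "%x. kZ (t, x)"] kZs[of t] by (auto simp: kz_def Z0_def)
 qed
qed

lemma kz_mass: "AE t in lborel. 0 < t --> (NN x. ennreal (kz (t, x))) = 1"
 using AE_Z_density
proof eventually_elim
 case (elim t)
 show ?case
 proof
  assume t: "0 < t"
  have "(NN x. ennreal (kz (t, x))) = emeasure (Z t) UNIV"
   by (subst elim[rule_format, OF t]) (simp add: emeasure_density)
  also have "... = 1"
   using prob_space.emeasure_space_1[OF prob_Z[OF t]] sets_eq_imp_space_eq[OF sets_Z[OF t]] by simp
  finally show "(NN x. ennreal (kz (t, x))) = 1" .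
 qed
qed

lemma joint_nn_integral:
 fixes F :: "real \<times> (real^'n) => ennreal"
 assumes "F : Bor"
 shows "(NN e. F e) = (NN t. (NN x. F (t, x)))"
  and "(%t. \<integral>\<^sup>+x. F (t, x) \<partial>lborel) : Bor"
proof -
 have m: "F : borel_measurable (borel \<Otimes>\<^sub>M borel)" by (rule slice_measurable[OF assms])
 show "(NN e. F e) = (NN t. (NN x. F (t, x)))"
  unfolding lborel_prod[symmetric] by (rule lborel.nn_integral_fst[symmetric]) (use m in simp)
 show "(%t. \<integral>\<^sup>+x. F (t, x) \<partial>lborel) : Bor"
  by (rule lborel.borel_measurable_nn_integral) (use m in \<open>simp add: split_beta'\<close>)
qed

lemma k_laplace: "(NN e. ennreal (exp (- fst e)) * k e) < \<infinity>"
proof -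
 have "(NN e. ennreal (exp (- fst e)) * k e) = (NN t. (NN x. ennreal (exp (- t)) * k (t, x)))"
  by (subst joint_nn_integral) simp_all
 also have "... <= (NN t. ennreal (exp (- t)) * (NN x. kY (t, x)))"
 proof (rule nn_integral_mono)
  fix t :: real
  have "(NN x. ennreal (exp (- t)) * k (t, x)) <= (NN x. ennreal (exp (- t)) * kY (t, x))"
   unfolding ky_def by (intro nn_integral_mono mult_left_mono) (simp_all add: ennreal_enn2real_if)
  then show "(NN x. ennreal (exp (- t)) * k (t, x)) <= ennreal (exp (- t)) * (NN x. kY (t, x))"
   using kY_slice[of t] by (simp add: nn_integral_cmult)
 qed
 also have "... < \<infinity>" by (rule kY_laplace_mass)
 finally show ?thesis .
qed

definition cut :: "real => (real \<times> (real^'n) => ennreal) => real \<times> (real^'n) => ennreal" where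
 "cut T F e = indicator {0<..<T} (fst e) * F e"

lemma cut_measurable [measurable]: "F : Bor ==> cut T F : Bor"
 unfolding cut_def[abs_def] by measurable

definition kmass :: "real => ennreal" where "kmass T = (NN e. cut T k e)"

lemma kmass_finite: "kmass T < \<infinity>"
proof -
 have "kmass T <= (NN e. ennreal (exp T) * (ennreal (exp (- fst e)) * k e))"
  unfolding kmass_def
 proof (rule nn_integral_mono)
  fix e :: "real \<times> (real^'n)"
  have "ennreal 1 <= ennreal (exp T) * ennreal (exp (- fst e))" if "fst e < T"
   using that by (simp add: ennreal_mult[symmetric] exp_add[symmetric])
  then have "ennreal 1 * k e <= ennreal (exp T) * ennreal (exp (- fst e)) * k e" if "fst e < T"
   using that by (intro mult_right_mono) auto
  then show "cut T k e <= ennreal (exp T) * (ennreal (exp (- fst e)) * k e)"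
   by (auto simp: cut_def mult.assoc split: split_indicator)
 qed
 also have "... = ennreal (exp T) * (NN e. ennreal (exp (- fst e)) * k e)" by (rule nn_integral_cmult) simp
 also have "... < \<infinity>" using k_laplace by (simp add: ennreal_mult_less_top)
 finally show ?thesis .
qed

text \<open>Dominated convergence on shrinking time intervals; this smallness fixes the length of a
  continuation step in \<open>good_extend\<close>.\<close>

lemma kmass_tendsto_0: "(%n. kmass (1 / real (Suc n))) ~~> 0"
proof -
 have "(%n. \<integral>\<^sup>+e. cut (1 / real (Suc n)) k e \<partial>lborel) ~~> (\<integral>\<^sup>+e. 0 \<partial>(lborel :: (real \<times> (real^'n)) measure))"
 proof (rule nn_integral_dominated_convergence[where w = "cut 1 k"])
  show "AE e in lborel. cut (1 / real (Suc n)) k e <= cut 1 k e" for n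
  proof (intro AE_I2)
   fix e
   have le: "1 / real (Suc n) <= 1" by simp
   show "cut (1 / real (Suc n)) k e <= cut 1 k e"
   proof (cases "0 < fst e & fst e < 1 / real (Suc n)")
   case True
   then have "fst e < 1" using le by linarith
   then show ?thesis using True by (simp add: cut_def)
   qed (auto simp: cut_def indicator_def)
  qed
  show "(NN e. cut 1 k e) < \<infinity>" using kmass_finite[of 1] by (simp add: kmass_def)
  show "AE e in lborel. (%n. cut (1 / real (Suc n)) k e) ~~> 0"
  proof (intro AE_I2)
   fix e
   show "(%n. cut (1 / real (Suc n)) k e) ~~> 0"
   proof (cases "0 < fst e")
   case True
   have "(%n. 1 / real (Suc n)) ~~> 0" using LIMSEQ_inverse_real_of_nat by (simp add: inverse_eq_divide)
   from order_tendstoD(2)[OF this True] have "eventually (%n. cut (1 / real (Suc n)) k e = 0) sequentially"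
   by eventually_elim (simp add: cut_def)
   then show ?thesis by (rule tendsto_eventually)
   qed (simp add: cut_def)
  qed
 qed simp_all
 then show ?thesis by (simp add: kmass_def)
qed

text \<open>Causality: kernel and source vanish at nonpositive times, so up to time \<open>T\<close>
  only the values of either factor on \<open>(0, T)\<close> enter. The end point \<open>T\<close> is
  included because both vanish at time 0.\<close>

lemma nconv_window:
 assumes "fst e <= T" "!!e. fst e <= 0 ==> F e = 0"
 shows "nconv k F e = nconv k (cut T F) e" "nconv k F e = nconv (cut T k) F e"
 unfolding nconv_def cut_def using assms ky_nonpos
 by (auto intro!: nn_integral_cong simp: ky_nonpos split: split_indicator)

lemma nconv_nonpos: "fst e <= 0 ==> (!!e. fst e <= 0 ==> F e = 0) ==> nconv k F e = 0"
 using nconv_window(1)[of e 0 F] by (simp add: nconv_def cut_def)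

lemma nconv_le:
 assumes F: "!!e. fst e <= 0 ==> F e = 0" and C: "AE e in lborel. 0 < fst e & fst e < T --> F e <= C" and e: "fst e <= T"
 shows "nconv k F e <= C * kmass T"
proof -
 have "nconv k F e = nconv k (cut T F) e" by (rule nconv_window(1)[OF e F])
 also have "... = nconv (cut T k) (cut T F) e" by (rule nconv_window(2)[OF e]) (simp add: cut_def)
 also have "... <= (NN e'. C * cut T k (e - e'))"
  unfolding nconv_def using C
  by (intro nn_integral_mono_AE) (auto elim!: eventually_mono simp: cut_def mult.commute intro: mult_left_mono mult_right_mono split: split_indicator)
 also have "... = C * (NN e'. cut T k (e - e'))" by (rule nn_integral_cmult) simp
 also have "(NN e'. cut T k (e - e')) = kmass T" unfolding kmass_def by (rule nn_integral_lborel_reflect) simp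
 finally show ?thesis .
qed

definition kappa :: "real => ennreal" where "kappa t = (NN x. k (t, x))"

lemma kappa_measurable [measurable]: "kappa : Bor"
 unfolding kappa_def[abs_def] by (rule joint_nn_integral) simp

lemma kappa_laplace: "(NN t. ennreal (exp (- z * t)) * kappa t) = (NN e. ennreal (exp (- z * fst e)) * k e)"
 unfolding kappa_def by (subst joint_nn_integral) (simp_all add: nn_integral_cmult)

text \<open>Integrating out space commutes with convolution: by Tonelli and translation invariance
  the spatial masses are convolved on the time line.\<close>

lemma nconv_slice_kernel:
 fixes kk :: "real \<times> (real^'n) => ennreal"
 assumes kk[measurable]: "kk : Bor" and F[measurable]: "F : Bor"
 shows "(NN x. nconv kk F (t, x)) = nconv (%s. \<integral>\<^sup>+x. kk (s, x) \<partial>lborel) (%s. \<integral>\<^sup>+y. F (s, y) \<partial>lborel) t"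
proof -
 have F2[measurable]: "F : borel_measurable (borel \<Otimes>\<^sub>M borel)" "(%x. F (s, x)) : Bor" for s
  by (rule slice_measurable[OF F])+
 have kk2[measurable]: "kk : borel_measurable (borel \<Otimes>\<^sub>M borel)" "(%x. kk (s, x)) : Bor" for s
  by (rule slice_measurable[OF kk])+
 have "nconv kk F (t, x) = (NN s. (NN y. kk (t - s, x - y) * F (s, y)))" for x
  unfolding nconv_def by (subst joint_nn_integral) simp_all
 then have "(NN x. nconv kk F (t, x)) = (NN x. (NN s. (NN y. kk (t - s, x - y) * F (s, y))))"
  by simp
 also have "... = (NN s. (NN x. (NN y. kk (t - s, x - y) * F (s, y))))"
 proof (rule lborel_pair.Fubini')
  have "(%q. \<integral>\<^sup>+y. k (t - fst q, snd q - y) * F (fst q, y) \<partial>lborel) : borel_measurable ((borel :: real measure) \<Otimes>\<^sub>M (borel :: (real^'n) measure))"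
   by (rule lborel.borel_measurable_nn_integral) (simp add: split_beta')
  then show "(%(s, x). \<integral>\<^sup>+y. kk (t - s, x - y) * F (s, y) \<partial>lborel) : borel_measurable (lborel \<Otimes>\<^sub>M lborel)"
   by (simp add: split_beta' cong: measurable_cong_sets)
 qed
 also have "... = (NN s. (NN x. kk (t - s, x)) * (NN y. F (s, y)))"
 proof (intro nn_integral_cong)
  fix s
  have "(NN x. (NN y. kk (t - s, x - y) * F (s, y))) = (NN y. (NN x. kk (t - s, x - y) * F (s, y)))"
   by (rule lborel_pair.Fubini') (simp add: split_beta')
  also have "... = (NN y. (NN x. kk (t - s, x)) * F (s, y))"
  proof (intro nn_integral_cong)
   fix y
   have "(NN x. kk (t - s, x - y) * F (s, y)) = (NN x. kk (t - s, x + - y)) * F (s, y)"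
   by (subst nn_integral_multc[symmetric]) simp_all
   also have "(NN x. kk (t - s, x + - y)) = (NN x. kk (t - s, x))"
   by (rule nn_integral_lborel_shift) simp
   finally show "(NN x. kk (t - s, x - y) * F (s, y)) = (NN x. kk (t - s, x)) * F (s, y)" .
  qed
  also have "... = (NN x. kk (t - s, x)) * (NN y. F (s, y))" by (rule nn_integral_cmult) simp
  finally show "(NN x. (NN y. kk (t - s, x - y) * F (s, y))) = (NN x. kk (t - s, x)) * (NN y. F (s, y))" .
 qed
 finally show ?thesis by (simp add: nconv_def)
qed

lemma nconv_slice:
 assumes "F : Bor"
 shows "(NN x. nconv k F (t, x)) = nconv kappa (%s. \<integral>\<^sup>+y. F (s, y) \<partial>lborel) t"
 unfolding kappa_def[abs_def] using assms by (intro nconv_slice_kernel) simp_all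

definition A :: "(real^'n => real) => real \<times> (real^'n) => ennreal" where
 "A f e = (NN y. ennreal (kz (fst e, snd e - y)) * ennreal (f y))"

primrec U :: "(real^'n => real) => nat => real \<times> (real^'n) => ennreal" where
 "U f 0 = (%e. 0)"
| "U f (Suc n) = (%e. A f e + nconv k (%e. pw p (U f n e)) e)"

definition V :: "(real^'n => real) => real \<times> (real^'n) => ennreal" where "V f e = (SUP n. U f n e)"

definition good :: "(real^'n => real) => real => bool" where
 "good f T \<longleftrightarrow> (\<exists>R::real. AE e in lborel. 0 < fst e & fst e < T --> V f e <= ennreal R)"

lemma A_measurable [measurable]:
 assumes [measurable]: "f : Bor"
 shows "A f : Bor"
proof -
 have "(%q. \<integral>\<^sup>+y. ennreal (kz (fst q, snd q - y)) * ennreal (f y) \<partial>lborel) : borel_measurable ((borel :: real measure) \<Otimes>\<^sub>M (borel :: (real^'n) measure))"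
  by (rule lborel.borel_measurable_nn_integral) (simp add: split_beta')
 then show ?thesis by (simp add: A_def[abs_def] borel_prod)
qed

lemma A_nonpos: "fst e <= 0 ==> A f e = 0"
 by (simp add: A_def kz_nonpos)

lemma U_measurable [measurable]: "f : Bor ==> U f n : Bor"
 by (induction n) simp_all

lemma V_measurable [measurable]: "f : Bor ==> V f : Bor"
 unfolding V_def[abs_def] by measurable

lemma U_nonpos: "fst e <= 0 ==> U f n e = 0"
proof (induction n arbitrary: e)
 case (Suc n)
 then show ?case using nconv_nonpos[of e "%e. pw p (U f n e)"] by (simp add: A_nonpos)
qed simp

lemma V_nonpos: "fst e <= 0 ==> V f e = 0"
 by (simp add: V_def U_nonpos)

lemma p0: "0 <= p" "1 <= p" using p by auto

lemma U_mono: "incseq (%n. U f n e)"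
proof (rule incseq_SucI)
 fix n show "U f n e <= U f (Suc n) e"
 proof (induction n arbitrary: e)
  case (Suc n)
  have "nconv k (%e. pw p (U f n e)) e <= nconv k (%e. pw p (U f (Suc n) e)) e"
   by (intro nconv_mono AE_I2 pw_mono p0 Suc.IH)
  then show ?case by (simp add: add_left_mono)
 qed simp
qed

text \<open>Monotone convergence along the iteration; infinite values are allowed, so neither
  smallness nor boundedness enters.\<close>

lemma V_eq:
 assumes [measurable]: "f : Bor"
 shows "V f e = A f e + nconv k (%e. pw p (V f e)) e"
proof -
 have "nconv k (%e. pw p (V f e)) e = (NN e'. (SUP n. k (e - e') * pw p (U f n e')))"
  unfolding nconv_def V_def by (intro nn_integral_cong) (simp add: pw_SUP[OF p0(2) U_mono] SUP_mult_left_ennreal)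
 also have "... = (SUP n. \<integral>\<^sup>+e'. k (e - e') * pw p (U f n e') \<partial>lborel)"
 proof (rule nn_integral_monotone_convergence_SUP)
  show "incseq (%n e'. k (e - e') * pw p (U f n e'))"
   using U_mono[of f] by (intro monoI le_funI mult_left_mono pw_mono p0) (auto dest: incseqD)
 qed simp
 finally have N: "nconv k (%e. pw p (V f e)) e = (SUP n. nconv k (%e. pw p (U f n e)) e)" by (simp add: nconv_def)
 have "V f e = (SUP n. U f (Suc n) e)"
 proof -
  have a: "(%n. U f n e) ~~> V f e" unfolding V_def by (rule LIMSEQ_SUP[OF U_mono])
  have "incseq (%n. U f (Suc n) e)" by (intro incseq_SucI incseq_SucD[OF U_mono])
  then have "(%n. U f (Suc n) e) ~~> (SUP n. U f (Suc n) e)" by (rule LIMSEQ_SUP)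
  then show ?thesis using LIMSEQ_unique[OF LIMSEQ_Suc[OF a]] by simp
 qed
 also have "... = A f e + (SUP n. nconv k (%e. pw p (U f n e)) e)"
  by (simp add: ennreal_SUP_add_right)
 finally show ?thesis by (simp add: N)
qed

lemma AE_pos_lift:
 assumes "AE t in lborel. 0 < t --> Q t"
 shows "AE e in (lborel :: (real \<times> (real^'n)) measure). 0 < fst e --> Q (fst e)"
proof -
 obtain N where N: "{t. \<not> (0 < t --> Q t)} \<subseteq> N" "emeasure lborel N = 0" "N : sets borel"
  using assms by (auto elim!: AE_E)
 have "emeasure (lborel \<Otimes>\<^sub>M lborel) (N \<times> (UNIV :: (real^'n) set)) = emeasure lborel N * emeasure lborel (UNIV :: (real^'n) set)"
  using N by (intro lborel.emeasure_pair_measure_Times) auto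
 then have "emeasure lborel (N \<times> (UNIV :: (real^'n) set)) = 0" using N by (simp add: lborel_prod)
 moreover have "N \<times> (UNIV :: (real^'n) set) : sets lborel" using N unfolding sets_lborel borel_prod[symmetric] by auto
 ultimately show ?thesis using N(1) by (intro AE_I[of _ _ "N \<times> UNIV"]) auto
qed

lemma A_le:
 assumes [measurable]: "f : Bor" and f: "!!x. f x <= R0"
 shows "AE e in lborel. A f e <= ennreal R0"
proof -
 have "AE e in (lborel :: (real \<times> (real^'n)) measure). 0 < fst e --> (NN x. ennreal (kz (fst e, x))) = 1"
  by (rule AE_pos_lift[OF kz_mass])
 then show ?thesis
 proof eventually_elim
  case (elim e)
  show ?case
  proof (cases "0 < fst e")
   case True
   have "A f e <= (NN y. ennreal (kz (fst e, snd e - y)) * ennreal R0)"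
   unfolding A_def using f by (intro nn_integral_mono mult_left_mono ennreal_leI) auto
   also have "... = (NN y. ennreal (kz (fst e, snd e - y))) * ennreal R0" by (rule nn_integral_multc) simp
   also have "(NN y. ennreal (kz (fst e, snd e - y))) = (NN y. ennreal (kz (fst e, y)))"
   by (rule nn_integral_lborel_reflect) simp
   finally show ?thesis using elim True by simp
  qed (simp add: A_nonpos)
 qed
qed

text \<open>The bound is proved for the iterates, since finiteness of \<open>V\<close> beyond
  \<open>T\<close> is the claim. The source before \<open>T\<close> contributes a fixed amount by
  hypothesis, and the source on the new piece contributes at most 1 when the piece is short.\<close>

lemma good_extend:
 assumes f[measurable]: "f : Bor" and f0: "!!x. f x <= R0" "0 <= R0" and T: "0 <= T" and g: "good f T"
 obtains dl where "0 < dl" "good f (T + dl)"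
proof -
 obtain R1 where R1: "AE e in lborel. 0 < fst e & fst e < T --> V f e <= ennreal R1" using g by (auto simp: good_def)
 define R where "R = \<bar>R1\<bar>"
 have R: "AE e in lborel. 0 < fst e & fst e < T --> V f e <= ennreal R"
  using R1 by eventually_elim (auto simp: R_def intro: order_trans[OF _ ennreal_leI])
 have R_nn: "0 <= R" by (simp add: R_def)
 define km where "km = enn2real (kmass (T + 1))"
 have km: "kmass (T + 1) = ennreal km" "0 <= km" using kmass_finite[of "T + 1"] by (simp_all add: km_def top.not_eq_extremum)
 \<comment> \<open>Datum, source before time \<open>T\<close>, and 1 for the source after
   \<open>T\<close>; the window \<open>T + 1\<close> covers every step length
   \<open>dl <= 1\<close>.\<close>
 define R' where "R' = R0 + R powr p * km + 1"
 have R'_nn: "0 <= R'" using f0 km by (simp add: R'_def)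
 have "(%n. ennreal (R' powr p) * kmass (1 / real (Suc n))) ~~> ennreal (R' powr p) * 0"
  by (intro ennreal_tendsto_cmult kmass_tendsto_0) auto
 from order_tendstoD(2)[OF this, of 1] have "eventually (%n. ennreal (R' powr p) * kmass (1 / real (Suc n)) < 1) sequentially" by simp
 then obtain m where m: "ennreal (R' powr p) * kmass (1 / real (Suc m)) < 1" by (auto simp: eventually_sequentially)
 define dl where "dl = 1 / real (Suc m)"
 have d: "0 < dl" "dl <= 1" by (auto simp: dl_def)
 have "AE e in lborel. 0 < fst e & fst e < T + dl --> U f n e <= ennreal R'" for n
 proof (induction n)
  case (Suc n)
  define F1 where "F1 = (%e :: real \<times> (real^'n). indicator {0<..<T} (fst e) * ennreal (R powr p))"
  define F2 where "F2 = (%e :: real \<times> (real^'n). indicator {T..<T + dl} (fst e) * indicator {0<..} (fst e) * ennreal (R' powr p))"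
  have Fm[measurable]: "F1 : Bor" "F2 : Bor" unfolding F1_def F2_def by measurable
  have Fle: "AE e in lborel. cut (T + dl) (%e. pw p (U f n e)) e <= F1 e + F2 e"
   using Suc R
  proof eventually_elim
   case (elim e)
   have "U f n e <= V f e" unfolding V_def by (rule SUP_upper) simp
   then have "pw p (U f n e) <= ennreal (R powr p)" if "0 < fst e" "fst e < T"
   using pw_mono[OF p0(1), of "U f n e" "ennreal R"] elim that by (auto simp: pw_ennreal R_nn intro: order_trans)
   moreover have "pw p (U f n e) <= ennreal (R' powr p)" if "0 < fst e" "fst e < T + dl"
   using pw_mono[OF p0(1), of "U f n e" "ennreal R'"] elim that by (auto simp: pw_ennreal R'_nn)
   ultimately show ?case by (auto simp: cut_def F1_def F2_def split: split_indicator)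
  qed
  have "AE e in lborel. A f e <= ennreal R0" by (rule A_le[OF f f0(1)])
  then show ?case
  proof eventually_elim
   case (elim e)
   show ?case
   proof
   assume e: "0 < fst e & fst e < T + dl"
   have "nconv k (%e. pw p (U f n e)) e = nconv k (cut (T + dl) (%e. pw p (U f n e))) e"
   using e by (intro nconv_window) (auto simp: U_nonpos)
   also have "... <= nconv k (%e. F1 e + F2 e) e" by (rule nconv_mono[OF Fle])
   also have "... = nconv k F1 e + nconv k F2 e" by (rule nconv_add) auto
   also have "nconv k F1 e <= ennreal (R powr p) * kmass (T + 1)"
   using e d by (intro nconv_le) (auto simp: F1_def split: split_indicator)
   also have "nconv k F2 e <= (NN e'. ennreal (R' powr p) * cut dl k (e - e'))"
   unfolding nconv_def F2_def using e
   by (intro nn_integral_mono) (auto simp: cut_def mult.commute ky_nonpos split: split_indicator)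
   also have "... = ennreal (R' powr p) * (NN e'. cut dl k (e - e'))" by (rule nn_integral_cmult) simp
   also have "(NN e'. cut dl k (e - e')) = kmass dl" unfolding kmass_def by (rule nn_integral_lborel_reflect) simp
   finally have "nconv k (%e. pw p (U f n e)) e <= ennreal (R powr p) * kmass (T + 1) + ennreal (R' powr p) * kmass dl"
   by (auto simp: add_mono add_left_mono add_right_mono)
   also have "... <= ennreal (R powr p * km) + ennreal 1"
   using m km by (intro add_mono) (auto simp: dl_def ennreal_mult)
   finally have "U f (Suc n) e <= ennreal R0 + (ennreal (R powr p * km) + ennreal 1)"
   using elim by (auto intro: add_mono)
   also have "... = ennreal R'"
   unfolding ennreal_plus[OF mult_nonneg_nonneg[OF powr_ge_zero km(2)] zero_le_one, symmetric] R'_def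
   by (subst ennreal_plus[symmetric]) (use f0 km in \<open>auto simp: add.assoc\<close>)
   finally show "U f (Suc n) e <= ennreal R'" .
   qed
  qed
 qed simp
 then have "AE e in lborel. \<forall>n. 0 < fst e & fst e < T + dl --> U f n e <= ennreal R'" unfolding AE_all_countable by (rule allI)
 then have "AE e in lborel. 0 < fst e & fst e < T + dl --> V f e <= ennreal R'"
  by eventually_elim (auto simp: V_def intro: SUP_least)
 then show ?thesis using d by (intro that[of dl]) (auto simp: good_def)
qed

lemma good_0: "good f 0" unfolding good_def by (intro exI[of _ 0] AE_I2) auto

lemma good_mono: "good f T ==> S <= T ==> good f S"
 unfolding good_def by (auto elim!: eventually_mono)

lemma small_laplace:
 assumes "0 <= L"
 obtains z where "1 <= z" "ennreal L * (NN e. ennreal (exp (- z * fst e)) * k e) <= ennreal (1/2)"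
proof (rule laplace_tends_0[OF ky_measurable fst_borel_measurable ky_nonpos k_laplace assms])
 fix z :: real
 assume "1 <= z" "ennreal L * (NN e. ennreal (exp (- z * fst e)) * k e) <= ennreal (1/2)"
 then show thesis by (rule that)
qed

lemma A_slice:
 assumes [measurable]: "f : Bor"
 shows "AE t in lborel. (NN x. A f (t, x)) <= (NN x. ennreal (f x))"
 using kz_mass
proof eventually_elim
 case (elim t)
 show ?case
 proof (cases "0 < t")
  case True
  have "(NN x. A f (t, x)) = (NN y. (NN x. ennreal (kz (t, x - y)) * ennreal (f y)))"
   unfolding A_def fst_conv snd_conv by (rule lborel_pair.Fubini') (simp add: split_beta')
  also have "... = (NN y. ennreal (f y))"
  proof (intro nn_integral_cong)
   fix y
   have "(NN x. ennreal (kz (t, x - y)) * ennreal (f y)) = (NN x. ennreal (kz (t, x + - y))) * ennreal (f y)"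
   by (subst nn_integral_multc[symmetric]) simp_all
   also have "(NN x. ennreal (kz (t, x + - y))) = (NN x. ennreal (kz (t, x)))"
   by (rule nn_integral_lborel_shift) simp
   finally show "(NN x. ennreal (kz (t, x - y)) * ennreal (f y)) = ennreal (f y)" using elim True by simp
  qed
  finally show ?thesis by simp
 qed (simp add: A_nonpos)
qed

text \<open>On values up to \<open>R\<close> the power is at most \<open>R powr (p - 1)\<close>
  times its argument, which makes the inequality for the spatial masses linear. The weight
  \<open>exp (z * t)\<close> closes it with \<open>2 * N0\<close> for all iterates at once: one half
  pays for the datum, the other for the convolution.\<close>

lemma V_slice_bound:
 assumes f[measurable]: "f : Bor" and f1: "(NN x. ennreal (f x)) <= ennreal N0" "0 <= N0"
  and R: "AE e in lborel. 0 < fst e & fst e < T --> V f e <= ennreal R" "0 <= R"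
 obtains B where "0 <= B" "AE t in lborel. 0 < t & t < T --> (NN x. V f (t, x)) <= ennreal B"
proof -
 define L where "L = R powr (p - 1)"
 have L0: "0 <= L" by (simp add: L_def)
 obtain z where z: "1 <= z" "ennreal L * (NN e. ennreal (exp (- z * fst e)) * k e) <= ennreal (1/2)"
  by (rule small_laplace[OF L0])
 have Fm: "(%t. \<integral>\<^sup>+x. F (t, x) \<partial>lborel) : Bor" if "F : Bor" for F :: "real \<times> (real^'n) => ennreal"
  by (rule joint_nn_integral[OF that])
 have pwle: "AE e in lborel. cut T (%e. pw p (U f n e)) e <= ennreal L * cut T (U f n) e" for n
  using R(1)
 proof eventually_elim
  case (elim e)
  show ?case
  proof (cases "0 < fst e & fst e < T")
   case True
   have "U f n e <= V f e" unfolding V_def by (rule SUP_upper) simp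
   then have "U f n e <= ennreal R" using elim True by auto
   then obtain r where r: "U f n e = ennreal r" "0 <= r" "r <= R"
   using R(2) by (cases "U f n e") (auto simp: ennreal_le_iff top_unique)
   have "r powr p = r powr (p - 1) * r"
   proof (cases "r = 0")
   case False
   then show ?thesis using r powr_add[of r "p - 1" 1] by simp
   qed simp
   also have "... <= L * r" unfolding L_def using r p by (intro mult_right_mono powr_mono2) auto
   finally have "ennreal (r powr p) <= ennreal L * ennreal r" using L0 r by (simp add: ennreal_mult[symmetric] ennreal_leI)
   then show ?thesis using True r by (simp add: cut_def pw_ennreal)
  qed (auto simp: cut_def)
 qed
 have "AE t in lborel. 0 < t & t < T --> (NN x. U f n (t, x)) <= ennreal (exp (z * t) * (2 * N0))" for n
 proof (induction n)
  case 0 then show ?case by simp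
 next
  case (Suc n)
  show ?case using A_slice[OF f]
  proof eventually_elim
   case (elim t)
   show ?case
   proof
   assume t: "0 < t & t < T"
   define m where "m = (%s. \<integral>\<^sup>+y. cut T (U f n) (s, y) \<partial>lborel)"
   have mm: "m : Bor" unfolding m_def by (rule Fm) simp
   have mb: "AE s in lborel. m s <= ennreal (exp (z * id s) * (2 * N0))"
   using Suc by eventually_elim (auto simp: m_def cut_def split: split_indicator)
   have "(NN x. nconv k (%e. pw p (U f n e)) (t, x)) = (NN x. nconv k (cut T (%e. pw p (U f n e))) (t, x))"
   using t by (intro nn_integral_cong nconv_window) (auto simp: U_nonpos)
   also have "... <= (NN x. nconv k (%e. ennreal L * cut T (U f n) e) (t, x))"
   by (intro nn_integral_mono nconv_mono pwle)
   also have "... = nconv kappa (%s. \<integral>\<^sup>+y. ennreal L * cut T (U f n) (s, y) \<partial>lborel) t"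
   by (rule nconv_slice) simp
   also have "... = nconv kappa (%s. ennreal L * m s) t"
   unfolding m_def using slice_measurable(1)[of "cut T (U f n)"] by (simp add: nn_integral_cmult)
   also have "... = ennreal L * nconv kappa m t" by (rule nconv_cmult) (use mm in auto)
   also have "... <= ennreal L * (ennreal (exp (z * id t) * (2 * N0)) * (NN s. ennreal (exp (- z * id s)) * kappa s))"
   using f1 mb by (intro mult_left_mono nconv_exp_bound) auto
   also have "... = ennreal (exp (z * t) * (2 * N0)) * (ennreal L * (NN e. ennreal (exp (- z * fst e)) * k e))"
   unfolding id_apply kappa_laplace by (simp add: mult_ac)
   also have "... <= ennreal (exp (z * t) * (2 * N0)) * ennreal (1/2)" by (intro mult_left_mono z) auto
   also have "... = ennreal (exp (z * t) * N0)" using f1 by (subst ennreal_mult[symmetric]) auto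
   finally have 1: "(NN x. nconv k (%e. pw p (U f n e)) (t, x)) <= ennreal (exp (z * t) * N0)" .
   have sm: "(%x. A f (t, x)) : Bor" "(%x. nconv k (%e. pw p (U f n e)) (t, x)) : Bor"
   by (rule slice_measurable; simp)+
   have "1 * N0 <= exp (z * t) * N0" using t z f1 by (intro mult_right_mono) auto
   then have "ennreal N0 <= ennreal (exp (z * t) * N0)" by (simp add: ennreal_leI)
   then have "(NN x. A f (t, x)) <= ennreal (exp (z * t) * N0)" using elim f1(1) by (meson order_trans)
   then have "(NN x. A f (t, x)) + (NN x. nconv k (%e. pw p (U f n e)) (t, x)) <= ennreal (exp (z * t) * N0) + ennreal (exp (z * t) * N0)"
   using 1 by (rule add_mono)
   also have "... = ennreal (exp (z * t) * (2 * N0))" using f1 by (subst ennreal_plus[symmetric]) auto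
   finally show "(NN x. U f (Suc n) (t, x)) <= ennreal (exp (z * t) * (2 * N0))"
   using sm by (simp add: nn_integral_add)
   qed
  qed
 qed
 then have "AE t in lborel. \<forall>n. 0 < t & t < T --> (NN x. U f n (t, x)) <= ennreal (exp (z * t) * (2 * N0))"
  unfolding AE_all_countable by (rule allI)
 then have "AE t in lborel. 0 < t & t < T --> (NN x. V f (t, x)) <= ennreal (exp (z * T) * (2 * N0))"
 proof eventually_elim
  case (elim t)
  show ?case
  proof
   assume t: "0 < t & t < T"
   have "(NN x. V f (t, x)) = (SUP n. \<integral>\<^sup>+x. U f n (t, x) \<partial>lborel)"
   unfolding V_def
   proof (rule nn_integral_monotone_convergence_SUP)
   show "incseq (%n x. U f n (t, x))" using U_mono[of f] by (auto simp: incseq_def le_fun_def)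
   show "(%x. U f n (t, x)) : borel_measurable lborel" for n using slice_measurable(1)[of "U f n"] by simp
   qed
   also have "... <= ennreal (exp (z * t) * (2 * N0))" using elim t by (intro SUP_least) auto
   also have "... <= ennreal (exp (z * T) * (2 * N0))" using t z f1 by (intro ennreal_leI mult_right_mono) auto
   finally show "(NN x. V f (t, x)) <= ennreal (exp (z * T) * (2 * N0))" .
  qed
 qed
 then show ?thesis using f1 by (intro that[of "exp (z * T) * (2 * N0)"]) auto
qed

end

section \<open>Strong measurability and the Duhamel term of a bounded source\<close>

lemma lborel_AE_reflect:
 fixes t :: real
 assumes "AE s in lborel. Q s"
 shows "AE s in lborel. Q (t - s)"
proof -
 obtain N where N: "{s. \<not> Q s} \<subseteq> N" "emeasure lborel N = 0" "N : sets borel"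
  using assms by (auto elim!: AE_E)
 note [measurable] = N(3)
 have "emeasure lborel {s. t - s : N} = (NN s. indicator {s. t - s : N} s)"
  by (subst nn_integral_indicator) simp_all
 also have "... = (NN s. indicator N (t - s))"
  by (intro nn_integral_cong) (auto split: split_indicator)
 also have "... = 0" using N by (subst nn_integral_lborel_reflect) auto
 finally show ?thesis using N by (intro AE_I[of _ _ "{s. t - s : N}"]) auto
qed

lemma ennreal_abs_integral_le:
 assumes "f : borel_measurable M"
 shows "ennreal \<bar>\<integral>x. f x \<partial>M\<bar> <= (\<integral>\<^sup>+x. ennreal \<bar>f x\<bar> \<partial>M)"
proof (cases "integrable M f")
 case True
 then show ?thesis using integral_norm_bound_ennreal[OF True] by simp
qed (simp add: not_integrable_integral_eq)

lemma strongly_measurable_uniformly_continuous: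
 fixes h :: "real => real^'n => real"
 assumes T: "0 < T" and h: "!!t. 0 < t ==> t < T ==> h t : normed_functions N"
  and uc: "!!eps. 0 < eps ==> \<exists>dl>0. \<forall>s t. 0 < s & s < T & 0 < t & t < T & \<bar>s - t\<bar> < dl --> N (%x. h s x - h t x) <= ennreal eps"
 shows "strongly_measurable_wrt N (lebesgue_on {0<..<T}) h"
proof -
 define idx where "idx = (%m t. real_of_int \<lfloor>real (Suc m) * t / T\<rfloor>)"
 \<comment> \<open>Midpoints of the cells: the shift by 1/2 keeps them strictly inside
   \<open>(0, T)\<close>, the only place where \<open>h\<close> is controlled.\<close>
 define pt where "pt = (%m r. (r + 1/2) * T / real (Suc m))"
 have idx: "0 <= idx m t & idx m t <= real m & \<bar>t - pt m (idx m t)\<bar> < T / real (Suc m)" if "0 < t" "t < T" for m t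
 proof -
  define y where "y = real (Suc m) * t / T"
  have "real (Suc m) * (t / T) < real (Suc m) * 1"
   using that T by (intro mult_strict_left_mono) auto
  then have y: "0 <= y" "y < real (Suc m)" "t = y * T / real (Suc m)"
   using that T by (simp_all add: y_def del: of_nat_Suc)
  have fl: "0 <= \<lfloor>y\<rfloor>" "\<lfloor>y\<rfloor> < int (Suc m)" using y by (simp_all add: floor_less_iff)
  have "\<bar>y - (real_of_int \<lfloor>y\<rfloor> + 1/2)\<bar> < 1" by linarith
  then have "\<bar>y - (real_of_int \<lfloor>y\<rfloor> + 1/2)\<bar> * (T / real (Suc m)) < 1 * (T / real (Suc m))"
   using T by (intro mult_strict_right_mono) auto
  moreover have "t - pt m (idx m t) = (y - (real_of_int \<lfloor>y\<rfloor> + 1/2)) * (T / real (Suc m))"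
   unfolding pt_def idx_def y_def[symmetric] by (subst y(3)) (simp add: left_diff_distrib diff_divide_distrib)
  ultimately have "\<bar>t - pt m (idx m t)\<bar> < T / real (Suc m)" using T by (simp add: abs_mult)
  then show ?thesis using fl by (simp add: idx_def y_def)
 qed
 have pt: "0 < pt m r & pt m r < T" if "0 <= r" "r <= real m" for m r
 proof -
  have "0 < (r + 1/2) * T" "(r + 1/2) * T < real (Suc m) * T"
   using that T by (auto intro!: mult_pos_pos mult_strict_right_mono)
  then show ?thesis unfolding pt_def by (auto simp: pos_divide_less_eq mult.commute[of T] simp del: of_nat_Suc)
 qed
 have "finite (idx m ` {0<..<T})" for m
 proof (rule finite_subset)
  show "idx m ` {0<..<T} \<subseteq> real_of_int ` {0..int m}"
  proof (rule image_subsetI)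
   fix t assume "t : {0<..<T}"
   then have "0 <= idx m t" "idx m t <= real m" using idx[of t m] by auto
   then show "idx m t : real_of_int ` {0..int m}" unfolding idx_def by (intro imageI) simp
  qed
 qed simp
 moreover have "idx m : borel_measurable (lebesgue_on {0<..<T})" for m
  unfolding idx_def by (rule measurable_lebesgue_on_borel) measurable
 ultimately have "simple_function (lebesgue_on {0<..<T}) (idx m)" for m
  by (intro simple_function_borel_measurable) auto
 then have sf: "simple_function (lebesgue_on {0<..<T}) (%t. h (pt m (idx m t)))" for m
  by (rule simple_function_compose1)
 show ?thesis
  unfolding strongly_measurable_wrt_def
 proof (intro exI[of _ "%m t. h (pt m (idx m t))"] conjI allI)
  fix m show "simple_wrt N (lebesgue_on {0<..<T}) (%t. h (pt m (idx m t)))"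
   unfolding simple_wrt_def using sf[of m] idx pt h by auto
  show "AE t in lebesgue_on {0<..<T}. h t : normed_functions N & (%k. N (%x. h t x - h (pt k (idx k t)) x)) ~~> 0"
   using AE_space
  proof eventually_elim
   case (elim t)
   then have t: "0 < t" "t < T" by auto
   have "(%k. N (%x. h t x - h (pt k (idx k t)) x)) ~~> 0"
   proof (rule order_tendstoI)
   fix a :: ennreal assume a: "0 < a"
   obtain eps where e: "0 < eps" "ennreal eps < a"
   proof (cases a)
   case (real r)
   then show ?thesis using a that[of "r/2"] by (simp add: ennreal_less_iff)
   qed (use that[of 1] in simp)
   obtain dl where d: "0 < dl" "!!s t. 0 < s ==> s < T ==> 0 < t ==> t < T ==> \<bar>s - t\<bar> < dl ==> N (%x. h s x - h t x) <= ennreal eps"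
   using uc[OF e(1)] by blast
   have "(%k. T * (1 / real (Suc k))) ~~> T * 0"
   using LIMSEQ_inverse_real_of_nat by (intro tendsto_intros) (simp add: inverse_eq_divide)
   from order_tendstoD(2)[OF this, of dl] d(1) have "eventually (%k. T / real (Suc k) < dl) sequentially" by simp
   then show "eventually (%k. N (%x. h t x - h (pt k (idx k t)) x) < a) sequentially"
   proof eventually_elim
   case (elim k)
   have "N (%x. h t x - h (pt k (idx k t)) x) <= ennreal eps"
   using idx[OF t, of k] pt[of "idx k t" k] t elim by (intro d(2)) auto
   then show ?case using e(2) by (rule le_less_trans)
   qed
   qed simp
   then show ?case using h[OF t] by simp
  qed
 qed
qed

lemma (in mild_setting) nconv_slice_le:
 fixes kk :: "real \<times> (real^'n) => ennreal"
 assumes kk[measurable]: "kk : Bor" and F[measurable]: "F : Bor"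
  and B: "AE s in lborel. (NN y. F (s, y)) <= B"
 shows "(NN x. nconv kk F (t, x)) <= B * (NN e. kk e)"
proof -
 define g where "g = (%s. \<integral>\<^sup>+x. kk (s, x) \<partial>lborel)"
 have g[measurable]: "g : Bor" unfolding g_def by (rule joint_nn_integral[OF kk])
 have "(NN x. nconv kk F (t, x)) = (NN s. g (t - s) * (NN y. F (s, y)))"
  unfolding nconv_slice_kernel[OF kk F] unfolding nconv_def g_def ..
 also have "... <= (NN s. B * g (t - s))"
  using B by (intro nn_integral_mono_AE) (auto elim!: eventually_mono simp: mult.commute[of B] intro: mult_left_mono)
 also have "... = B * (NN s. g (t - s))" by (rule nn_integral_cmult) simp
 also have "(NN s. g (t - s)) = (NN s. g s)" by (rule nn_integral_lborel_reflect) simp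
 also have "... = (NN e. kk e)" unfolding g_def by (rule joint_nn_integral(1)[OF kk, symmetric])
 finally show ?thesis .
qed

text \<open>A bounded source on \<open>(0, T)\<close> with bounded spatial mass, meant for a version
  of the power of \<open>V\<close>. Keeping it abstract separates the regularity of the Duhamel term
  \<open>W\<close> from the fixed point.\<close>

locale source = mild_setting \<alpha>\<^sub>1 \<alpha>\<^sub>2 c Z Y p
 for \<alpha>\<^sub>1 \<alpha>\<^sub>2 c p :: real and Z Y :: "real => (real^'n) measure" +
 fixes F :: "real \<times> (real^'n) => real" and C B T :: real
 assumes F_m [measurable]: "F : Bor" and F_nn: "!!e. 0 <= F e" and F_le: "!!e. F e <= C"
  and F_out: "!!e. \<not> (0 < fst e & fst e < T) ==> F e = 0"
  and F_slice: "AE s in lborel. (NN y. ennreal (F (s, y))) <= ennreal B" and T: "0 < T"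
begin

text \<open>The kernel is cut off in time to become integrable on space-time; by \<open>W_eq\<close>
  the cut is not felt up to time \<open>T + 1\<close>.\<close>

definition K :: "real \<times> (real^'n) => real" where "K e = (if 0 < fst e & fst e < T + 1 then ky e else 0)"

definition W :: "real \<times> (real^'n) => real" where "W e = (LB e'. K (e - e') * F e')"

lemma K_m [measurable]: "K : Bor" unfolding K_def[abs_def] by measurable

lemma F_pair [measurable]: "F : borel_measurable (borel \<Otimes>\<^sub>M borel)" "(%x. F (t, x)) : Bor"
 and K_pair [measurable]: "K : borel_measurable (borel \<Otimes>\<^sub>M borel)" "(%x. K (t, x)) : Bor"
 by (rule slice_measurable[OF F_m] slice_measurable[OF K_m])+

lemma K_nn: "0 <= K e" by (simp add: K_def ky_nonneg)

lemma C_nn: "0 <= C" using F_nn[of undefined] F_le[of undefined] by linarith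

lemma ennreal_K: "ennreal (K e) = cut (T + 1) k e" by (simp add: K_def cut_def)

lemma nn_K: "(NN e. ennreal (K e)) = kmass (T + 1)" by (simp add: ennreal_K kmass_def)

lemma K_int: "integrable lborel K"
 using kmass_finite[of "T + 1"] by (intro integrableI_nonneg) (auto simp: K_nn nn_K)

lemma nconv_K_le: "nconv (%e. ennreal (K e)) (%e. ennreal (F e)) e <= ennreal C * kmass (T + 1)"
proof -
 have "nconv (%e. ennreal (K e)) (%e. ennreal (F e)) e <= (NN e'. ennreal C * ennreal (K (e - e')))"
  unfolding nconv_def mult.commute[of "ennreal C"] by (intro nn_integral_mono mult_left_mono ennreal_leI F_le) auto
 also have "... = ennreal C * (NN e'. ennreal (K (e - e')))" by (rule nn_integral_cmult) simp
 also have "(NN e'. ennreal (K (e - e'))) = kmass (T + 1)"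
  by (subst nn_integral_lborel_reflect[of "%e. ennreal (K e)"]) (simp_all add: nn_K)
 finally show ?thesis .
qed

lemma KF_int: "integrable lborel (%e'. K (e - e') * F e')"
proof (rule integrableI_nonneg)
 have "(NN e'. ennreal (K (e - e') * F e')) <= ennreal C * kmass (T + 1)"
  using nconv_K_le[of e] by (simp add: nconv_def ennreal_mult K_nn F_nn)
 also have "... < \<infinity>" using kmass_finite[of "T + 1"] by (simp add: ennreal_mult_less_top)
 finally show "(NN e'. ennreal (K (e - e') * F e')) < \<infinity>" .
qed (auto simp: K_nn F_nn)

lemma W_nconv: "ennreal (W e) = nconv (%e. ennreal (K e)) (%e. ennreal (F e)) e"
 unfolding W_def nconv_def
 by (subst nn_integral_eq_integral[symmetric, OF KF_int]) (auto simp: K_nn F_nn ennreal_mult)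

lemma W_eq: "fst e <= T + 1 ==> nconv k (%e. ennreal (F e)) e = ennreal (W e)"
 unfolding W_nconv ennreal_K by (rule nconv_window(2)) (auto simp: F_out)

lemma W_nn: "0 <= W e" unfolding W_def by (intro integral_nonneg_AE) (simp add: K_nn F_nn)

lemma W_le: "W e <= C * enn2real (kmass (T + 1))"
proof -
 have "ennreal (W e) <= ennreal (C * enn2real (kmass (T + 1)))"
  using nconv_K_le[of e] kmass_finite[of "T + 1"] C_nn by (simp add: W_nconv ennreal_mult)
 then show ?thesis using C_nn by (simp add: ennreal_le_iff)
qed

lemma W_m [measurable]: "W : Bor"
 unfolding W_def[abs_def] by (rule lborel.borel_measurable_lebesgue_integral) (simp add: split_beta')

lemma W_slice [measurable]: "(%x. W (t, x)) : Bor" by (rule slice_measurable[OF W_m])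

lemma W_nonpos: "fst e <= 0 ==> W e = 0"
proof -
 assume "fst e <= 0"
 then have 0: "K (e - e') * F e' = 0" for e' using F_out[of e'] by (auto simp: K_def)
 show ?thesis unfolding W_def 0 by simp
qed

definition osc :: "real \<times> (real^'n) => ennreal" where "osc h = (NN e. ennreal \<bar>K (e + h) - K e\<bar>)"

lemma osc_small: "0 < eps ==> \<exists>dl>0. \<forall>h. norm h < dl --> osc h < ennreal eps"
 unfolding osc_def using L1_translation_continuous[OF K_int] by blast

text \<open>The increment of the argument is moved onto the kernel. Continuity of \<open>W\<close>
  in space and time therefore comes from continuity of translations of \<open>K\<close> in L^1 and
  asks of \<open>F\<close> no more than its bounds.\<close>

lemma W_diff_nconv: "ennreal \<bar>W e - W e1\<bar> <= nconv (%d. ennreal \<bar>K (d + (e - e1)) - K d\<bar>) (%e. ennreal (F e)) e1"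
proof -
 have "W e - W e1 = (LB e'. K (e - e') * F e' - K (e1 - e') * F e')"
  unfolding W_def by (rule Bochner_Integration.integral_diff[symmetric, OF KF_int KF_int])
 then have "ennreal \<bar>W e - W e1\<bar> <= (NN e'. ennreal \<bar>K (e - e') * F e' - K (e1 - e') * F e'\<bar>)"
  by (simp add: ennreal_abs_integral_le)
 also have "... = nconv (%d. ennreal \<bar>K (d + (e - e1)) - K d\<bar>) (%e. ennreal (F e)) e1"
  unfolding nconv_def
 proof (intro nn_integral_cong)
  fix e'
  have "e1 - e' + (e - e1) = e - e'" by simp
  then show "ennreal \<bar>K (e - e') * F e' - K (e1 - e') * F e'\<bar> = ennreal \<bar>K (e1 - e' + (e - e1)) - K (e1 - e')\<bar> * ennreal (F e')"
   by (simp only: left_diff_distrib[symmetric] abs_mult abs_of_nonneg[OF F_nn] ennreal_mult[OF abs_ge_zero F_nn])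
 qed
 finally show ?thesis .
qed

lemma W_diff_le: "ennreal \<bar>W e - W e1\<bar> <= ennreal C * osc (e - e1)"
proof -
 let ?k = "%d. ennreal \<bar>K (d + (e - e1)) - K d\<bar>"
 have "nconv ?k (%e. ennreal (F e)) e1 <= (NN e'. ennreal C * ?k (e1 - e'))"
  unfolding nconv_def mult.commute[of "ennreal C"] by (intro nn_integral_mono mult_left_mono ennreal_leI F_le) auto
 also have "... = ennreal C * (NN e'. ?k (e1 - e'))" by (rule nn_integral_cmult) simp
 also have "(NN e'. ?k (e1 - e')) = osc (e - e1)"
  unfolding osc_def by (rule nn_integral_lborel_reflect) simp
 finally show ?thesis using W_diff_nconv[of e e1] by (rule order_trans[rotated])
qed

lemma W_diff_L1: "L1_norm (%x. W (t, x) - W (t1, x)) <= ennreal B * osc (t - t1, 0)"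
proof -
 let ?k = "%d. ennreal \<bar>K (d + (t - t1, 0)) - K d\<bar>"
 have "L1_norm (%x. W (t, x) - W (t1, x)) <= (NN x. nconv ?k (%e. ennreal (F e)) (t1, x))"
  unfolding L1_norm_def
 proof (rule nn_integral_mono)
  fix x
  show "ennreal \<bar>W (t, x) - W (t1, x)\<bar> <= nconv ?k (%e. ennreal (F e)) (t1, x)"
   using W_diff_nconv[of "(t, x)" "(t1, x)"] by simp
 qed
 also have "... <= ennreal B * osc (t - t1, 0)"
  unfolding osc_def by (rule nconv_slice_le[OF _ _ F_slice]) auto
 finally show ?thesis .
qed

lemma W_L1: "L1_norm (%x. W (t, x)) <= ennreal B * kmass (T + 1)"
proof -
 have "L1_norm (%x. W (t, x)) = (NN x. nconv (%e. ennreal (K e)) (%e. ennreal (F e)) (t, x))"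
  unfolding L1_norm_def by (simp add: W_nn W_nconv)
 also have "... <= ennreal B * (NN e. ennreal (K e))" by (rule nconv_slice_le[OF _ _ F_slice]) auto
 finally show ?thesis by (simp add: nn_K)
qed

lemma W_normed: "(%x. W (t, x)) : normed_functions L1_norm" "(%x. W (t, x)) : normed_functions Linf_norm"
proof -
 have "L1_norm (%x. W (t, x)) < \<infinity>"
  using W_L1[of t] kmass_finite[of "T + 1"] by (auto intro: le_less_trans simp: ennreal_mult_less_top)
 then show "(%x. W (t, x)) : normed_functions L1_norm" by (simp add: normed_functions_def)
 have "Linf_norm (%x. W (t, x)) <= ennreal (C * enn2real (kmass (T + 1)))"
  using W_le W_nn by (intro Linf_norm_le) auto
 also have "... < \<infinity>" by simp
 finally show "(%x. W (t, x)) : normed_functions Linf_norm" by (simp add: normed_functions_def)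
qed

lemma W_strongly_measurable: "strongly_measurable_wrt Linf_norm (lebesgue_on {0<..<T}) (%t x. W (t, x))"
proof (rule strongly_measurable_uniformly_continuous[OF T W_normed(2)])
 fix eps :: real assume e: "0 < eps"
 obtain dl where d: "0 < dl" "!!h. norm h < dl ==> osc h < ennreal (eps / (C + 1))"
  using osc_small[of "eps / (C + 1)"] e C_nn by auto
 have "Linf_norm (%x. W (s, x) - W (t, x)) <= ennreal eps" if "\<bar>s - t\<bar> < dl" for s t
 proof (intro Linf_norm_le AE_I2)
  fix x :: "real^'n"
  have "ennreal \<bar>W (s, x) - W (t, x)\<bar> <= ennreal C * osc ((s, x) - (t, x))" by (rule W_diff_le)
  also have "... <= ennreal C * ennreal (eps / (C + 1))"
   using d(2)[of "(s - t, 0)"] that by (intro mult_left_mono) (auto simp: norm_Pair)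
  also have "... = ennreal (C * (eps / (C + 1)))" using C_nn e by (intro ennreal_mult[symmetric]) auto
  also have "... <= ennreal eps" using C_nn e by (intro ennreal_leI) (simp add: field_simps)
  finally show "\<bar>W (s, x) - W (t, x)\<bar> <= eps" using e by (simp add: ennreal_le_iff)
 qed simp
 then show "\<exists>dl>0. \<forall>s t. 0 < s & s < T & 0 < t & t < T & \<bar>s - t\<bar> < dl --> Linf_norm (%x. W (s, x) - W (t, x)) <= ennreal eps"
  using d(1) by blast
qed

text \<open>For almost every \<open>s\<close> the measure at time \<open>t - s\<close> has a
  density, so the integrand is a convolution with a function and may be computed with
  \<open>F\<close>, although \<open>g s\<close> agrees with it only almost everywhere. The L^1
  integral then comes from Tonelli, the L^infinity integral from
  \<open>approximable_convolution_Linf\<close>.\<close>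

lemma W_bochner:
 assumes N: "N : {L1_norm, Linf_norm}" and t: "0 < t" "t <= T"
  and g: "AE s in lborel. 0 < s & s < T --> g s : Bor & (AE y in lborel. g s y = F (s, y))"
 shows "has_bochner_integral_wrt N (lebesgue_on {0<..<t}) (%s. P_family Y (t - s) (g s)) (%x. W (t, x))"
proof -
 define H where "H = (%e. \<integral>y. K (t - fst e, snd e - y) * F (fst e, y) \<partial>lborel)"
 have Hm[measurable]: "H : Bor"
 proof -
  have "H : borel_measurable ((borel :: real measure) \<Otimes>\<^sub>M (borel :: (real^'n) measure))"
   unfolding H_def by (rule lborel.borel_measurable_lebesgue_integral) (simp add: split_beta')
  then show ?thesis by (simp add: borel_prod)
 qed
 have H0: "H (s, x) = 0" if "\<not> (0 < s & s < t)" for s x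
  using that F_out[of "(s, _)"] by (auto simp: H_def K_def)
 have eqh: "AE s in lebesgue_on {0<..<t}. P_family Y (t - s) (g s) = (%x. H (s, x))"
  unfolding AE_lebesgue_on[OF borel_open[OF open_greaterThanLessThan]]
  using lborel_AE_reflect[OF AE_Y_density, of t] g
 proof eventually_elim
  case (elim s)
  show ?case
  proof
   assume s: "s : {0<..<t}"
   then have g': "g s : Bor" "AE y in lborel. g s y = F (s, y)" using elim(2) t by auto
   show "P_family Y (t - s) (g s) = (%x. H (s, x))"
   proof
   fix x
   have "P_family Y (t - s) (g s) x = (LB y. ky (t - s, x - y) * g s y)"
   using elim(1) s g' ky_nonneg by (simp add: P_family_def measure_convolution_density)
   also have "... = H (s, x)" unfolding H_def fst_conv snd_conv
   proof (rule integral_cong_AE)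
   show "AE y in lborel. ky (t - s, x - y) * g s y = K (t - s, x - y) * F (s, y)"
   using g'(2) by eventually_elim (use s t in \<open>simp add: K_def\<close>)
   qed (use g' in simp_all)
   finally show "P_family Y (t - s) (g s) x = H (s, x)" .
   qed
  qed
 qed
 have W: "(%x. \<integral>s. H (s, x) \<partial>lebesgue_on {0<..<t}) = (%x. W (t, x))"
 proof
  fix x
  have [measurable]: "(%s. H (s, x)) : Bor"
   using slice_measurable(2)[OF Hm] by simp
  have "(\<integral>s. H (s, x) \<partial>lebesgue_on {0<..<t}) = (LB s. indicator {0<..<t} s * H (s, x))"
   by (subst integral_restrict_space) (auto simp: integral_completion)
  also have "... = (LB s. H (s, x))"
   using H0 by (intro Bochner_Integration.integral_cong) (auto split: split_indicator)
  also have "... = (\<integral>e. K ((t, x) - e) * F e \<partial>(lborel \<Otimes>\<^sub>M lborel))"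
   using KF_int[of "(t, x)"] unfolding H_def
   by (subst lborel_pair.integral_fst'[symmetric]) (simp_all add: lborel_prod)
  finally show "(\<integral>s. H (s, x) \<partial>lebesgue_on {0<..<t}) = W (t, x)" by (simp add: W_def lborel_prod)
 qed
 have "approximable N (lebesgue_on {0<..<t}) (%s. P_family Y (t - s) (g s)) (%x. W (t, x))"
 proof (cases "N = L1_norm")
  case True
  have "(NN s. indicator {0<..<t} s * (NN x. ennreal \<bar>H (s, x)\<bar>))
   <= (NN s. (NN x. (NN y. ennreal (K (t - s, x - y)) * ennreal (F (s, y)))))"
  proof (rule nn_integral_mono)
   fix s
   have "(NN x. ennreal \<bar>H (s, x)\<bar>) <= (NN x. (NN y. ennreal (K (t - s, x - y)) * ennreal (F (s, y))))"
   proof (rule nn_integral_mono)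
   fix x
   have "ennreal \<bar>H (s, x)\<bar> <= (NN y. ennreal \<bar>K (t - s, x - y) * F (s, y)\<bar>)"
   unfolding H_def fst_conv snd_conv by (rule ennreal_abs_integral_le) simp
   then show "ennreal \<bar>H (s, x)\<bar> <= (NN y. ennreal (K (t - s, x - y)) * ennreal (F (s, y)))"
   by (simp add: K_nn F_nn ennreal_mult)
   qed
   then show "indicator {0<..<t} s * (NN x. ennreal \<bar>H (s, x)\<bar>) <= (NN x. (NN y. ennreal (K (t - s, x - y)) * ennreal (F (s, y))))"
   by (auto split: split_indicator)
  qed
  also have "... = (NN x. (NN s. (NN y. ennreal (K (t - s, x - y)) * ennreal (F (s, y)))))"
  proof (rule lborel_pair.Fubini'[symmetric])
   have "(%q. \<integral>\<^sup>+y. ennreal (K (t - fst q, snd q - y)) * ennreal (F (fst q, y)) \<partial>lborel) : borel_measurable ((borel :: real measure) \<Otimes>\<^sub>M (borel :: (real^'n) measure))"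
   by (rule lborel.borel_measurable_nn_integral) (simp add: split_beta')
   then show "(%(s, x). \<integral>\<^sup>+y. ennreal (K (t - s, x - y)) * ennreal (F (s, y)) \<partial>lborel) : borel_measurable (lborel \<Otimes>\<^sub>M lborel)"
   by (simp add: split_beta' cong: measurable_cong_sets)
  qed
  also have "... = L1_norm (%x. W (t, x))"
   unfolding L1_norm_def by (intro nn_integral_cong) (simp add: W_nn W_nconv nconv_def joint_nn_integral(1))
  also have "... < \<infinity>" using W_normed(1)[of t] by (simp add: normed_functions_def)
  finally show ?thesis using approximable_joint_L1[OF Hm t(1) _ eqh] unfolding W True by simp
 next
  case False
  define kk where "kk = (%e. K (t - fst e, snd e))"
  have kkm: "kk : Bor" unfolding kk_def by measurable
  define q where "q = (%s. \<integral>\<^sup>+x. ennreal (K (s, x)) \<partial>lborel)"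
  have [measurable]: "q : Bor" unfolding q_def by (rule joint_nn_integral(2)) simp
  have "(NN s. indicator {0<..<t} s * (NN x. ennreal \<bar>kk (s, x)\<bar>)) <= (NN s. q (t - s))"
   by (intro nn_integral_mono) (auto simp: kk_def q_def K_nn split: split_indicator)
  also have "... = (NN s. q s)" by (rule nn_integral_lborel_reflect) simp
  also have "... = kmass (T + 1)" unfolding q_def nn_K[symmetric] by (rule joint_nn_integral(1)[symmetric]) simp
  also have "... < \<infinity>" by (rule kmass_finite)
  finally have 1: "(NN s. indicator {0<..<t} s * (NN x. ennreal \<bar>kk (s, x)\<bar>)) < \<infinity>" .
  have "(NN s. indicator {0<..<t} s * (NN x. ennreal \<bar>F (s, x)\<bar>)) <= (NN s. ennreal B * indicator {0<..<t} s)"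
   using F_slice by (intro nn_integral_mono_AE) (auto elim!: eventually_mono simp: F_nn split: split_indicator)
  also have "... < \<infinity>" using t by (subst nn_integral_cmult_indicator) (auto simp: ennreal_mult_less_top)
  finally have 2: "(NN s. indicator {0<..<t} s * (NN x. ennreal \<bar>F (s, x)\<bar>)) < \<infinity>" .
  have 3: "\<bar>F e\<bar> <= C" for e using F_nn[of e] F_le[of e] by simp
  have "(%x. H (s, x)) = (%x. \<integral>y. kk (s, x - y) * F (s, y) \<partial>lborel)" for s by (simp add: H_def kk_def)
  note H' = this
  have "approximable Linf_norm (lebesgue_on {0<..<t}) (%s. P_family Y (t - s) (g s))
   (%x. \<integral>s. (LB y. kk (s, x - y) * F (s, y)) \<partial>lebesgue_on {0<..<t})"
   by (rule approximable_convolution_Linf[OF kkm F_m t(1) 1 2 3 eqh[unfolded H']])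
  then show ?thesis using N False W by (simp add: H_def kk_def)
 qed
 then show ?thesis using N W_normed[of t] by (intro approximable_has_bochner_integral) auto
qed

end

section \<open>Estimates for Bochner integrals and continuity in time\<close>

lemma norm_diff_triangle:
 fixes f g h :: "real^'n => real"
 assumes "N : {L1_norm, Linf_norm}" "f : Bor" "g : Bor" "h : Bor"
 shows "N (%x. f x - h x) <= N (%x. f x - g x) + N (%x. g x - h x)"
 using norm_triangle[of N "%x. f x - g x" "%x. g x - h x"] assms by simp

lemma norm_scale_le:
 fixes f :: "real^'n => real"
 assumes N: "N : {L1_norm, Linf_norm}" and f[measurable]: "f : Bor" and c: "0 <= c"
 shows "N (%x. c * f x) <= ennreal c * N f"
proof -
 have 1: "ennreal \<bar>c * f x\<bar> = ennreal c * ennreal \<bar>f x\<bar>" for x using c by (simp add: abs_mult ennreal_mult)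
 show ?thesis
 proof (cases "N = L1_norm")
  case True
  then show ?thesis by (simp add: L1_norm_def 1 nn_integral_cmult)
 next
  case False
  have "AE x in lborel. ennreal \<bar>c * f x\<bar> <= ennreal c * Linf_norm f"
   using Linf_norm_AE[of f] unfolding 1 by (auto elim!: eventually_mono intro: mult_left_mono)
  then have "Linf_norm (%x. c * f x) <= ennreal c * Linf_norm f"
   unfolding Linf_norm_def by (intro esssup_I) simp_all
  then show ?thesis using N False by auto
 qed
qed

lemma norm_sum_le:
 fixes A :: "(real^'n => real) set"
 assumes N: "N : {L1_norm, Linf_norm}" and "finite A" and "!!f. f : A ==> f : Bor" and c: "!!f. 0 <= c f"
 shows "N (%x. \<Sum>f\<in>A. c f * f x) <= (\<Sum>f\<in>A. ennreal (c f) * N f)"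
 using assms(2,3)
proof (induction A rule: finite_induct)
 case empty
 then show ?case using norm_minus(3)[OF N] by simp
next
 case (insert f A)
 have m: "f : Bor" "(%x. \<Sum>f\<in>A. c f * f x) : Bor"
  using insert by (auto intro!: borel_measurable_sum)
 have "N (%x. c f * f x + (\<Sum>f\<in>A. c f * f x)) <= N (%x. c f * f x) + N (%x. \<Sum>f\<in>A. c f * f x)"
  using m by (intro norm_triangle[OF N]) auto
 also have "... <= ennreal (c f) * N f + (\<Sum>f\<in>A. ennreal (c f) * N f)"
  using insert m by (intro add_mono norm_scale_le[OF N _ c]) auto
 finally show ?case using insert by simp
qed

text \<open>Over the finitely many level sets the integral is a finite sum with the measures of
  these sets as coefficients, and the norm inequality is the triangle inequality for that
  sum.\<close>

lemma simple_integral_norm_le: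
 fixes g :: "real => real^'n => real"
 assumes N: "N : {L1_norm, Linf_norm}" and g: "simple_wrt N (lebesgue_on {0<..<T}) g" and T: "0 < T"
 shows "(%x. \<integral>t. g t x \<partial>lebesgue_on {0<..<T}) : Bor \<and>
  N (%x. \<integral>t. g t x \<partial>lebesgue_on {0<..<T}) <= (\<integral>\<^sup>+t. N (g t) \<partial>lebesgue_on {0<..<T})"
proof -
 let ?M = "lebesgue_on {0<..<T}"
 have sf: "simple_function ?M g" and gb: "!!t. t : {0<..<T} ==> g t : Bor" using g by (auto simp: simple_wrt_def normed_functions_def)
 have fin: "finite (g ` {0<..<T})" using simple_functionD(1)[OF sf] by simp
 define c where "c = (%f. emeasure ?M (g -` {f} \<inter> {0<..<T}))"
 have cm: "g -` {f} \<inter> {0<..<T} : sets ?M" for f using simple_functionD(2)[OF sf, of "{f}"] by simp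
 have cfin: "c f < \<infinity>" for f
 proof -
  have "c f <= emeasure ?M {0<..<T}" unfolding c_def by (intro emeasure_mono) auto
  also have "... < \<infinity>" using T by (simp add: emeasure_restrict_space)
  finally show ?thesis .
 qed
 have val: "g t x = (\<Sum>f\<in>g ` {0<..<T}. indicator (g -` {f} \<inter> {0<..<T}) t * f x)" if "t : {0<..<T}" for t x
 proof -
  have "(\<Sum>f\<in>g ` {0<..<T}. indicator (g -` {f} \<inter> {0<..<T}) t * f x) = (\<Sum>f\<in>g ` {0<..<T}. if f = g t then f x else 0)"
   using that by (intro sum.cong) (auto split: split_indicator)
  then show ?thesis using fin that by (simp add: sum.delta)
 qed
 have "(\<integral>t. g t x \<partial>?M) = (\<Sum>f\<in>g ` {0<..<T}. enn2real (c f) * f x)" for x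
 proof -
  have "(\<integral>t. g t x \<partial>?M) = (\<integral>t. (\<Sum>f\<in>g ` {0<..<T}. indicator (g -` {f} \<inter> {0<..<T}) t * f x) \<partial>?M)"
   using val by (intro Bochner_Integration.integral_cong) auto
  also have "... = (\<Sum>f\<in>g ` {0<..<T}. (\<integral>t. indicator (g -` {f} \<inter> {0<..<T}) t * f x \<partial>?M))"
   using cm cfin by (intro Bochner_Integration.integral_sum integrable_mult_left integrable_real_indicator) (auto simp: c_def)
  also have "... = (\<Sum>f\<in>g ` {0<..<T}. enn2real (c f) * f x)"
   using cm by (intro sum.cong refl) (simp add: c_def measure_def)
  finally show ?thesis .
 qed
 note gi = this
 have m: "(%x. \<integral>t. g t x \<partial>?M) : Bor" unfolding gi using gb by (auto intro!: borel_measurable_sum)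
 have "N (%x. \<integral>t. g t x \<partial>?M) <= (\<Sum>f\<in>g ` {0<..<T}. ennreal (enn2real (c f)) * N f)"
  unfolding gi using fin gb by (intro norm_sum_le[OF N]) auto
 also have "... = (\<Sum>f\<in>g ` {0<..<T}. c f * N f)" using cfin by simp
 also have "... = (\<integral>\<^sup>+t. N (g t) \<partial>?M)"
 proof -
  have "(\<integral>\<^sup>+t. N (g t) \<partial>?M) = (\<integral>\<^sup>+t. (\<Sum>f\<in>g ` {0<..<T}. N f * indicator (g -` {f} \<inter> {0<..<T}) t) \<partial>?M)"
  proof (intro nn_integral_cong)
   fix t assume t: "t : space ?M"
   have "(\<Sum>f\<in>g ` {0<..<T}. N f * indicator (g -` {f} \<inter> {0<..<T}) t) = (\<Sum>f\<in>g ` {0<..<T}. if f = g t then N f else 0)"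
   using t by (intro sum.cong) (auto split: split_indicator)
   then show "N (g t) = (\<Sum>f\<in>g ` {0<..<T}. N f * indicator (g -` {f} \<inter> {0<..<T}) t)"
   using fin t by (simp add: sum.delta)
  qed
  also have "... = (\<Sum>f\<in>g ` {0<..<T}. N f * c f)"
   using cm by (subst nn_integral_sum) (auto simp: nn_integral_cmult_indicator c_def intro!: borel_measurable_times borel_measurable_indicator)
  finally show ?thesis by (simp add: mult.commute)
 qed
 finally show ?thesis using m by blast
qed

text \<open>For step functions the inequality is a finite triangle inequality, and both integrals
  are limits of such. The case \<open>h1 = h2\<close> with \<open>G = 0\<close> shows that the
  integral is unique up to norm zero.\<close>

lemma bochner_integral_diff_le:
 fixes h1 h2 :: "real => real^'n => real"
 assumes N: "N : {L1_norm, Linf_norm}" and w1: "has_bochner_integral_wrt N (lebesgue_on {0<..<T}) h1 w1"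
  and w2: "has_bochner_integral_wrt N (lebesgue_on {0<..<T}) h2 w2" and T: "0 < T"
  and G: "G : borel_measurable (lebesgue_on {0<..<T})" "AE t in lebesgue_on {0<..<T}. N (%x. h1 t x - h2 t x) <= G t"
 shows "N (%x. w1 x - w2 x) <= (\<integral>\<^sup>+t. G t \<partial>lebesgue_on {0<..<T})"
proof -
 let ?M = "lebesgue_on {0<..<T}"
 obtain r where r: "!!k. simple_wrt N ?M (r k)" "(%k. \<integral>\<^sup>+t. N (%x. h1 t x - r k t x) \<partial>?M) ~~> 0"
  "(%k. N (%x. w1 x - (\<integral>t. r k t x \<partial>?M))) ~~> 0"
  using w1 unfolding has_bochner_integral_wrt_def by blast
 obtain s where s: "!!k. simple_wrt N ?M (s k)" "(%k. \<integral>\<^sup>+t. N (%x. h2 t x - s k t x) \<partial>?M) ~~> 0"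
  "(%k. N (%x. w2 x - (\<integral>t. s k t x \<partial>?M))) ~~> 0"
  using w2 unfolding has_bochner_integral_wrt_def by blast
 have wm: "w1 : Bor" "w2 : Bor"
  using w1 w2 by (auto simp: has_bochner_integral_wrt_def normed_functions_def)
 have sm: "(%t. N (%x. h t x - q t x)) : borel_measurable ?M"
  if "strongly_measurable_wrt N ?M h" "simple_wrt N ?M q" for h q :: "real => real^'n => real"
 proof -
  have "strongly_measurable_wrt N ?M (%t x. h t x + - q t x)"
  proof (intro strongly_measurable_add[OF N] strongly_measurable_uminus[OF N] that(1))
   show "strongly_measurable_wrt N ?M q"
   unfolding strongly_measurable_wrt_def using that(2) norm_minus(3)[OF N]
   by (intro exI[of _ "%_. q"]) (auto simp: simple_wrt_def intro!: AE_I2)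
  qed
  from strongly_measurable_norm[OF N _ this] show ?thesis by simp
 qed
 have hm: "strongly_measurable_wrt N ?M h1" "strongly_measurable_wrt N ?M h2"
  using w1 w2 by (auto simp: has_bochner_integral_wrt_def)
 have hb': "AE t in ?M. h t : Bor" if h: "strongly_measurable_wrt N ?M h" for h :: "real => real^'n => real"
 proof -
  obtain q :: "nat => real => real^'n => real"
   where "AE t in ?M. h t : normed_functions N & (%k. N (%x. h t x - q k t x)) ~~> 0"
   using h unfolding strongly_measurable_wrt_def by blast
  then show ?thesis by eventually_elim (simp add: normed_functions_def)
 qed
 note hb = hb'[OF hm(1)] hb'[OF hm(2)]
 show ?thesis
 proof (rule LIMSEQ_le_const)
  let ?a = "%k. N (%x. w1 x - (\<integral>t. r k t x \<partial>?M))" and ?a' = "%k. N (%x. w2 x - (\<integral>t. s k t x \<partial>?M))"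
  let ?b = "%k. (\<integral>\<^sup>+t. N (%x. h1 t x - r k t x) \<partial>?M)" and ?b' = "%k. (\<integral>\<^sup>+t. N (%x. h2 t x - s k t x) \<partial>?M)"
  let ?I = "\<integral>\<^sup>+t. G t \<partial>?M"
  show "(%k. ?a k + ((?b k + (?I + ?b' k)) + ?a' k)) ~~> ?I"
   using tendsto_add[OF r(3) tendsto_add[OF tendsto_add[OF r(2) tendsto_add[OF tendsto_const[of ?I] s(2)]] s(3)]] by simp
  show "\<exists>n0. \<forall>k\<ge>n0. N (%x. w1 x - w2 x) <= ?a k + ((?b k + (?I + ?b' k)) + ?a' k)"
  proof (intro exI allI impI)
   fix k
   have nf: "(%x. f x - f' x) : normed_functions N" if "f : normed_functions N" "f' : normed_functions N" for f f' :: "real^'n => real"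
   proof -
   have m: "f : Bor" "f' : Bor" using that by (auto simp: normed_functions_def)
   have "N (%x. f x + (- f' x)) <= N f + N (%x. - f' x)" using m by (intro norm_triangle[OF N]) auto
   also have "... < \<infinity>" using that norm_minus(1)[OF N, of f'] by (auto simp: normed_functions_def)
   finally show ?thesis using m by (simp add: normed_functions_def)
   qed
   have d: "simple_wrt N ?M (%t x. r k t x - s k t x)"
   using simple_function_compose2[of ?M "r k" "s k" "%a b x. a x - b x"] s(1)[of k] r(1)[of k] nf by (auto simp: simple_wrt_def)
   note stp = simple_integral_norm_le[OF N d T] simple_integral_norm_le[OF N s(1)[of k] T] simple_integral_norm_le[OF N r(1)[of k] T]
   let ?s = "%x. \<integral>t. s k t x \<partial>?M" and ?r = "%x. \<integral>t. r k t x \<partial>?M"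
   have rf: "simple_function ?M (r k)" "simple_function ?M (s k)" using r(1)[of k] s(1)[of k] by (auto simp: simple_wrt_def)
   have "?r x - ?s x = (\<integral>t. r k t x - s k t x \<partial>?M)" for x
   by (rule Bochner_Integration.integral_diff[symmetric, OF simple_step_integrable[OF rf(1)] simple_step_integrable[OF rf(2)]])
   then have "N (%x. ?r x - ?s x) = N (%x. \<integral>t. r k t x - s k t x \<partial>?M)" by simp
   also have "... <= (\<integral>\<^sup>+t. N (%x. r k t x - s k t x) \<partial>?M)" using stp(1) by blast
   also have "... <= (\<integral>\<^sup>+t. N (%x. h1 t x - r k t x) + (G t + N (%x. h2 t x - s k t x)) \<partial>?M)"
   proof (rule nn_integral_mono_AE)
   show "AE t in ?M. N (%x. r k t x - s k t x) <= N (%x. h1 t x - r k t x) + (G t + N (%x. h2 t x - s k t x))"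
   using G(2) hb AE_space
   proof eventually_elim
   case (elim t)
   have m: "r k t : Bor" "s k t : Bor"
   using r(1)[of k] s(1)[of k] elim by (auto simp: simple_wrt_def normed_functions_def)
   have "N (%x. r k t x - s k t x) <= N (%x. r k t x - h1 t x) + N (%x. h1 t x - s k t x)"
   by (rule norm_diff_triangle[OF N]) (use m elim in auto)
   also have "N (%x. h1 t x - s k t x) <= N (%x. h1 t x - h2 t x) + N (%x. h2 t x - s k t x)"
   by (rule norm_diff_triangle[OF N]) (use m elim in auto)
   also have "N (%x. r k t x - h1 t x) = N (%x. h1 t x - r k t x)" by (rule norm_minus(2)[OF N])
   finally show ?case using elim(1) by (auto intro: order_trans add_left_mono add_right_mono)
   qed
   qed
   also have "... = ?b k + (?I + ?b' k)"
   using sm[OF hm(1) r(1)] sm[OF hm(2) s(1)] G(1) by (subst nn_integral_add, auto simp: nn_integral_add)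
   finally have 1: "N (%x. ?r x - ?s x) <= ?b k + (?I + ?b' k)" .
   have "N (%x. w1 x - w2 x) <= ?a k + N (%x. ?r x - w2 x)"
   by (rule norm_diff_triangle[OF N]) (use wm stp in auto)
   also have "N (%x. ?r x - w2 x) <= N (%x. ?r x - ?s x) + N (%x. ?s x - w2 x)"
   by (rule norm_diff_triangle[OF N]) (use wm stp in auto)
   also have "N (%x. ?s x - w2 x) = ?a' k" by (rule norm_minus(2)[OF N])
   also note 1
   finally show "N (%x. w1 x - w2 x) <= ?a k + ((?b k + (?I + ?b' k)) + ?a' k)"
   by (auto simp: add_left_mono add_right_mono)
  qed
 qed
qed

lemma continuous_wrt_sequentially:
 assumes N: "N : {L1_norm, Linf_norm}" and v: "continuous_wrt N J v" "t : J" "!!n. X n : J" "X ~~> t"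
 shows "(%n. N (%x. v (X n) x - v t x)) ~~> 0"
proof -
 have "continuous (at t within J) (%s. N (%x. v s x - v t x))"
  using v(1,2) norm_minus(3)[OF N] by (simp add: continuous_wrt_def continuous_within)
 from continuous_within_tendsto_compose'[OF this v(3,4)] show ?thesis using norm_minus(3)[OF N] by simp
qed

lemma continuous_wrtI_sequentially:
 assumes "!!t. t : J ==> v t : normed_functions N"
  and "!!t X. t : J ==> (!!n. X n : J) ==> X ~~> t ==> (%n. N (%x. v (X n) x - v t x)) ~~> 0"
 shows "continuous_wrt N J v"
 using assms unfolding continuous_wrt_def tendsto_at_iff_sequentially comp_def by (auto simp: comp_def)

text \<open>Unbounded norms would occur along a sequence of times; a convergent subsequence in the
  compact interval contradicts continuity at its limit.\<close>

lemma continuous_wrt_bounded: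
 assumes N: "N : {L1_norm, Linf_norm}" and v: "continuous_wrt N {0..T} v"
 obtains M :: real where "0 <= M" "!!t. 0 <= t ==> t <= T ==> N (v t) <= ennreal M"
proof (rule ccontr)
 assume *: "\<not> thesis"
 have "\<exists>t\<in>{0..T}. \<not> N (v t) <= ennreal (real n)" for n
 proof (rule ccontr)
  assume "\<not> (\<exists>t\<in>{0..T}. \<not> N (v t) <= ennreal (real n))"
  then have "0 <= t ==> t <= T ==> N (v t) <= ennreal (real n)" for t by auto
  from that[OF _ this] * show False by simp
 qed
 then obtain X where X: "!!n. X n : {0..T}" "!!n. \<not> N (v (X n)) <= ennreal (real n)" by metis
 obtain l r where l: "l : {0..T}" "strict_mono r" "(X \<circ> r) ~~> l"
  using compact_Icc[of 0 T] X(1) unfolding compact_eq_seq_compact_metric seq_compact_def by metis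
 have "(%n. N (%x. v (X (r n)) x - v l x)) ~~> 0"
  using continuous_wrt_sequentially[OF N v l(1), of "X \<circ> r"] X l(3) by (simp add: comp_def)
 from order_tendstoD(2)[OF this, of 1] have ev: "eventually (%n. N (%x. v (X (r n)) x - v l x) < 1) sequentially" by simp
 have nf: "v t : normed_functions N" if "t : {0..T}" for t using v that by (auto simp: continuous_wrt_def)
 obtain c where c: "N (v l) = ennreal c" "0 <= c" using nf[OF l(1)] by (cases "N (v l)") (auto simp: normed_functions_def)
 have "eventually (%n. real n <= 1 + c) sequentially" using ev
 proof eventually_elim
  case (elim n)
  have m: "v l : Bor" "v (X (r n)) : Bor"
   using nf[OF l(1)] nf[OF X(1)] by (auto simp: normed_functions_def)
  have "N (%x. (v (X (r n)) x - v l x) + v l x) <= N (%x. v (X (r n)) x - v l x) + N (v l)"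
   using m by (intro norm_triangle[OF N]) auto
  also have "... <= ennreal 1 + ennreal c" using elim c by (intro add_mono) auto
  also have "... = ennreal (1 + c)" using c by (intro ennreal_plus[symmetric]) auto
  finally have "N (v (X (r n))) <= ennreal (1 + c)" by simp
  then have "\<not> ennreal (1 + c) <= ennreal (real (r n))" using X(2)[of "r n"] by (meson order_trans)
  then have "real (r n) < 1 + c" using ennreal_leI by (meson not_le)
  moreover have "n <= r n" by (rule seq_suble[OF l(2)])
  ultimately show ?case by linarith
 qed
 moreover have "eventually (%n. 1 + c < real n) sequentially"
  using filterlim_real_sequentially by (simp add: filterlim_at_top_dense)
 ultimately have "eventually (%n. False) sequentially" by eventually_elim simp
 then show False by simp
qed

lemma strongly_measurable_cong:
 assumes "strongly_measurable_wrt N M g" "AE t in M. h t = g t"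
 shows "strongly_measurable_wrt N M h"
proof -
 obtain s where s: "\<forall>k. simple_wrt N M (s k)" "AE t in M. g t : normed_functions N & (%k. N (%x. g t x - s k t x)) ~~> 0"
  using assms(1) unfolding strongly_measurable_wrt_def by blast
 have "AE t in M. h t : normed_functions N & (%k. N (%x. h t x - s k t x)) ~~> 0"
  using s(2) assms(2) by eventually_elim simp
 then show ?thesis unfolding strongly_measurable_wrt_def using s(1) by blast
qed

text \<open>For the mild equation at time 0, where the interval of integration is empty.\<close>

lemma bochner_empty:
 fixes h :: "real => real^'n => real"
 assumes N: "N : {L1_norm, Linf_norm}"
 shows "has_bochner_integral_wrt N (lebesgue_on {0<..<0}) h (%x. 0)"
proof -
 have sp: "space (lebesgue_on {0<..<0 :: real}) = {}" by simp
 have "simple_wrt N (lebesgue_on {0<..<0}) (%t x. 0)" by (simp add: simple_wrt_def simple_function_def)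
 moreover have "AE t in lebesgue_on {0<..<0 :: real}. P t" for P by (rule AE_I2) simp
 ultimately show ?thesis
  unfolding has_bochner_integral_wrt_def strongly_measurable_wrt_def
  using norm_minus(3)[OF N] nn_integral_empty[OF sp]
  by (auto simp: normed_functions_def intro!: exI[of _ "%_ _ _. 0"])
qed

lemma X_norm_less_top: "f : L1 \<inter> Linf ==> integrable lborel f"
 by (intro integrableI_bounded) (auto simp: normed_functions_def L1_norm_def)

section \<open>The linear family on initial data\<close>

context mild_setting
begin

lemma S_family_Z0:
 assumes "g : Bor" "0 <= t"
 shows "S_family Z t g = measure_convolution (Z0 t) g"
 using assms by (auto simp: S_family_def Z0_def measure_convolution_def integral_return)

lemma Z0_finite: "finite_measure (Z0 t)" and Z0_mass: "emeasure (Z0 t) UNIV = 1"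
 using prob_space.finite_measure[OF prob_Z0] prob_space.emeasure_space_1[OF prob_Z0, of t] sets_eq_imp_space_eq[OF sets_Z0, of t] by auto

lemma S_measurable:
 assumes "g : Bor" "0 <= t"
 shows "S_family Z t g : Bor"
 unfolding S_family_Z0[OF assms] by (rule measure_convolution_measurable[OF Z0_finite sets_Z0 assms(1)])

lemma shift_integrable:
 assumes g[measurable]: "g : Bor" and R: "!!x. 0 <= g x" "!!x. g x <= (R :: real)"
 shows "integrable (Z0 t) (%y. g (x - y))"
proof -
 interpret prob_space "Z0 t" by (rule prob_Z0)
 have "(%y. g (x - y)) : borel_measurable (Z0 t)" by (simp add: measurable_cong_sets[OF sets_Z0 refl])
 then show ?thesis using R by (intro integrable_const_bound[of _ R]) auto
qed

lemma S_bounds: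
 assumes g: "g : Bor" and R: "!!x. 0 <= g x" "!!x. g x <= R" and t: "0 <= t"
 shows "0 <= S_family Z t g x" "S_family Z t g x <= R"
proof -
 interpret prob_space "Z0 t" by (rule prob_Z0)
 show "0 <= S_family Z t g x"
  unfolding S_family_Z0[OF g t] measure_convolution_def using R by (intro integral_nonneg_AE) simp
 show "S_family Z t g x <= R"
  unfolding S_family_Z0[OF g t] measure_convolution_def using R
  by (intro integral_le_const shift_integrable[OF g]) auto
qed

lemma S_mono:
 assumes f: "f : Bor" "!!x. 0 <= f x" and g: "g : Bor" "!!x. g x <= R"
  and fg: "!!x. f x <= g x" and t: "0 <= t"
 shows "S_family Z t f x <= S_family Z t g x"
 unfolding S_family_Z0[OF f(1) t] S_family_Z0[OF g(1) t] measure_convolution_def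
 using fg f(2) g(2) by (intro integral_mono shift_integrable[of _ R] f(1) g(1)) (auto intro: order_trans)

lemma S_L1_diff:
 assumes f: "integrable lborel f" and g: "integrable lborel g" and t: "0 <= t"
 shows "L1_norm (%x. S_family Z t f x - S_family Z t g x) <= L1_norm (%x. f x - g x)"
proof -
 have m: "f : Bor" "g : Bor" using f g by auto
 show ?thesis unfolding S_family_Z0[OF m(1) t] S_family_Z0[OF m(2) t] L1_norm_def
  using L1_convolution_diff_le[OF Z0_finite sets_Z0 f g, of t] by (simp add: Z0_mass)
qed

lemma S_cong_AE:
 assumes f: "integrable lborel f" and g: "integrable lborel g" and t: "0 <= t" and fg: "AE x in lborel. f x = g x"
 shows "AE x in lborel. S_family Z t f x = S_family Z t g x"
proof -
 have m: "f : Bor" "g : Bor" using f g by auto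
 have "L1_norm (%x. f x - g x) = 0" using fg m by (subst norm_eq_0_iff) auto
 then have "L1_norm (%x. S_family Z t f x - S_family Z t g x) = 0" using S_L1_diff[OF f g t] by simp
 then show ?thesis using S_measurable[OF m(1) t] S_measurable[OF m(2) t] by (subst (asm) norm_eq_0_iff) auto
qed

lemma S_L1_sequentially:
 assumes g: "integrable lborel g" "!!x. 0 <= g x" and X: "X ~~> t" "!!n. 0 <= X n"
 shows "(%n. L1_norm (%x. S_family Z (X n) g x - S_family Z t g x)) ~~> 0"
proof -
 have m: "g : Bor" using g by auto
 have t: "0 <= t" using LIMSEQ_le_const[OF X(1)] X(2) by blast
 show ?thesis
  unfolding S_family_Z0[OF m t] S_family_Z0[OF m X(2)] L1_norm_def
  by (rule weak_convergence_imp_L1_convolution[OF prob_Z0 prob_Z0 sets_Z0 sets_Z0 _ g]) (rule Z0_weakly_continuous[OF _ _ X])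
qed

text \<open>\<open>u0\<close> is the given representative, on which \<open>S_family\<close> acts
  pointwise; \<open>f\<close> is a representative with both bounds valid everywhere, which drives
  the iteration. They are kept apart so that \<open>u0\<close> can be exchanged for a continuous
  version without changing \<open>V\<close>.\<close>

definition datum :: "(real^'n => real) => (real^'n => real) => real => bool" where
 "datum u0 f R0 \<longleftrightarrow> integrable lborel u0 & integrable lborel f & (\<forall>x. 0 <= f x & f x <= R0) & (AE x in lborel. u0 x = f x)"

lemma datumD:
 assumes "datum u0 f R0"
 shows "integrable lborel u0" "integrable lborel f" "u0 : Bor" "f : Bor"
  "0 <= f x" "f x <= R0" "AE x in lborel. u0 x = f x" "0 <= R0"
  "(NN x. ennreal (f x)) = ennreal (LB x. f x)"
proof -
 show "integrable lborel u0" "integrable lborel f" "AE x in lborel. u0 x = f x" "0 <= f x" "f x <= R0"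
  using assms by (auto simp: datum_def)
 then show "u0 : Bor" "f : Bor" "0 <= R0" by auto
 show "(NN x. ennreal (f x)) = ennreal (LB x. f x)"
  using assms by (intro nn_integral_eq_integral) (auto simp: datum_def)
qed

lemma S_datum_AE: "datum u0 f R0 ==> 0 <= t ==> AE x in lborel. S_family Z t u0 x = S_family Z t f x"
 by (rule S_cong_AE[OF datumD(1) datumD(2) _ datumD(7)])

lemma S_datum_normed:
 assumes D: "datum u0 f R0" and t: "0 <= t"
 shows "S_family Z t u0 : normed_functions L1_norm" "S_family Z t u0 : normed_functions Linf_norm" "Linf_norm (S_family Z t u0) <= ennreal R0"
proof -
 have m: "S_family Z t u0 : Bor" by (rule S_measurable[OF datumD(3)[OF D] t])
 have "L1_norm (%x. S_family Z t u0 x - S_family Z t (%_. 0) x) <= L1_norm (%x. u0 x - 0)"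
  by (rule S_L1_diff[OF datumD(1)[OF D] _ t]) simp
 moreover have "S_family Z t (%_. 0) x = 0" for x by (simp add: S_family_def measure_convolution_def)
 moreover have "L1_norm u0 < \<infinity>" using datumD(1)[OF D] by (simp add: L1_norm_def integrable_iff_bounded)
 ultimately show "S_family Z t u0 : normed_functions L1_norm" using m by (simp add: normed_functions_def)
 show b: "Linf_norm (S_family Z t u0) <= ennreal R0"
  using S_datum_AE[OF D t] S_bounds[OF datumD(4)[OF D] datumD(5)[OF D] datumD(6)[OF D] t]
  by (intro Linf_norm_le[OF m]) (auto elim!: eventually_mono)
 then have "Linf_norm (S_family Z t u0) < \<infinity>" by (rule le_less_trans) simp
 then show "S_family Z t u0 : normed_functions Linf_norm" using m by (simp add: normed_functions_def)
qed

text \<open>The identity holds at every \<open>x\<close> although \<open>u0\<close> and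
  \<open>f\<close> agree only almost everywhere, because a measure with a density does not see null
  sets.\<close>

lemma S_kernel:
 assumes D: "datum u0 f R0"
 shows "AE t in lborel. 0 < t --> S_family Z t u0 = (%x. \<integral>y. kz (t, x - y) * f y \<partial>lborel)"
 using AE_Z_density
proof eventually_elim
 case (elim t)
 note [measurable] = datumD(3)[OF D] datumD(4)[OF D]
 show ?case
 proof (intro impI ext)
  fix x assume t: "0 < t"
  then have "S_family Z t u0 x = (LB y. kz (t, x - y) * u0 y)"
   using elim datumD(3)[OF D] kz_nonneg by (simp add: S_family_def measure_convolution_density)
  also have "... = (LB y. kz (t, x - y) * f y)"
   using datumD(7)[OF D] by (intro integral_cong_AE) (auto elim!: eventually_mono)
  finally show "S_family Z t u0 x = (LB y. kz (t, x - y) * f y)" .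
 qed
qed

lemma S_eq_A:
 assumes D: "datum u0 f R0"
 shows "AE t in lborel. 0 < t --> (\<forall>x. A f (t, x) = ennreal (S_family Z t u0 x))"
 using S_kernel[OF D] kz_mass
proof eventually_elim
 case (elim t)
 note [measurable] = datumD(4)[OF D]
 show ?case
 proof (intro impI allI)
  fix x assume t: "0 < t"
  have eq: "A f (t, x) = (NN y. ennreal (kz (t, x - y) * f y))"
   by (simp add: A_def ennreal_mult kz_nonneg datumD(5)[OF D])
  have "A f (t, x) <= (NN y. ennreal (kz (t, x - y)) * ennreal R0)"
   unfolding A_def fst_conv snd_conv by (intro nn_integral_mono mult_left_mono ennreal_leI datumD(6)[OF D]) simp
  also have "... = (NN y. ennreal (kz (t, x - y))) * ennreal R0" by (rule nn_integral_multc) simp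
  also have "(NN y. ennreal (kz (t, x - y))) = 1"
   using elim(2) t by (subst nn_integral_lborel_reflect[of "%y. ennreal (kz (t, y))"]) simp_all
  finally have "(NN y. ennreal (kz (t, x - y) * f y)) < \<infinity>" unfolding eq by (auto intro: le_less_trans)
  then have "integrable lborel (%y. kz (t, x - y) * f y)"
   by (intro integrableI_nonneg) (auto simp: kz_nonneg datumD(5)[OF D])
  then show "A f (t, x) = ennreal (S_family Z t u0 x)"
   using elim(1) t unfolding eq by (subst nn_integral_eq_integral) (auto simp: kz_nonneg datumD(5)[OF D])
 qed
qed

text \<open>A convolution with the space-time kernel \<open>kz\<close> whose second factor is
  constant in time, so the approximation result for L^infinity applies.\<close>

lemma S_strongly_measurable:
 assumes D: "datum u0 f R0" and T: "0 < T"
 shows "strongly_measurable_wrt Linf_norm (lebesgue_on {0<..<T}) (%t. S_family Z t u0)"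
proof (rule approximable_strongly_measurable[OF _ approximable_convolution_Linf[where k = kz and f = "%e. f (snd e)" and R = R0]])
 note [measurable] = datumD(4)[OF D]
 show "(%e. f (snd e)) : borel_measurable (borel :: (real \<times> (real^'n)) measure)" by measurable
 have "(NN t. indicator {0<..<T} t * (NN x. ennreal \<bar>kz (t, x)\<bar>)) <= (NN t. 1 * indicator {0<..<T} t)"
  using kz_mass by (intro nn_integral_mono_AE) (auto elim!: eventually_mono simp: kz_nonneg split: split_indicator)
 also have "... < \<infinity>" using T by simp
 finally show "(NN t. indicator {0<..<T} t * (NN x. ennreal \<bar>kz (t, x)\<bar>)) < \<infinity>" .
 have "(NN t. indicator {0<..<T} t * (NN x. ennreal \<bar>f (snd (t, x))\<bar>)) = (NN t. ennreal (LB x. f x) * indicator {0<..<T} t)"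
  by (simp add: datumD(5)[OF D] datumD(9)[OF D] mult.commute)
 also have "... < \<infinity>" using T by (subst nn_integral_cmult_indicator) (auto simp: ennreal_mult_less_top)
 finally show "(NN t. indicator {0<..<T} t * (NN x. ennreal \<bar>f (snd (t, x))\<bar>)) < \<infinity>" .
 show "\<bar>f (snd e)\<bar> <= R0" for e :: "real \<times> (real^'n)" using datumD(5,6)[OF D, of "snd e"] by simp
 show "AE t in lebesgue_on {0<..<T}. S_family Z t u0 = (%x. \<integral>y. kz (t, x - y) * f (snd (t, y)) \<partial>lborel)"
  using S_kernel[OF D] unfolding AE_lebesgue_on[OF borel_open[OF open_greaterThanLessThan]] by (auto elim!: eventually_mono)
qed (use T in simp_all)

end

section \<open>From the fixed point to mild solutions\<close>

context source
begin

lemma W_L1_sequentially: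
 assumes X: "X ~~> t"
 shows "(%n. L1_norm (%x. W (X n, x) - W (t, x))) ~~> 0"
proof (rule ennreal_tendsto_0_le)
 show "L1_norm (%x. W (X n, x) - W (t, x)) <= ennreal B * osc (X n - t, 0)" for n by (rule W_diff_L1)
 have "(%n. osc (X n - t, 0)) ~~> 0"
 proof (rule order_tendstoI)
  fix a :: ennreal assume a: "0 < a"
  obtain eps where e: "0 < eps" "ennreal eps <= a"
  proof (cases a)
   case (real r)
   then show ?thesis using a that[of r] by simp
  qed (use that[of 1] in simp)
  obtain dl where d: "0 < dl" "!!h. norm h < dl ==> osc h < ennreal eps" using osc_small[OF e(1)] by blast
  have "eventually (%n. dist (X n) t < dl) sequentially" using X d(1) by (rule tendstoD)
  then show "eventually (%n. osc (X n - t, 0) < a) sequentially"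
   by eventually_elim (use d(2) e(2) in \<open>auto simp: norm_Pair dist_norm intro!: less_le_trans[OF d(2)]\<close>)
 qed simp
 then have "(%n. ennreal B * osc (X n - t, 0)) ~~> ennreal B * 0" by (intro ennreal_tendsto_cmult) auto
 then show "(%n. ennreal B * osc (X n - t, 0)) ~~> 0" by simp
qed

text \<open>Continuity in L^1 comes from weak continuity of \<open>Z0\<close> for the linear part,
  through the nonnegative representative \<open>f\<close>, and from the oscillation of the kernel
  for \<open>W\<close>; \<open>W_bochner\<close> supplies the equation in both norms.\<close>

lemma mild_solutionI:
 assumes D: "datum u0 f R0" and u: "!!t x. 0 <= t ==> t <= T ==> u t x = S_family Z t u0 x + W (t, x)"
  and uF: "AE s in lborel. 0 < s & s < T --> (AE y in lborel. (max 0 (u s y)) powr p = F (s, y))"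
 shows "mild_solution Z Y p u0 T u"
proof -
 have ueq: "u t = (%x. S_family Z t u0 x + W (t, x))" if "0 <= t" "t <= T" for t using u that by auto
 have nf: "u t : normed_functions N" "S_family Z t u0 : normed_functions N"
  if N: "N : {L1_norm, Linf_norm}" and t: "0 <= t" "t <= T" for N t
 proof -
  have a: "S_family Z t u0 : normed_functions N" "(%x. W (t, x)) : normed_functions N"
   using N S_datum_normed[OF D t(1)] W_normed[of t] by auto
  show "S_family Z t u0 : normed_functions N" by (rule a)
  have m: "S_family Z t u0 : Bor" using a by (simp add: normed_functions_def)
  have "N (u t) <= N (S_family Z t u0) + N (%x. W (t, x))" unfolding ueq[OF t] using m by (intro norm_triangle[OF N]) auto
  also have "... < \<infinity>" using a by (simp add: normed_functions_def)
  finally show "u t : normed_functions N" using m by (simp add: normed_functions_def ueq[OF t])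
 qed
 have eq: "mild_equation_in N Z Y p u0 u t" if N: "N : {L1_norm, Linf_norm}" and t: "0 <= t" "t <= T" for N t
 proof -
  have "has_bochner_integral_wrt N (lebesgue_on {0<..<t}) (%s. P_family Y (t - s) (%x. (max 0 (u s x)) powr p)) (%x. W (t, x))"
  proof (cases "t = 0")
   case True
   then show ?thesis using bochner_empty[OF N] by (simp add: W_nonpos)
  next
   case False
   show ?thesis
   proof (rule W_bochner[OF N])
   show "AE s in lborel. 0 < s & s < T --> (%x. max 0 (u s x) powr p) : Bor & (AE y in lborel. max 0 (u s y) powr p = F (s, y))"
   using uF
   proof eventually_elim
   case (elim s)
   have "u s : Bor" if "0 < s" "s < T"
   using nf(1)[of L1_norm s] that by (simp add: normed_functions_def)
   then show ?case using elim by auto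
   qed
   qed (use False t in auto)
  qed
  then show ?thesis unfolding mild_equation_in_def
   using nf[OF N t] norm_minus(3)[OF N] by (auto simp: ueq[OF t] intro!: exI[of _ "%x. W (t, x)"])
 qed
 have "continuous_wrt L1_norm {0..T} u"
 proof (rule continuous_wrtI_sequentially)
  fix t X assume t: "t : {0..T}" and X: "!!n. X n : {0..T}" "X ~~> t"
  have Xp: "0 <= X n" "X n <= T" "0 <= t" "t <= T" for n using X(1)[of n] t by auto
  show "(%n. L1_norm (%x. u (X n) x - u t x)) ~~> 0"
  proof (rule ennreal_tendsto_0_le)
   fix n
   have Sm: "S_family Z s u0 : Bor" if "0 <= s" for s by (rule S_measurable[OF datumD(3)[OF D] that])
   have Sf: "S_family Z s f : Bor" if "0 <= s" for s by (rule S_measurable[OF datumD(4)[OF D] that])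
   note [measurable] = Sm[OF Xp(1)[of n]] Sm[OF Xp(3)] Sf[OF Xp(1)[of n]] Sf[OF Xp(3)]
   have "(%x. u (X n) x - u t x) = (%x. (S_family Z (X n) u0 x - S_family Z t u0 x) + (W (X n, x) - W (t, x)))"
   using Xp by (simp add: ueq algebra_simps)
   then have "L1_norm (%x. u (X n) x - u t x) <= L1_norm (%x. S_family Z (X n) u0 x - S_family Z t u0 x) + L1_norm (%x. W (X n, x) - W (t, x))"
   by (simp only:) (rule norm_triangle; simp)
   also have "L1_norm (%x. S_family Z (X n) u0 x - S_family Z t u0 x) = L1_norm (%x. S_family Z (X n) f x - S_family Z t f x)"
   using S_datum_AE[OF D Xp(1)[of n]] S_datum_AE[OF D Xp(3)] by (intro norm_AE_cong) (auto elim: eventually_elim2)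
   finally show "L1_norm (%x. u (X n) x - u t x) <= L1_norm (%x. S_family Z (X n) f x - S_family Z t f x) + L1_norm (%x. W (X n, x) - W (t, x))" .
  next
   show "(%n. L1_norm (%x. S_family Z (X n) f x - S_family Z t f x) + L1_norm (%x. W (X n, x) - W (t, x))) ~~> 0"
   using tendsto_add[OF S_L1_sequentially[OF datumD(2)[OF D] datumD(5)[OF D] X(2) Xp(1)] W_L1_sequentially[OF X(2)]] by simp
  qed
 qed (use nf in auto)
 moreover have sm: "strongly_measurable_wrt Linf_norm (lebesgue_on {0<..<T}) u"
 proof (rule strongly_measurable_cong[OF strongly_measurable_add[OF _ S_strongly_measurable[OF D T] W_strongly_measurable]])
  show "AE t in lebesgue_on {0<..<T}. u t = (%x. S_family Z t u0 x + W (t, x))"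
   using AE_space by eventually_elim (simp add: ueq)
 qed simp
 moreover have "ess_sup_Linf T u < \<infinity>"
 proof -
  let ?C = "C * enn2real (kmass (T + 1))"
  have "ess_sup_Linf T u <= ennreal R0 + ennreal ?C"
   unfolding ess_sup_Linf_def
  proof (rule esssup_I)
   show "(%t. Linf_norm (u t)) : borel_measurable (lebesgue_on {0<..<T})" by (rule strongly_measurable_norm[OF _ _ sm]) auto
   show "AE t in lebesgue_on {0<..<T}. Linf_norm (u t) <= ennreal R0 + ennreal ?C"
   using AE_space
   proof eventually_elim
   case (elim t)
   then have t: "0 <= t" "t <= T" by auto
   have m: "S_family Z t u0 : Bor" by (rule S_measurable[OF datumD(3)[OF D] t(1)])
   have "Linf_norm (u t) <= Linf_norm (S_family Z t u0) + Linf_norm (%x. W (t, x))"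
   unfolding ueq[OF t] using m by (intro norm_triangle) auto
   also have "... <= ennreal R0 + ennreal ?C"
   using W_le W_nn by (intro add_mono S_datum_normed(3)[OF D t(1)] Linf_norm_le) auto
   finally show ?case .
   qed
  qed
  then show ?thesis by (auto intro: le_less_trans)
 qed
 ultimately have "u : XT T" by (simp add: XT_def)
 then show ?thesis unfolding mild_solution_def using eq by (auto intro!: AE_I2)
qed

end

context mild_setting
begin

text \<open>\<open>V\<close> vanishes at time 0 and may take infinite values; this real-valued
  version is given by the right-hand side of the equation at every time and starts at
  \<open>u0\<close> itself.\<close>

definition sol :: "(real^'n => real) => (real^'n => real) => real => real^'n => real" where
 "sol u0 f t x = S_family Z t u0 x + enn2real (nconv k (%e. pw p (V f e)) (t, x))"

text \<open>Boundedness of \<open>V\<close> on \<open>(0, T)\<close> holds only almost everywhere,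
  so the source is set to 0 on the exceptional set, which the convolution does not notice; the bound
  on its spatial mass is \<open>V_slice_bound\<close>.\<close>

lemma good_source:
 assumes D: "datum u0 f R0" and g: "good f T" and T: "0 < T"
 obtains F C B where "source \<alpha>\<^sub>1 \<alpha>\<^sub>2 c p Z Y F C B T"
  "AE e in lborel. 0 < fst e & fst e < T --> ennreal (F e) = pw p (V f e)"
  "!!t x. t <= T ==> nconv k (%e. pw p (V f e)) (t, x) = nconv k (%e. ennreal (F e)) (t, x)"
proof -
 note f = datumD(4)[OF D]
 note [measurable] = f
 obtain R1 where R1: "AE e in lborel. 0 < fst e & fst e < T --> V f e <= ennreal R1" using g by (auto simp: good_def)
 define R where "R = \<bar>R1\<bar>"
 have R: "AE e in lborel. 0 < fst e & fst e < T --> V f e <= ennreal R" "0 <= R"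
  using R1 by (auto elim!: eventually_mono simp: R_def intro: order_trans[OF _ ennreal_leI])
 define N0 where "N0 = (LB x. f x)"
 have N0: "0 <= N0" unfolding N0_def by (intro integral_nonneg_AE) (simp add: datumD(5)[OF D])
 obtain B0 where B0: "0 <= B0" "AE t in lborel. 0 < t & t < T --> (NN x. V f (t, x)) <= ennreal B0"
  by (rule V_slice_bound[OF f _ N0 R]) (simp add: datumD(9)[OF D] N0_def)
 define F where "F e = (if 0 < fst e & fst e < T & V f e <= ennreal R then enn2real (pw p (V f e)) else 0)" for e
 have pwR: "\<exists>r\<ge>0. r <= R & V f e = ennreal r & pw p (V f e) = ennreal (r powr p)" if "V f e <= ennreal R" for e
  using that R(2) by (cases "V f e") (auto simp: ennreal_le_iff top_unique pw_ennreal)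
 have F1: "ennreal (F e) = pw p (V f e)" if "0 < fst e" "fst e < T" "V f e <= ennreal R" for e
  using pwR[OF that(3)] that by (auto simp: F_def)
 have F2: "0 <= F e & F e <= R powr p" for e
  using pwR[of e] p0 by (auto simp: F_def intro!: powr_mono2)
 have F3: "ennreal (F e) <= ennreal (R powr (p - 1)) * V f e" for e
 proof (cases "0 < fst e & fst e < T & V f e <= ennreal R")
  case True
  then obtain r where r: "0 <= r" "r <= R" "V f e = ennreal r" "pw p (V f e) = ennreal (r powr p)" using pwR[of e] by blast
  have "r powr p = r powr (p - 1) * r"
  proof (cases "r = 0")
   case False
   then show ?thesis using r powr_add[of r "p - 1" 1] by simp
  qed simp
  also have "... <= R powr (p - 1) * r" using r p by (intro mult_right_mono powr_mono2) auto
  finally have "ennreal (r powr p) <= ennreal (R powr (p - 1)) * ennreal r" using r by (simp add: ennreal_mult[symmetric] ennreal_leI)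
  then show ?thesis using F1[of e] True r by simp
 qed (auto simp: F_def)
 have Fm[measurable]: "F : Bor" unfolding F_def[abs_def] by measurable
 have AEF: "AE e in lborel. 0 < fst e & fst e < T --> ennreal (F e) = pw p (V f e)"
  using R(1) by eventually_elim (auto intro: F1)
 show ?thesis
 proof (rule that[of F "R powr p" "R powr (p - 1) * B0"])
  show "source \<alpha>\<^sub>1 \<alpha>\<^sub>2 c p Z Y F (R powr p) (R powr (p - 1) * B0) T"
  proof (intro source.intro source_axioms.intro mild_setting_axioms)
   show "AE s in lborel. (NN y. ennreal (F (s, y))) <= ennreal (R powr (p - 1) * B0)"
   using B0(2)
   proof eventually_elim
   case (elim s)
   show ?case
   proof (cases "0 < s & s < T")
   case True
   have "(NN y. ennreal (F (s, y))) <= (NN y. ennreal (R powr (p - 1)) * V f (s, y))"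
   by (intro nn_integral_mono F3)
   also have "... = ennreal (R powr (p - 1)) * (NN y. V f (s, y))"
   using slice_measurable(1)[of "V f"] by (intro nn_integral_cmult) simp
   also have "... <= ennreal (R powr (p - 1)) * ennreal B0" using elim True by (intro mult_left_mono) auto
   finally show ?thesis using B0(1) by (simp add: ennreal_mult)
   qed (auto simp: F_def)
   qed
  qed (use F2 T in \<open>auto simp: F_def\<close>)
  show "nconv k (%e. pw p (V f e)) (t, x) = nconv k (%e. ennreal (F e)) (t, x)" if "t <= T" for t x
  proof -
   have "nconv k (%e. pw p (V f e)) (t, x) = nconv k (cut T (%e. pw p (V f e))) (t, x)"
   using that by (intro nconv_window) (auto simp: V_nonpos)
   also have "... = nconv k (cut T (%e. ennreal (F e))) (t, x)"
   using AEF by (intro nconv_cong) (auto elim!: eventually_mono simp: cut_def split: split_indicator)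
   also have "... = nconv k (%e. ennreal (F e)) (t, x)"
   using that by (intro nconv_window(1)[symmetric]) (auto simp: F_def)
   finally show ?thesis .
  qed
 qed (rule AEF)
qed

lemma sol_nonneg: "datum u0 f R0 ==> 0 <= t ==> AE x in lborel. 0 <= sol u0 f t x"
 using S_datum_AE[of u0 f R0 t] S_bounds(1)[of f R0 t] datumD(4,5,6)[of u0 f R0]
 by (auto elim!: eventually_mono simp: sol_def)

text \<open>At almost every time both sides are sums of the same two convolutions, which are finite
  at every point; hence equality for all \<open>x\<close> and not only almost all.\<close>

lemma sol_eq_V:
 assumes D: "datum u0 f R0" and g: "good f T" and T: "0 < T"
 shows "AE t in lborel. 0 < t & t < T --> (\<forall>x. V f (t, x) = ennreal (sol u0 f t x))"
proof -
 obtain F C B where F: "source \<alpha>\<^sub>1 \<alpha>\<^sub>2 c p Z Y F C B T"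
  "!!t x. t <= T ==> nconv k (%e. pw p (V f e)) (t, x) = nconv k (%e. ennreal (F e)) (t, x)"
  by (rule good_source[OF D g T]) blast
 interpret source \<alpha>\<^sub>1 \<alpha>\<^sub>2 c p Z Y F C B T by (rule F(1))
 show ?thesis using S_eq_A[OF D] S_kernel[OF D]
 proof eventually_elim
  case (elim t)
  show ?case
  proof (intro impI allI)
   fix x assume t: "0 < t & t < T"
   have n: "nconv k (%e. pw p (V f e)) (t, x) = ennreal (W (t, x))" using F(2)[of t x] W_eq[of "(t, x)"] t by simp
   have "0 <= S_family Z t u0 x"
   using elim(2) t by (simp add: integral_nonneg_AE kz_nonneg datumD(5)[OF D])
   then show "V f (t, x) = ennreal (sol u0 f t x)"
   using elim(1) t by (subst V_eq[OF datumD(4)[OF D]]) (simp add: n sol_def W_nn ennreal_plus)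
  qed
 qed
qed

lemma sol_mild_solution:
 assumes D: "datum u0 f R0" and g: "good f T" and T: "0 < T"
 shows "mild_solution Z Y p u0 T (sol u0 f)"
proof -
 obtain F C B where F: "source \<alpha>\<^sub>1 \<alpha>\<^sub>2 c p Z Y F C B T"
  "AE e in lborel. 0 < fst e & fst e < T --> ennreal (F e) = pw p (V f e)"
  "!!t x. t <= T ==> nconv k (%e. pw p (V f e)) (t, x) = nconv k (%e. ennreal (F e)) (t, x)"
  by (rule good_source[OF D g T]) blast
 interpret source \<alpha>\<^sub>1 \<alpha>\<^sub>2 c p Z Y F C B T by (rule F(1))
 note [measurable] = datumD(4)[OF D]
 show ?thesis
 proof (rule mild_solutionI[OF D])
  show "sol u0 f t x = S_family Z t u0 x + W (t, x)" if "0 <= t" "t <= T" for t x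
   using F(3)[of t x] W_eq[of "(t, x)"] that W_nn by (simp add: sol_def)
  have "AE s in lborel. AE y in lborel. 0 < fst (s, y) & fst (s, y) < T --> ennreal (F (s, y)) = pw p (V f (s, y))"
   using F(2) by (subst (asm) joint_slice_AE) simp_all
  then show "AE s in lborel. 0 < s & s < T --> (AE y in lborel. (max 0 (sol u0 f s y)) powr p = F (s, y))"
   using sol_eq_V[OF D g T]
  proof eventually_elim
   case (elim s)
   show ?case
   proof
   assume s: "0 < s & s < T"
   have "AE y in lborel. 0 <= sol u0 f s y" using s by (intro sol_nonneg[OF D]) simp
   then show "AE y in lborel. (max 0 (sol u0 f s y)) powr p = F (s, y)"
   using elim(1)
   proof eventually_elim
   case (elim y)
   then have "ennreal (F (s, y)) = ennreal (sol u0 f s y powr p)"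
   using \<open>0 < s & s < T --> (\<forall>x. V f (s, x) = ennreal (sol u0 f s x))\<close> s by (simp add: pw_ennreal)
   then show ?case using elim F_nn by (simp add: max_def)
   qed
   qed
  qed
 qed
qed

end

section \<open>Uniqueness and continuous dependence\<close>

lemma kernel_norm_le:
 fixes q f h :: "real^'n => real"
 assumes N: "N : {L1_norm, Linf_norm}" and [measurable]: "q : Bor" "f : Bor" "h : Bor"
  and le: "!!x. ennreal \<bar>h x\<bar> <= (NN y. ennreal (q (x - y)) * ennreal \<bar>f y\<bar>)"
 shows "N h <= (NN y. ennreal (q y)) * N f"
proof (cases "N = L1_norm")
 case True
 have "L1_norm h <= (NN x. (NN y. ennreal (q (x - y)) * ennreal \<bar>f y\<bar>))"
  unfolding L1_norm_def by (intro nn_integral_mono le)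
 also have "... = (NN y. (NN x. ennreal (q (x - y)) * ennreal \<bar>f y\<bar>))"
  by (rule lborel_pair.Fubini') (simp add: split_beta')
 also have "... = (NN y. (NN x. ennreal (q x)) * ennreal \<bar>f y\<bar>)"
 proof (rule nn_integral_cong)
  fix y
  have "(NN x. ennreal (q (x - y)) * ennreal \<bar>f y\<bar>) = (NN x. ennreal (q (x + - y))) * ennreal \<bar>f y\<bar>"
   by (subst nn_integral_multc[symmetric]) simp_all
  also have "(NN x. ennreal (q (x + - y))) = (NN x. ennreal (q x))"
   by (rule nn_integral_lborel_shift) simp
  finally show "(NN x. ennreal (q (x - y)) * ennreal \<bar>f y\<bar>) = (NN x. ennreal (q x)) * ennreal \<bar>f y\<bar>" .
 qed
 also have "... = (NN x. ennreal (q x)) * L1_norm f" unfolding L1_norm_def by (rule nn_integral_cmult) simp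
 finally show ?thesis using True by simp
next
 case False
 have "ennreal \<bar>h x\<bar> <= (NN y. ennreal (q y)) * Linf_norm f" for x
 proof -
  have "ennreal \<bar>h x\<bar> <= (NN y. ennreal (q (x - y)) * Linf_norm f)"
   using Linf_norm_AE[of f]
   by (intro order_trans[OF le nn_integral_mono_AE]) (auto elim!: eventually_mono intro: mult_left_mono)
  also have "... = (NN y. ennreal (q (x - y))) * Linf_norm f" by (rule nn_integral_multc) simp
  also have "(NN y. ennreal (q (x - y))) = (NN y. ennreal (q y))"
   by (rule nn_integral_lborel_reflect) simp
  finally show ?thesis .
 qed
 then have "Linf_norm h <= (NN y. ennreal (q y)) * Linf_norm f"
  unfolding Linf_norm_def[of h] by (intro esssup_I) auto
 then show ?thesis using N False by auto
qed

text \<open>Young's inequality in the form of \<open>kernel_norm_le\<close>, applied to the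
  difference; the bounds on \<open>g1\<close> and \<open>g2\<close> ensure that both convolution
  integrals exist at every point.\<close>

lemma kernel_diff_norm_le:
 fixes q g1 g2 :: "real^'n => real"
 assumes N: "N : {L1_norm, Linf_norm}" and [measurable]: "q : Bor" "g1 : Bor" "g2 : Bor"
  and q: "!!x. 0 <= q x" "(NN y. ennreal (q y)) < \<infinity>"
  and g: "AE y in lborel. \<bar>g1 y\<bar> <= R" "AE y in lborel. \<bar>g2 y\<bar> <= R"
 shows "N (%x. (LB y. q (x - y) * g1 y) - (LB y. q (x - y) * g2 y)) <= (NN y. ennreal (q y)) * N (%y. g1 y - g2 y)"
proof (rule kernel_norm_le[OF N])
 have int: "integrable lborel (%y. q (x - y) * g' y)" if [measurable]: "g' : Bor" and b: "AE y in lborel. \<bar>g' y\<bar> <= R" for g' x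
 proof (rule integrableI_bounded)
  have "(NN y. ennreal (norm (q (x - y) * g' y))) <= (NN y. ennreal (q (x - y)) * ennreal R)"
   using b by (intro nn_integral_mono_AE) (auto elim!: eventually_mono simp: abs_mult ennreal_mult q intro!: mult_left_mono ennreal_leI)
  also have "... = (NN y. ennreal (q (x - y))) * ennreal R" by (rule nn_integral_multc) simp
  also have "(NN y. ennreal (q (x - y))) = (NN y. ennreal (q y))"
   by (rule nn_integral_lborel_reflect) simp
  finally show "(NN y. ennreal (norm (q (x - y) * g' y))) < \<infinity>" using q(2) by (auto intro: le_less_trans simp: ennreal_mult_less_top)
 qed simp
 have m: "(%x. \<integral>y. q (x - y) * g' y \<partial>lborel) : Bor" if [measurable]: "g' : Bor" for g'
  by (rule lborel.borel_measurable_lebesgue_integral) (simp add: split_beta')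
 show "(%x. (LB y. q (x - y) * g1 y) - (LB y. q (x - y) * g2 y)) : Bor"
  using m[of g1] m[of g2] by simp
 fix x
 have "(LB y. q (x - y) * g1 y) - (LB y. q (x - y) * g2 y) = (LB y. q (x - y) * g1 y - q (x - y) * g2 y)"
  by (rule Bochner_Integration.integral_diff[symmetric]) (intro int g; simp)+
 then have "ennreal \<bar>(LB y. q (x - y) * g1 y) - (LB y. q (x - y) * g2 y)\<bar> <= (NN y. ennreal \<bar>q (x - y) * g1 y - q (x - y) * g2 y\<bar>)"
  by (simp add: ennreal_abs_integral_le)
 also have "... = (NN y. ennreal (q (x - y)) * ennreal \<bar>g1 y - g2 y\<bar>)"
  by (intro nn_integral_cong) (simp add: right_diff_distrib[symmetric] abs_mult ennreal_mult q)
 finally show "ennreal \<bar>(LB y. q (x - y) * g1 y) - (LB y. q (x - y) * g2 y)\<bar> <= (NN y. ennreal (q (x - y)) * ennreal \<bar>g1 y - g2 y\<bar>)" .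
qed simp_all

lemma norm_powr_diff_le:
 fixes u v :: "real^'n => real"
 assumes N: "N : {L1_norm, Linf_norm}" and [measurable]: "u : Bor" "v : Bor"
  and p: "1 < p" and b: "AE y in lborel. \<bar>u y\<bar> <= R" "AE y in lborel. \<bar>v y\<bar> <= R"
 shows "N (%y. max 0 (u y) powr p - max 0 (v y) powr p) <= ennreal (p * R powr (p - 1)) * N (%y. u y - v y)"
proof -
 let ?L = "p * R powr (p - 1)"
 have L: "0 <= ?L" using p by simp
 have "AE y in lborel. \<bar>max 0 (u y) powr p - max 0 (v y) powr p\<bar> <= \<bar>?L * (u y - v y)\<bar>"
  using b
 proof eventually_elim
  case (elim y)
  have "\<bar>max 0 (u y) powr p - max 0 (v y) powr p\<bar> <= ?L * \<bar>max 0 (u y) - max 0 (v y)\<bar>"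
   using elim by (intro powr_diff_le[OF p]) auto
  also have "... <= ?L * \<bar>u y - v y\<bar>" using L by (intro mult_left_mono) auto
  also have "... = \<bar>?L * (u y - v y)\<bar>" using L by (simp only: abs_mult[of ?L] abs_of_nonneg)
  finally show ?case .
 qed
 then have "AE y in lborel. ennreal \<bar>max 0 (u y) powr p - max 0 (v y) powr p\<bar> <= ennreal \<bar>?L * (u y - v y)\<bar>"
  by eventually_elim (rule ennreal_leI)
 then have "N (%y. max 0 (u y) powr p - max 0 (v y) powr p) <= N (%y. ?L * (u y - v y))"
  using N unfolding L1_norm_def[abs_def] Linf_norm_def[abs_def]
  by (auto intro!: nn_integral_mono_AE esssup_AE_mono)
 also have "... <= ennreal ?L * N (%y. u y - v y)" by (rule norm_scale_le[OF N _ L]) simp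
 finally show ?thesis .
qed

lemma AE_interval_exists:
 fixes a b :: real
 assumes "AE x in lborel. P x" "a < b"
 obtains x where "a < x" "x < b" "P x"
proof (rule ccontr)
 assume n: "\<not> thesis"
 have "AE x in lborel. x \<notin> {a<..<b}" using assms(1) by eventually_elim (use n that in auto)
 then have "emeasure lborel {a<..<b} = 0" by (subst (asm) AE_iff_measurable[of "{a<..<b}"]) auto
 then show False using assms(2) by simp
qed

text \<open>Times at which the bound holds are dense, so every time of the closed interval, end
  points included, is a limit of such times from inside \<open>(0, T)\<close>, and continuity in L^1
  carries the bound over.\<close>

lemma L1_AE_extend:
 fixes u v :: "real => real^'n => real"
 assumes u: "continuous_wrt L1_norm {0..T} u" and v: "continuous_wrt L1_norm {0..T} v" and T: "0 < T"
  and b: "AE t in lborel. 0 < t & t < T --> L1_norm (%x. u t x - v t x) <= b" and t: "t : {0..T}"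
 shows "L1_norm (%x. u t x - v t x) <= b"
proof -
 have N: "(L1_norm :: (real^'n => real) => ennreal) : {L1_norm, Linf_norm}" by simp
 have "\<exists>s. max 0 (t - 1 / real (Suc n)) < s & s < min T (t + 1 / real (Suc n)) & (0 < s & s < T --> L1_norm (%x. u s x - v s x) <= b)" for n
 proof -
  have w: "max 0 (t - e) < min T (t + e)" if "0 < e" for e using t T that by auto
  have "0 < 1 / real (Suc n)" by simp
  from AE_interval_exists[OF b w[OF this]] obtain s where "max 0 (t - 1 / real (Suc n)) < s" "s < min T (t + 1 / real (Suc n))"
   "0 < s & s < T --> L1_norm (%x. u s x - v s x) <= b" .
  then show ?thesis by blast
 qed
 then obtain X where X: "!!n. max 0 (t - 1 / real (Suc n)) < X n" "!!n. X n < min T (t + 1 / real (Suc n))"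
  "!!n. 0 < X n & X n < T --> L1_norm (%x. u (X n) x - v (X n) x) <= b" by metis
 have XT: "0 < X n" "X n < T" "X n : {0..T}" for n using X(1)[of n] X(2)[of n] by auto
 have "X ~~> t"
 proof (rule tendsto_sandwich[of "%n. t - 1 / real (Suc n)" _ _ "%n. t + 1 / real (Suc n)"])
  have "(%n. 1 / real (Suc n)) ~~> 0" using LIMSEQ_inverse_real_of_nat by (simp add: inverse_eq_divide)
  then show "(%n. t - 1 / real (Suc n)) ~~> t" "(%n. t + 1 / real (Suc n)) ~~> t"
   using tendsto_diff[OF tendsto_const[of t]] tendsto_add[OF tendsto_const[of t]] by fastforce+
  show "eventually (%n. t - 1 / real (Suc n) <= X n) sequentially" "eventually (%n. X n <= t + 1 / real (Suc n)) sequentially"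
   using X(1,2) by (auto intro!: always_eventually less_imp_le simp del: of_nat_Suc)
 qed
 note lim = continuous_wrt_sequentially[OF N u t XT(3) this] continuous_wrt_sequentially[OF N v t XT(3) this]
 have m: "u s : Bor" "v s : Bor" if "s : {0..T}" for s
  using u v that by (auto simp: continuous_wrt_def normed_functions_def)
 show ?thesis
 proof (rule LIMSEQ_le_const)
  show "(%n. L1_norm (%x. u (X n) x - u t x) + (b + L1_norm (%x. v (X n) x - v t x))) ~~> b"
   using tendsto_add[OF lim(1) tendsto_add[OF tendsto_const[of b] lim(2)]] by simp
  show "\<exists>N. \<forall>n\<ge>N. L1_norm (%x. u t x - v t x) <= L1_norm (%x. u (X n) x - u t x) + (b + L1_norm (%x. v (X n) x - v t x))"
  proof (intro exI allI impI)
   fix n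
   have "L1_norm (%x. u t x - v t x) <= L1_norm (%x. u t x - u (X n) x) + L1_norm (%x. u (X n) x - v t x)"
   by (rule norm_diff_triangle[OF N]) (auto intro: m t XT(3))
   also have "L1_norm (%x. u (X n) x - v t x) <= L1_norm (%x. u (X n) x - v (X n) x) + L1_norm (%x. v (X n) x - v t x)"
   by (rule norm_diff_triangle[OF N]) (auto intro: m t XT(3))
   also have "L1_norm (%x. u (X n) x - v (X n) x) <= b" using X(3)[of n] XT[of n] by simp
   also have "L1_norm (%x. u t x - u (X n) x) = L1_norm (%x. u (X n) x - u t x)" by (rule norm_minus(2)[OF N])
   finally show "L1_norm (%x. u t x - v t x) <= L1_norm (%x. u (X n) x - u t x) + (b + L1_norm (%x. v (X n) x - v t x))"
   by (auto simp: add_left_mono add_right_mono)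
  qed
 qed
qed

lemma XT_bound:
 assumes "u : XT T"
 obtains R :: real where "0 <= R" "AE t in lborel. 0 < t & t < T --> Linf_norm (u t) <= ennreal R"
proof -
 have "ess_sup_Linf T u < \<infinity>" using assms by (simp add: XT_def)
 then obtain R where R: "0 <= R" "ess_sup_Linf T u = ennreal R" by (cases "ess_sup_Linf T u") auto
 have "AE t in lebesgue_on {0<..<T}. Linf_norm (u t) <= ennreal R"
  using esssup_AE[of "%t. Linf_norm (u t)" "lebesgue_on {0<..<T}"] R(2) by (simp add: ess_sup_Linf_def)
 then have "AE t in lborel. t : {0<..<T} --> Linf_norm (u t) <= ennreal R" by (subst (asm) AE_lebesgue_on) auto
 then show ?thesis using R(1) by (intro that[of R]) (auto elim!: eventually_mono)
qed

lemma strongly_measurable_mono: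
 assumes h: "strongly_measurable_wrt N (lebesgue_on {0<..<T}) h" and S: "S <= T"
 shows "strongly_measurable_wrt N (lebesgue_on {0<..<S}) h"
proof -
 obtain s where s: "!!k. simple_wrt N (lebesgue_on {0<..<T}) (s k)"
  "AE t in lebesgue_on {0<..<T}. h t : normed_functions N & (%k. N (%x. h t x - s k t x)) ~~> 0"
  using h unfolding strongly_measurable_wrt_def by blast
 have "simple_wrt N (lebesgue_on {0<..<S}) (s k)" for k
 proof -
  have f: "finite (s k ` {0<..<T})" and m: "!!x. x : s k ` {0<..<T} ==> s k -` {x} \<inter> {0<..<T} : sets (lebesgue_on {0<..<T})"
   and r: "s k : {0<..<T} \<rightarrow> normed_functions N"
   using s(1)[of k] by (auto simp: simple_wrt_def simple_function_def)
  have "finite (s k ` {0<..<S})" by (rule finite_subset[OF image_mono f]) (use S in auto)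
  moreover have "s k -` {x} \<inter> {0<..<S} : sets (lebesgue_on {0<..<S})" if "x : s k ` {0<..<S}" for x
  proof -
   have "s k -` {x} \<inter> {0<..<T} : sets lebesgue" using m[of x] that S by (auto simp: sets_restrict_space_iff)
   then have "s k -` {x} \<inter> {0<..<T} \<inter> {0<..<S} : sets lebesgue" by auto
   moreover have "s k -` {x} \<inter> {0<..<T} \<inter> {0<..<S} = s k -` {x} \<inter> {0<..<S}" using S by auto
   ultimately show ?thesis by (simp add: sets_restrict_space_iff)
  qed
  ultimately show ?thesis using r S by (auto simp: simple_wrt_def simple_function_def)
 qed
 moreover have "AE t in lebesgue_on {0<..<S}. h t : normed_functions N & (%k. N (%x. h t x - s k t x)) ~~> 0"
  using s(2) S unfolding AE_lebesgue_on[OF borel_open[OF open_greaterThanLessThan]] by (auto elim!: eventually_mono)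
 ultimately show ?thesis unfolding strongly_measurable_wrt_def by blast
qed

lemma mild_solution_restrict:
 assumes u: "mild_solution Z Y p u0 T u" and S: "S <= T"
 shows "mild_solution Z Y p u0 S u"
proof -
 have XT: "u : XT T" using u by (simp add: mild_solution_def)
 obtain R where R: "0 <= R" "AE t in lborel. 0 < t & t < T --> Linf_norm (u t) <= ennreal R" by (rule XT_bound[OF XT])
 have sm: "strongly_measurable_wrt Linf_norm (lebesgue_on {0<..<S}) u"
  by (rule strongly_measurable_mono[OF _ S]) (use XT in \<open>simp add: XT_def\<close>)
 have "continuous_wrt L1_norm {0..S} u"
  unfolding continuous_wrt_def
 proof (intro ballI conjI)
  fix t assume t: "t : {0..S}"
  then have a: "u t : L1" and b: "((%s. L1_norm (%x. u s x - u t x)) \<longlongrightarrow> 0) (at t within {0..T})"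
   using XT S by (auto simp: XT_def continuous_wrt_def)
  show "u t : L1" by (rule a)
  show "((%s. L1_norm (%x. u s x - u t x)) \<longlongrightarrow> 0) (at t within {0..S})"
   by (rule tendsto_within_subset[OF b]) (use S in auto)
 qed
 moreover have "ess_sup_Linf S u <= ennreal R" unfolding ess_sup_Linf_def
 proof (rule esssup_I)
  show "(%t. Linf_norm (u t)) : borel_measurable (lebesgue_on {0<..<S})" by (rule strongly_measurable_norm[OF _ _ sm]) auto
  show "AE t in lebesgue_on {0<..<S}. Linf_norm (u t) <= ennreal R"
   using R(2) S unfolding AE_lebesgue_on[OF borel_open[OF open_greaterThanLessThan]] by (auto elim!: eventually_mono)
 qed
 ultimately have "u : XT S" using sm by (auto simp: XT_def intro: le_less_trans)
 moreover have "AE t in lebesgue_on {0<..<S}. mild_equation_in Linf_norm Z Y p u0 u t"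
  using u S unfolding mild_solution_def AE_lebesgue_on[OF borel_open[OF open_greaterThanLessThan]] by (auto elim!: eventually_mono)
 ultimately show ?thesis using u S by (auto simp: mild_solution_def)
qed

context mild_setting
begin

lemma kappa_finite: "AE t in lborel. kappa t < \<infinity>"
proof -
 have "(NN t. ennreal (exp (- 1 * t)) * kappa t) < \<infinity>" unfolding kappa_laplace using k_laplace by simp
 then have "AE t in lborel. ennreal (exp (- 1 * t)) * kappa t \<noteq> \<infinity>" by (intro nn_integral_PInf_AE) auto
 then show ?thesis by eventually_elim (auto simp: ennreal_mult_eq_top_iff top.not_eq_extremum)
qed

lemma S_contraction:
 assumes N: "N : {L1_norm, Linf_norm}" and D: "datum u0 f R0" and D': "datum v0 g R1"
 shows "AE t in lborel. 0 < t --> N (%x. S_family Z t u0 x - S_family Z t v0 x) <= N (%x. u0 x - v0 x)"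
 using S_kernel[OF D] S_kernel[OF D'] kz_mass
proof eventually_elim
 case (elim t)
 note [measurable] = datumD(3,4)[OF D] datumD(3,4)[OF D']
 show ?case
 proof
  assume t: "0 < t"
  have "N (%x. S_family Z t u0 x - S_family Z t v0 x) <= (NN y. ennreal (kz (t, y))) * N (%y. f y - g y)"
   unfolding elim(1)[rule_format, OF t] elim(2)[rule_format, OF t]
  proof (rule kernel_diff_norm_le[OF N, where R = "max R0 R1"])
   show "AE y in lborel. \<bar>f y\<bar> <= max R0 R1" using datumD(5,6)[OF D] by (intro AE_I2) (auto simp: le_max_iff_disj)
   show "AE y in lborel. \<bar>g y\<bar> <= max R0 R1" using datumD(5,6)[OF D'] by (intro AE_I2) (auto simp: le_max_iff_disj)
  qed (use elim(3) t kz_nonneg in simp_all)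
  also have "... = N (%y. f y - g y)" using elim(3) t by simp
  also have "... = N (%x. u0 x - v0 x)"
   using datumD(7)[OF D] datumD(7)[OF D'] by (intro norm_AE_cong[OF N]) (auto elim: eventually_elim2)
  finally show "N (%x. S_family Z t u0 x - S_family Z t v0 x) <= N (%x. u0 x - v0 x)" .
 qed
qed

text \<open>The distance \<open>m t\<close> of the solutions is at most \<open>dl\<close> plus the
  convolution in time of \<open>L * kappa\<close> with \<open>m\<close>, where \<open>L\<close> is
  the Lipschitz constant of the power on \<open>[0, R]\<close>. The a priori bound on
  \<open>m\<close> that \<open>weighted_bound\<close> starts from is continuity on a compact
  interval in the case of L^1, and \<open>R\<close> in the case of L^infinity.\<close>

lemma mild_dependence:
 assumes N: "N : {L1_norm, Linf_norm}" and D: "datum u0 f R0" and D': "datum v0 g R1" and T: "0 < T"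
  and u: "mild_solution Z Y p u0 T u" and v: "mild_solution Z Y p v0 T v"
  and R: "0 <= R" "AE t in lborel. 0 < t & t < T --> Linf_norm (u t) <= ennreal R"
   "AE t in lborel. 0 < t & t < T --> Linf_norm (v t) <= ennreal R"
  and dl: "0 <= dl" "N (%x. u0 x - v0 x) <= ennreal dl"
  and z: "1 <= z" "ennreal (p * R powr (p - 1)) * (NN e. ennreal (exp (- z * fst e)) * k e) <= ennreal (1/2)"
 shows "AE t in lborel. 0 < t & t < T --> N (%x. u t x - v t x) <= ennreal (exp (z * T) * (2 * dl))"
proof -
 define L where "L = p * R powr (p - 1)"
 have L: "0 <= L" using p by (simp add: L_def)
 \<comment> \<open>Set to 0 outside \<open>(0, T)\<close> to be causal, as the weighted estimate
   requires.\<close>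
 define m where "m t = (if 0 < t & t < T then N (%x. u t x - v t x) else 0)" for t
 have uXT: "u : XT T" and vXT: "v : XT T" using u v by (auto simp: mild_solution_def)
 have bm: "u t : Bor" "v t : Bor" if "0 <= t" "t <= T" for t
  using uXT vXT that by (auto simp: XT_def continuous_wrt_def normed_functions_def)
 obtain M where M: "0 <= M" "AE t in lborel. m t <= ennreal M"
 proof (cases "N = L1_norm")
  case True
  obtain M1 where M1: "0 <= M1" "!!t. 0 <= t ==> t <= T ==> L1_norm (u t) <= ennreal M1"
   using continuous_wrt_bounded[of L1_norm T u] uXT by (auto simp: XT_def)
  obtain M2 where M2: "0 <= M2" "!!t. 0 <= t ==> t <= T ==> L1_norm (v t) <= ennreal M2"
   using continuous_wrt_bounded[of L1_norm T v] vXT by (auto simp: XT_def)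
  have "m t <= ennreal (M1 + M2)" for t
  proof (cases "0 < t & t < T")
   case True
   then have "N (%x. u t x + - v t x) <= N (u t) + N (%x. - v t x)" using bm[of t] by (intro norm_triangle[OF N]) auto
   also have "... <= ennreal M1 + ennreal M2"
   using M1(2)[of t] M2(2)[of t] True \<open>N = L1_norm\<close> norm_minus(1)[OF N] by (intro add_mono) auto
   finally show ?thesis using True M1(1) M2(1) by (simp add: m_def ennreal_plus)
  qed (auto simp: m_def)
  then show ?thesis using M1(1) M2(1) that[of "M1 + M2"] by simp
 next
  case False
  then have NL: "N = Linf_norm" using N by simp
  have "AE t in lborel. m t <= ennreal (R + R)" using R(2,3)
  proof eventually_elim
   case (elim t)
   show ?case
   proof (cases "0 < t & t < T")
   case True
   then have "N (%x. u t x + - v t x) <= N (u t) + N (%x. - v t x)" using bm[of t] by (intro norm_triangle[OF N]) auto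
   also have "... <= ennreal R + ennreal R" using elim True norm_minus(1)[OF N] by (intro add_mono) (auto simp: NL)
   finally have "N (%x. u t x + - v t x) <= ennreal (R + R)" unfolding ennreal_plus[OF R(1) R(1)] .
   then show ?thesis using True by (simp add: m_def)
   qed (auto simp: m_def)
  qed
  then show ?thesis using R(1) that[of "R + R"] by simp
 qed
 have eqs: "AE t in lborel. 0 < t & t < T --> mild_equation_in N Z Y p u0 u t & mild_equation_in N Z Y p v0 v t"
 proof (cases "N = L1_norm")
  case False
  then have NL: "N = Linf_norm" using N by simp
  have "AE t in lborel. t : {0<..<T} --> mild_equation_in N Z Y p u0 u t" "AE t in lborel. t : {0<..<T} --> mild_equation_in N Z Y p v0 v t"
   using u v unfolding mild_solution_def NL AE_lebesgue_on[OF borel_open[OF open_greaterThanLessThan]] by auto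
  then show ?thesis by eventually_elim auto
 qed (use u v in \<open>auto simp: mild_solution_def\<close>)
 have ineq: "AE t in lborel. m t <= ennreal dl + ennreal 1 * nconv (%s. ennreal L * kappa s) m t"
  using eqs S_contraction[OF N D D']
 proof eventually_elim
  case (elim t)
  show ?case
  proof (cases "0 < t & t < T")
   case True
   then have t: "0 < t" "t < T" by auto
   let ?M = "lebesgue_on {0<..<t}"
   let ?h1 = "%s. P_family Y (t - s) (%x. (max 0 (u s x)) powr p)" and ?h2 = "%s. P_family Y (t - s) (%x. (max 0 (v s x)) powr p)"
   let ?S1 = "S_family Z t u0" and ?S2 = "S_family Z t v0"
   obtain w1 where w1: "has_bochner_integral_wrt N ?M ?h1 w1" "N (%x. u t x - (?S1 x + w1 x)) = 0"
   using elim(1) True by (auto simp: mild_equation_in_def)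
   obtain w2 where w2: "has_bochner_integral_wrt N ?M ?h2 w2" "N (%x. v t x - (?S2 x + w2 x)) = 0"
   using elim(1) True by (auto simp: mild_equation_in_def)
   have wm: "w1 : Bor" "w2 : Bor"
   using w1(1) w2(1) by (auto simp: has_bochner_integral_wrt_def normed_functions_def)
   have Sm: "?S1 : Bor" "?S2 : Bor"
   using t by (auto intro!: S_measurable datumD(3)[OF D] datumD(3)[OF D'])
   note [measurable] = wm Sm bm(1)[of t, OF less_imp_le less_imp_le, OF t] bm(2)[of t, OF less_imp_le less_imp_le, OF t]
   have ae: "AE x in lborel. u t x = ?S1 x + w1 x" "AE x in lborel. v t x = ?S2 x + w2 x"
   using w1(2) w2(2) by (simp_all add: norm_eq_0_iff[OF N])
   have "m t = N (%x. u t x - v t x)" using True by (simp add: m_def)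
   also have "... = N (%x. (?S1 x - ?S2 x) + (w1 x - w2 x))"
   using ae by (intro norm_AE_cong[OF N]) (auto elim: eventually_elim2)
   also have "... <= N (%x. ?S1 x - ?S2 x) + N (%x. w1 x - w2 x)" by (rule norm_triangle[OF N]) auto
   also have "N (%x. ?S1 x - ?S2 x) <= ennreal dl" using elim(2) t dl(2) by (auto intro: order_trans)
   also have "N (%x. w1 x - w2 x) <= (\<integral>\<^sup>+s. N (%x. ?h1 s x - ?h2 s x) \<partial>?M)"
   proof (rule bochner_integral_diff_le[OF N w1(1) w2(1) t(1)])
   have "strongly_measurable_wrt N ?M (%s x. ?h1 s x + - ?h2 s x)"
   using w1(1) w2(1) by (intro strongly_measurable_add[OF N] strongly_measurable_uminus[OF N]) (auto simp: has_bochner_integral_wrt_def)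
   from strongly_measurable_norm[OF N _ this] show "(%s. N (%x. ?h1 s x - ?h2 s x)) : borel_measurable ?M" by simp
   qed simp
   also have "... <= (\<integral>\<^sup>+s. ennreal L * kappa (t - s) * m s \<partial>?M)"
   proof (rule nn_integral_mono_AE)
   show "AE s in ?M. N (%x. ?h1 s x - ?h2 s x) <= ennreal L * kappa (t - s) * m s"
   unfolding AE_lebesgue_on[OF borel_open[OF open_greaterThanLessThan]]
   using lborel_AE_reflect[OF AE_Y_density, of t] lborel_AE_reflect[OF kappa_finite, of t] R(2,3)
   proof eventually_elim
   case (elim s)
   show ?case
   proof
   assume s: "s : {0<..<t}"
   note [measurable] = bm(1)[of s] bm(2)[of s]
   have us[measurable]: "u s : Bor" "v s : Bor" using bm[of s] s t by auto
   have Rb: "AE y in lborel. \<bar>h y\<bar> <= R" if "Linf_norm h <= ennreal R" for h :: "real^'n => real"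
   using Linf_norm_AE[of h]
   proof eventually_elim
   case (elim y)
   then have "ennreal \<bar>h y\<bar> <= ennreal R" using that by (rule order_trans)
   then show ?case using R(1) by (simp add: ennreal_le_iff)
   qed
   have bb: "AE y in lborel. \<bar>u s y\<bar> <= R" "AE y in lborel. \<bar>v s y\<bar> <= R"
   using elim(3,4) s t by (auto intro!: Rb)
   have pb: "\<bar>max 0 a powr p\<bar> <= R powr p" if "\<bar>a\<bar> <= R" for a
   using that p0 R(1) by (auto intro!: powr_mono2)
   have Yd: "P_family Y (t - s) h = (%x. \<integral>y. ky (t - s, x - y) * h y \<partial>lborel)" if "h : Bor" for h
   using elim(1) s that ky_nonneg by (auto simp: P_family_def measure_convolution_density fun_eq_iff)
   have pm: "(%x. max 0 (u s x) powr p) : Bor" "(%x. max 0 (v s x) powr p) : Bor"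
   by measurable
   have "N (%x. ?h1 s x - ?h2 s x) <= (NN y. ennreal (ky (t - s, y))) * N (%y. max 0 (u s y) powr p - max 0 (v s y) powr p)"
   unfolding Yd[OF pm(1)] Yd[OF pm(2)]
   proof (rule kernel_diff_norm_le[OF N, where R = "R powr p"])
   show "(NN y. ennreal (ky (t - s, y))) < \<infinity>" using elim(2) by (simp add: kappa_def)
   show "AE y in lborel. \<bar>max 0 (u s y) powr p\<bar> <= R powr p" using bb(1) by eventually_elim (rule pb)
   show "AE y in lborel. \<bar>max 0 (v s y) powr p\<bar> <= R powr p" using bb(2) by eventually_elim (rule pb)
   qed (simp_all add: ky_nonneg)
   also have "... <= kappa (t - s) * (ennreal L * N (%y. u s y - v s y))"
   unfolding kappa_def L_def by (intro mult_left_mono norm_powr_diff_le[OF N us p bb]) simp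
   finally show "N (%x. ?h1 s x - ?h2 s x) <= ennreal L * kappa (t - s) * m s"
   using s t by (simp add: m_def mult_ac)
   qed
   qed
   qed
   also have "... = (NN s. indicator {0<..<t} s * (ennreal L * kappa (t - s) * m s))"
   by (rule nn_integral_lebesgue_on) simp
   also have "... = nconv (%s. ennreal L * kappa s) m t"
   unfolding nconv_def by (intro nn_integral_cong) (auto simp: m_def kappa_def ky_nonpos split: split_indicator)
   finally show ?thesis by (simp add: add_left_mono add_right_mono)
  qed (auto simp: m_def)
 qed
 have Lk: "ennreal 1 * (NN s. ennreal (exp (- z * id s)) * (ennreal L * kappa s)) <= ennreal (1/2)"
 proof -
  have "(NN s. ennreal (exp (- z * id s)) * (ennreal L * kappa s)) = (NN s. ennreal L * (ennreal (exp (- z * s)) * kappa s))"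
   by (intro nn_integral_cong) (simp add: mult_ac)
  also have "... = ennreal L * (NN e. ennreal (exp (- z * fst e)) * k e)"
   unfolding kappa_laplace[symmetric] by (rule nn_integral_cmult) simp
  finally show ?thesis using z(2) by (simp add: L_def)
 qed
 \<comment> \<open>As \<open>j\<close> grows the a priori bound \<open>M\<close> drops out and only
   \<open>dl\<close> is left.\<close>
 have "AE t in lborel. m t <= ennreal (exp (z * id t) * (2 * dl + M / 2 ^ j))" for j
  using weighted_bound[where k = "%s. ennreal L * kappa s" and tau = id and D = m, OF _ _ _ M(1) dl(1) _ Lk M(2) _ ineq, of j] z(1)
  by (simp add: m_def)
 then have "AE t in lborel. \<forall>j. m t <= ennreal (exp (z * id t) * (2 * dl + M / 2 ^ j))" unfolding AE_all_countable by (rule allI)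
 then show ?thesis
 proof eventually_elim
  case (elim t)
  show ?case
  proof
   assume t: "0 < t & t < T"
   have "(%j. M * (1 / 2) ^ j) ~~> M * 0" by (intro tendsto_intros LIMSEQ_realpow_zero) auto
   then have "(%j. ennreal (exp (z * t) * (2 * dl + M / 2 ^ j))) ~~> ennreal (exp (z * t) * (2 * dl + 0))"
   by (intro tendsto_ennrealI tendsto_intros) (simp add: power_divide)
   then have "m t <= ennreal (exp (z * t) * (2 * dl))"
   using elim by (intro LIMSEQ_le_const[of "%j. ennreal (exp (z * t) * (2 * dl + M / 2 ^ j))"]) auto
   also have "... <= ennreal (exp (z * T) * (2 * dl))" using t z(1) dl(1) by (intro ennreal_leI mult_right_mono) auto
   finally show "N (%x. u t x - v t x) <= ennreal (exp (z * T) * (2 * dl))" using t by (simp add: m_def)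
  qed
 qed
qed

text \<open>Dependence with \<open>dl = 0\<close> gives equality at almost every time, and
  continuity in L^1 extends it to every time.\<close>

lemma mild_unique:
 assumes D: "datum u0 f R0" and T: "0 < T" and u: "mild_solution Z Y p u0 T u" and v: "mild_solution Z Y p u0 T v"
  and t: "t : {0..T}"
 shows "AE x in lborel. u t x = v t x"
proof -
 have XT: "u : XT T" "v : XT T" using u v by (auto simp: mild_solution_def)
 obtain R1 where R1: "0 <= R1" "AE t in lborel. 0 < t & t < T --> Linf_norm (u t) <= ennreal R1" by (rule XT_bound[OF XT(1)])
 obtain R2 where R2: "0 <= R2" "AE t in lborel. 0 < t & t < T --> Linf_norm (v t) <= ennreal R2" by (rule XT_bound[OF XT(2)])
 define R where "R = max R1 R2"
 have R: "0 <= R" "ennreal R1 <= ennreal R" "ennreal R2 <= ennreal R" using R1(1) by (auto simp: R_def intro: ennreal_leI)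
 have bd: "AE t in lborel. 0 < t & t < T --> Linf_norm (u t) <= ennreal R"
  using R1(2) by eventually_elim (meson order_trans R(2))
 have bd': "AE t in lborel. 0 < t & t < T --> Linf_norm (v t) <= ennreal R"
  using R2(2) by eventually_elim (meson order_trans R(3))
 obtain z where z: "1 <= z" "ennreal (p * R powr (p - 1)) * (NN e. ennreal (exp (- z * fst e)) * k e) <= ennreal (1/2)"
  by (rule small_laplace[of "p * R powr (p - 1)"]) (use p in auto)
 have "AE t in lborel. 0 < t & t < T --> L1_norm (%x. u t x - v t x) <= ennreal (exp (z * T) * (2 * 0))"
  using norm_minus(3)[of L1_norm] by (intro mild_dependence[OF _ D D T u v R(1) bd bd' _ _ z]) auto
 then have "L1_norm (%x. u t x - v t x) <= ennreal (exp (z * T) * (2 * 0))"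
  using XT by (intro L1_AE_extend[OF _ _ T _ t]) (auto simp: XT_def)
 moreover have "u t : Bor" "v t : Bor"
  using XT t by (auto simp: XT_def continuous_wrt_def normed_functions_def)
 ultimately show ?thesis using norm_eq_0_iff[of L1_norm "%x. u t x - v t x"] by simp
qed

text \<open>The bound \<open>R\<close> of a mild solution is inherited by the monotone limit \<open>V\<close> on every interval
 on which \<open>V\<close> is bounded, so \<open>V\<close> cannot cease to be bounded before the solution ends.\<close>

lemma good_of_mild_solution:
 assumes D: "datum u0 f R0" and T: "0 < T" and v: "mild_solution Z Y p u0 T v"
 shows "good f T"
proof -
 note f = datumD(4)[OF D]
 note [measurable] = f
 obtain R where R: "0 <= R" "AE t in lborel. 0 < t & t < T --> Linf_norm (v t) <= ennreal R"
  using XT_bound[of v T] v by (auto simp: mild_solution_def)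
 have VR: "AE e in lborel. 0 < fst e & fst e < tau --> V f e <= ennreal R" if g: "good f tau" and tau: "0 < tau" "tau <= T" for tau
 proof -
  have eq: "AE x in lborel. sol u0 f t x = v t x" if "t : {0..tau}" for t
   by (rule mild_unique[OF D tau(1) sol_mild_solution[OF D g tau(1)] mild_solution_restrict[OF v tau(2)] that])
  have "AE t in lborel. AE x in lborel. 0 < fst (t, x) & fst (t, x) < tau --> V f (t, x) <= ennreal R"
   using sol_eq_V[OF D g tau(1)] R(2)
  proof eventually_elim
   case (elim t)
   show ?case
   proof (cases "0 < t & t < tau")
   case True
   have "AE x in lborel. sol u0 f t x = v t x" using True by (intro eq) auto
   then show ?thesis using Linf_norm_AE[of "v t"]
   proof eventually_elim
   case (elim x)
   have "V f (t, x) = ennreal (v t x)" using elim(1) True \<open>0 < t & t < tau --> (\<forall>x. V f (t, x) = ennreal (sol u0 f t x))\<close> by simp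
   also have "... <= ennreal \<bar>v t x\<bar>" by (intro ennreal_leI) simp
   also have "... <= ennreal R" using elim(2) True tau(2) \<open>0 < t & t < T --> Linf_norm (v t) <= ennreal R\<close> by (auto intro: order_trans)
   finally show ?case by simp
   qed
   qed auto
  qed
  then show ?thesis by (subst joint_slice_AE) simp_all
 qed
 define S where "S = {tau. 0 < tau & tau <= T & good f tau}"
 have step: "\<exists>tau'\<in>S. tau < tau'" if h: "0 <= tau" "tau < T" "good f tau" for tau
 proof -
  obtain dl where d: "0 < dl" "good f (tau + dl)"
   using good_extend[OF f datumD(6)[OF D] datumD(8)[OF D] h(1,3)] by blast
  then have "min (tau + dl) T : S" "tau < min (tau + dl) T" using h T by (auto simp: S_def intro: good_mono)
  then show ?thesis by blast
 qed
 obtain tau0 where t0: "tau0 : S" using step[OF order_refl T good_0] by blast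
 have bdd: "bdd_above S" by (rule bdd_aboveI[of _ T]) (simp add: S_def)
 define s where "s = Sup S"
 have "tau0 <= s" unfolding s_def by (rule cSup_upper[OF t0 bdd])
 moreover have "0 < tau0" using t0 by (simp add: S_def)
 ultimately have s0: "0 < s" by linarith
 have sT: "s <= T" unfolding s_def
 proof (rule cSup_least)
  show "S \<noteq> {}" using t0 by blast
  show "x <= T" if "x : S" for x using that by (simp add: S_def)
 qed
 note s = s0 sT
 \<comment> \<open>Countably many good times approach the supremum, so the bound \<open>R\<close>,
   which is the same for each of them, survives there outside one null set.\<close>
 have "\<exists>tau\<in>S. s - 1 / real (Suc n) < tau" for n
 proof -
  have "S \<noteq> {}" using t0 by blast
  moreover have "s - 1 / real (Suc n) < Sup S" by (simp add: s_def)
  ultimately show ?thesis using less_cSup_iff[OF _ bdd] by blast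
 qed
 then obtain tau where tau: "!!n. tau n : S" "!!n. s - 1 / real (Suc n) < tau n" by metis
 have "AE e in lborel. 0 < fst e & fst e < tau n --> V f e <= ennreal R" for n
  using tau(1)[of n] by (intro VR) (auto simp: S_def)
 then have "AE e in lborel. \<forall>n. 0 < fst e & fst e < tau n --> V f e <= ennreal R" unfolding AE_all_countable by (rule allI)
 then have "AE e in lborel. 0 < fst e & fst e < s --> V f e <= ennreal R"
 proof eventually_elim
  case (elim e)
  show ?case
  proof
   assume e: "0 < fst e & fst e < s"
   then obtain n where "inverse (real (Suc n)) < s - fst e" using reals_Archimedean[of "s - fst e"] by auto
   then have "fst e < tau n" using tau(2)[of n] by (simp add: inverse_eq_divide del: of_nat_Suc)
   then show "V f e <= ennreal R" using elim e by blast
  qed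
 qed
 then have gs: "good f s" by (auto simp: good_def)
 have "s = T"
 proof (rule ccontr)
  assume "s \<noteq> T"
  then obtain tau' where "tau' : S" "s < tau'" using step[OF less_imp_le[OF s0] _ gs] sT by fastforce
  then show False using cSup_upper[OF \<open>tau' : S\<close> bdd] unfolding s_def by linarith
 qed
 then show ?thesis using gs by simp
qed

end

section \<open>Maximality, comparison, dependence on data and BUC regularity\<close>

lemma continuous_wrt_existence:
 assumes "!!T. 0 < T ==> ereal T < Tm ==> continuous_wrt N {0..T} v"
 shows "continuous_wrt N (existence_interval Tm) v"
 unfolding continuous_wrt_def
proof (intro ballI)
 fix t assume t: "t : existence_interval Tm"
 then obtain T where T: "t < T" "ereal T < Tm" using ereal_dense2[of "ereal t" Tm] by (auto simp: existence_interval_def)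
 have t0: "0 <= t" using t by (simp add: existence_interval_def)
 have "at t within existence_interval Tm = at t within {0..T}"
  using T by (intro at_within_nhd[of t "{..<T}"]) (auto simp: existence_interval_def intro: less_trans[OF _ T(2)])
 then show "v t : normed_functions N & ((%s. N (%x. v s x - v t x)) \<longlongrightarrow> 0) (at t within existence_interval Tm)"
  using assms[of T] T t0 by (auto simp: continuous_wrt_def)
qed

text \<open>Were the value at \<open>x\<close> larger, the oscillation bound would keep the absolute
  value of \<open>h\<close> at least \<open>eta\<close> on the ball of radius \<open>d\<close>
  around \<open>x\<close>, more than its L^1 norm allows.\<close>

lemma abs_le_of_L1_norm:
 fixes h :: "real^'n => real"
 assumes [measurable]: "h : Bor" and d: "0 < d" and eta: "0 < eta"
  and osc: "!!x x'. dist x x' < d ==> \<bar>h x - h x'\<bar> <= eta"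
  and L1: "L1_norm h < ennreal eta * emeasure lborel (ball (0 :: real^'n) d)"
 shows "\<bar>h x\<bar> <= 2 * eta"
proof (rule ccontr)
 assume n: "\<not> \<bar>h x\<bar> <= 2 * eta"
 have "ennreal eta * emeasure lborel (ball x d) = (NN y. ennreal eta * indicator (ball x d) y)"
  by (rule nn_integral_cmult_indicator[symmetric]) simp
 also have "... <= L1_norm h"
  unfolding L1_norm_def
 proof (rule nn_integral_mono)
  fix y
  have "eta <= \<bar>h y\<bar>" if "dist x y < d" using osc[OF that] n by linarith
  then show "ennreal eta * indicator (ball x d) y <= ennreal \<bar>h y\<bar>"
   by (auto split: split_indicator intro!: ennreal_leI)
 qed
 finally show False using L1 d by (simp add: emeasure_ball)
qed

lemma norms_le_X_norm: "L1_norm f <= X_norm f" "Linf_norm f <= X_norm f"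
 by (simp_all add: X_norm_def)

context mild_setting
begin

text \<open>Clipping into the interval from 0 to \<open>Linf_norm u0\<close> alters a nonnegative
  bounded datum on a null set only and makes the bounds of \<open>datum\<close> hold
  everywhere.\<close>

definition rep :: "(real^'n => real) => real^'n => real" where
 "rep u0 x = min (max 0 (u0 x)) (enn2real (Linf_norm u0))"

lemma datum_rep:
 assumes u: "u0 : L1 \<inter> Linf" and nn: "AE x in lborel. 0 <= u0 x"
 shows "datum u0 (rep u0) (enn2real (Linf_norm u0))"
proof -
 have int: "integrable lborel u0" by (rule X_norm_less_top[OF u])
 have [measurable]: "u0 : Bor" using u by (simp add: normed_functions_def)
 have eq: "AE x in lborel. u0 x = rep u0 x"
  using Linf_norm_AE[of u0] nn
 proof eventually_elim
  case (elim x)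
  have "Linf_norm u0 = ennreal (enn2real (Linf_norm u0))" using u by (simp add: normed_functions_def)
  then have "\<bar>u0 x\<bar> <= enn2real (Linf_norm u0)" using elim(1) by (metis ennreal_le_iff enn2real_nonneg)
  then show ?case using elim(2) by (simp add: rep_def)
 qed
 have m: "rep u0 : Bor" unfolding rep_def[abs_def] by measurable
 have "integrable lborel (rep u0)" using integrable_cong_AE[of u0 lborel "rep u0"] m eq int by simp
 then show ?thesis using int eq by (auto simp: datum_def rep_def)
qed

definition tmax :: "(real^'n => real) => ereal" where "tmax f = Sup (ereal ` {T. 0 < T & good f T})"

text \<open>\<open>good_extend\<close> makes the set of good times open to the right, so its
  supremum is never attained.\<close>

lemma good_iff_less_tmax:
 assumes D: "datum u0 f R0" and T: "0 < T"
 shows "good f T \<longleftrightarrow> ereal T < tmax f"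
proof
 assume g: "good f T"
 obtain dl where d: "0 < dl" "good f (T + dl)"
  using good_extend[OF datumD(4)[OF D] datumD(6)[OF D] datumD(8)[OF D] less_imp_le[OF T] g] by blast
 have "ereal T < ereal (T + dl)" using d by simp
 also have "... <= tmax f" unfolding tmax_def by (rule Sup_upper) (use d T in auto)
 finally show "ereal T < tmax f" .
next
 assume "ereal T < tmax f"
 then show "good f T" unfolding tmax_def less_Sup_iff by (auto intro: good_mono)
qed

lemma tmax_pos: "datum u0 f R0 ==> 0 < tmax f"
proof -
 assume D: "datum u0 f R0"
 obtain dl where d: "0 < dl" "good f (0 + dl)"
  using good_extend[OF datumD(4)[OF D] datumD(6)[OF D] datumD(8)[OF D] order_refl good_0] by blast
 then have "ereal dl < tmax f" using good_iff_less_tmax[OF D d(1)] by simp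
 moreover have "0 < ereal dl" using d by simp
 ultimately show ?thesis by (rule less_trans[rotated])
qed

lemma sol_mild: "datum u0 f R0 ==> 0 < T ==> ereal T < tmax f ==> mild_solution Z Y p u0 T (sol u0 f)"
 using good_iff_less_tmax sol_mild_solution by blast

lemma sol_maximal:
 assumes D: "datum u0 f R0"
 shows "nonneg_maximal_solution Z Y p u0 (tmax f) (sol u0 f)"
proof -
 \<comment> \<open>More than maximality: no mild solution at all reaches \<open>tmax f\<close>,
   since its bound would make that time good.\<close>
 have "\<not> mild_solution Z Y p u0 T v" if "tmax f <= ereal T" for T v
 proof
  assume "mild_solution Z Y p u0 T v"
  moreover have T: "0 < T" using less_le_trans[OF tmax_pos[OF D] that] by simp
  ultimately have "good f T" by (intro good_of_mild_solution[OF D])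
  then show False using that good_iff_less_tmax[OF D T] by simp
 qed
 moreover have "continuous_wrt L1_norm (existence_interval (tmax f)) (sol u0 f)"
  using sol_mild[OF D] by (intro continuous_wrt_existence) (auto simp: mild_solution_def XT_def)
 ultimately show ?thesis
  unfolding nonneg_maximal_solution_def maximal_mild_solution_def
  using tmax_pos[OF D] sol_mild[OF D] sol_nonneg[OF D]
  by (auto simp: existence_interval_def mild_solution_def XT_def)
qed

text \<open>A maximal solution cannot outlive \<open>tmax f\<close> by
  \<open>good_of_mild_solution\<close>; were it to stop earlier, \<open>sol u0 f\<close> would
  extend it properly. Agreement in between is \<open>mild_unique\<close> on compact
  subintervals.\<close>

lemma maximal_solution_eq:
 assumes D: "datum u0 f R0" and u: "nonneg_maximal_solution Z Y p u0 Tm u"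
 shows "Tm = tmax f" "t : existence_interval Tm ==> AE x in lborel. u t x = sol u0 f t x"
proof -
 have Tm: "0 < Tm" and um: "!!T. 0 < T ==> ereal T < Tm ==> mild_solution Z Y p u0 T u"
  and mx: "!!T v. Tm <= ereal T ==> mild_solution Z Y p u0 T v ==> \<not> (\<forall>t\<in>existence_interval Tm. AE x in lborel. v t x = u t x)"
  using u unfolding nonneg_maximal_solution_def maximal_mild_solution_def by blast+
 have le: "Tm <= tmax f"
 proof (rule ccontr)
  assume "\<not> Tm <= tmax f"
  then have "tmax f < Tm" by simp
  then obtain T where T: "tmax f < ereal T" "ereal T < Tm" using ereal_dense2 by blast
  have T0: "0 < T" using less_trans[OF tmax_pos[OF D] T(1)] by simp
  have "good f T" by (rule good_of_mild_solution[OF D T0 um[OF T0 T(2)]])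
  then show False using good_iff_less_tmax[OF D T0] T(1) by simp
 qed
 have eq: "AE x in lborel. u t x = sol u0 f t x" if t: "t : existence_interval Tm" for t
 proof -
  obtain T where T: "t < T" "ereal T < Tm" using ereal_dense2[of "ereal t" Tm] t by (auto simp: existence_interval_def)
  have T0: "0 < T" "t : {0..T}" using t T by (auto simp: existence_interval_def)
  show ?thesis by (rule mild_unique[OF D T0(1) um[OF T0(1) T(2)] sol_mild[OF D T0(1) less_le_trans[OF T(2) le]] T0(2)])
 qed
 then show "AE x in lborel. u t x = sol u0 f t x" if "t : existence_interval Tm" for t using that by blast
 show "Tm = tmax f"
 proof (rule ccontr)
  assume "Tm \<noteq> tmax f"
  then have "Tm < tmax f" using le by simp
  then obtain T where T: "Tm < ereal T" "ereal T < tmax f" using ereal_dense2 by blast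
  have T0: "0 < T" using less_trans[OF Tm T(1)] by simp
  have "\<forall>t\<in>existence_interval Tm. AE x in lborel. sol u0 f t x = u t x"
  proof
   fix t assume "t : existence_interval Tm"
   from eq[OF this] show "AE x in lborel. sol u0 f t x = u t x" by eventually_elim simp
  qed
  then show False using mx[OF less_imp_le[OF T(1)] sol_mild[OF D T0 T(2)]] by blast
 qed
qed

lemma V_mono:
 assumes fg: "AE x in lborel. f x <= g x"
 shows "V f e <= V g e"
proof -
 have A: "A f e <= A g e" for e
  unfolding A_def using fg by (intro nn_integral_mono_AE) (auto elim!: eventually_mono intro: mult_left_mono ennreal_leI)
 have "U f n e <= U g n e" for n e
 proof (induction n arbitrary: e)
  case (Suc n)
  then show ?case by (auto intro!: add_mono A nconv_mono AE_I2 pw_mono p0)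
 qed simp
 then show ?thesis unfolding V_def by (intro SUP_mono) blast
qed

lemma nconv_V_finite:
 assumes D: "datum u0 f R0" and t: "t : existence_interval (tmax f)"
 shows "nconv k (%e. pw p (V f e)) (t, x) < \<infinity>"
proof -
 obtain T where tT: "t < T" "ereal T < tmax f" using ereal_dense2[of "ereal t" "tmax f"] t by (auto simp: existence_interval_def)
 have T0: "0 < T" using t tT by (auto simp: existence_interval_def)
 have g: "good f T" using good_iff_less_tmax[OF D T0] tT(2) by simp
 obtain F C B where F: "source \<alpha>\<^sub>1 \<alpha>\<^sub>2 c p Z Y F C B T"
  "!!t x. t <= T ==> nconv k (%e. pw p (V f e)) (t, x) = nconv k (%e. ennreal (F e)) (t, x)"
  by (rule good_source[OF D g T0]) blast
 interpret source \<alpha>\<^sub>1 \<alpha>\<^sub>2 c p Z Y F C B T by (rule F(1))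
 show ?thesis using F(2)[of t x] W_eq[of "(t, x)"] tT by simp
qed

lemma sol_mono:
 assumes D: "datum u0 f R0" and D': "datum v0 g R1" and le: "AE x in lborel. u0 x <= v0 x"
  and t: "t : existence_interval (tmax g)"
 shows "AE x in lborel. sol u0 f t x <= sol v0 g t x"
proof -
 have t0: "0 <= t" using t by (simp add: existence_interval_def)
 have fg: "AE x in lborel. f x <= g x" using datumD(7)[OF D] datumD(7)[OF D'] le by eventually_elim simp
 \<comment> \<open>The representative \<open>g\<close> dominates \<open>f\<close> only almost
   everywhere; the maximum is a representative of \<open>v0\<close> that dominates \<open>f\<close>
   everywhere, as \<open>S_mono\<close> wants.\<close>
 define h where "h x = max (f x) (g x)" for x
 have Dh: "datum v0 h (max R0 R1)"
  unfolding datum_def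
 proof (intro conjI allI)
  show "integrable lborel h" unfolding h_def[abs_def] using datumD(2)[OF D] datumD(2)[OF D'] by (rule integrable_max)
  show "AE x in lborel. v0 x = h x" using fg datumD(7)[OF D'] by eventually_elim (simp add: h_def)
  show "0 <= h x" "h x <= max R0 R1" for x
   using datumD(5,6)[OF D, of x] datumD(5,6)[OF D', of x] by (auto simp: h_def)
 qed (rule datumD(1)[OF D'])
 have S: "S_family Z t f x <= S_family Z t h x" for x
  using datumD(4,5)[OF D] datumD(4,6)[OF Dh] by (intro S_mono[of f h "max R0 R1"] t0) (auto simp: h_def)
 \<comment> \<open>Finiteness of the larger convolution is essential here, because
   \<open>enn2real\<close> sends infinity to 0.\<close>
 have n: "enn2real (nconv k (%e. pw p (V f e)) (t, x)) <= enn2real (nconv k (%e. pw p (V g e)) (t, x))" for x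
  using nconv_V_finite[OF D' t] by (intro enn2real_mono nconv_mono AE_I2 pw_mono p0 V_mono[OF fg]) simp
 show ?thesis using S_datum_AE[OF D t0] S_datum_AE[OF Dh t0]
  by eventually_elim (use S n in \<open>simp add: sol_def add_mono\<close>)
qed

lemma dependence_XT:
 fixes R eps :: real
 assumes T: "0 < T" and e: "0 < eps"
 obtains dl where "0 < dl" "!!u0 f R0 v0 g R1 u v. datum u0 f R0 ==> datum v0 g R1 ==> mild_solution Z Y p u0 T u ==> mild_solution Z Y p v0 T v
  ==> XT_norm T u <= ennreal R ==> XT_norm T v <= ennreal R ==> X_norm (%x. u0 x - v0 x) < ennreal dl
  ==> XT_norm T (%t x. u t x - v t x) < ennreal eps"
proof -
 define R' where "R' = max R 0"
 have R': "0 <= R'" "ennreal R <= ennreal R'" by (auto simp: R'_def intro: ennreal_leI)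
 obtain z where z: "1 <= z" "ennreal (p * R' powr (p - 1)) * (NN e. ennreal (exp (- z * fst e)) * k e) <= ennreal (1/2)"
  by (rule small_laplace[of "p * R' powr (p - 1)"]) (use p in auto)
 \<comment> \<open>Both halves of the norm are then at most
   \<open>exp (z * T) * (2 * dl) = eps / 4\<close>. Since \<open>z\<close> was chosen from
   \<open>R\<close> before any solution, \<open>dl\<close> is uniform.\<close>
 define dl where "dl = eps / (8 * exp (z * T))"
 have d: "0 < dl" using e by (simp add: dl_def)
 have b: "exp (z * T) * (2 * dl) = eps / 4" by (simp add: dl_def)
 show ?thesis
 proof (rule that[OF d])
  fix u0 f R0 v0 g R1 u v
  assume D: "datum u0 f R0" "datum v0 g R1" and u: "mild_solution Z Y p u0 T u" and v: "mild_solution Z Y p v0 T v"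
   and R: "XT_norm T u <= ennreal R" "XT_norm T v <= ennreal R" and X: "X_norm (%x. u0 x - v0 x) < ennreal dl"
  have XT: "u : XT T" "v : XT T" using u v by (auto simp: mild_solution_def)
  have bd: "AE t in lborel. 0 < t & t < T --> Linf_norm (w t) <= ennreal R'" if "XT_norm T w <= ennreal R" for w
  proof -
   have "ess_sup_Linf T w <= XT_norm T w" by (simp add: XT_norm_def)
   then have le: "ess_sup_Linf T w <= ennreal R'" using that R'(2) by (meson order_trans)
   have "AE t in lebesgue_on {0<..<T}. Linf_norm (w t) <= ess_sup_Linf T w"
   unfolding ess_sup_Linf_def by (rule esssup_AE)
   then have "AE t in lborel. t : {0<..<T} --> Linf_norm (w t) <= ess_sup_Linf T w" by (subst (asm) AE_lebesgue_on) auto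
   then show ?thesis
   proof eventually_elim
   case (elim t)
   then show ?case using order_trans[OF _ le] by auto
   qed
  qed
  have dep: "AE t in lborel. 0 < t & t < T --> N (%x. u t x - v t x) <= ennreal (eps / 4)" if N: "N : {L1_norm, Linf_norm}" for N
  proof -
   have "N (%x. u0 x - v0 x) <= X_norm (%x. u0 x - v0 x)" using N norms_le_X_norm by auto
   then have "N (%x. u0 x - v0 x) <= ennreal dl" using X by (meson less_imp_le order_trans)
   from mild_dependence[OF N D T u v R'(1) bd[OF R(1)] bd[OF R(2)] less_imp_le[OF d] this z] show ?thesis unfolding b .
  qed
  have "(SUP t\<in>{0..T}. L1_norm (%x. u t x - v t x)) <= ennreal (eps / 4)"
   using XT dep[of L1_norm] by (intro SUP_least L1_AE_extend[OF _ _ T]) (auto simp: XT_def)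
  moreover have "ess_sup_Linf T (%t x. u t x - v t x) <= ennreal (eps / 4)"
   unfolding ess_sup_Linf_def
  proof (rule esssup_I)
   have "strongly_measurable_wrt Linf_norm (lebesgue_on {0<..<T}) (%t x. u t x + - v t x)"
   using XT by (intro strongly_measurable_add strongly_measurable_uminus) (auto simp: XT_def)
   from strongly_measurable_norm[OF _ _ this]
   show "(%t. Linf_norm (%x. u t x - v t x)) : borel_measurable (lebesgue_on {0<..<T})" by simp
   show "AE t in lebesgue_on {0<..<T}. Linf_norm (%x. u t x - v t x) <= ennreal (eps / 4)"
   using dep[of Linf_norm] unfolding AE_lebesgue_on[OF borel_open[OF open_greaterThanLessThan]] by simp
  qed
  ultimately have "XT_norm T (%t x. u t x - v t x) <= ennreal (eps / 4) + ennreal (eps / 4)" unfolding XT_norm_def by (rule add_mono)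
  also have "... = ennreal (eps / 4 + eps / 4)" using e by (intro ennreal_plus[symmetric]) auto
  also have "... < ennreal eps" using e by (intro ennreal_lessI) auto
  finally show "XT_norm T (%t x. u t x - v t x) < ennreal eps" .
 qed
qed

text \<open>Convolution with a probability measure preserves the modulus of continuity of
  \<open>g0\<close>, and that of \<open>W\<close> is \<open>C\<close> times the L^1 oscillation of
  the kernel. Neither involves the time, which gives one modulus for all \<open>t\<close> up to
  \<open>T\<close>.\<close>

lemma sol_equicontinuous:
 assumes D: "datum g0 f R0" and g: "good f T" and T: "0 < T"
  and g0: "!!x. 0 <= g0 x" "!!x. g0 x <= Rg" and uc: "uniformly_continuous_on UNIV g0" and e: "0 < eta"
 shows "\<exists>d>0. \<forall>t x x'. 0 <= t & t <= T & dist x x' < d --> \<bar>sol g0 f t x - sol g0 f t x'\<bar> <= eta"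
  and "\<exists>M. \<forall>t x. 0 <= t & t <= T --> \<bar>sol g0 f t x\<bar> <= M"
proof -
 obtain F C B where F: "source \<alpha>\<^sub>1 \<alpha>\<^sub>2 c p Z Y F C B T"
  "!!t x. t <= T ==> nconv k (%e. pw p (V f e)) (t, x) = nconv k (%e. ennreal (F e)) (t, x)"
  by (rule good_source[OF D g T]) blast
 interpret source \<alpha>\<^sub>1 \<alpha>\<^sub>2 c p Z Y F C B T by (rule F(1))
 have sol: "sol g0 f t x = S_family Z t g0 x + W (t, x)" if "t <= T" for t x
  using F(2)[of t x] W_eq[of "(t, x)"] that W_nn by (simp add: sol_def)
 note gm = datumD(3)[OF D]
 have S: "0 <= S_family Z t g0 x" "S_family Z t g0 x <= Rg" if "0 <= t" for t x
  by (rule S_bounds[OF gm g0 that])+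
 have "\<bar>sol g0 f t x\<bar> <= Rg + C * enn2real (kmass (T + 1))" if "0 <= t" "t <= T" for t x
  using S[OF that(1), of x] W_nn[of "(t, x)"] W_le[of "(t, x)"] sol[OF that(2), of x] by linarith
 then show "\<exists>M. \<forall>t x. 0 <= t & t <= T --> \<bar>sol g0 f t x\<bar> <= M" by blast
 have "0 < eta / 2" using e by simp
 with uc[unfolded uniformly_continuous_on_def, rule_format] obtain d1
  where d1': "0 < d1" "\<forall>x\<in>UNIV. \<forall>x'\<in>UNIV. dist x' x < d1 --> dist (g0 x') (g0 x) < eta / 2" by meson
 have d1: "0 < d1" "dist x x' < d1 ==> dist (g0 x) (g0 x') < eta / 2" for x x' using d1' by simp_all
 obtain d2 where d2: "0 < d2" "!!h. norm h < d2 ==> osc h < ennreal (eta / 2 / (C + 1))"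
  using osc_small[of "eta / 2 / (C + 1)"] e C_nn by auto
 have "\<bar>sol g0 f t x - sol g0 f t x'\<bar> <= eta" if t: "0 <= t" "t <= T" and x: "dist x x' < min d1 d2" for t x x'
 proof -
  interpret Z: prob_space "Z0 t" by (rule prob_Z0)
  have i: "integrable (Z0 t) (%y. g0 (x - y))" for x by (rule shift_integrable[OF gm g0])
  have "S_family Z t g0 x - S_family Z t g0 x' = (\<integral>y. g0 (x - y) - g0 (x' - y) \<partial>Z0 t)"
   unfolding S_family_Z0[OF gm t(1)] measure_convolution_def by (rule Bochner_Integration.integral_diff[symmetric, OF i i])
  moreover have "\<bar>\<integral>y. g0 (x - y) - g0 (x' - y) \<partial>Z0 t\<bar> <= (\<integral>y. \<bar>g0 (x - y) - g0 (x' - y)\<bar> \<partial>Z0 t)" by (rule integral_abs_bound)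
  moreover have "(\<integral>y. \<bar>g0 (x - y) - g0 (x' - y)\<bar> \<partial>Z0 t) <= eta / 2"
  proof (rule Z.integral_le_const)
   show "integrable (Z0 t) (%y. \<bar>g0 (x - y) - g0 (x' - y)\<bar>)" using i by (intro integrable_abs Bochner_Integration.integrable_diff)
   show "AE y in Z0 t. \<bar>g0 (x - y) - g0 (x' - y)\<bar> <= eta / 2"
   using d1(2)[of "x - y" "x' - y" for y] x by (intro AE_I2) (auto simp: dist_norm intro: less_imp_le)
  qed
  moreover have "\<bar>W (t, x) - W (t, x')\<bar> <= eta / 2"
  proof -
   have "ennreal \<bar>W (t, x) - W (t, x')\<bar> <= ennreal C * osc ((t, x) - (t, x'))" by (rule W_diff_le)
   also have "... <= ennreal C * ennreal (eta / 2 / (C + 1))"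
   using d2(2)[of "(0, x - x')"] x by (intro mult_left_mono) (auto simp: norm_Pair dist_norm)
   also have "... = ennreal (C * (eta / 2 / (C + 1)))" using C_nn e by (intro ennreal_mult[symmetric]) auto
   also have "... <= ennreal (eta / 2)" using C_nn e by (intro ennreal_leI) (simp add: field_simps)
   finally show ?thesis using e by (simp add: ennreal_le_iff)
  qed
  ultimately show ?thesis using sol[OF t(2), of x] sol[OF t(2), of x'] by linarith
 qed
 then show "\<exists>d>0. \<forall>t x x'. 0 <= t & t <= T & dist x x' < d --> \<bar>sol g0 f t x - sol g0 f t x'\<bar> <= eta"
  using d1(1) d2(1) by (intro exI[of _ "min d1 d2"]) auto
qed

lemma sol_BUC:
 assumes D: "datum g0 f R0" and g0: "!!x. 0 <= g0 x" "!!x. g0 x <= Rg" and uc: "uniformly_continuous_on UNIV g0"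
 shows "t : existence_interval (tmax f) ==> sol g0 f t : BUC" "continuous_wrt X_norm (existence_interval (tmax f)) (sol g0 f)"
proof -
 have eqc: "\<exists>d>0. \<forall>t x x'. 0 <= t & t <= T & dist x x' < d --> \<bar>sol g0 f t x - sol g0 f t x'\<bar> <= eta"
  "\<exists>M. \<forall>t x. 0 <= t & t <= T --> \<bar>sol g0 f t x\<bar> <= M"
  if T: "0 < T" "ereal T < tmax f" and e: "0 < eta" for T eta :: real
  using sol_equicontinuous[OF D _ T(1) g0 uc e] good_iff_less_tmax[OF D T(1)] T(2) by auto
 show "sol g0 f t : BUC" if t: "t : existence_interval (tmax f)" for t
 proof -
  obtain T where T: "t < T" "ereal T < tmax f" using ereal_dense2[of "ereal t" "tmax f"] t by (auto simp: existence_interval_def)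
  have T0: "0 < T" "0 <= t" using t T by (auto simp: existence_interval_def)
  obtain M where "\<forall>t x. 0 <= t & t <= T --> \<bar>sol g0 f t x\<bar> <= M" using eqc(2)[OF T0(1) T(2) zero_less_one] by blast
  then have "bounded (range (sol g0 f t))" using T T0 unfolding bounded_iff by (intro exI[of _ M]) auto
  moreover have "uniformly_continuous_on UNIV (sol g0 f t)"
   unfolding uniformly_continuous_on_def
  proof (intro allI impI)
   fix e :: real assume e: "0 < e"
   then obtain d where "0 < d" "\<forall>t x x'. 0 <= t & t <= T & dist x x' < d --> \<bar>sol g0 f t x - sol g0 f t x'\<bar> <= e / 2"
   using eqc(1)[OF T0(1) T(2), of "e / 2"] by auto
   then show "\<exists>d>0. \<forall>x\<in>UNIV. \<forall>x'\<in>UNIV. dist x' x < d --> dist (sol g0 f t x') (sol g0 f t x) < e"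
   using T T0 e by (intro exI[of _ d]) (force simp: dist_real_def)
  qed
  ultimately show ?thesis by (simp add: BUC_def)
 qed
 show "continuous_wrt X_norm (existence_interval (tmax f)) (sol g0 f)"
 proof (rule continuous_wrt_existence)
  fix T assume T: "0 < T" "ereal T < tmax f"
  have cont: "continuous_wrt L1_norm {0..T} (sol g0 f)" using sol_mild[OF D T] by (simp add: mild_solution_def XT_def)
  have m: "sol g0 f t : Bor" "L1_norm (sol g0 f t) < \<infinity>" if "t : {0..T}" for t
   using cont that by (auto simp: continuous_wrt_def normed_functions_def)
  obtain M where M: "\<forall>t x. 0 <= t & t <= T --> \<bar>sol g0 f t x\<bar> <= M" using eqc(2)[OF T zero_less_one] by blast
  show "continuous_wrt X_norm {0..T} (sol g0 f)"
  proof (rule continuous_wrtI_sequentially)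
   fix t assume t: "t : {0..T}"
   have "Linf_norm (sol g0 f t) <= ennreal M" using M t by (intro Linf_norm_le m) auto
   then have "Linf_norm (sol g0 f t) < \<infinity>" by (rule le_less_trans) simp
   then show "sol g0 f t : normed_functions X_norm" using m[OF t] by (simp add: normed_functions_def X_norm_def)
  next
   fix t X assume t: "t : {0..T}" and X: "!!n. X n : {0..T}" "X ~~> t"
   define h where "h n x = sol g0 f (X n) x - sol g0 f t x" for n x
   have hm: "h n : Bor" for n unfolding h_def[abs_def] using m(1)[OF X(1)] m(1)[OF t] by simp
   have L1: "(%n. L1_norm (h n)) ~~> 0"
   unfolding h_def[abs_def] by (rule continuous_wrt_sequentially[OF _ cont t X]) simp
   have "(%n. Linf_norm (h n)) ~~> 0"
   proof (rule order_tendstoI)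
   fix a :: ennreal assume a: "0 < a"
   \<comment> \<open>The difference of the solution at two times oscillates by at most
     \<open>2 * eta\<close>, and \<open>abs_le_of_L1_norm\<close> doubles this once more, whence the
     factor 4.\<close>
   obtain eta where e: "0 < eta" "ennreal (4 * eta) < a"
   proof (cases a)
   case (real r)
   then show ?thesis using a that[of "r / 8"] by (simp add: ennreal_less_iff)
   qed (use that[of 1] in simp)
   obtain d where d: "0 < d" "!!t x x'. 0 <= t ==> t <= T ==> dist x x' < d ==> \<bar>sol g0 f t x - sol g0 f t x'\<bar> <= eta"
   using eqc(1)[OF T e(1)] by blast
   have "0 < emeasure lborel (ball (0 :: real^'n) d)"
   unfolding emeasure_ball[OF less_imp_le[OF d(1)]] ennreal_less_zero_iff
   using d(1) by (intro mult_pos_pos zero_less_power unit_ball_vol_pos) simp_all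
   moreover have "0 < ennreal (2 * eta)" using e(1) by (simp only: ennreal_less_zero_iff mult_pos_pos zero_less_numeral)
   ultimately have "0 < ennreal (2 * eta) * emeasure lborel (ball (0 :: real^'n) d)"
   by (simp only: ennreal_zero_less_mult_iff simp_thms)
   from order_tendstoD(2)[OF L1 this] show "eventually (%n. Linf_norm (h n) < a) sequentially"
   proof eventually_elim
   case (elim n)
   have "\<bar>h n x\<bar> <= 2 * (2 * eta)" for x
   proof (rule abs_le_of_L1_norm[OF hm d(1) _ _ elim])
   fix x x' :: "real^'n" assume "dist x x' < d"
   then have "\<bar>sol g0 f (X n) x - sol g0 f (X n) x'\<bar> <= eta" "\<bar>sol g0 f t x - sol g0 f t x'\<bar> <= eta"
   using X(1)[of n] t by (auto intro!: d(2))
   then show "\<bar>h n x - h n x'\<bar> <= 2 * eta" unfolding h_def by linarith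
   qed (use e(1) in simp)
   then have "Linf_norm (h n) <= ennreal (4 * eta)" by (intro Linf_norm_le hm) simp
   then show ?case using e(2) by (rule le_less_trans)
   qed
   qed simp
   from tendsto_add[OF L1 this] show "(%n. X_norm (%x. sol g0 f (X n) x - sol g0 f t x)) ~~> 0"
   by (simp add: X_norm_def h_def[abs_def])
  qed
 qed
qed

text \<open>The nonnegative continuous representative \<open>g0\<close> of \<open>u0\<close> is
  propagated in its place, because \<open>S_family\<close> acts pointwise; the iteration keeps its
  own datum \<open>rep u0\<close>, so existence time and almost everywhere values are
  unchanged.\<close>

lemma BUC_solution:
 assumes u0: "u0 : L1 \<inter> Linf" "AE x in lborel. 0 <= u0 x" and g: "g : BUC" "AE x in lborel. u0 x = g x"
  and u: "nonneg_maximal_solution Z Y p u0 Tm u"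
 shows "\<exists>v. (\<forall>t\<in>existence_interval Tm. v t : BUC & (AE x in lborel. v t x = u t x)) & continuous_wrt X_norm (existence_interval Tm) v"
proof -
 let ?f = "rep u0"
 have D: "datum u0 ?f (enn2real (Linf_norm u0))" by (rule datum_rep[OF u0])
 define g0 where "g0 x = max 0 (g x)" for x
 have uc: "uniformly_continuous_on UNIV g0"
  unfolding uniformly_continuous_on_def
 proof (intro allI impI)
  fix e :: real assume "0 < e"
  then obtain d where d: "0 < d" "\<forall>x\<in>UNIV. \<forall>x'\<in>UNIV. dist x' x < d --> dist (g x') (g x) < e"
   using g(1) unfolding BUC_def uniformly_continuous_on_def by blast
  have "dist (g0 x') (g0 x) <= dist (g x') (g x)" for x x' by (auto simp: g0_def dist_real_def)
  then have "dist x' x < d ==> dist (g0 x') (g0 x) < e" for x x' using d(2) le_less_trans by blast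
  then show "\<exists>d>0. \<forall>x\<in>UNIV. \<forall>x'\<in>UNIV. dist x' x < d --> dist (g0 x') (g0 x) < e"
   using d(1) by blast
 qed
 obtain Rg where Rg: "!!x. \<bar>g x\<bar> <= Rg" using g(1) by (auto simp: BUC_def bounded_iff)
 have b: "0 <= g0 x" "g0 x <= Rg" for x using Rg[of x] by (auto simp: g0_def)
 have gm: "g0 : Bor"
  using uniformly_continuous_imp_continuous[OF uc] by (rule borel_measurable_continuous_onI)
 have eq: "AE x in lborel. g0 x = u0 x" using g(2) u0(2) by eventually_elim (simp add: g0_def)
 have "integrable lborel g0"
  using integrable_cong_AE[of g0 lborel u0] gm eq datumD(1,3)[OF D] by simp
 then have D': "datum g0 ?f (enn2real (Linf_norm u0))"
  using D eq by (auto simp: datum_def elim: eventually_elim2)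
 note Tm = maximal_solution_eq(1)[OF D u]
 have ae: "AE x in lborel. sol g0 ?f t x = u t x" if t: "t : existence_interval Tm" for t
 proof -
  have t0: "0 <= t" using t by (simp add: existence_interval_def)
  show ?thesis using S_datum_AE[OF D t0] S_datum_AE[OF D' t0] maximal_solution_eq(2)[OF D u t]
   by eventually_elim (simp add: sol_def)
 qed
 show ?thesis
 proof (intro exI[of _ "sol g0 ?f"] conjI ballI)
  fix t assume t: "t : existence_interval Tm"
  show "sol g0 ?f t : BUC" by (rule sol_BUC(1)[OF D' b uc t[unfolded Tm]])
  show "AE x in lborel. sol g0 ?f t x = u t x" by (rule ae[OF t])
 next
  show "continuous_wrt X_norm (existence_interval Tm) (sol g0 ?f)"
   unfolding Tm by (rule sol_BUC(2)[OF D' b uc])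
 qed
qed

end

theorem theorem3p5:
  fixes \<alpha>\<^sub>1 \<alpha>\<^sub>2 c p :: real
    and Z Y :: "real \<Rightarrow> (real^'n) measure"
  assumes "\<alpha>\<^sub>1 \<in> {0<..<1}" and "\<alpha>\<^sub>2 \<in> {0<..<1}" and "0 < c" and "1 < p"
    and "bernstein_function (\<lambda>s. inverse (Psi \<alpha>\<^sub>1 \<alpha>\<^sub>2 c s))"
    and "Z_kernel \<alpha>\<^sub>1 \<alpha>\<^sub>2 c Z" and "Y_kernel \<alpha>\<^sub>1 \<alpha>\<^sub>2 c Y"
  shows
    "(\<forall>u\<^sub>0 \<in> L1 \<inter> Linf. (AE x in lborel. 0 \<le> u\<^sub>0 x) \<longrightarrow>
       (\<exists>Tmax u. nonneg_maximal_solution Z Y p u\<^sub>0 Tmax u \<and>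
          (\<forall>Tmax' u'. nonneg_maximal_solution Z Y p u\<^sub>0 Tmax' u' \<longrightarrow>
             Tmax' = Tmax \<and>
             (\<forall>t\<in>existence_interval Tmax. AE x in lborel. u' t x = u t x))))
     \<and>
     (\<forall>u\<^sub>0 \<in> L1 \<inter> Linf. \<forall>Tmax u.
       (AE x in lborel. 0 \<le> u\<^sub>0 x) \<longrightarrow>
       (\<exists>g\<in>BUC. AE x in lborel. u\<^sub>0 x = g x) \<longrightarrow>
       nonneg_maximal_solution Z Y p u\<^sub>0 Tmax u \<longrightarrow>
       (\<exists>v. (\<forall>t\<in>existence_interval Tmax. v t \<in> BUC \<and> (AE x in lborel. v t x = u t x)) \<and>
            continuous_wrt X_norm (existence_interval Tmax) v))
     \<and>
     (\<forall>u\<^sub>0 \<in> L1 \<inter> Linf. \<forall>v\<^sub>0 \<in> L1 \<inter> Linf. \<forall>Tu u Tv v.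
       (AE x in lborel. 0 \<le> u\<^sub>0 x \<and> u\<^sub>0 x \<le> v\<^sub>0 x) \<longrightarrow>
       nonneg_maximal_solution Z Y p u\<^sub>0 Tu u \<longrightarrow>
       nonneg_maximal_solution Z Y p v\<^sub>0 Tv v \<longrightarrow>
       (\<forall>t\<in>existence_interval Tu \<inter> existence_interval Tv. AE x in lborel. u t x \<le> v t x))
     \<and>
     (\<forall>T>0. \<forall>R :: real. \<forall>\<epsilon>>0. \<exists>\<delta>>0.
       \<forall>u\<^sub>0 \<in> L1 \<inter> Linf. \<forall>v\<^sub>0 \<in> L1 \<inter> Linf. \<forall>Tu u Tv v.
       (AE x in lborel. 0 \<le> u\<^sub>0 x) \<longrightarrow> (AE x in lborel. 0 \<le> v\<^sub>0 x) \<longrightarrow>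
       nonneg_maximal_solution Z Y p u\<^sub>0 Tu u \<longrightarrow>
       nonneg_maximal_solution Z Y p v\<^sub>0 Tv v \<longrightarrow>
       ereal T < Tu \<longrightarrow> ereal T < Tv \<longrightarrow>
       XT_norm T u \<le> ennreal R \<longrightarrow> XT_norm T v \<le> ennreal R \<longrightarrow>
       X_norm (\<lambda>x. u\<^sub>0 x - v\<^sub>0 x) < ennreal \<delta> \<longrightarrow>
       XT_norm T (\<lambda>t x. u t x - v t x) < ennreal \<epsilon>)"
proof -
  interpret mild_setting \<alpha>\<^sub>1 \<alpha>\<^sub>2 c Z Y p
    using assms by unfold_locales auto
  have D: "datum u\<^sub>0 (rep u\<^sub>0) (enn2real (Linf_norm u\<^sub>0))" if "u\<^sub>0 \<in> L1 \<inter> Linf" "AE x in lborel. 0 \<le> u\<^sub>0 x" for u\<^sub>0 :: "real^'n \<Rightarrow> real"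
    using that by (rule datum_rep)
  show ?thesis
  proof (intro conjI ballI allI impI)
    fix u\<^sub>0 :: "real^'n \<Rightarrow> real" assume u: "u\<^sub>0 \<in> L1 \<inter> Linf" "AE x in lborel. 0 \<le> u\<^sub>0 x"
    note eq = maximal_solution_eq[OF D[OF u]]
    show "\<exists>Tmax u. nonneg_maximal_solution Z Y p u\<^sub>0 Tmax u \<and>
        (\<forall>Tmax' u'. nonneg_maximal_solution Z Y p u\<^sub>0 Tmax' u' \<longrightarrow>
          Tmax' = Tmax \<and> (\<forall>t\<in>existence_interval Tmax. AE x in lborel. u' t x = u t x))"
    proof (intro exI[of _ "tmax (rep u\<^sub>0)"] exI[of _ "sol u\<^sub>0 (rep u\<^sub>0)"] conjI allI impI ballI)
      show "nonneg_maximal_solution Z Y p u\<^sub>0 (tmax (rep u\<^sub>0)) (sol u\<^sub>0 (rep u\<^sub>0))" by (rule sol_maximal[OF D[OF u]])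
      fix Tm' u' assume u': "nonneg_maximal_solution Z Y p u\<^sub>0 Tm' u'"
      show "Tm' = tmax (rep u\<^sub>0)" by (rule eq(1)[OF u'])
      then show "AE x in lborel. u' t x = sol u\<^sub>0 (rep u\<^sub>0) t x" if "t \<in> existence_interval (tmax (rep u\<^sub>0))" for t
        using eq(2)[OF u'] that by simp
    qed
  next
    fix u\<^sub>0 :: "real^'n \<Rightarrow> real" and Tm u
    assume u: "u\<^sub>0 \<in> L1 \<inter> Linf" "AE x in lborel. 0 \<le> u\<^sub>0 x" and g: "\<exists>g\<in>BUC. AE x in lborel. u\<^sub>0 x = g x"
      and s: "nonneg_maximal_solution Z Y p u\<^sub>0 Tm u"
    obtain g where "g \<in> BUC" "AE x in lborel. u\<^sub>0 x = g x" using g by blast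
    then show "\<exists>v. (\<forall>t\<in>existence_interval Tm. v t \<in> BUC \<and> (AE x in lborel. v t x = u t x)) \<and>
        continuous_wrt X_norm (existence_interval Tm) v"
      by (rule BUC_solution[OF u _ _ s])
  next
    fix u\<^sub>0 v\<^sub>0 :: "real^'n \<Rightarrow> real" and Tu u Tv v t
    assume uv: "u\<^sub>0 \<in> L1 \<inter> Linf" "v\<^sub>0 \<in> L1 \<inter> Linf" "AE x in lborel. 0 \<le> u\<^sub>0 x \<and> u\<^sub>0 x \<le> v\<^sub>0 x"
      and s: "nonneg_maximal_solution Z Y p u\<^sub>0 Tu u" "nonneg_maximal_solution Z Y p v\<^sub>0 Tv v"
      and t: "t \<in> existence_interval Tu \<inter> existence_interval Tv"
    have nn: "AE x in lborel. 0 \<le> u\<^sub>0 x" using uv(3) by eventually_elim simp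
    have le: "AE x in lborel. u\<^sub>0 x \<le> v\<^sub>0 x" using uv(3) by eventually_elim simp
    have nn': "AE x in lborel. 0 \<le> v\<^sub>0 x" using uv(3) by eventually_elim linarith
    note Du = D[OF uv(1) nn] and Dv = D[OF uv(2) nn']
    have "t \<in> existence_interval (tmax (rep v\<^sub>0))" using t maximal_solution_eq(1)[OF Dv s(2)] by simp
    from sol_mono[OF Du Dv le this] maximal_solution_eq(2)[OF Du s(1), of t] maximal_solution_eq(2)[OF Dv s(2), of t] t
    show "AE x in lborel. u t x \<le> v t x" by (auto elim: eventually_elim2)
  next
    fix T R \<epsilon> :: real assume T: "0 < T" and e: "0 < \<epsilon>"
    obtain \<delta> where d: "0 < \<delta>" "\<And>u\<^sub>0 f R0 v\<^sub>0 g R1 u v. datum u\<^sub>0 f R0 \<Longrightarrow> datum v\<^sub>0 g R1 \<Longrightarrow> mild_solution Z Y p u\<^sub>0 T u \<Longrightarrow> mild_solution Z Y p v\<^sub>0 T v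
        \<Longrightarrow> XT_norm T u \<le> ennreal R \<Longrightarrow> XT_norm T v \<le> ennreal R \<Longrightarrow> X_norm (\<lambda>x. u\<^sub>0 x - v\<^sub>0 x) < ennreal \<delta>
        \<Longrightarrow> XT_norm T (\<lambda>t x. u t x - v t x) < ennreal \<epsilon>"
      by (rule dependence_XT[OF T e, of R]) blast
    have ms: "mild_solution Z Y p u\<^sub>0 T u" if "nonneg_maximal_solution Z Y p u\<^sub>0 Tu u" "ereal T < Tu" for u\<^sub>0 u Tu
      using that T by (auto simp: nonneg_maximal_solution_def maximal_mild_solution_def)
    show "\<exists>\<delta>>0. \<forall>u\<^sub>0 \<in> L1 \<inter> Linf. \<forall>v\<^sub>0 \<in> L1 \<inter> Linf. \<forall>Tu u Tv v.
       (AE x in lborel. 0 \<le> u\<^sub>0 x) \<longrightarrow> (AE x in lborel. 0 \<le> v\<^sub>0 x) \<longrightarrow>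
       nonneg_maximal_solution Z Y p u\<^sub>0 Tu u \<longrightarrow>
       nonneg_maximal_solution Z Y p v\<^sub>0 Tv v \<longrightarrow>
       ereal T < Tu \<longrightarrow> ereal T < Tv \<longrightarrow>
       XT_norm T u \<le> ennreal R \<longrightarrow> XT_norm T v \<le> ennreal R \<longrightarrow>
       X_norm (\<lambda>x. u\<^sub>0 x - v\<^sub>0 x) < ennreal \<delta> \<longrightarrow>
       XT_norm T (\<lambda>t x. u t x - v t x) < ennreal \<epsilon>"
      by (intro exI[of _ \<delta>] conjI d(1) ballI allI impI) (rule d(2)[OF D D ms ms])
  qed
qed

end
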